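(* Let $n\geq7$ and let $T=\bigcup_{i\in\mathcal{I}_T}\mathcal{C}^{(i)}\subseteq S_n$, where $\mathcal{I}_T$ is a nonempty subset of $\{1,2,3,4,5,6\}$ which is not one of $\{2\},\{3\},\{6\},\{2,3\},\{2,6\},\{3,6\},\{2,3,6\}$ (equivalently, $G=\mathrm{Cay}(S_n,T)$ is connected) and also not one of $\{1,3\},\{1,6\},\{4,6\},\{1,2,3\},\{1,2,6\},\{1,3,6\},\{1,4,6\},\{2,4,6\},\{3,4,6\},\{1,2,3,6\},\{1,2,4,6\},\{1,3,4,6\},\{2,3,4,6\},\{2,3,5,6\},\{1,2,3,4,6\}$. Let $m=\max_{\tau\in T}|\mathrm{supp}(\tau)|$, and for $k\geq0$ let $T_k=\{\tau\in T:\{1,\ldots,k\}\subseteq\mathrm{supp}(\tau)\}$ and $G_k=\mathrm{Cay}(S_n,T_k)$. Then for $0\leq k\leq m-1$, $G_k$ is connected and $$\lambda_2(G_k)=\lambda_2(B_\Pi^{(k)})=|T_k\cap(S_n)_{k+1}|-|T_k\cap(S_n)_{k+2,k+1}|,$$ where $B_\Pi^{(k)}=(b_{st})_{n\times n}$ with $b_{st}=|T_k\cap(S_n)_{t,s}|$.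
   Context: $S_n$ acts on $[n]$ on the right ($x^{\sigma\rho}=(x^\sigma)^\rho$). The conjugacy classes are: $\mathcal{C}^{(1)}$ all transpositions $(p,q)$; $\mathcal{C}^{(2)}$ all 3-cycles $(p,q,r)$; $\mathcal{C}^{(3)}$ all products $(p,q)(r,s)$ of two disjoint transpositions; $\mathcal{C}^{(4)}$ all 4-cycles; $\mathcal{C}^{(5)}$ all products $(p,q,r)(s,t)$ of a 3-cycle and a disjoint transposition; $\mathcal{C}^{(6)}$ all 5-cycles (letters pairwise distinct in $[n]$). $\mathrm{supp}(\tau)$ is the set of points moved by $\tau$. $(S_n)_{j,i}=\{\sigma:j^\sigma=i\}$, $(S_n)_j=(S_n)_{j,j}$. $\mathrm{Cay}(S_n,S)$ has vertex set $S_n$ and edges $\{\sigma,\tau\sigma\}$, $\tau\in S$. $\lambda_2$ is the second largest eigenvalue (adjacency eigenvalue for graphs), counted with multiplicity. *)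

theory Defs
  imports
    "HOL-Combinatorics.Cycles"
    "Graph_Theory.Digraph_Component"
    "Jordan_Normal_Form.Char_Poly"
begin

text \<open>
  The symmetric group on \<open>[n] = {1..n}\<close> acts on the right: the image of a point \<open>x\<close> under \<open>\<sigma>\<close>
  is \<open>\<sigma> x\<close>, and the product \<open>\<sigma> \<rho>\<close> is the permutation that applies \<open>\<sigma>\<close> first.
\<close>

definition sym_perms :: "nat \<Rightarrow> (nat \<Rightarrow> nat) set" where
  "sym_perms n = {\<sigma>. \<sigma> permutes {1..n}}"

definition perm_mult :: "(nat \<Rightarrow> nat) \<Rightarrow> (nat \<Rightarrow> nat) \<Rightarrow> nat \<Rightarrow> nat"  (infixl "\<odot>" 70) where
  "\<sigma> \<odot> \<rho> = \<rho> \<circ> \<sigma>"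

definition supp :: "(nat \<Rightarrow> nat) \<Rightarrow> nat set" where
  "supp \<sigma> = {x. \<sigma> x \<noteq> x}"

definition transporter :: "nat \<Rightarrow> nat \<Rightarrow> nat \<Rightarrow> (nat \<Rightarrow> nat) set" where
  "transporter n j i = {\<sigma> \<in> sym_perms n. \<sigma> j = i}"

definition stabilizer :: "nat \<Rightarrow> nat \<Rightarrow> (nat \<Rightarrow> nat) set" where
  "stabilizer n j = transporter n j j"

text \<open>
  The term \<open>cycle_of_list [x, y, z]\<close> is the cycle \<open>x \<mapsto> y \<mapsto> z \<mapsto> x\<close>.
\<close>

definition conj_class :: "nat \<Rightarrow> nat \<Rightarrow> (nat \<Rightarrow> nat) set" where
  "conj_class n i =
    (if i = 1 then {cycle_of_list [p, q] | p q.
         distinct [p, q] \<and> set [p, q] \<subseteq> {1..n}}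
     else if i = 2 then {cycle_of_list [p, q, r] | p q r.
         distinct [p, q, r] \<and> set [p, q, r] \<subseteq> {1..n}}
     else if i = 3 then {cycle_of_list [p, q] \<odot> cycle_of_list [r, s] | p q r s.
         distinct [p, q, r, s] \<and> set [p, q, r, s] \<subseteq> {1..n}}
     else if i = 4 then {cycle_of_list [p, q, r, s] | p q r s.
         distinct [p, q, r, s] \<and> set [p, q, r, s] \<subseteq> {1..n}}
     else if i = 5 then {cycle_of_list [p, q, r] \<odot> cycle_of_list [s, t] | p q r s t.
         distinct [p, q, r, s, t] \<and> set [p, q, r, s, t] \<subseteq> {1..n}}
     else if i = 6 then {cycle_of_list [p, q, r, s, t] | p q r s t.
         distinct [p, q, r, s, t] \<and> set [p, q, r, s, t] \<subseteq> {1..n}}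
     else {})"

text \<open>
  An undirected graph is represented by the digraph that contains both orientations of every edge;
  the edges here are the pairs \<open>{\<sigma>, \<tau> \<odot> \<sigma>}\<close>.
\<close>

definition cayley :: "nat \<Rightarrow> (nat \<Rightarrow> nat) set \<Rightarrow> (nat \<Rightarrow> nat) pair_pre_digraph" where
  "cayley n S = \<lparr> pverts = sym_perms n,
     parcs = {(\<sigma>, \<rho>). \<sigma> \<in> sym_perms n \<and> \<rho> \<in> sym_perms n \<and>
                (\<exists>\<tau>\<in>S. \<rho> = \<tau> \<odot> \<sigma> \<or> \<sigma> = \<tau> \<odot> \<rho>)} \<rparr>"

definition moving_subset :: "(nat \<Rightarrow> nat) set \<Rightarrow> nat \<Rightarrow> (nat \<Rightarrow> nat) set" where
  "moving_subset T k = {\<tau> \<in> T. {1..k} \<subseteq> supp \<tau>}"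

text \<open>
  The adjacency matrix refers to an arbitrary enumeration of the (finite) vertex set. A different
  enumeration conjugates it by a permutation matrix, which leaves the spectrum unchanged.
\<close>

definition vertex_enum :: "'a pair_pre_digraph \<Rightarrow> 'a list" where
  "vertex_enum G = (SOME vs. distinct vs \<and> set vs = pverts G)"

definition adjacency_matrix :: "'a pair_pre_digraph \<Rightarrow> real mat" where
  "adjacency_matrix G =
    (let vs = vertex_enum G
     in mat (length vs) (length vs) (\<lambda>(i, j). of_bool ((vs ! i, vs ! j) \<in> parcs G)))"

text \<open>
  \<open>eigenvalues_desc A\<close> lists the real eigenvalues of \<open>A\<close> in descending order, each repeated according
  to its algebraic multiplicity. For real symmetric \<open>A\<close> these are all the eigenvalues, and algebraic
  and geometric multiplicities agree.
\<close>

definition eigenvalues_desc :: "real mat \<Rightarrow> real list" where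
  "eigenvalues_desc A = rev (sorted_list_of_multiset (proots (char_poly A)))"

definition second_eigenvalue :: "real mat \<Rightarrow> real" where
  "second_eigenvalue A = eigenvalues_desc A ! 1"

definition graph_second_eigenvalue :: "'a pair_pre_digraph \<Rightarrow> real" where
  "graph_second_eigenvalue G = second_eigenvalue (adjacency_matrix G)"

text \<open>
  Rows and columns of a \<open>mat\<close> are indexed from 0, so the entry in position \<open>(i, j)\<close> is
  \<open>b\<^sub>s\<^sub>t\<close> with \<open>s = i + 1\<close>, \<open>t = j + 1\<close>.
\<close>

definition quotient_matrix :: "nat \<Rightarrow> (nat \<Rightarrow> nat) set \<Rightarrow> real mat" where
  "quotient_matrix n S =
    mat n n (\<lambda>(i, j). real (card (S \<inter> transporter n (j + 1) (i + 1))))"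

end

theory Submission
  imports Defs "HOL-Analysis.Function_Topology"
begin

text \<open>
  Every class is treated separately. Let \<open>T\<close> be the part of one class that moves all points of a set
  \<open>K\<close> and none outside a set \<open>A\<close>, acting on functions on the symmetric group by
  \<open>f \<mapsto> (\<sigma> \<mapsto> \<Sum>\<tau>\<in>T. f (\<sigma> \<circ> \<tau>))\<close>. With \<open>a = card A\<close> and \<open>k = card K\<close>, the quadratic form of this
  operator is at most \<open>mu i a k\<close> times the squared norm on all functions that are orthogonal to the trivial
  and the sign representation of the symmetric group on \<open>A\<close>. This is an induction on \<open>a\<close>: either the
  function is still generic on \<open>A - {x}\<close> for all \<open>x\<close>, and then the splitting of \<open>T\<close> according to whether a
  point of \<open>A - K\<close> is moved gives the bound, or it is a constituent of a representation induced from the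
  trivial or the sign character of a point stabiliser, where \<open>T\<close> acts by an explicit matrix with
  few distinct entries. The induction starts at \<open>a = 7\<close>. There all class sums are polynomials in
  the Jucys--Murphy elements, and the joint eigenvalues of the latter form content sequences, of
  which there are finitely many; for two distinguished points one also needs the transposition of
  these points, which generates with the Jucys--Murphy elements a degenerate affine Hecke algebra of rank two.

  Adding the bounds over the classes in \<open>I\<close>, only the eigenvalue of the sign representation remains, and
  it is here that the exceptional sets \<open>I\<close> drop out. The bound is attained at
  \<open>f \<sigma> = [\<sigma> (k + 1) = 1] - [\<sigma> (k + 2) = 1]\<close>, which is lifted from the quotient matrix. It is smaller than the
  degree, so the indicator function of a component cannot be a new eigenfunction, and the graph is connected.
\<close>

section \<open>Self-adjoint operators on functions on a finite set\<close>

text \<open>The constant \<open>mu i a k\<close> is the eigenvalue that the class has on the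
  difference of two points outside \<open>K\<close>. It obeys the recursion given by the splitting,
  so the induction loses nothing, and every class attains its constant at the same function, so
  adding the classes loses nothing either. The base cannot lie below seven points: on six points
  with \<open>K\<close> empty the 5-cycles have \<open>mu 6 6 0 = 0\<close>, while the irreducible
  representation (3,2,1) gives 144 / 16 = 9. The obstacle in the base is the case of three or more
  prescribed points. For at most two, inclusion-exclusion expresses the operator through class sums
  of a chain of subsets, up to one transposition; for more points the subsets involved are too far
  from a chain. That case is reduced to six points, where the estimate does hold for
  \<open>k >= 3\<close>: averaging leads back to configurations with exactly two points outside
  \<open>K\<close>. Irreducible representations do not occur in the argument: genericity is a system
  of linear equations, and maximal Rayleigh quotients supply the eigenvectors.\<close>

locale fin_index =
  fixes G :: "'a set"
  assumes finG: "finite G"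
begin

definition V :: "('a \<Rightarrow> real) set" where
  "V = {f. \<forall>x. x \<notin> G \<longrightarrow> f x = 0}"

definition ip :: "('a \<Rightarrow> real) \<Rightarrow> ('a \<Rightarrow> real) \<Rightarrow> real" where
  "ip f g = (\<Sum>x\<in>G. f x * g x)"

text \<open>Closedness makes the unit sphere of such a space compact, so that quadratic forms attain
  their maximum without a choice of basis.\<close>

definition subsp :: "('a \<Rightarrow> real) set \<Rightarrow> bool" where
  "subsp U \<longleftrightarrow> U \<subseteq> V \<and> closed U \<and> (\<lambda>x. 0) \<in> U \<and>
     (\<forall>f\<in>U. \<forall>g\<in>U. \<forall>a b. (\<lambda>x. a * f x + b * g x) \<in> U)"

definition selfadj :: "(('a \<Rightarrow> real) \<Rightarrow> 'a \<Rightarrow> real) \<Rightarrow> bool" where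
  "selfadj A \<longleftrightarrow> (\<forall>f\<in>V. A f \<in> V) \<and>
     (\<forall>f\<in>V. \<forall>g\<in>V. \<forall>a b. A (\<lambda>x. a * f x + b * g x) = (\<lambda>x. a * A f x + b * A g x)) \<and>
     (\<forall>f\<in>V. \<forall>g\<in>V. ip (A f) g = ip f (A g))"

lemma ip_commute: "ip f g = ip g f"
  by (simp add: ip_def mult.commute)

lemma ip_left: "ip (\<lambda>x. a * f x + b * g x) h = a * ip f h + b * ip g h"
  by (simp add: ip_def algebra_simps sum.distrib sum_distrib_left)

lemma ip_right: "ip h (\<lambda>x. a * f x + b * g x) = a * ip h f + b * ip h g"
  by (simp add: ip_def algebra_simps sum.distrib sum_distrib_left)

lemma ip_scale: "ip (\<lambda>x. a * f x) h = a * ip f h" "ip h (\<lambda>x. a * f x) = a * ip h f"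
  by (simp_all add: ip_def algebra_simps sum_distrib_left)

lemma ip_add: "ip (\<lambda>x. f x + g x) h = ip f h + ip g h"
  by (simp add: ip_def algebra_simps sum.distrib)

lemma ip_nonneg: "ip f f \<ge> 0"
  by (simp add: ip_def sum_nonneg)

lemma ip_eq_0_iff: "f \<in> V \<Longrightarrow> ip f f = 0 \<longleftrightarrow> f = (\<lambda>x. 0)"
  by (auto simp: ip_def V_def sum_nonneg_eq_0_iff finG fun_eq_iff)

lemma ip_pos: "f \<in> V \<Longrightarrow> f \<noteq> (\<lambda>x. 0) \<Longrightarrow> ip f f > 0"
  using ip_nonneg[of f] ip_eq_0_iff[of f] by linarith

lemma zero_V [simp]: "(\<lambda>x. 0) \<in> V"
  by (simp add: V_def)

lemma comb_V: "f \<in> V \<Longrightarrow> g \<in> V \<Longrightarrow> (\<lambda>x. a * f x + b * g x) \<in> V"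
  by (simp add: V_def)

lemma subsp_V: "subsp U \<Longrightarrow> f \<in> U \<Longrightarrow> f \<in> V"
  by (auto simp: subsp_def)

lemma subsp_comb: "subsp U \<Longrightarrow> f \<in> U \<Longrightarrow> g \<in> U \<Longrightarrow> (\<lambda>x. a * f x + b * g x) \<in> U"
  by (auto simp: subsp_def)

lemma subsp_scale: "subsp U \<Longrightarrow> f \<in> U \<Longrightarrow> (\<lambda>x. a * f x) \<in> U"
  using subsp_comb[of U f f a 0] by simp

lemma selfadj_V: "selfadj A \<Longrightarrow> f \<in> V \<Longrightarrow> A f \<in> V"
  by (auto simp: selfadj_def)

lemma selfadj_comb: "selfadj A \<Longrightarrow> f \<in> V \<Longrightarrow> g \<in> V \<Longrightarrow>
    A (\<lambda>x. a * f x + b * g x) = (\<lambda>x. a * A f x + b * A g x)"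
  by (auto simp: selfadj_def)

lemma selfadj_scale: "selfadj A \<Longrightarrow> f \<in> V \<Longrightarrow> A (\<lambda>x. a * f x) = (\<lambda>x. a * A f x)"
  using selfadj_comb[of A f f a 0] by simp

lemma selfadj_ip: "selfadj A \<Longrightarrow> f \<in> V \<Longrightarrow> g \<in> V \<Longrightarrow> ip (A f) g = ip f (A g)"
  by (auto simp: selfadj_def)

lemma selfadj_zero: "selfadj A \<Longrightarrow> A (\<lambda>x. 0) = (\<lambda>x. 0)"
  using selfadj_scale[of A "\<lambda>x. 0" 0] by simp

definition delta :: "'a \<Rightarrow> 'a \<Rightarrow> real" where "delta y = (\<lambda>x. if x = y then 1 else 0)"

lemma selfadj_expand:
  assumes "selfadj A" "f \<in> V" "y \<in> G"
  shows "A f y = (\<Sum>x\<in>G. f x * A (delta y) x)"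
proof -
  have dV: "delta y \<in> V" using assms(3) by (auto simp: V_def delta_def)
  have "ip (delta y) (A f) = (\<Sum>x\<in>G. if x = y then A f x else 0)"
    unfolding ip_def delta_def by (rule sum.cong) auto
  then have "A f y = ip (delta y) (A f)" using assms(3) finG by simp
  also have "\<dots> = ip (A (delta y)) f" using selfadj_ip[OF assms(1) dV assms(2)] by simp
  finally show ?thesis by (simp add: ip_def mult.commute)
qed

lemma continuous_on_selfadj:
  assumes "selfadj A"
  shows "continuous_on V (\<lambda>f. A f y)"
proof (cases "y \<in> G")
  case True
  have "continuous_on V (\<lambda>f. \<Sum>x\<in>G. f x * A (delta y) x)"
    by (intro continuous_intros continuous_on_subset[OF continuous_on_product_coordinates]) auto
  then show ?thesis using selfadj_expand[OF assms _ True] by (simp cong: continuous_on_cong)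
next
  case False
  then have "\<And>f. f \<in> V \<Longrightarrow> A f y = 0" using selfadj_V[OF assms] by (auto simp: V_def)
  then show ?thesis by (simp cong: continuous_on_cong)
qed

lemma continuous_on_coord: "continuous_on S (\<lambda>f. f y :: real)"
  by (rule continuous_on_subset[OF continuous_on_product_coordinates]) auto

lemma closed_V: "closed V"
proof -
  have "V = (\<Inter>y\<in>-G. {f. f y = 0})" by (auto simp: V_def)
  moreover have "closed {f. f y = (0::real)}" for y :: 'a
    by (intro closed_Collect_eq continuous_on_coord continuous_on_const)
  ultimately show ?thesis by auto
qed

lemma subsp_Inter: "S \<noteq> {} \<Longrightarrow> (\<And>U. U \<in> S \<Longrightarrow> subsp U) \<Longrightarrow> subsp (\<Inter>S)"
  unfolding subsp_def by (intro conjI closed_Inter ballI allI InterI) blast+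

lemma subsp_Int: "subsp U \<Longrightarrow> subsp W \<Longrightarrow> subsp (U \<inter> W)"
  using subsp_Inter[of "{U, W}"] by auto

lemma subsp_eigenspace:
  assumes "subsp U" "selfadj A"
  shows "subsp {f \<in> U. A f = (\<lambda>x. l * f x)}"
proof -
  have UV: "U \<subseteq> V" and clU: "closed U" using assms(1) by (auto simp: subsp_def)
  have "closed {f \<in> U. A f y = l * f y}" for y
    using clU continuous_on_subset[OF continuous_on_selfadj[OF assms(2)] UV]
    by (intro continuous_closed_preimage_constant[of U "\<lambda>f. A f y - l * f y" 0, simplified]
        continuous_intros continuous_on_coord) auto
  moreover have "{f \<in> U. A f = (\<lambda>x. l * f x)} = (\<Inter>y. {f \<in> U. A f y = l * f y})"
    by (auto simp: fun_eq_iff)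
  ultimately have "closed {f \<in> U. A f = (\<lambda>x. l * f x)}" by auto
  moreover have "A (\<lambda>x. 0) = (\<lambda>x. 0)" using selfadj_zero[OF assms(2)] .
  ultimately show ?thesis using assms(1) UV unfolding subsp_def
    by (auto simp: selfadj_comb[OF assms(2)] subset_iff fun_eq_iff algebra_simps)
qed

text \<open>The equations that define \<open>gen1\<close>, and through it \<open>Gen\<close> and
  \<open>W\<close>, have this form.\<close>

lemma subsp_linear_condition:
  assumes "\<And>y. y \<in> Y \<Longrightarrow> finite (S y)"
  shows "subsp {f \<in> V. \<forall>y\<in>Y. (\<Sum>t\<in>S y. c y t * f (h y t)) = 0}"
proof -
  have "{f \<in> V. \<forall>y\<in>Y. (\<Sum>t\<in>S y. c y t * f (h y t)) = 0} =
      V \<inter> (\<Inter>y\<in>Y. {f. (\<Sum>t\<in>S y. c y t * f (h y t)) = 0})" by auto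
  moreover have "closed {f. (\<Sum>t\<in>S y. c y t * f (h y t)) = 0}" for y
    by (intro closed_Collect_eq continuous_intros continuous_on_coord)
  ultimately have "closed {f \<in> V. \<forall>y\<in>Y. (\<Sum>t\<in>S y. c y t * f (h y t)) = 0}"
    using closed_V by (metis (no_types, lifting) closed_INT closed_Int)
  then show ?thesis unfolding subsp_def
    by (auto simp: comb_V algebra_simps sum.distrib simp flip: sum_distrib_left)
qed

text \<open>The quadratic form of \<open>A\<close> attains its maximum on the compact unit sphere of
  \<open>U\<close>. A maximizer is an eigenvector, because the residual \<open>A v - l v\<close>
  lies in \<open>U\<close> and would otherwise be a direction of increase.\<close>

lemma max_eigenvector:
  assumes U: "subsp U" and A: "selfadj A" and inv: "\<And>f. f \<in> U \<Longrightarrow> A f \<in> U"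
    and ne: "f0 \<in> U" "f0 \<noteq> (\<lambda>x. 0)"
  obtains v l where "v \<in> U" "v \<noteq> (\<lambda>x. 0)" "A v = (\<lambda>x. l * v x)"
    "\<And>f. f \<in> U \<Longrightarrow> ip (A f) f \<le> l * ip f f"
proof -
  have UV: "U \<subseteq> V" and clU: "closed U" using U by (auto simp: subsp_def)
  define S where "S = {f \<in> U. ip f f = 1}"
  define box where "box = {f::'a\<Rightarrow>real. \<forall>x. f x \<in> (if x \<in> G then {-1..1} else {0})}"
  have "box = PiE UNIV (\<lambda>x. if x \<in> G then {-1..1} else {0})"
    by (auto simp: box_def PiE_def Pi_def extensional_def)
  then have cbox: "compact box"
    using compactin_PiE[of "\<lambda>_. euclidean" UNIV "\<lambda>x::'a. if x \<in> G then {-1..1::real} else {0}"]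
    by (auto simp: euclidean_product_topology)
  have Sbox: "S \<subseteq> box"
  proof
    fix f assume f: "f \<in> S"
    have "\<bar>f x\<bar> \<le> 1" if "x \<in> G" for x
    proof -
      have "f x * f x \<le> (\<Sum>x\<in>G. f x * f x)"
        by (rule member_le_sum) (use that finG in auto)
      also have "\<dots> = 1" using f by (simp add: S_def ip_def)
      finally show ?thesis by (metis abs_square_le_1 power2_eq_square)
    qed
    moreover have "f x = 0" if "x \<notin> G" for x using f UV that by (auto simp: S_def V_def)
    ultimately show "f \<in> box" by (auto simp: box_def abs_le_iff minus_le_iff)
  qed
  have "continuous_on UNIV (\<lambda>f. ip f f)"
    unfolding ip_def by (intro continuous_intros continuous_on_coord)
  then have "closed {f. ip f f = 1}"
    by (intro closed_Collect_eq continuous_on_const)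
  then have "closed S" using clU by (auto simp: S_def Collect_conj_eq intro: closed_Int)
  then have "compact (box \<inter> S)" using cbox by (rule compact_Int_closed[rotated])
  then have cS: "compact S" using Sbox by (simp add: Int_absorb1)
  have pos0: "ip f0 f0 > 0" using ip_pos ne UV by auto
  define c0 where "c0 = 1 / sqrt (ip f0 f0)"
  have "c0 * c0 * ip f0 f0 = 1" using pos0 by (simp add: c0_def)
  then have neS: "(\<lambda>x. c0 * f0 x) \<in> S"
    using subsp_scale[OF U ne(1)] by (auto simp: S_def ip_scale)
  have cont: "continuous_on S (\<lambda>f. ip (A f) f)"
    unfolding ip_def
    by (intro continuous_intros continuous_on_coord continuous_on_subset[OF continuous_on_selfadj[OF A]])
      (use UV S_def in auto)
  obtain v where v: "v \<in> S" and vmax: "\<And>f. f \<in> S \<Longrightarrow> ip (A f) f \<le> ip (A v) v"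
    using continuous_attains_sup[OF cS _ cont] neS by blast
  define l where "l = ip (A v) v"
  have vU: "v \<in> U" and v1: "ip v v = 1" using v by (auto simp: S_def)
  have vV: "v \<in> V" using vU UV by auto
  have bound: "ip (A f) f \<le> l * ip f f" if f: "f \<in> U" for f
  proof (cases "f = (\<lambda>x. 0)")
    case True
    then show ?thesis by (simp add: ip_def)
  next
    case False
    have p: "ip f f > 0" using ip_pos False f UV by auto
    define c where "c = 1 / sqrt (ip f f)"
    have cc: "c * c * ip f f = 1" using p by (simp add: c_def)
    then have "(\<lambda>x. c * f x) \<in> S" using subsp_scale[OF U f] by (auto simp: S_def ip_scale)
    from vmax[OF this] have "c * c * ip (A f) f \<le> l"
      using selfadj_scale[OF A, of f c] f UV by (simp add: ip_scale l_def subset_iff)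
    then have "c * c * ip (A f) f * ip f f \<le> l * ip f f" using p by (intro mult_right_mono) auto
    moreover have "c * c * ip (A f) f * ip f f = ip (A f) f"
      using cc by (metis mult.commute mult.left_commute mult_1)
    ultimately show ?thesis by simp
  qed
  define g where "g = (\<lambda>x. 1 * A v x + (- l) * v x)"
  have gU: "g \<in> U" unfolding g_def by (intro subsp_comb[OF U] inv vU)
  have gV: "g \<in> V" using gU UV by auto
  have AgV: "A g \<in> V" and AvV: "A v \<in> V" using selfadj_V[OF A] gV vV by auto
  \<comment> \<open>The bound on \<open>U\<close> is evaluated at \<open>v + t g\<close>. The terms
    free of \<open>t\<close> cancel and the linear term reduces to \<open>2 t (ip g g)\<close>, so a
    small positive \<open>t\<close> will contradict \<open>ip g g > 0\<close>.\<close>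
  have key: "2 * t * ip g g \<le> t\<^sup>2 * (l * ip g g - ip (A g) g)" for t
  proof -
    let ?w = "\<lambda>x. 1 * v x + t * g x"
    have w: "?w \<in> U" by (intro subsp_comb[OF U] vU gU)
    have "A ?w = (\<lambda>x. 1 * A v x + t * A g x)" by (rule selfadj_comb[OF A vV gV])
    then have "ip (A ?w) ?w = l + t * ip (A v) g + t * ip (A g) v + t\<^sup>2 * ip (A g) g"
      by (simp only: ip_left ip_right) (simp add: l_def algebra_simps power2_eq_square)
    moreover have "ip (A g) v = ip (A v) g" using selfadj_ip[OF A gV vV] by (simp add: ip_commute)
    moreover have "ip ?w ?w = 1 + 2 * t * ip v g + t\<^sup>2 * ip g g"
      by (simp only: ip_left ip_right)
        (simp add: v1 algebra_simps power2_eq_square ip_commute[of g v])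
    ultimately have "l + 2 * t * ip (A v) g + t\<^sup>2 * ip (A g) g \<le> l * (1 + 2 * t * ip v g + t\<^sup>2 * ip g g)"
      using bound[OF w] by simp
    moreover have "ip (A v) g = ip g g + l * ip v g"
    proof -
      have "ip g g = ip (\<lambda>x. 1 * A v x + (- l) * v x) g" by (simp only: g_def)
      then show ?thesis by (simp only: ip_left)
    qed
    ultimately show ?thesis by (simp add: algebra_simps)
  qed
  have "ip g g = 0"
  proof (rule ccontr)
    assume "ip g g \<noteq> 0"
    then have p: "ip g g > 0" using ip_nonneg[of g] by linarith
    define M where "M = \<bar>l * ip g g - ip (A g) g\<bar> + 1"
    have M: "M > 0" by (simp add: M_def)
    define t where "t = ip g g / M"
    have t: "t > 0" using p M by (simp add: t_def)
    have "2 * t * ip g g \<le> t\<^sup>2 * M"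
      using key[of t] by (smt (verit) M_def mult_left_mono zero_le_power2)
    then have "2 * ip g g \<le> t * M" using t by (simp add: power2_eq_square)
    also have "t * M = ip g g" using M by (simp add: t_def)
    finally show False using p by simp
  qed
  then have "g = (\<lambda>x. 0)" using ip_eq_0_iff gV by auto
  then have "A v = (\<lambda>x. l * v x)" by (auto simp: g_def fun_eq_iff)
  moreover have "v \<noteq> (\<lambda>x. 0)" using v1 by (auto simp: ip_def)
  ultimately show thesis using that vU bound by blast
qed

text \<open>An eigenspace of one operator is invariant under the others, since they commute;
  \<open>U\<close> is cut down to eigenspaces operator by operator.\<close>

lemma common_eigenvector:
  assumes "subsp U" "f0 \<in> U" "f0 \<noteq> (\<lambda>x. 0)"
    and "\<And>A. A \<in> set As \<Longrightarrow> selfadj A"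
    and "\<And>A f. A \<in> set As \<Longrightarrow> f \<in> U \<Longrightarrow> A f \<in> U"
    and "\<And>A B f. A \<in> set As \<Longrightarrow> B \<in> set As \<Longrightarrow> f \<in> V \<Longrightarrow> A (B f) = B (A f)"
  shows "\<exists>v\<in>U. v \<noteq> (\<lambda>x. 0) \<and> (\<forall>A\<in>set As. \<exists>l. A v = (\<lambda>x. l * v x))"
  using assms
proof (induction As arbitrary: U f0)
  case Nil
  then show ?case by auto
next
  case (Cons A As)
  have A: "selfadj A" "\<And>f. f \<in> U \<Longrightarrow> A f \<in> U" using Cons.prems(4,5) by auto
  obtain v l where v: "v \<in> U" "v \<noteq> (\<lambda>x. 0)" "A v = (\<lambda>x. l * v x)"
    by (rule max_eigenvector[OF Cons.prems(1) A Cons.prems(2,3)])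
  let ?U = "{f \<in> U. A f = (\<lambda>x. l * f x)}"
  have "\<exists>v\<in>?U. v \<noteq> (\<lambda>x. 0) \<and> (\<forall>A\<in>set As. \<exists>l. A v = (\<lambda>x. l * v x))"
  proof (rule Cons.IH)
    show "subsp ?U" using subsp_eigenspace Cons.prems(1,4) by auto
    show "v \<in> ?U" using v by auto
    fix B f assume B: "B \<in> set As" and f: "f \<in> ?U"
    have fV: "f \<in> V" using f subsp_V[OF Cons.prems(1)] by auto
    have "A (B f) = B (A f)" using Cons.prems(6)[of A B f] B fV by auto
    also have "\<dots> = (\<lambda>x. l * B f x)" using f selfadj_scale[OF Cons.prems(4)[of B] fV] B by auto
    finally show "B f \<in> ?U" using Cons.prems(5)[of B f] B f by auto
  qed (use v Cons.prems in auto)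
  then show ?case by auto
qed

text \<open>The largest eigenvalue of \<open>A\<close> on \<open>U\<close> controls the form, and
  its eigenspace contains a joint eigenvector of the commuting family \<open>As\<close>. Hence only
  those eigenvalues of \<open>A\<close> have to be estimated that occur at joint
  eigenvectors.\<close>

lemma quadratic_bound:
  assumes U: "subsp U" and A: "selfadj A" and inv: "\<And>f. f \<in> U \<Longrightarrow> A f \<in> U"
    and As: "\<And>B. B \<in> set As \<Longrightarrow> selfadj B" "\<And>B f. B \<in> set As \<Longrightarrow> f \<in> U \<Longrightarrow> B f \<in> U"
    and comm: "\<And>B C f. B \<in> set (A # As) \<Longrightarrow> C \<in> set (A # As) \<Longrightarrow> f \<in> V \<Longrightarrow> B (C f) = C (B f)"
    and bd: "\<And>v l. v \<in> U \<Longrightarrow> v \<noteq> (\<lambda>x. 0) \<Longrightarrow> A v = (\<lambda>x. l * v x) \<Longrightarrow>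
        \<forall>B\<in>set As. \<exists>c. B v = (\<lambda>x. c * v x) \<Longrightarrow> l \<le> b"
    and f: "f \<in> U"
  shows "ip (A f) f \<le> b * ip f f"
proof (cases "f = (\<lambda>x. 0)")
  case True
  then show ?thesis by (simp add: ip_def)
next
  case False
  obtain v l where v: "v \<in> U" "v \<noteq> (\<lambda>x. 0)" "A v = (\<lambda>x. l * v x)"
    and mx: "\<And>f. f \<in> U \<Longrightarrow> ip (A f) f \<le> l * ip f f"
    using max_eigenvector[OF U A inv f False] by auto
  let ?U = "{f \<in> U. A f = (\<lambda>x. l * f x)}"
  have "\<exists>v\<in>?U. v \<noteq> (\<lambda>x. 0) \<and> (\<forall>A\<in>set As. \<exists>l. A v = (\<lambda>x. l * v x))"
  proof (rule common_eigenvector)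
    show "subsp ?U" using subsp_eigenspace U A by auto
    show "v \<in> ?U" using v by auto
    fix B f assume B: "B \<in> set As" and f: "f \<in> ?U"
    have fV: "f \<in> V" using f subsp_V[OF U] by auto
    have "A (B f) = B (A f)" using comm[of A B f] B fV by auto
    also have "\<dots> = (\<lambda>x. l * B f x)" using f selfadj_scale[OF As(1)[OF B] fV] by auto
    finally show "B f \<in> ?U" using As(2)[OF B] f by auto
  qed (use v As comm in auto)
  then obtain w where "w \<in> ?U" "w \<noteq> (\<lambda>x. 0)" "\<forall>A\<in>set As. \<exists>l. A w = (\<lambda>x. l * w x)" by auto
  then have "l \<le> b" using bd by auto
  then have "l * ip f f \<le> b * ip f f" using ip_nonneg by (intro mult_right_mono) auto
  then show ?thesis using mx[OF f] by linarith
qed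

end

abbreviation pinv :: "('a \<Rightarrow> 'a) \<Rightarrow> 'a \<Rightarrow> 'a" where
  "pinv \<equiv> inv_into UNIV"

text \<open>
  Keeps the number 1 of the first class a numeral.
\<close>

declare One_nat_def [simp del]

section \<open>The six conjugacy classes\<close>

text \<open>
  The elements of class \<open>i\<close> have a leading cycle of length \<open>lead i\<close>, move \<open>msz i\<close> points and have
  sign \<open>eps i\<close>.
\<close>

definition lead :: "nat \<Rightarrow> nat" where
  "lead i = (if i = 1 \<or> i = 3 then 2 else if i = 2 \<or> i = 5 then 3 else if i = 4 then 4 else 5)"

definition msz :: "nat \<Rightarrow> nat" where
  "msz i = (if i = 1 then 2 else if i = 2 then 3 else if i = 3 \<or> i = 4 then 4 else 5)"

definition eps :: "nat \<Rightarrow> int" where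
  "eps i = (if i = 2 \<or> i = 3 \<or> i = 6 then 1 else - 1)"

text \<open>The first \<open>k\<close> letters form the cycle that is applied first, in accordance
  with \<open>perm_mult\<close>. For the classes of single cycles \<open>lead i = msz i\<close>, so
  that the second list is empty and its cycle is the identity.\<close>

definition cyc2 :: "nat \<Rightarrow> nat list \<Rightarrow> nat \<Rightarrow> nat" where
  "cyc2 k l = cycle_of_list (drop k l) \<circ> cycle_of_list (take k l)"

text \<open>The letters range over all natural numbers. The ground set enters only in
  \<open>Tc\<close>, so that the parts of a class on different sets \<open>A\<close> are subsets of
  one fixed class.\<close>

definition cls :: "nat \<Rightarrow> (nat \<Rightarrow> nat) set" where
  "cls i = {cyc2 (lead i) l | l. i \<in> {1..6} \<and> distinct l \<and> length l = msz i}"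

definition Tc :: "nat \<Rightarrow> nat set \<Rightarrow> nat set \<Rightarrow> (nat \<Rightarrow> nat) set" where
  "Tc i A K = {\<tau> \<in> cls i. K \<subseteq> supp \<tau> \<and> supp \<tau> \<subseteq> A}"

lemma in_1_6: "i \<in> {1..6::nat} \<longleftrightarrow> i = 1 \<or> i = 2 \<or> i = 3 \<or> i = 4 \<or> i = 5 \<or> i = 6"
  by auto

lemma supp_cycle:
  assumes "distinct cs" "length cs \<noteq> 1"
  shows "supp (cycle_of_list cs) = set cs"
proof
  show "supp (cycle_of_list cs) \<subseteq> set cs"
    using id_outside_supp[of _ cs] by (auto simp: supp_def)
  show "set cs \<subseteq> supp (cycle_of_list cs)"
  proof
    fix x assume "x \<in> set cs"
    then obtain j where j: "j < length cs" "x = cs ! j" by (auto simp: in_set_conv_nth)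
    have "cycle_of_list cs x = map (cycle_of_list cs ^^ 1) cs ! j" using j by (simp add: One_nat_def)
    also have "\<dots> = rotate 1 cs ! j" using cyclic_rotation[OF assms(1), of 1] by simp
    also have "\<dots> = cs ! (Suc j mod length cs)" using j by (simp add: One_nat_def nth_rotate1)
    finally have *: "cycle_of_list cs x = cs ! (Suc j mod length cs)" .
    have "Suc j mod length cs \<noteq> j"
      using j assms(2) by (cases "Suc j = length cs") auto
    moreover have "Suc j mod length cs < length cs" using j by (intro mod_less_divisor) auto
    ultimately have "cycle_of_list cs x \<noteq> x"
      unfolding * using j assms(1) by (simp add: nth_eq_iff_index_eq)
    then show "x \<in> supp (cycle_of_list cs)" by (simp add: supp_def)
  qed
qed

lemma supp_comp_disjoint:
  assumes "supp p \<inter> supp q = {}" "bij q"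
  shows "supp (p \<circ> q) = supp p \<union> supp q"
proof -
  have "q x \<notin> supp p" if "q x \<noteq> x" for x
  proof -
    have "q (q x) \<noteq> q x" using that assms(2) by (meson bij_is_inj injD)
    then show ?thesis using assms(1) by (auto simp: supp_def)
  qed
  then show ?thesis using assms(1) by (auto simp: supp_def; metis)
qed

lemma supp_cyc2:
  assumes "distinct l" "2 \<le> k" "length l \<noteq> Suc k" "length l \<ge> 2"
  shows "supp (cyc2 k l) = set l"
proof -
  have d: "set (take k l) \<inter> set (drop k l) = {}" using assms(1)
    by (simp add: set_take_disj_set_drop_if_distinct)
  have "supp (cycle_of_list (drop k l)) = set (drop k l)"
    using assms by (intro supp_cycle) auto
  moreover have "supp (cycle_of_list (take k l)) = set (take k l)"
    using assms by (intro supp_cycle) auto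
  ultimately have "supp (cyc2 k l) = set (drop k l) \<union> set (take k l)"
    unfolding cyc2_def using d
    by (subst supp_comp_disjoint) (auto intro: permutation_bijective permutation_of_cycle)
  also have "\<dots> = set l" by (metis Un_commute append_take_drop_id set_append)
  finally show ?thesis .
qed

lemma supp_cls_list:
  assumes "i \<in> {1..6}" "distinct l" "length l = msz i"
  shows "supp (cyc2 (lead i) l) = set l"
  using assms by (intro supp_cyc2) (auto simp: in_1_6 lead_def msz_def)

lemma finite_supp_cls: "\<tau> \<in> cls i \<Longrightarrow> finite (supp \<tau>)"
  by (auto simp: cls_def supp_cls_list)

lemma card_supp_cls: "\<tau> \<in> cls i \<Longrightarrow> card (supp \<tau>) = msz i"
  by (auto simp: cls_def supp_cls_list distinct_card)

lemma permutation_cls: "\<tau> \<in> cls i \<Longrightarrow> permutation \<tau>"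
  by (auto simp: cls_def cyc2_def intro!: permutation_compose permutation_of_cycle)

lemma conj_cls:
  assumes "\<tau> \<in> cls i" "bij p"
  shows "p \<circ> \<tau> \<circ> pinv p \<in> cls i"
proof -
  obtain l where l: "\<tau> = cyc2 (lead i) l" "i \<in> {1..6}" "distinct l" "length l = msz i"
    using assms(1) by (auto simp: cls_def)
  have "p \<circ> \<tau> \<circ> pinv p = (p \<circ> cycle_of_list (drop (lead i) l) \<circ> pinv p) \<circ>
      (p \<circ> cycle_of_list (take (lead i) l) \<circ> pinv p)"
    using assms(2) by (simp add: l(1) cyc2_def fun_eq_iff bij_is_inj)
  also have "\<dots> = cyc2 (lead i) (map p l)"
    using l(3) assms(2) by (simp add: conjugation_of_cycle cyc2_def drop_map take_map)
  finally show ?thesis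
    using l inj_on_subset[OF bij_is_inj[OF assms(2)], of "set l"]
    by (auto simp: cls_def distinct_map intro!: exI[of _ "map p l"])
qed

lemma supp_conj:
  assumes p: "bij p"
  shows "supp (p \<circ> \<tau> \<circ> pinv p) = p ` supp \<tau>"
proof -
  have "x \<in> supp (p \<circ> \<tau> \<circ> pinv p) \<longleftrightarrow> pinv p x \<in> supp \<tau>" for x
    using bij_inv_eq_iff[OF p, of "\<tau> (pinv p x)" x] by (auto simp: supp_def)
  moreover have "x \<in> p ` S \<longleftrightarrow> pinv p x \<in> S" for x S
    using bij_inv_eq_iff[OF p] by (metis image_iff)
  ultimately show ?thesis by auto
qed

lemma length2: "length l = 2 \<longleftrightarrow> (\<exists>p q. l = [p, q])"
  by (auto simp: numeral_eq_Suc length_Suc_conv)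
lemma length3: "length l = 3 \<longleftrightarrow> (\<exists>p q r. l = [p, q, r])"
  by (auto simp: numeral_eq_Suc length_Suc_conv)
lemma length4: "length l = 4 \<longleftrightarrow> (\<exists>p q r s. l = [p, q, r, s])"
  by (auto simp: numeral_eq_Suc length_Suc_conv)
lemma length5: "length l = 5 \<longleftrightarrow> (\<exists>p q r s t. l = [p, q, r, s, t])"
  by (auto simp: numeral_eq_Suc length_Suc_conv)

lemma cyc2_cls:
  "cyc2 (lead 1) [p, q] = cycle_of_list [p, q]"
  "cyc2 (lead 2) [p, q, r] = cycle_of_list [p, q, r]"
  "cyc2 (lead 3) [p, q, r, s] = cycle_of_list [r, s] \<circ> cycle_of_list [p, q]"
  "cyc2 (lead 4) [p, q, r, s] = cycle_of_list [p, q, r, s]"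
  "cyc2 (lead 5) [p, q, r, s, t] = cycle_of_list [s, t] \<circ> cycle_of_list [p, q, r]"
  "cyc2 (lead 6) [p, q, r, s, t] = cycle_of_list [p, q, r, s, t]"
  by (simp_all add: cyc2_def lead_def numeral_eq_Suc)

lemma msz_simps: "msz 1 = 2" "msz 2 = 3" "msz 3 = 4" "msz 4 = 4" "msz 5 = 5" "msz 6 = 5"
  by (simp_all add: msz_def)

lemma cls_image: "i \<in> {1..6} \<Longrightarrow> cls i = {cyc2 (lead i) l | l. distinct l \<and> length l = msz i}"
  by (simp add: cls_def)

lemma cls_explicit:
  "cls 1 = {cycle_of_list [p, q] | p q. distinct [p, q]}"
  "cls 2 = {cycle_of_list [p, q, r] | p q r. distinct [p, q, r]}"
  "cls 3 = {cycle_of_list [r, s] \<circ> cycle_of_list [p, q] | p q r s. distinct [p, q, r, s]}"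
  "cls 4 = {cycle_of_list [p, q, r, s] | p q r s. distinct [p, q, r, s]}"
  "cls 5 = {cycle_of_list [s, t] \<circ> cycle_of_list [p, q, r] | p q r s t. distinct [p, q, r, s, t]}"
  "cls 6 = {cycle_of_list [p, q, r, s, t] | p q r s t. distinct [p, q, r, s, t]}"
proof -
  note im = cls_image[unfolded in_1_6]
  show "cls 1 = {cycle_of_list [p, q] | p q. distinct [p, q]}"
    unfolding cyc2_cls(1)[symmetric] by (subst im, simp, unfold msz_simps length2, blast)
  show "cls 2 = {cycle_of_list [p, q, r] | p q r. distinct [p, q, r]}"
    unfolding cyc2_cls(2)[symmetric] by (subst im, simp, unfold msz_simps length3, blast)
  show "cls 3 = {cycle_of_list [r, s] \<circ> cycle_of_list [p, q] | p q r s. distinct [p, q, r, s]}"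
    unfolding cyc2_cls(3)[symmetric] by (subst im, simp, unfold msz_simps length4, blast)
  show "cls 4 = {cycle_of_list [p, q, r, s] | p q r s. distinct [p, q, r, s]}"
    unfolding cyc2_cls(4)[symmetric] by (subst im, simp, unfold msz_simps length4, blast)
  show "cls 5 = {cycle_of_list [s, t] \<circ> cycle_of_list [p, q, r] | p q r s t. distinct [p, q, r, s, t]}"
    unfolding cyc2_cls(5)[symmetric] by (subst im, simp, unfold msz_simps length5, blast)
  show "cls 6 = {cycle_of_list [p, q, r, s, t] | p q r s t. distinct [p, q, r, s, t]}"
    unfolding cyc2_cls(6)[symmetric] by (subst im, simp, unfold msz_simps length5, blast)
qed

lemma cls_cases:
  assumes "\<tau> \<in> cls i"
  obtains (1) p q where "i = 1" "\<tau> = cycle_of_list [p, q]" "distinct [p, q]"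
  | (2) p q r where "i = 2" "\<tau> = cycle_of_list [p, q, r]" "distinct [p, q, r]"
  | (3) p q r s where "i = 3" "\<tau> = cycle_of_list [r, s] \<circ> cycle_of_list [p, q]" "distinct [p, q, r, s]"
  | (4) p q r s where "i = 4" "\<tau> = cycle_of_list [p, q, r, s]" "distinct [p, q, r, s]"
  | (5) p q r s t where "i = 5" "\<tau> = cycle_of_list [s, t] \<circ> cycle_of_list [p, q, r]"
      "distinct [p, q, r, s, t]"
  | (6) p q r s t where "i = 6" "\<tau> = cycle_of_list [p, q, r, s, t]" "distinct [p, q, r, s, t]"
proof -
  note prem = that
  have "i \<in> {1..6}" using assms by (auto simp: cls_def)
  then have "i = 1 \<or> i = 2 \<or> i = 3 \<or> i = 4 \<or> i = 5 \<or> i = 6" unfolding in_1_6 .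
  moreover have thesis if i: "i = 1"
  proof -
    obtain p q where "\<tau> = cycle_of_list [p, q]" "distinct [p, q]" using assms unfolding i cls_explicit by blast
    then show thesis by (rule prem(1)[OF i])
  qed
  moreover have thesis if i: "i = 2"
  proof -
    obtain p q r where "\<tau> = cycle_of_list [p, q, r]" "distinct [p, q, r]" using assms unfolding i cls_explicit by blast
    then show thesis by (rule prem(2)[OF i])
  qed
  moreover have thesis if i: "i = 3"
  proof -
    obtain p q r s where "\<tau> = cycle_of_list [r, s] \<circ> cycle_of_list [p, q]" "distinct [p, q, r, s]" using assms unfolding i cls_explicit by blast
    then show thesis by (rule prem(3)[OF i])
  qed
  moreover have thesis if i: "i = 4"
  proof -
    obtain p q r s where "\<tau> = cycle_of_list [p, q, r, s]" "distinct [p, q, r, s]" using assms unfolding i cls_explicit by blast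
    then show thesis by (rule prem(4)[OF i])
  qed
  moreover have thesis if i: "i = 5"
  proof -
    obtain p q r s t where "\<tau> = cycle_of_list [s, t] \<circ> cycle_of_list [p, q, r]" "distinct [p, q, r, s, t]" using assms unfolding i cls_explicit by blast
    then show thesis by (rule prem(5)[OF i])
  qed
  moreover have thesis if i: "i = 6"
  proof -
    obtain p q r s t where "\<tau> = cycle_of_list [p, q, r, s, t]" "distinct [p, q, r, s, t]" using assms unfolding i cls_explicit by blast
    then show thesis by (rule prem(6)[OF i])
  qed
  ultimately show thesis by blast
qed

text \<open>Reversing the letters of each cycle inverts it, and the disjoint factors in classes 3
  and 5 commute.\<close>

lemma inv_cls:
  assumes "\<tau> \<in> cls i"
  shows "pinv \<tau> \<in> cls i"
proof -
  have *: "pinv \<tau> = \<rho>" if "\<rho> \<circ> \<tau> = id" "\<tau> \<circ> \<rho> = id" for \<rho>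
    by (rule inv_unique_comp[OF that(2) that(1)])
  have "\<exists>\<rho>\<in>cls i. \<rho> \<circ> \<tau> = id \<and> \<tau> \<circ> \<rho> = id"
    using assms
  proof (cases rule: cls_cases)
    case (1 p q)
    have "cycle_of_list [p, q] \<in> cls i" using 1 unfolding 1(1) cls_explicit by blast
    then show ?thesis using 1 by (intro bexI[of _ "cycle_of_list [p, q]"]) auto
  next
    case (2 p q r)
    have "cycle_of_list [r, q, p] \<in> cls i"
      using 2(3) unfolding 2(1) cls_explicit by (auto simp del: cycle_of_list.simps)
    then show ?thesis unfolding 2(2)
      by (intro bexI[of _ "cycle_of_list [r, q, p]"])
        (simp_all add: fun_eq_iff transpose_commute[of r q] transpose_commute[of q p])
  next
    case (3 p q r s)
    have "cycle_of_list [p, q] \<circ> cycle_of_list [r, s] \<in> cls i"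
      using 3(3) unfolding 3(1) cls_explicit mem_Collect_eq
      by (intro exI[of _ r] exI[of _ s] exI[of _ p] exI[of _ q]) auto
    then show ?thesis unfolding 3(2)
      by (intro bexI[of _ "cycle_of_list [p, q] \<circ> cycle_of_list [r, s]"])
        (simp_all add: fun_eq_iff)
  next
    case (4 p q r s)
    have "cycle_of_list [s, r, q, p] \<in> cls i"
      using 4(3) unfolding 4(1) cls_explicit mem_Collect_eq
      by (intro exI[of _ s] exI[of _ r] exI[of _ q] exI[of _ p]) auto
    then show ?thesis unfolding 4(2)
      by (intro bexI[of _ "cycle_of_list [s, r, q, p]"])
        (simp_all add: fun_eq_iff transpose_commute[of s r] transpose_commute[of r q] transpose_commute[of q p])
  next
    case (5 p q r s t)
    have "cycle_of_list [s, t] \<circ> cycle_of_list [r, q, p] = cycle_of_list [r, q, p] \<circ> cycle_of_list [s, t]"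
      using 5(3) by (intro cycles_commute) auto
    moreover have "cycle_of_list [s, t] \<circ> cycle_of_list [r, q, p] \<in> cls i"
      using 5(3) unfolding 5(1) cls_explicit mem_Collect_eq
      by (intro exI[of _ r] exI[of _ q] exI[of _ p] exI[of _ s] exI[of _ t]) auto
    ultimately have "cycle_of_list [r, q, p] \<circ> cycle_of_list [s, t] \<in> cls i" by simp
    then show ?thesis unfolding 5(2)
      by (intro bexI[of _ "cycle_of_list [r, q, p] \<circ> cycle_of_list [s, t]"])
        (simp_all add: fun_eq_iff transpose_commute[of r q] transpose_commute[of q p])
  next
    case (6 p q r s t)
    have "cycle_of_list [t, s, r, q, p] \<in> cls i"
      using 6(3) unfolding 6(1) cls_explicit mem_Collect_eq
      by (intro exI[of _ t] exI[of _ s] exI[of _ r] exI[of _ q] exI[of _ p]) auto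
    then show ?thesis unfolding 6(2)
      by (intro bexI[of _ "cycle_of_list [t, s, r, q, p]"])
        (simp_all add: fun_eq_iff transpose_commute[of t s] transpose_commute[of s r]
          transpose_commute[of r q] transpose_commute[of q p])
  qed
  then show ?thesis using * by auto
qed

lemma sign_cls:
  assumes "\<tau> \<in> cls i"
  shows "sign \<tau> = eps i"
  using assms
  by (cases rule: cls_cases)
    (simp_all add: eps_def sign_compose sign_swap_id permutation_compose permutation_swap_id)

lemma supp_inv: "bij \<tau> \<Longrightarrow> supp (pinv \<tau>) = supp \<tau>"
  by (auto simp: supp_def) (metis bij_inv_eq_iff)+

lemma permutes_supp: "bij p \<Longrightarrow> supp p \<subseteq> A \<Longrightarrow> p permutes A"
  by (auto simp: supp_def permutes_def bij_iff)

lemma supp_permutes: "p permutes A \<Longrightarrow> supp p \<subseteq> A"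
  by (auto simp: supp_def permutes_def)

lemma bij_cls: "\<tau> \<in> cls i \<Longrightarrow> bij \<tau>"
  using permutation_cls permutation_bijective by auto

lemma Tc_permutes: "\<tau> \<in> Tc i A K \<Longrightarrow> \<tau> permutes A"
  by (auto simp: Tc_def intro: permutes_supp bij_cls)

lemma finite_Tc: "finite A \<Longrightarrow> finite (Tc i A K)"
  by (rule finite_subset[OF _ finite_permutations[of A]]) (auto intro: Tc_permutes)

lemma inv_Tc: "\<tau> \<in> Tc i A K \<Longrightarrow> pinv \<tau> \<in> Tc i A K"
  by (auto simp: Tc_def inv_cls supp_inv bij_cls)

lemma conj_Tc:
  assumes "bij p"
  shows "(\<lambda>\<tau>. p \<circ> \<tau> \<circ> pinv p) ` Tc i A K = Tc i (p ` A) (p ` K)"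
proof
  show "(\<lambda>\<tau>. p \<circ> \<tau> \<circ> pinv p) ` Tc i A K \<subseteq> Tc i (p ` A) (p ` K)"
    unfolding Tc_def
    by (auto simp only: conj_cls[OF _ assms] supp_conj[OF assms] image_iff) blast+
  show "Tc i (p ` A) (p ` K) \<subseteq> (\<lambda>\<tau>. p \<circ> \<tau> \<circ> pinv p) ` Tc i A K"
  proof
    fix \<tau> assume \<tau>: "\<tau> \<in> Tc i (p ` A) (p ` K)"
    define \<rho> where "\<rho> = pinv p \<circ> \<tau> \<circ> pinv (pinv p)"
    have b: "bij (pinv p)" using assms by (simp add: bij_imp_bij_inv)
    have "\<rho> \<in> cls i" unfolding \<rho>_def using \<tau> by (intro conj_cls b) (auto simp: Tc_def)
    moreover have "supp \<rho> = pinv p ` supp \<tau>" unfolding \<rho>_def by (rule supp_conj[OF b])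
    moreover have "pinv p ` (p ` S) = S" for S using assms by (simp add: bij_is_inj image_inv_f_f)
    ultimately have "\<rho> \<in> Tc i A K" using \<tau> unfolding Tc_def
      by (metis (mono_tags, lifting) image_mono mem_Collect_eq)
    moreover have "\<tau> = p \<circ> \<rho> \<circ> pinv p"
      using assms by (simp add: \<rho>_def fun_eq_iff inv_inv_eq bij_is_surj surj_f_inv_f)
    ultimately show "\<tau> \<in> (\<lambda>\<tau>. p \<circ> \<tau> \<circ> pinv p) ` Tc i A K" by auto
  qed
qed

text \<open>An element of the class either fixes \<open>x\<close> or moves it. The counting
  inductions and the inductive estimate all follow this splitting, which removes \<open>x\<close>
  from \<open>A\<close> or adds it to \<open>K\<close>.\<close>

lemma Tc_split: "Tc i A K = Tc i (A - {x}) K \<union> Tc i A (insert x K)"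
  and Tc_split_disjoint: "Tc i (A - {x}) K \<inter> Tc i A (insert x K) = {}"
  by (auto simp: Tc_def)

lemma sum_Tc_split:
  fixes g :: "(nat \<Rightarrow> nat) \<Rightarrow> 'b::comm_monoid_add"
  assumes "finite A"
  shows "sum g (Tc i A K) = sum g (Tc i (A - {x}) K) + sum g (Tc i A (insert x K))"
  by (subst Tc_split[of i A K x], rule sum.union_disjoint)
    (use assms Tc_split_disjoint[of i A x K] in \<open>simp_all add: finite_Tc\<close>)

lemma Tc_explicit:
  "i \<in> {1..6} \<Longrightarrow> Tc i A K =
     {cyc2 (lead i) l | l. distinct l \<and> length l = msz i \<and> K \<subseteq> set l \<and> set l \<subseteq> A}"
  by (auto simp: Tc_def cls_def supp_cls_list)

lemma conj_class_eq: "conj_class n i = Tc i {1..n} {}"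
proof (cases "i \<in> {1..6}")
  case True
  note ex = Tc_explicit[unfolded in_1_6]
  have c1: "conj_class n 1 = Tc 1 {1..n} {}"
  proof -
    have "Tc 1 {1..n} {} = {cyc2 (lead 1) l | l. (distinct l \<and> set l \<subseteq> {1..n}) \<and> length l = 2}"
      by (subst ex, simp, unfold msz_simps, blast)
    also have "\<dots> = conj_class n 1"
      unfolding length2 conj_class_def perm_mult_def cyc2_cls(1)[symmetric]
      by (simp only: if_True if_False one_eq_numeral_iff numeral_eq_one_iff numeral_eq_iff num.simps simp_thms, blast)
    finally show ?thesis by simp
  qed
  have c2: "conj_class n 2 = Tc 2 {1..n} {}"
  proof -
    have "Tc 2 {1..n} {} = {cyc2 (lead 2) l | l. (distinct l \<and> set l \<subseteq> {1..n}) \<and> length l = 3}"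
      by (subst ex, simp, unfold msz_simps, blast)
    also have "\<dots> = conj_class n 2"
      unfolding length3 conj_class_def perm_mult_def cyc2_cls(2)[symmetric]
      by (simp only: if_True if_False one_eq_numeral_iff numeral_eq_one_iff numeral_eq_iff num.simps simp_thms, blast)
    finally show ?thesis by simp
  qed
  have c3: "conj_class n 3 = Tc 3 {1..n} {}"
  proof -
    have "Tc 3 {1..n} {} = {cyc2 (lead 3) l | l. (distinct l \<and> set l \<subseteq> {1..n}) \<and> length l = 4}"
      by (subst ex, simp, unfold msz_simps, blast)
    also have "\<dots> = conj_class n 3"
      unfolding length4 conj_class_def perm_mult_def cyc2_cls(3)[symmetric]
      by (simp only: if_True if_False one_eq_numeral_iff numeral_eq_one_iff numeral_eq_iff num.simps simp_thms, blast)
    finally show ?thesis by simp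
  qed
  have c4: "conj_class n 4 = Tc 4 {1..n} {}"
  proof -
    have "Tc 4 {1..n} {} = {cyc2 (lead 4) l | l. (distinct l \<and> set l \<subseteq> {1..n}) \<and> length l = 4}"
      by (subst ex, simp, unfold msz_simps, blast)
    also have "\<dots> = conj_class n 4"
      unfolding length4 conj_class_def perm_mult_def cyc2_cls(4)[symmetric]
      by (simp only: if_True if_False one_eq_numeral_iff numeral_eq_one_iff numeral_eq_iff num.simps simp_thms, blast)
    finally show ?thesis by simp
  qed
  have c5: "conj_class n 5 = Tc 5 {1..n} {}"
  proof -
    have "Tc 5 {1..n} {} = {cyc2 (lead 5) l | l. (distinct l \<and> set l \<subseteq> {1..n}) \<and> length l = 5}"
      by (subst ex, simp, unfold msz_simps, blast)
    also have "\<dots> = conj_class n 5"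
      unfolding length5 conj_class_def perm_mult_def cyc2_cls(5)[symmetric]
      by (simp only: if_True if_False one_eq_numeral_iff numeral_eq_one_iff numeral_eq_iff num.simps simp_thms, blast)
    finally show ?thesis by simp
  qed
  have c6: "conj_class n 6 = Tc 6 {1..n} {}"
  proof -
    have "Tc 6 {1..n} {} = {cyc2 (lead 6) l | l. (distinct l \<and> set l \<subseteq> {1..n}) \<and> length l = 5}"
      by (subst ex, simp, unfold msz_simps, blast)
    also have "\<dots> = conj_class n 6"
      unfolding length5 conj_class_def perm_mult_def cyc2_cls(6)[symmetric]
      by (simp only: if_True if_False one_eq_numeral_iff numeral_eq_one_iff numeral_eq_iff num.simps simp_thms, blast)
    finally show ?thesis by simp
  qed
  show ?thesis using True c1 c2 c3 c4 c5 c6 unfolding in_1_6 by metis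
next
  case False
  then show ?thesis by (auto simp: Tc_def cls_def conj_class_def)
qed

section \<open>Rooted decompositions of the class sums\<close>

definition dl :: "nat set \<Rightarrow> nat \<Rightarrow> nat list set" where
  "dl B r = {l. distinct l \<and> length l = r \<and> set l \<subseteq> B}"

lemma finite_dl: "finite B \<Longrightarrow> finite (dl B r)"
  unfolding dl_def by (rule finite_subset[OF _ finite_lists_length_eq[of B r]]) auto

lemma card_set_dl: "l \<in> dl B r \<Longrightarrow> card (set l) = r"
  by (auto simp: dl_def distinct_card)

lemma sum_dl1:
  fixes h :: "nat list \<Rightarrow> 'b::comm_monoid_add"
  assumes "finite B" "r > 0"
  shows "sum h (dl B r) = (\<Sum>b\<in>B. \<Sum>l\<in>dl (B - {b}) (r - 1). h (b # l))"
proof -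
  have "dl B r = (\<lambda>(b, l). b # l) ` (SIGMA b:B. dl (B - {b}) (r - 1))"
  proof (intro equalityI subsetI)
    fix l assume "l \<in> dl B r"
    then show "l \<in> (\<lambda>(b, l). b # l) ` (SIGMA b:B. dl (B - {b}) (r - 1))"
      using assms(2) by (cases l) (auto simp: dl_def image_iff)
  qed (use assms(2) in \<open>auto simp: dl_def\<close>)
  then have "sum h (dl B r) = (\<Sum>x\<in>(SIGMA b:B. dl (B - {b}) (r - 1)). h ((\<lambda>(b, l). b # l) x))"
    by (simp add: sum.reindex inj_on_def)
  also have "\<dots> = (\<Sum>b\<in>B. \<Sum>l\<in>dl (B - {b}) (r - 1). h (b # l))"
    using assms(1) by (subst sum.Sigma) (auto simp: finite_dl case_prod_unfold)
  finally show ?thesis .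
qed

lemma sum_dl2:
  fixes h :: "nat list \<Rightarrow> 'b::comm_monoid_add"
  assumes "finite B" "r > 0"
  shows "sum h (dl B r) = (\<Sum>l\<in>dl B (r - 1). \<Sum>b\<in>B - set l. h (b # l))"
proof -
  have "dl B r = (\<lambda>(l, b). b # l) ` (SIGMA l:dl B (r - 1). B - set l)"
  proof (intro equalityI subsetI)
    fix l assume "l \<in> dl B r"
    then show "l \<in> (\<lambda>(l, b). b # l) ` (SIGMA l:dl B (r - 1). B - set l)"
      using assms(2) by (cases l) (auto simp: dl_def image_iff)
  qed (use assms(2) in \<open>auto simp: dl_def\<close>)
  then have "sum h (dl B r) = (\<Sum>x\<in>(SIGMA l:dl B (r - 1). B - set l). h ((\<lambda>(l, b). b # l) x))"
    by (simp add: sum.reindex inj_on_def)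
  also have "\<dots> = (\<Sum>l\<in>dl B (r - 1). \<Sum>b\<in>B - set l. h (b # l))"
    using assms(1) by (subst sum.Sigma) (auto simp: finite_dl case_prod_unfold)
  finally show ?thesis .
qed

lemma sum_dl_rev:
  fixes h :: "nat list \<Rightarrow> 'b::comm_monoid_add"
  shows "(\<Sum>l\<in>dl B r. h (rev l)) = sum h (dl B r)"
  by (rule sum.reindex_bij_witness[of _ rev rev]) (auto simp: dl_def)

lemma sum_dl_1:
  fixes h :: "nat list \<Rightarrow> 'b::comm_monoid_add"
  shows "sum h (dl B 1) = (\<Sum>b\<in>B. h [b])"
proof (rule sum.reindex_bij_witness[of _ "\<lambda>b. [b]" hd])
  fix l assume "l \<in> dl B 1"
  then have "length l = 1" "set l \<subseteq> B" by (auto simp: dl_def)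
  then show "[hd l] = l" "hd l \<in> B" "h [hd l] = h l" by (cases l; auto simp: One_nat_def)+
qed (auto simp: dl_def One_nat_def)

lemma cycle_conv_funpow:
  assumes "distinct cs" "n < length cs"
  shows "cs ! n = (cycle_of_list cs ^^ n) (cs ! 0)"
proof -
  have "(cycle_of_list cs ^^ n) (cs ! 0) = map (cycle_of_list cs ^^ n) cs ! 0"
    using assms(2) by (subst nth_map) auto
  also have "\<dots> = rotate n cs ! 0" using cyclic_rotation[OF assms(1)] by simp
  also have "\<dots> = cs ! n" using assms(2) by (subst nth_rotate) auto
  finally show ?thesis by simp
qed

lemma cycle_inj:
  assumes "cycle_of_list (x # l) = cycle_of_list (x # l')" "distinct (x # l)" "distinct (x # l')"
    "length l = length l'"
  shows "l = l'"
proof -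
  have "x # l = x # l'"
    using assms by (intro nth_equalityI) (simp, metis cycle_conv_funpow length_Cons nth_Cons_0)
  then show ?thesis by simp
qed

lemma cyc2_cycle: "i \<in> {1, 2, 4, 6} \<Longrightarrow> length l = msz i \<Longrightarrow> cyc2 (lead i) l = cycle_of_list l"
  by (auto simp: cyc2_def lead_def msz_def)

text \<open>A rotation brings \<open>x\<close> to the front, and the cycle then determines the list.
  Sums over cycles through \<open>x\<close> become sums over lists without multiplicities.\<close>

lemma Tc_root_cycle:
  assumes i: "i \<in> {1, 2, 4, 6}" and x: "x \<notin> B"
  shows "Tc i (insert x B) {x} = (\<lambda>l. cycle_of_list (x # l)) ` dl B (msz i - 1)"
proof (intro equalityI subsetI)
  have i6: "i \<in> {1..6}" using i by auto
  have m: "msz i > 1" by (simp add: msz_def)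
  {
    fix \<tau> assume "\<tau> \<in> Tc i (insert x B) {x}"
    then obtain l where l: "\<tau> = cycle_of_list l" "distinct l" "length l = msz i" "x \<in> set l"
      "set l \<subseteq> insert x B"
      unfolding Tc_explicit[OF i6] using cyc2_cycle[OF i] by auto
    obtain us vs where uv: "l = us @ x # vs" using l(4) by (meson split_list)
    have r: "rotate (length us) l = x # vs @ us" by (simp add: uv rotate_append)
    have "\<tau> = cycle_of_list (x # vs @ us)"
      unfolding l(1) r[symmetric] by (rule cycle_of_list_rotate_independent[OF l(2)])
    moreover have "vs @ us \<in> dl B (msz i - 1)" using l m unfolding uv by (auto simp: dl_def)
    ultimately show "\<tau> \<in> (\<lambda>l. cycle_of_list (x # l)) ` dl B (msz i - 1)" by blast
  }
  {
    fix \<tau> assume "\<tau> \<in> (\<lambda>l. cycle_of_list (x # l)) ` dl B (msz i - 1)"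
    then obtain l where l: "\<tau> = cycle_of_list (x # l)" "l \<in> dl B (msz i - 1)" by blast
    then have "distinct (x # l)" "length (x # l) = msz i" "{x} \<subseteq> set (x # l)" "set (x # l) \<subseteq> insert x B"
      using x m by (auto simp: dl_def)
    moreover from this have "\<tau> = cyc2 (lead i) (x # l)" using cyc2_cycle[OF i] l by simp
    ultimately show "\<tau> \<in> Tc i (insert x B) {x}" unfolding Tc_explicit[OF i6] by blast
  }
qed

lemma sum_root_cycle:
  fixes g :: "(nat \<Rightarrow> nat) \<Rightarrow> 'b::comm_monoid_add"
  assumes "i \<in> {1, 2, 4, 6}" and x: "x \<notin> B"
  shows "sum g (Tc i (insert x B) {x}) = (\<Sum>l\<in>dl B (msz i - 1). g (cycle_of_list (x # l)))"
proof -
  have "inj_on (\<lambda>l. cycle_of_list (x # l)) (dl B (msz i - 1))"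
    using x by (intro inj_onI cycle_inj[of x]) (auto simp: dl_def)
  then show ?thesis unfolding Tc_root_cycle[OF assms] by (simp add: sum.reindex)
qed

lemma sum_root_1:
  fixes g :: "(nat \<Rightarrow> nat) \<Rightarrow> 'b::comm_monoid_add"
  assumes "x \<notin> B"
  shows "sum g (Tc 1 (insert x B) {x}) = (\<Sum>b\<in>B. g (transpose x b))"
  using sum_root_cycle[of 1 x B g] assms by (simp add: msz_simps sum_dl_1[unfolded One_nat_def])

lemma sum_root_at:
  fixes g :: "(nat \<Rightarrow> nat) \<Rightarrow> 'b::comm_monoid_add"
  assumes "i \<in> {1, 2, 4, 6}" and "b \<in> B"
  shows "sum g (Tc i B {b}) = (\<Sum>l\<in>dl (B - {b}) (msz i - 1). g (cycle_of_list (b # l)))"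
  using sum_root_cycle[of i b "B - {b}" g] assms by (simp add: insert_absorb)

lemma Tc_1_explicit: "Tc 1 C {} = {transpose p q | p q. p \<noteq> q \<and> p \<in> C \<and> q \<in> C}"
proof -
  have "Tc 1 C {} = {cyc2 (lead 1) l | l. distinct l \<and> length l = 2 \<and> set l \<subseteq> C}"
    by (subst Tc_explicit, simp, unfold msz_simps) simp
  also have "\<dots> = {cyc2 (lead 1) [p, q] | p q. distinct [p, q] \<and> set [p, q] \<subseteq> C}"
    unfolding length2 by blast
  finally show ?thesis by (simp add: cyc2_cls)
qed

lemma Tc_fix: "\<tau> \<in> Tc i A K \<Longrightarrow> x \<notin> A \<Longrightarrow> \<tau> x = x"
  by (auto simp: Tc_def supp_def)

lemma transpose_comp_cancel: "transpose x b \<circ> \<tau> = transpose x b \<circ> \<tau>' \<Longrightarrow> \<tau> = \<tau>'"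
  by (metis comp_assoc comp_id id_comp swap_id_idempotent)

lemma Tc_root_3:
  assumes x: "x \<notin> B"
  shows "Tc 3 (insert x B) {x} = (\<lambda>(b, \<tau>). transpose x b \<circ> \<tau>) ` (SIGMA b:B. Tc 1 (B - {b}) {})"
proof (intro equalityI subsetI)
  {
    fix \<tau> assume "\<tau> \<in> Tc 3 (insert x B) {x}"
    then obtain p q r s where d: "distinct [p, q, r, s]" "x \<in> {p, q, r, s}" "{p, q, r, s} \<subseteq> insert x B"
      and \<tau>: "\<tau> = transpose r s \<circ> transpose p q"
      by (subst (asm) Tc_explicit, simp, unfold msz_simps length4) (auto simp: cyc2_cls)
    have comm: "transpose r s \<circ> transpose p q = transpose p q \<circ> transpose r s"
      using d by (auto simp: fun_eq_iff transpose_def)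
    have "\<exists>b c e. \<tau> = transpose x b \<circ> transpose c e \<and> distinct [x, b, c, e] \<and> {b, c, e} \<subseteq> B"
    proof -
      consider "x = r" | "x = s" | "x = p" | "x = q" using d by auto
      then show ?thesis
      proof cases
        case 1
        then show ?thesis using d \<tau> by (intro exI[of _ s] exI[of _ p] exI[of _ q]) auto
      next
        case 2
        have "\<tau> = transpose s r \<circ> transpose p q" unfolding \<tau> by (subst transpose_commute) (rule refl)
        then show ?thesis using d 2 by (intro exI[of _ r] exI[of _ p] exI[of _ q]) auto
      next
        case 3
        then show ?thesis using d \<tau> comm by (intro exI[of _ q] exI[of _ r] exI[of _ s]) auto
      next
        case 4
        have "\<tau> = transpose q p \<circ> transpose r s" unfolding \<tau> comm by (subst transpose_commute) (rule refl)
        then show ?thesis using d 4 by (intro exI[of _ p] exI[of _ r] exI[of _ s]) auto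
      qed
    qed
    then obtain b c e where "\<tau> = transpose x b \<circ> transpose c e" "distinct [x, b, c, e]" "{b, c, e} \<subseteq> B"
      by blast
    then show "\<tau> \<in> (\<lambda>(b, \<tau>). transpose x b \<circ> \<tau>) ` (SIGMA b:B. Tc 1 (B - {b}) {})"
      unfolding Tc_1_explicit by (intro image_eqI[of _ _ "(b, transpose c e)"]) auto
  }
  {
    fix \<tau> assume "\<tau> \<in> (\<lambda>(b, \<tau>). transpose x b \<circ> \<tau>) ` (SIGMA b:B. Tc 1 (B - {b}) {})"
    then obtain b c e where "\<tau> = transpose x b \<circ> transpose c e" "distinct [c, e, x, b]" "{b, c, e} \<subseteq> B"
      using x unfolding Tc_1_explicit by auto
    moreover from this have "\<tau> = cyc2 (lead 3) [c, e, x, b]" by (simp add: cyc2_cls)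
    ultimately show "\<tau> \<in> Tc 3 (insert x B) {x}"
      by (subst Tc_explicit, simp) (auto simp: msz_simps intro!: exI[of _ "[c, e, x, b]"])
  }
qed

lemma sum_root_3:
  fixes g :: "(nat \<Rightarrow> nat) \<Rightarrow> 'b::comm_monoid_add"
  assumes x: "x \<notin> B" and fin: "finite B"
  shows "sum g (Tc 3 (insert x B) {x}) = (\<Sum>b\<in>B. \<Sum>\<tau>\<in>Tc 1 (B - {b}) {}. g (transpose x b \<circ> \<tau>))"
proof -
  have "inj_on (\<lambda>(b, \<tau>). transpose x b \<circ> \<tau>) (SIGMA b:B. Tc 1 (B - {b}) {})"
  proof (rule inj_onI, clarsimp)
    fix b \<tau> b' \<tau>'
    assume h: "\<tau> \<in> Tc 1 (B - {b}) {}" "\<tau>' \<in> Tc 1 (B - {b'}) {}"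
      and eq: "transpose x b \<circ> \<tau> = transpose x b' \<circ> \<tau>'"
    have "\<tau> x = x" "\<tau>' x = x" using h x by (auto intro: Tc_fix)
    then have "b = b'" using fun_cong[OF eq, of x] by simp
    then show "b = b' \<and> \<tau> = \<tau>'" using eq transpose_comp_cancel by auto
  qed
  then show ?thesis unfolding Tc_root_3[OF x]
    using fin by (simp add: sum.reindex sum.Sigma finite_Tc case_prod_unfold)
qed

text \<open>The root \<open>x\<close> lies either in the transposition or in the 3-cycle; in both
  shapes the factor that contains \<open>x\<close> is written on the left.\<close>

lemma Tc_root_5:
  assumes x: "x \<notin> B"
  shows "Tc 5 (insert x B) {x} =
     (\<lambda>(b, \<tau>). transpose x b \<circ> \<tau>) ` (SIGMA b:B. Tc 2 (B - {b}) {}) \<union>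
     (\<lambda>(l, \<tau>). cycle_of_list (x # l) \<circ> \<tau>) ` (SIGMA l:dl B 2. Tc 1 (B - set l) {})" (is "_ = ?P \<union> ?Q")
proof (intro equalityI subsetI)
  {
    fix \<tau> assume "\<tau> \<in> Tc 5 (insert x B) {x}"
    then obtain l where l: "\<tau> = cyc2 (lead 5) l" "distinct l" "length l = 5" "x \<in> set l" "set l \<subseteq> insert x B"
      by (subst (asm) Tc_explicit, simp, unfold msz_simps) auto
    then obtain p q r s t where pl: "l = [p, q, r, s, t]" unfolding length5 by blast
    have d: "distinct [p, q, r, s, t]" "x \<in> {p, q, r, s, t}" "{p, q, r, s, t} \<subseteq> insert x B"
      using l unfolding pl by auto
    have \<tau>: "\<tau> = transpose s t \<circ> cycle_of_list [p, q, r]"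
      using l(1) by (simp add: pl cyc2_cls)
    have \<tau>': "\<tau> = cycle_of_list [p, q, r] \<circ> transpose s t"
      using cycles_commute[of "[s, t]" "[p, q, r]"] d unfolding \<tau> by simp
    have rot: "cycle_of_list [p, q, r] = cycle_of_list [q, r, p]"
      "cycle_of_list [p, q, r] = cycle_of_list [r, p, q]"
      using cycle_of_list_rotate_independent[of "[p, q, r]" 1]
        cycle_of_list_rotate_independent[of "[p, q, r]" 2] d
      by (simp_all add: numeral_2_eq_2 One_nat_def del: cycle_of_list.simps)
    have P: "transpose x b \<circ> cycle_of_list [p, q, r] \<in> ?P" if "b \<in> B" "b \<notin> {p, q, r}" "{p, q, r} \<subseteq> B" for b
    proof -
      have "cycle_of_list [p, q, r] \<in> Tc 2 (B - {b}) {}"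
        by (subst Tc_explicit, simp, unfold msz_simps mem_Collect_eq, rule exI[of _ "[p, q, r]"])
          (use d that in \<open>auto simp: cyc2_cls simp del: cycle_of_list.simps\<close>)
      then show ?thesis using that by (intro image_eqI[of _ _ "(b, cycle_of_list [p, q, r])"]) auto
    qed
    have Q: "cycle_of_list [x, b, c] \<circ> transpose s t \<in> ?Q"
      if "distinct [b, c, s, t]" "{b, c, s, t} \<subseteq> B" for b c
    proof -
      have "transpose s t \<in> Tc 1 (B - set [b, c]) {}" unfolding Tc_1_explicit using that by auto
      moreover have "[b, c] \<in> dl B 2" using that by (auto simp: dl_def)
      ultimately show ?thesis by (intro image_eqI[of _ _ "([b, c], transpose s t)"]) auto
    qed
    consider "x = p" | "x = q" | "x = r" | "x = s" | "x = t" using d by auto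
    then show "\<tau> \<in> ?P \<union> ?Q"
    proof cases
      case 1
      then show ?thesis using Q[of q r] d \<tau>' by auto
    next
      case 2
      then show ?thesis using Q[of r p] d \<tau>' rot(1) by (auto simp del: cycle_of_list.simps)
    next
      case 3
      then show ?thesis using Q[of p q] d \<tau>' rot(2) by (auto simp del: cycle_of_list.simps)
    next
      case 4
      then show ?thesis using P[of t] d \<tau> by (auto simp del: cycle_of_list.simps)
    next
      case 5
      have "\<tau> = transpose t s \<circ> cycle_of_list [p, q, r]" unfolding \<tau> by (subst transpose_commute) (rule refl)
      then show ?thesis using P[of s] d 5 by (auto simp del: cycle_of_list.simps)
    qed
  }
  {
    fix \<tau> assume "\<tau> \<in> ?P \<union> ?Q"
    then have "\<exists>l. \<tau> = cyc2 (lead 5) l \<and> distinct l \<and> length l = 5 \<and> {x} \<subseteq> set l \<and> set l \<subseteq> insert x B"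
    proof
      assume "\<tau> \<in> ?P"
      then obtain b \<rho> where b: "b \<in> B" "\<rho> \<in> Tc 2 (B - {b}) {}" "\<tau> = transpose x b \<circ> \<rho>" by auto
      then obtain l where l: "\<rho> = cyc2 (lead 2) l" "distinct l" "length l = 3" "set l \<subseteq> B - {b}"
        by (subst (asm) Tc_explicit, simp, unfold msz_simps) auto
      then obtain p q r where pl: "l = [p, q, r]" unfolding length3 by blast
      show ?thesis by (rule exI[of _ "[p, q, r, x, b]"])
          (use b(1,3) l x in \<open>auto simp: pl cyc2_cls\<close>)
    next
      assume "\<tau> \<in> ?Q"
      then obtain l \<rho> where l: "l \<in> dl B 2" "\<rho> \<in> Tc 1 (B - set l) {}" "\<tau> = cycle_of_list (x # l) \<circ> \<rho>" by auto
      then obtain b c where bc: "l = [b, c]" "b \<noteq> c" "b \<in> B" "c \<in> B" unfolding dl_def length2 by auto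
      obtain s t where st: "\<rho> = transpose s t" "s \<noteq> t" "{s, t} \<subseteq> B - {b, c}"
        using l(2) unfolding Tc_1_explicit bc by auto
      have "distinct [x, b, c, s, t]" using bc st x by auto
      then have "\<tau> = cyc2 (lead 5) [x, b, c, s, t]"
        using cycles_commute[of "[s, t]" "[x, b, c]"] l(3) by (simp add: cyc2_cls st bc)
      then show ?thesis by (intro exI[of _ "[x, b, c, s, t]"])
          (use bc st x in auto)
    qed
    then show "\<tau> \<in> Tc 5 (insert x B) {x}" by (subst Tc_explicit, simp) (simp add: msz_simps)
  }
qed

lemma sum_root_5:
  fixes g :: "(nat \<Rightarrow> nat) \<Rightarrow> 'b::comm_monoid_add"
  assumes x: "x \<notin> B" and fin: "finite B"
  shows "sum g (Tc 5 (insert x B) {x}) = (\<Sum>b\<in>B. \<Sum>\<tau>\<in>Tc 2 (B - {b}) {}. g (transpose x b \<circ> \<tau>)) +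
     (\<Sum>l\<in>dl B 2. \<Sum>\<tau>\<in>Tc 1 (B - set l) {}. g (cycle_of_list (x # l) \<circ> \<tau>))"
proof -
  let ?S = "SIGMA b:B. Tc 2 (B - {b}) {}" and ?R = "SIGMA l:dl B 2. Tc 1 (B - set l) {}"
  have ip: "inj_on (\<lambda>(b, \<tau>). transpose x b \<circ> \<tau>) ?S"
  proof (rule inj_onI, clarsimp)
    fix b \<tau> b' \<tau>'
    assume h: "\<tau> \<in> Tc 2 (B - {b}) {}" "\<tau>' \<in> Tc 2 (B - {b'}) {}"
      and eq: "transpose x b \<circ> \<tau> = transpose x b' \<circ> \<tau>'"
    have "\<tau> x = x" "\<tau>' x = x" using h x by (auto intro: Tc_fix)
    then have "b = b'" using fun_cong[OF eq, of x] by simp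
    then show "b = b' \<and> \<tau> = \<tau>'" using eq transpose_comp_cancel by auto
  qed
  have val: "(cycle_of_list (x # l) \<circ> \<tau>) x = l ! 0 \<and> (cycle_of_list (x # l) \<circ> \<tau>) (l ! 0) = l ! 1 \<and>
      l = [l ! 0, l ! 1] \<and> l ! 1 \<noteq> x"
    if lB: "l \<in> dl B 2" and \<tau>B: "\<tau> \<in> Tc 1 (B - set l) {}" for l \<tau>
  proof -
    obtain b c where l: "l = [b, c]" "b \<noteq> c" "b \<in> B" "c \<in> B" using lB unfolding dl_def length2 by auto
    have "\<tau> x = x" "\<tau> b = b" using \<tau>B x by (auto intro!: Tc_fix simp: l)
    then show ?thesis using l x by (auto simp: One_nat_def transpose_def)
  qed
  have iq: "inj_on (\<lambda>(l, \<tau>). cycle_of_list (x # l) \<circ> \<tau>) ?R"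
  proof (rule inj_onI, clarsimp simp del: cycle_of_list.simps)
    fix l \<tau> l' \<tau>'
    assume h: "l \<in> dl B 2" "\<tau> \<in> Tc 1 (B - set l) {}" "l' \<in> dl B 2" "\<tau>' \<in> Tc 1 (B - set l') {}"
      and eq: "cycle_of_list (x # l) \<circ> \<tau> = cycle_of_list (x # l') \<circ> \<tau>'"
    have "l ! 0 = l' ! 0" "l ! 1 = l' ! 1" "l = [l ! 0, l ! 1]" "l' = [l' ! 0, l' ! 1]"
      using val[OF h(1,2)] val[OF h(3,4)] eq by metis+
    then have "l = l'" by metis
    moreover have "inj (cycle_of_list (x # l))"
      using permutation_bijective[OF permutation_of_cycle] bij_is_inj by blast
    ultimately show "l = l' \<and> \<tau> = \<tau>'" using eq by (auto simp: fun_eq_iff inj_eq simp del: cycle_of_list.simps)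
  qed
  \<comment> \<open>The second iterate of \<open>x\<close> separates the two families: it is
    \<open>x\<close> in the first and a different point in the second.\<close>
  have disj: "(\<lambda>(b, \<tau>). transpose x b \<circ> \<tau>) ` ?S \<inter> (\<lambda>(l, \<tau>). cycle_of_list (x # l) \<circ> \<tau>) ` ?R = {}"
  proof (rule equals0I)
    fix \<sigma> assume "\<sigma> \<in> (\<lambda>(b, \<tau>). transpose x b \<circ> \<tau>) ` ?S \<inter> (\<lambda>(l, \<tau>). cycle_of_list (x # l) \<circ> \<tau>) ` ?R"
    then obtain b \<tau> l \<tau>' where h: "b \<in> B" "\<tau> \<in> Tc 2 (B - {b}) {}" "\<sigma> = transpose x b \<circ> \<tau>"
      "l \<in> dl B 2" "\<tau>' \<in> Tc 1 (B - set l) {}" "\<sigma> = cycle_of_list (x # l) \<circ> \<tau>'" by auto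
    have "\<tau> x = x" "\<tau> b = b" using h x by (auto intro: Tc_fix)
    then have "\<sigma> (\<sigma> x) = x" using h(3) by simp
    moreover have "\<sigma> (\<sigma> x) \<noteq> x" using val[OF h(4,5)] h(6) by metis
    ultimately show False by simp
  qed
  show ?thesis unfolding Tc_root_5[OF x]
    using fin ip iq disj
    by (subst sum.union_disjoint)
      (auto simp: sum.reindex sum.Sigma finite_Tc finite_dl case_prod_unfold simp del: cycle_of_list.simps)
qed

lemma sum_double_count:
  fixes g :: "(nat \<Rightarrow> nat) \<Rightarrow> real"
  assumes "finite B"
  shows "(\<Sum>b\<in>B. sum g (Tc i B {b})) = real (msz i) * sum g (Tc i B {})"
proof -
  have e: "Tc i B {b} = {\<tau> \<in> Tc i B {}. b \<in> supp \<tau>}" for b by (auto simp: Tc_def)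
  have "(\<Sum>b\<in>B. sum g (Tc i B {b})) = (\<Sum>b\<in>B. \<Sum>\<tau>\<in>Tc i B {}. if b \<in> supp \<tau> then g \<tau> else 0)"
    unfolding e using assms by (simp add: sum.inter_filter finite_Tc)
  also have "\<dots> = (\<Sum>\<tau>\<in>Tc i B {}. \<Sum>b\<in>B. if b \<in> supp \<tau> then g \<tau> else 0)"
    by (rule sum.swap)
  also have "\<dots> = (\<Sum>\<tau>\<in>Tc i B {}. real (msz i) * g \<tau>)"
  proof (rule sum.cong)
    fix \<tau> assume \<tau>: "\<tau> \<in> Tc i B {}"
    then have "{b \<in> B. b \<in> supp \<tau>} = supp \<tau>" by (auto simp: Tc_def)
    then have "(\<Sum>b\<in>B. if b \<in> supp \<tau> then g \<tau> else 0) = real (card (supp \<tau>)) * g \<tau>"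
      using assms by (simp flip: sum.inter_filter)
    then show "(\<Sum>b\<in>B. if b \<in> supp \<tau> then g \<tau> else 0) = real (msz i) * g \<tau>"
      using \<tau> card_supp_cls[of \<tau> i] by (simp add: Tc_def)
  qed simp
  finally show ?thesis by (simp add: sum_distrib_left)
qed

text \<open>Each cycle of length \<open>msz i\<close> comes from \<open>msz i\<close> lists, one for
  each letter that can stand in front.\<close>

lemma sum_cycles_all:
  fixes g :: "(nat \<Rightarrow> nat) \<Rightarrow> real"
  assumes "finite B" "i \<in> {1, 2, 4, 6}"
  shows "(\<Sum>l\<in>dl B (msz i). g (cycle_of_list l)) = real (msz i) * sum g (Tc i B {})"
proof -
  have "msz i > 0" by (simp add: msz_def)
  then have "(\<Sum>l\<in>dl B (msz i). g (cycle_of_list l)) =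
      (\<Sum>b\<in>B. \<Sum>l\<in>dl (B - {b}) (msz i - 1). g (cycle_of_list (b # l)))"
    by (rule sum_dl1[OF assms(1)])
  also have "\<dots> = (\<Sum>b\<in>B. sum g (Tc i B {b}))"
    by (rule sum.cong) (simp_all add: sum_root_at[OF assms(2)])
  finally show ?thesis using sum_double_count[OF assms(1)] by simp
qed

section \<open>Products of rooted class sums with the transpositions at the root\<close>

lemma cycle_insert_right:
  assumes "distinct (x # b # c # l)"
  shows "cycle_of_list (x # c # l) \<circ> transpose x b = cycle_of_list (x # b # c # l)"
proof -
  have "cycle_of_list (c # l) \<circ> cycle_of_list [x, b] = cycle_of_list [x, b] \<circ> cycle_of_list (c # l)"
    using assms by (intro cycles_commute) auto
  then have "cycle_of_list (c # l) \<circ> transpose x b = transpose x b \<circ> cycle_of_list (c # l)" by simp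
  moreover have "transpose x c \<circ> transpose x b = transpose x b \<circ> transpose b c"
    using assms by (auto simp: fun_eq_iff transpose_def)
  ultimately show ?thesis by (simp add: comp_assoc) (metis comp_assoc)
qed

lemma cycle_mult_transpose:
  "distinct [x, b, c] \<Longrightarrow> cycle_of_list [x, b, c] \<circ> transpose x b = transpose x c"
  "distinct [x, b, c] \<Longrightarrow> cycle_of_list [x, b, c] \<circ> transpose x c = transpose c b"
  "distinct [x, b, c, e] \<Longrightarrow> cycle_of_list [x, b, c, e] \<circ> transpose x b = cycle_of_list [x, c, e]"
  "distinct [x, b, c, e] \<Longrightarrow> cycle_of_list [x, b, c, e] \<circ> transpose x c = transpose x e \<circ> transpose c b"
  "distinct [x, b, c, e] \<Longrightarrow> cycle_of_list [x, b, c, e] \<circ> transpose x e = cycle_of_list [e, b, c]"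
  "distinct [x, b, c, e] \<Longrightarrow> cycle_of_list [x, b, c] \<circ> transpose b e = cycle_of_list [x, b, e, c]"
  by (auto simp: fun_eq_iff transpose_def)

lemma sum_split_list:
  fixes F :: "nat \<Rightarrow> real"
  assumes "finite B" "l \<in> dl B r"
  shows "sum F B = (\<Sum>b\<in>B - set l. F b) + sum_list (map F l)"
proof -
  have "sum F B = sum F (B - set l) + sum F (set l)"
    using assms by (intro sum.subset_diff) (auto simp: dl_def)
  moreover have "sum F (set l) = sum_list (map F l)"
    using assms by (simp add: dl_def sum_list_distinct_conv_sum_set)
  ultimately show ?thesis by simp
qed

lemma sum_dl_snoc:
  fixes h :: "nat list \<Rightarrow> 'b::comm_monoid_add"
  assumes "finite B" "r > 0"
  shows "sum h (dl B r) = (\<Sum>l\<in>dl B (r - 1). \<Sum>b\<in>B - set l. h (l @ [b]))"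
proof -
  have "sum h (dl B r) = (\<Sum>l\<in>dl B r. h (rev l))" by (rule sum_dl_rev[symmetric])
  also have "\<dots> = (\<Sum>l\<in>dl B (r - 1). \<Sum>b\<in>B - set (rev l). h (rev l @ [b]))"
    by (subst sum_dl2[OF assms]) simp
  also have "\<dots> = (\<Sum>l\<in>dl B (r - 1). \<Sum>b\<in>B - set l. h (l @ [b]))"
    by (rule sum_dl_rev)
  finally show ?thesis .
qed

lemma dl_2E:
  assumes "l \<in> dl B 2"
  obtains b c where "l = [b, c]" "b \<noteq> c" "b \<in> B" "c \<in> B"
  using assms unfolding dl_def length2 by auto

lemma dl_3E:
  assumes "l \<in> dl B 3"
  obtains b c e where "l = [b, c, e]" "distinct [b, c, e]" "b \<in> B" "c \<in> B" "e \<in> B"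
  using assms unfolding dl_def length3 by auto

context
  fixes B :: "nat set" and x :: nat and g :: "(nat \<Rightarrow> nat) \<Rightarrow> real"
  assumes fin: "finite B" and x: "x \<notin> B"
begin

lemma card_diff_dl: "l \<in> dl B r \<Longrightarrow> real (card (B - set l)) = real (card B) - real r"
  using fin card_set_dl[of l B r] card_mono[OF fin, of "set l"]
  by (subst card_Diff_subset) (auto simp: dl_def of_nat_diff)

text \<open>With \<open>X\<close> the sum of the transpositions \<open>(x b)\<close>, this expands
  the square of \<open>X\<close>: equal factors cancel, different ones give each 3-cycle through
  \<open>x\<close> once. The next identities expand further products in the same way; together they
  express the rooted part of each class through \<open>X\<close> and the class sums of
  \<open>B\<close>.\<close>

lemma class_id_2:
  "(\<Sum>b\<in>B. \<Sum>b'\<in>B. g (transpose x b \<circ> transpose x b')) =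
     sum g (Tc 2 (insert x B) {x}) + real (card B) * g id"
proof -
  have "(\<Sum>b'\<in>B. g (transpose x b \<circ> transpose x b')) =
      (\<Sum>b'\<in>B - {b}. g (cycle_of_list [x, b', b])) + g id" if "b \<in> B" for b
  proof -
    have "(\<Sum>b'\<in>B. g (transpose x b \<circ> transpose x b')) =
        g (transpose x b \<circ> transpose x b) + (\<Sum>b'\<in>B - {b}. g (transpose x b \<circ> transpose x b'))"
      by (rule sum.remove[OF fin that])
    moreover have "transpose x b \<circ> transpose x b' = cycle_of_list [x, b', b]" if "b' \<in> B - {b}" for b'
      using cycle_insert_right[of x b' b "[]"] that x \<open>b \<in> B\<close> by auto
    ultimately show ?thesis by (simp del: cycle_of_list.simps)
  qed
  then have "(\<Sum>b\<in>B. \<Sum>b'\<in>B. g (transpose x b \<circ> transpose x b')) =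
      (\<Sum>b\<in>B. \<Sum>b'\<in>B - {b}. g (cycle_of_list [x, b', b])) + real (card B) * g id"
    by (simp add: sum.distrib del: cycle_of_list.simps)
  moreover have "sum g (Tc 2 (insert x B) {x}) = (\<Sum>l\<in>dl B 2. g (cycle_of_list (x # l)))"
    using sum_root_cycle[of 2 x B g] x by (simp add: msz_simps)
  moreover have "\<dots> = (\<Sum>l\<in>dl B 1. \<Sum>b\<in>B - set l. g (cycle_of_list (x # b # l)))"
    by (subst sum_dl2[OF fin]) (simp_all add: One_nat_def)
  moreover have "\<dots> = (\<Sum>b\<in>B. \<Sum>b'\<in>B - {b}. g (cycle_of_list [x, b', b]))"
    by (subst sum_dl_1) simp
  ultimately show ?thesis by simp
qed

lemma sum_dl_drop_hd:
  assumes "r > 0"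
  shows "(\<Sum>l\<in>dl B r. h (tl l)) = (real (card B) - real (r - 1)) * sum h (dl B (r - 1))"
proof -
  have "(\<Sum>l\<in>dl B r. h (tl l)) = (\<Sum>l\<in>dl B (r - 1). \<Sum>b\<in>B - set l. h l)"
    by (subst sum_dl2[OF fin assms]) simp
  also have "\<dots> = (\<Sum>l\<in>dl B (r - 1). (real (card B) - real (r - 1)) * h l)"
    by (rule sum.cong) (simp_all add: card_diff_dl[of _ "r - 1"])
  finally show ?thesis by (simp add: sum_distrib_left)
qed

text \<open>In the product of a 3-cycle through \<open>x\<close> with \<open>(x b)\<close>, a new
  \<open>b\<close> lengthens the cycle to a 4-cycle. If \<open>b\<close> belongs to the cycle, a
  transposition remains. For one choice it contains \<open>x\<close>, and the lost letter is any of
  \<open>card B - 1\<close> points; for the other it avoids \<open>x\<close> and arises from both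
  orders of its letters.\<close>

lemma class_id_4:
  "(\<Sum>\<tau>\<in>Tc 2 (insert x B) {x}. \<Sum>b\<in>B. g (\<tau> \<circ> transpose x b)) =
     sum g (Tc 4 (insert x B) {x}) + (real (card B) - 1) * sum g (Tc 1 (insert x B) {x})
     + 2 * sum g (Tc 1 B {})"
proof -
  have "(\<Sum>\<tau>\<in>Tc 2 (insert x B) {x}. \<Sum>b\<in>B. g (\<tau> \<circ> transpose x b)) =
      (\<Sum>l\<in>dl B 2. \<Sum>b\<in>B. g (cycle_of_list (x # l) \<circ> transpose x b))"
    using sum_root_cycle[of 2 x B] x by (simp add: msz_simps del: cycle_of_list.simps)
  also have "\<dots> = (\<Sum>l\<in>dl B 2. (\<Sum>b\<in>B - set l. g (cycle_of_list (x # b # l)))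
       + g (cycle_of_list (x # tl l)) + g (cycle_of_list (rev l)))"
  proof (rule sum.cong)
    fix l assume l: "l \<in> dl B 2"
    obtain b c where bc: "l = [b, c]" "b \<noteq> c" "b \<in> B" "c \<in> B" using l by (rule dl_2E)
    have "(\<Sum>e\<in>B. g (cycle_of_list (x # l) \<circ> transpose x e)) =
      (\<Sum>e\<in>B - set l. g (cycle_of_list (x # l) \<circ> transpose x e)) +
       (g (cycle_of_list [x, b, c] \<circ> transpose x b) + g (cycle_of_list [x, b, c] \<circ> transpose x c))"
      by (subst sum_split_list[OF fin l]) (simp add: bc)
    also have "(\<Sum>e\<in>B - set l. g (cycle_of_list (x # l) \<circ> transpose x e)) =
        (\<Sum>e\<in>B - set l. g (cycle_of_list (x # e # l)))"
    proof (rule sum.cong)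
      fix e assume "e \<in> B - set l"
      then have "cycle_of_list (x # l) \<circ> transpose x e = cycle_of_list (x # e # l)"
        unfolding bc(1) using bc x by (intro cycle_insert_right) auto
      then show "g (cycle_of_list (x # l) \<circ> transpose x e) = g (cycle_of_list (x # e # l))" by simp
    qed simp
    moreover have "distinct [x, b, c]" using bc x by auto
    ultimately show "(\<Sum>e\<in>B. g (cycle_of_list (x # l) \<circ> transpose x e)) =
        (\<Sum>b\<in>B - set l. g (cycle_of_list (x # b # l))) + g (cycle_of_list (x # tl l)) + g (cycle_of_list (rev l))"
      by (simp only: cycle_mult_transpose(1,2)) (simp add: bc)
  qed simp
  also have "\<dots> = (\<Sum>l\<in>dl B 2. \<Sum>b\<in>B - set l. g (cycle_of_list (x # b # l)))
      + (\<Sum>l\<in>dl B 2. g (cycle_of_list (x # tl l))) + (\<Sum>l\<in>dl B 2. g (cycle_of_list (rev l)))"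
    by (simp add: sum.distrib)
  also have "(\<Sum>l\<in>dl B 2. \<Sum>b\<in>B - set l. g (cycle_of_list (x # b # l))) = sum g (Tc 4 (insert x B) {x})"
    using sum_root_cycle[of 4 x B g] x sum_dl2[OF fin, of 3 "\<lambda>l. g (cycle_of_list (x # l))"]
    by (simp add: msz_simps)
  also have "(\<Sum>l\<in>dl B 2. g (cycle_of_list (x # tl l))) = (real (card B) - 1) * sum g (Tc 1 (insert x B) {x})"
    using sum_dl_drop_hd[of 2 "\<lambda>l. g (cycle_of_list (x # l))"] sum_root_cycle[of 1 x B g] x
    by (simp add: msz_simps)
  also have "(\<Sum>l\<in>dl B 2. g (cycle_of_list (rev l))) = 2 * sum g (Tc 1 B {})"
    using sum_cycles_all[OF fin, of 1 g] sum_dl_rev[of "\<lambda>l. g (cycle_of_list l)" B 2]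
    by (simp add: msz_simps)
  finally show ?thesis .
qed

lemma class_id_3:
  "(\<Sum>b\<in>B. \<Sum>\<tau>\<in>Tc 1 B {}. g (transpose x b \<circ> \<tau>)) =
     sum g (Tc 3 (insert x B) {x}) + sum g (Tc 2 (insert x B) {x})"
proof -
  have "(\<Sum>\<tau>\<in>Tc 1 B {}. g (transpose x b \<circ> \<tau>)) =
     (\<Sum>\<tau>\<in>Tc 1 (B - {b}) {}. g (transpose x b \<circ> \<tau>)) +
     (\<Sum>l\<in>dl (B - {b}) 1. g (cycle_of_list (x # b # l)))" if "b \<in> B" for b
    using sum_Tc_split[OF fin, of "\<lambda>\<tau>. g (transpose x b \<circ> \<tau>)" 1 "{}" b]
      sum_root_at[of 1 b B "\<lambda>\<tau>. g (transpose x b \<circ> \<tau>)"] that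
    by (simp add: msz_simps(1)[unfolded One_nat_def] One_nat_def)
  then have "(\<Sum>b\<in>B. \<Sum>\<tau>\<in>Tc 1 B {}. g (transpose x b \<circ> \<tau>)) =
      (\<Sum>b\<in>B. \<Sum>\<tau>\<in>Tc 1 (B - {b}) {}. g (transpose x b \<circ> \<tau>)) +
      (\<Sum>b\<in>B. \<Sum>l\<in>dl (B - {b}) 1. g (cycle_of_list (x # b # l)))"
    by (simp add: sum.distrib)
  moreover have "(\<Sum>b\<in>B. \<Sum>l\<in>dl (B - {b}) 1. g (cycle_of_list (x # b # l))) = sum g (Tc 2 (insert x B) {x})"
    using sum_root_cycle[of 2 x B g] x sum_dl1[OF fin, of 2 "\<lambda>l. g (cycle_of_list (x # l))"]
    by (simp add: msz_simps One_nat_def)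
  ultimately show ?thesis using sum_root_3[OF x fin, of g] by simp
qed

lemma sum_pair_rest:
  fixes h :: "(nat \<Rightarrow> nat) \<Rightarrow> real"
  assumes "finite C"
  shows "(\<Sum>l\<in>dl C 2. h (transpose (l ! 0) (l ! 1))) = 2 * sum h (Tc 1 C {})"
proof -
  have "(\<Sum>l\<in>dl C 2. h (transpose (l ! 0) (l ! 1))) = (\<Sum>l\<in>dl C 2. h (cycle_of_list l))"
    by (rule sum.cong) (auto elim!: dl_2E simp: One_nat_def)
  then show ?thesis using sum_cycles_all[OF assms, of 1 h] by (simp add: msz_simps)
qed

text \<open>In the product of \<open>(x b c e)\<close> with \<open>(x y)\<close>, a new
  \<open>y\<close> gives a 5-cycle, \<open>y = b\<close> leaves a 3-cycle through \<open>x\<close>,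
  \<open>y = c\<close> splits the cycle into two transpositions and \<open>y = e\<close> cuts off
  \<open>x\<close>. The coefficients count the lists with the same result: \<open>card B - 2\<close>
  lost letters, two orders of the transposition away from \<open>x\<close>, three rotations of the
  3-cycle.\<close>

lemma class_id_6:
  "(\<Sum>\<tau>\<in>Tc 4 (insert x B) {x}. \<Sum>b\<in>B. g (\<tau> \<circ> transpose x b)) =
     sum g (Tc 6 (insert x B) {x}) + (real (card B) - 2) * sum g (Tc 2 (insert x B) {x})
     + 2 * sum g (Tc 3 (insert x B) {x}) + 3 * sum g (Tc 2 B {})"
proof -
  have "(\<Sum>\<tau>\<in>Tc 4 (insert x B) {x}. \<Sum>b\<in>B. g (\<tau> \<circ> transpose x b)) =
      (\<Sum>l\<in>dl B 3. \<Sum>b\<in>B. g (cycle_of_list (x # l) \<circ> transpose x b))"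
    using sum_root_cycle[of 4 x B] x by (simp add: msz_simps del: cycle_of_list.simps)
  also have "\<dots> = (\<Sum>l\<in>dl B 3. (\<Sum>b\<in>B - set l. g (cycle_of_list (x # b # l)))
       + g (cycle_of_list (x # tl l)) + g (transpose x (rev l ! 0) \<circ> transpose (rev l ! 1) (rev l ! 2))
       + g (cycle_of_list l))"
  proof (rule sum.cong)
    fix l assume l: "l \<in> dl B 3"
    obtain b c e where bc: "l = [b, c, e]" "distinct [b, c, e]" "b \<in> B" "c \<in> B" "e \<in> B"
      using l by (rule dl_3E)
    have d: "distinct [x, b, c, e]" using bc x by auto
    have rot: "cycle_of_list [e, b, c] = cycle_of_list l"
      using cycle_of_list_rotate_independent[of l 2] bc by (simp add: numeral_2_eq_2)
    have "(\<Sum>y\<in>B. g (cycle_of_list (x # l) \<circ> transpose x y)) =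
      (\<Sum>y\<in>B - set l. g (cycle_of_list (x # l) \<circ> transpose x y)) +
       (g (cycle_of_list [x, b, c, e] \<circ> transpose x b) + (g (cycle_of_list [x, b, c, e] \<circ> transpose x c)
         + g (cycle_of_list [x, b, c, e] \<circ> transpose x e)))"
      by (subst sum_split_list[OF fin l]) (simp add: bc)
    also have "(\<Sum>y\<in>B - set l. g (cycle_of_list (x # l) \<circ> transpose x y)) =
        (\<Sum>y\<in>B - set l. g (cycle_of_list (x # y # l)))"
    proof (rule sum.cong)
      fix y assume "y \<in> B - set l"
      then have "cycle_of_list (x # l) \<circ> transpose x y = cycle_of_list (x # y # l)"
        unfolding bc(1) using bc x by (intro cycle_insert_right) auto
      then show "g (cycle_of_list (x # l) \<circ> transpose x y) = g (cycle_of_list (x # y # l))" by simp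
    qed simp
    finally have eq: "(\<Sum>y\<in>B. g (cycle_of_list (x # l) \<circ> transpose x y)) =
        (\<Sum>y\<in>B - set l. g (cycle_of_list (x # y # l))) + (g (cycle_of_list [x, c, e]) +
        (g (transpose x e \<circ> transpose c b) + g (cycle_of_list l)))"
      unfolding cycle_mult_transpose(3-5)[OF d] rot .
    have "x # tl l = [x, c, e]" "rev l ! 0 = e" "rev l ! 1 = c" "rev l ! 2 = b"
      by (simp_all add: bc One_nat_def numeral_2_eq_2)
    then show "(\<Sum>y\<in>B. g (cycle_of_list (x # l) \<circ> transpose x y)) =
        (\<Sum>b\<in>B - set l. g (cycle_of_list (x # b # l)))
       + g (cycle_of_list (x # tl l)) + g (transpose x (rev l ! 0) \<circ> transpose (rev l ! 1) (rev l ! 2))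
       + g (cycle_of_list l)"
      unfolding eq by (simp only: add.assoc)
  qed simp
  also have "\<dots> = (\<Sum>l\<in>dl B 3. \<Sum>b\<in>B - set l. g (cycle_of_list (x # b # l)))
      + (\<Sum>l\<in>dl B 3. g (cycle_of_list (x # tl l)))
      + (\<Sum>l\<in>dl B 3. g (transpose x (rev l ! 0) \<circ> transpose (rev l ! 1) (rev l ! 2)))
      + (\<Sum>l\<in>dl B 3. g (cycle_of_list l))"
    by (simp add: sum.distrib)
  also have "(\<Sum>l\<in>dl B 3. \<Sum>b\<in>B - set l. g (cycle_of_list (x # b # l))) = sum g (Tc 6 (insert x B) {x})"
    using sum_root_cycle[of 6 x B g] x sum_dl2[OF fin, of 4 "\<lambda>l. g (cycle_of_list (x # l))"]
    by (simp add: msz_simps)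
  also have "(\<Sum>l\<in>dl B 3. g (cycle_of_list (x # tl l))) = (real (card B) - 2) * sum g (Tc 2 (insert x B) {x})"
    using sum_dl_drop_hd[of 3 "\<lambda>l. g (cycle_of_list (x # l))"] sum_root_cycle[of 2 x B g] x
    by (simp add: msz_simps)
  also have "(\<Sum>l\<in>dl B 3. g (cycle_of_list l)) = 3 * sum g (Tc 2 B {})"
    using sum_cycles_all[OF fin, of 2 g] by (simp add: msz_simps)
  also have "(\<Sum>l\<in>dl B 3. g (transpose x (rev l ! 0) \<circ> transpose (rev l ! 1) (rev l ! 2))) =
      2 * sum g (Tc 3 (insert x B) {x})"
  proof -
    have "(\<Sum>l\<in>dl B 3. g (transpose x (rev l ! 0) \<circ> transpose (rev l ! 1) (rev l ! 2))) =
        (\<Sum>l\<in>dl B 3. g (transpose x (l ! 0) \<circ> transpose (l ! 1) (l ! 2)))"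
      by (rule sum_dl_rev)
    also have "\<dots> = (\<Sum>b\<in>B. \<Sum>l\<in>dl (B - {b}) 2. g (transpose x b \<circ> transpose (l ! 0) (l ! 1)))"
      by (subst sum_dl1[OF fin]) (simp_all add: numeral_2_eq_2 One_nat_def)
    also have "\<dots> = (\<Sum>b\<in>B. 2 * (\<Sum>\<tau>\<in>Tc 1 (B - {b}) {}. g (transpose x b \<circ> \<tau>)))"
      using fin by (intro sum.cong refl sum_pair_rest) auto
    finally show ?thesis using sum_root_3[OF x fin, of g] by (simp add: sum_distrib_left)
  qed
  finally show ?thesis by linarith
qed

text \<open>The two products are taken together because \<open>x\<close> can lie in either cycle of
  an element of class 5. Factors that share exactly one letter give a 4-cycle, once from the first
  product and twice from the second; if the transposition lies inside the 3-cycle, a transposition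
  at \<open>x\<close> remains.\<close>

lemma class_id_5:
  "(\<Sum>b\<in>B. \<Sum>\<tau>\<in>Tc 2 B {}. g (transpose x b \<circ> \<tau>)) +
   (\<Sum>\<rho>\<in>Tc 2 (insert x B) {x}. \<Sum>\<tau>\<in>Tc 1 B {}. g (\<rho> \<circ> \<tau>)) =
     sum g (Tc 5 (insert x B) {x}) + 3 * sum g (Tc 4 (insert x B) {x})
     + (real (card B) - 1) * sum g (Tc 1 (insert x B) {x})"
proof -
  have S4: "sum g (Tc 4 (insert x B) {x}) = (\<Sum>l\<in>dl B 3. g (cycle_of_list (x # l)))"
    using sum_root_cycle[of 4 x B g] x by (simp add: msz_simps)
  have "(\<Sum>\<tau>\<in>Tc 2 B {}. g (transpose x b \<circ> \<tau>)) =
     (\<Sum>\<tau>\<in>Tc 2 (B - {b}) {}. g (transpose x b \<circ> \<tau>)) +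
     (\<Sum>l\<in>dl (B - {b}) 2. g (cycle_of_list (x # b # l)))" if "b \<in> B" for b
    using sum_Tc_split[OF fin, of "\<lambda>\<tau>. g (transpose x b \<circ> \<tau>)" 2 "{}" b]
      sum_root_at[of 2 b B "\<lambda>\<tau>. g (transpose x b \<circ> \<tau>)"] that
    by (simp add: msz_simps)
  then have P: "(\<Sum>b\<in>B. \<Sum>\<tau>\<in>Tc 2 B {}. g (transpose x b \<circ> \<tau>)) =
      (\<Sum>b\<in>B. \<Sum>\<tau>\<in>Tc 2 (B - {b}) {}. g (transpose x b \<circ> \<tau>)) + sum g (Tc 4 (insert x B) {x})"
    unfolding S4 by (simp add: sum.distrib sum_dl1[OF fin, of 3])
  have Q1: "(\<Sum>\<tau>\<in>Tc 1 B {}. g (cycle_of_list (x # l) \<circ> \<tau>)) =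
      (\<Sum>\<tau>\<in>Tc 1 (B - set l) {}. g (cycle_of_list (x # l) \<circ> \<tau>)) +
      (\<Sum>e\<in>B - set l. g (cycle_of_list (x # l @ [e]))) +
      (\<Sum>e\<in>B - set l. g (cycle_of_list [x, l ! 0, e, l ! 1])) + g (cycle_of_list [x, l ! 0])"
    if l: "l \<in> dl B 2" for l
  proof -
    obtain b c where bc: "l = [b, c]" "b \<noteq> c" "b \<in> B" "c \<in> B" using l by (rule dl_2E)
    let ?F = "\<lambda>\<tau>. g (cycle_of_list (x # l) \<circ> \<tau>)"
    have s: "B - {b} - {c} = B - set l" by (auto simp: bc)
    have "sum ?F (Tc 1 B {}) = sum ?F (Tc 1 (B - {b}) {}) + sum ?F (Tc 1 B {b})"
      by (rule sum_Tc_split[OF fin])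
    also have "sum ?F (Tc 1 (B - {b}) {}) = sum ?F (Tc 1 (B - set l) {}) + sum ?F (Tc 1 (B - {b}) {c})"
      unfolding s[symmetric] by (rule sum_Tc_split) (use fin in auto)
    also have "sum ?F (Tc 1 (B - {b}) {c}) = (\<Sum>e\<in>B - set l. ?F (transpose c e))"
      using sum_root_at[of 1 c "B - {b}" ?F] bc s by (simp add: msz_simps sum_dl_1[unfolded One_nat_def])
    also have "\<dots> = (\<Sum>e\<in>B - set l. g (cycle_of_list (x # l @ [e])))"
      by (simp add: bc comp_assoc)
    also have "sum ?F (Tc 1 B {b}) = (\<Sum>e\<in>B - {b}. ?F (transpose b e))"
      using sum_root_at[of 1 b B ?F] bc by (simp add: msz_simps sum_dl_1[unfolded One_nat_def])
    also have "\<dots> = ?F (transpose b c) + (\<Sum>e\<in>B - {b} - {c}. ?F (transpose b e))"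
      using fin bc by (intro sum.remove) auto
    also have "?F (transpose b c) = g (cycle_of_list [x, b])"
      by (simp add: bc comp_assoc)
    also have "(\<Sum>e\<in>B - {b} - {c}. ?F (transpose b e)) = (\<Sum>e\<in>B - set l. g (cycle_of_list [x, b, e, c]))"
      unfolding s
    proof (rule sum.cong)
      fix e assume "e \<in> B - set l"
      then have "distinct [x, b, c, e]" using bc x by auto
      from cycle_mult_transpose(6)[OF this]
      show "?F (transpose b e) = g (cycle_of_list [x, b, e, c])" by (simp only: bc)
    qed simp
    finally have eq: "sum ?F (Tc 1 B {}) = sum ?F (Tc 1 (B - set l) {}) +
        (\<Sum>e\<in>B - set l. g (cycle_of_list (x # l @ [e]))) + (g (cycle_of_list [x, b]) +
        (\<Sum>e\<in>B - set l. g (cycle_of_list [x, b, e, c])))" .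
    have "l ! 0 = b" "l ! 1 = c" by (simp_all add: bc One_nat_def)
    then show ?thesis unfolding eq by (simp only: add_ac)
  qed
  have "(\<Sum>\<rho>\<in>Tc 2 (insert x B) {x}. \<Sum>\<tau>\<in>Tc 1 B {}. g (\<rho> \<circ> \<tau>)) =
      (\<Sum>l\<in>dl B 2. \<Sum>\<tau>\<in>Tc 1 B {}. g (cycle_of_list (x # l) \<circ> \<tau>))"
    using sum_root_cycle[of 2 x B] x by (simp add: msz_simps del: cycle_of_list.simps)
  also have "\<dots> = (\<Sum>l\<in>dl B 2. \<Sum>\<tau>\<in>Tc 1 (B - set l) {}. g (cycle_of_list (x # l) \<circ> \<tau>)) +
      (\<Sum>l\<in>dl B 2. \<Sum>e\<in>B - set l. g (cycle_of_list (x # l @ [e]))) +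
      (\<Sum>l\<in>dl B 2. \<Sum>e\<in>B - set l. g (cycle_of_list [x, l ! 0, e, l ! 1])) +
      (\<Sum>l\<in>dl B 2. g (cycle_of_list [x, l ! 0]))"
    by (simp add: Q1 sum.distrib del: cycle_of_list.simps)
  also have "(\<Sum>l\<in>dl B 2. \<Sum>e\<in>B - set l. g (cycle_of_list (x # l @ [e]))) = sum g (Tc 4 (insert x B) {x})"
    unfolding S4 by (subst sum_dl_snoc[OF fin]) simp_all
  also have "(\<Sum>l\<in>dl B 2. \<Sum>e\<in>B - set l. g (cycle_of_list [x, l ! 0, e, l ! 1])) = sum g (Tc 4 (insert x B) {x})"
  proof -
    have "(\<Sum>l\<in>dl B 2. \<Sum>e\<in>B - set l. g (cycle_of_list [x, l ! 0, e, l ! 1])) =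
        (\<Sum>l\<in>dl B 2. \<Sum>e\<in>B - set l. g (cycle_of_list [x, (l @ [e]) ! 0, (l @ [e]) ! 2, (l @ [e]) ! 1]))"
    proof (intro sum.cong refl)
      fix l e assume "l \<in> dl B 2"
      then obtain b c where "l = [b, c]" by (rule dl_2E)
      then have "(l @ [e]) ! 0 = l ! 0" "(l @ [e]) ! 2 = e" "(l @ [e]) ! 1 = l ! 1"
        by (simp_all add: One_nat_def numeral_2_eq_2)
      then show "g (cycle_of_list [x, l ! 0, e, l ! 1]) =
          g (cycle_of_list [x, (l @ [e]) ! 0, (l @ [e]) ! 2, (l @ [e]) ! 1])" by (simp only:)
    qed
    also have "\<dots> = (\<Sum>l\<in>dl B 3. g (cycle_of_list [x, l ! 0, l ! 2, l ! 1]))"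
      by (subst sum_dl_snoc[OF fin, of 3]) simp_all
    also have "\<dots> = (\<Sum>l\<in>dl B 3. g (cycle_of_list (x # l)))"
      unfolding dl_def length3
      by (rule sum.reindex_bij_witness[of _ "\<lambda>l. [l ! 0, l ! 2, l ! 1]" "\<lambda>l. [l ! 0, l ! 2, l ! 1]"])
        (auto simp: One_nat_def numeral_2_eq_2 simp del: cycle_of_list.simps)
    finally show ?thesis by (simp only: S4)
  qed
  also have "(\<Sum>l\<in>dl B 2. g (cycle_of_list [x, l ! 0])) = (real (card B) - 1) * sum g (Tc 1 (insert x B) {x})"
  proof -
    have "(\<Sum>l\<in>dl B 2. g (cycle_of_list [x, l ! 0])) = (\<Sum>b\<in>B. \<Sum>l\<in>dl (B - {b}) 1. g (transpose x b))"
      by (subst sum_dl1[OF fin]) (simp_all add: One_nat_def)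
    also have "\<dots> = (\<Sum>b\<in>B. (real (card B) - 1) * g (transpose x b))"
    proof (rule sum.cong)
      fix b assume "b \<in> B"
      then have "real (card (B - {b})) = real (card B) - 1" using fin
        by (metis One_nat_def card_Diff_singleton card_gt_0_iff empty_iff of_nat_1 of_nat_diff Suc_leI)
      then show "(\<Sum>l\<in>dl (B - {b}) 1. g (transpose x b)) = (real (card B) - 1) * g (transpose x b)"
        by (subst sum_dl_1) simp
    qed simp
    finally show ?thesis using sum_root_1[OF x, of g] by (simp add: sum_distrib_left)
  qed
  finally show ?thesis using P sum_root_5[OF x fin, of g] by linarith
qed

end

section \<open>Cardinalities\<close>

text \<open>
  The number of elements of class \<open>i\<close> with a given support, and the number of \<open>m\<close>-subsets of an
  \<open>a\<close>-set that contain \<open>k\<close> given points.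
\<close>

definition full_support_card :: "nat \<Rightarrow> nat" where
  "full_support_card i = (if i = 1 then 1 else if i = 2 then 2 else if i = 3 then 3 else if i = 4 then 6
     else if i = 5 then 20 else 24)"

definition subset_card :: "nat \<Rightarrow> nat \<Rightarrow> nat \<Rightarrow> nat" where
  "subset_card m a k = (if k \<le> m then (a - k) choose (m - k) else 0)"

lemma subset_card_Suc:
  assumes "k < a"
  shows "subset_card m a k = subset_card m (a - 1) k + subset_card m a (Suc k)"
proof (cases "k < m")
  case True
  obtain x y where "a = Suc (k + x)" "m = Suc (k + y)"
    using assms True by (meson less_imp_Suc_add)
  then show ?thesis by (simp add: subset_card_def)
qed (auto simp: subset_card_def)

lemma Tc_full:
  assumes "finite A" "card A = msz i" "K \<subseteq> A"
  shows "Tc i A K = Tc i A A"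
proof -
  have "supp \<tau> = A" if "\<tau> \<in> cls i" "supp \<tau> \<subseteq> A" for \<tau>
    using that assms card_supp_cls[OF that(1)] by (metis card_subset_eq)
  then show ?thesis using assms(3) by (auto simp: Tc_def)
qed

lemma card_dl: "finite B \<Longrightarrow> r \<le> card B \<Longrightarrow> card (dl B r) = \<Prod>{card B - r + 1..card B}"
  using card_lists_distinct_length_eq[of B r] by (simp add: dl_def conj_ac cong: conj_cong)

lemma card_as_sum: "card S = (\<Sum>x\<in>S. 1::nat)"
  by simp

lemma card_Tc_full:
  assumes "finite A" "card A = msz i" "i \<in> {1..6}"
  shows "card (Tc i A A) = full_support_card i"
proof -
  have cyc: "card (Tc i A A) = fact (msz i - 1)"
    if A: "finite A" "card A = msz i" and i: "i \<in> {1, 2, 4, 6}" for i and A :: "nat set"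
  proof -
    have "A \<noteq> {}" using A by (auto simp: msz_def split: if_splits)
    then obtain x where x: "x \<in> A" by auto
    have "card (Tc i A A) = card (Tc i A {x})" using Tc_full[OF A, of "{x}"] x by simp
    also have "\<dots> = card (dl (A - {x}) (msz i - 1))"
      unfolding card_as_sum using sum_root_at[OF i x, of "\<lambda>_. 1::nat"] by simp
    also have "\<dots> = \<Prod>{1..msz i - 1}"
      using A x by (subst card_dl) auto
    finally show ?thesis by (simp add: fact_prod)
  qed
  have c1: "card (Tc 1 C {}) = 1" if "finite C" "card C = 2" for C
    using cyc[of C 1] Tc_full[of C 1 "{}"] that by (simp add: msz_simps)
  have c2: "card (Tc 2 C {}) = 2" if "finite C" "card C = 3" for C
    using cyc[of C 2] Tc_full[of C 2 "{}"] that by (simp add: msz_simps)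
  consider "i \<in> {1, 2, 4, 6}" | "i = 3" | "i = 5" using assms(3) unfolding in_1_6 by blast
  then show ?thesis
  proof cases
    case 1
    have f: "fact (2 - 1) = (1::nat)" "fact (3 - 1) = (2::nat)" "fact (4 - 1) = (6::nat)" "fact (5 - 1) = (24::nat)"
      by (simp_all add: numeral_eq_Suc One_nat_def)
    from 1 have "i = 1 \<or> i = 2 \<or> i = 4 \<or> i = 6" by simp
    then show ?thesis unfolding cyc[OF assms(1,2) 1]
      by (elim disjE; simp only: msz_simps f) (simp_all add: full_support_card_def)
  next
    case 2
    have "A \<noteq> {}" using assms(2) by (auto simp: msz_def split: if_splits)
    then obtain x where x: "x \<in> A" by auto
    define B where "B = A - {x}"
    have B: "x \<notin> B" "finite B" "insert x B = A" "card B = 3"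
      using assms x 2 by (auto simp: B_def msz_simps)
    have "card (Tc 3 A A) = card (Tc 3 (insert x B) {x})"
      using Tc_full[OF assms(1,2), of "{x}"] x 2 B by simp
    also have "\<dots> = (\<Sum>b\<in>B. card (Tc 1 (B - {b}) {}))"
      unfolding card_as_sum using sum_root_3[OF B(1,2), of "\<lambda>_. 1::nat"] by simp
    also have "\<dots> = 3" using B by (simp add: c1)
    finally show ?thesis using 2 by (simp add: full_support_card_def)
  next
    case 3
    have "A \<noteq> {}" using assms(2) by (auto simp: msz_def split: if_splits)
    then obtain x where x: "x \<in> A" by auto
    define B where "B = A - {x}"
    have B: "x \<notin> B" "finite B" "insert x B = A" "card B = 4"
      using assms x 3 by (auto simp: B_def msz_simps)
    have "card (Tc 5 A A) = card (Tc 5 (insert x B) {x})"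
      using Tc_full[OF assms(1,2), of "{x}"] x 3 B by simp
    also have "\<dots> = (\<Sum>b\<in>B. card (Tc 2 (B - {b}) {})) + (\<Sum>l\<in>dl B 2. card (Tc 1 (B - set l) {}))"
      unfolding card_as_sum using sum_root_5[OF B(1,2), of "\<lambda>_. 1::nat"] by simp
    also have "(\<Sum>b\<in>B. card (Tc 2 (B - {b}) {})) = 8" using B by (simp add: c2)
    also have "(\<Sum>l\<in>dl B 2. card (Tc 1 (B - set l) {})) = (\<Sum>l\<in>dl B 2. 1)"
    proof (rule sum.cong)
      fix l assume "l \<in> dl B 2"
      then have "card (B - set l) = 2"
        using B card_set_dl[of l B 2] by (subst card_Diff_subset) (auto simp: dl_def)
      then show "card (Tc 1 (B - set l) {}) = 1" using B by (intro c1) auto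
    qed simp
    also have "(\<Sum>l\<in>dl B 2. 1::nat) = 12" using B by (simp add: card_dl numeral_eq_Suc)
    finally show ?thesis using 3 by (simp add: full_support_card_def)
  qed
qed

lemma Tc_AA_empty:
  assumes "card A \<noteq> msz i"
  shows "Tc i A A = {}"
proof -
  have "supp \<tau> \<noteq> A" if "\<tau> \<in> cls i" for \<tau> using card_supp_cls[OF that] assms by auto
  then show ?thesis by (auto simp: Tc_def)
qed

lemma subset_card_diag: "subset_card m a a = (if a = m then 1 else 0)"
  by (auto simp: subset_card_def)

text \<open>Both sides obey the same recursion when a point of \<open>A - K\<close> is split off; on
  the right this is Pascal's rule. The recursion ends at \<open>K = A\<close>, where the whole
  support is prescribed.\<close>

lemma card_Tc:
  assumes "finite A" "K \<subseteq> A" "i \<in> {1..6}"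
  shows "card (Tc i A K) = full_support_card i * subset_card (msz i) (card A) (card K)"
  using assms(1,2)
proof (induction "card (A - K)" arbitrary: A K rule: less_induct)
  case less
  show ?case
  proof (cases "A = K")
    case True
    then show ?thesis using card_Tc_full[of A i] Tc_AA_empty[of A i] less.prems assms(3)
      by (cases "card A = msz i") (simp_all add: subset_card_diag)
  next
    case False
    then obtain x where x: "x \<in> A" "x \<notin> K" using less.prems by auto
    have s1: "card (A - {x} - K) < card (A - K)" "card (A - insert x K) < card (A - K)"
      using x less.prems by (auto intro!: psubset_card_mono simp del: card_Diff_insert)
    have fK: "finite K" using less.prems finite_subset by auto
    have kA: "card K < card A" using less.prems False by (simp add: psubset_card_mono psubsetI)
    have "card (Tc i A K) = card (Tc i (A - {x}) K) + card (Tc i A (insert x K))"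
      unfolding card_as_sum by (rule sum_Tc_split[OF less.prems(1)])
    also have "card (Tc i (A - {x}) K) = full_support_card i * subset_card (msz i) (card A - 1) (card K)"
      using x less.prems by (subst less.hyps[OF s1(1)]) auto
    also have "card (Tc i A (insert x K)) = full_support_card i * subset_card (msz i) (card A) (Suc (card K))"
      using x less.prems fK by (subst less.hyps[OF s1(2)]) auto
    finally show ?thesis using subset_card_Suc[OF kA, of "msz i"] by (simp add: algebra_simps)
  qed
qed

text \<open>Conjugation by \<open>(z z')\<close> fixes \<open>w\<close> and preserves
  \<open>A\<close>, so all \<open>msz i - 1\<close> possible images of \<open>w\<close> are equally
  frequent.\<close>

lemma card_move_full:
  assumes "finite A" "card A = msz i" "i \<in> {1..6}" "w \<in> A" "z \<in> A" "w \<noteq> z"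
  shows "(msz i - 1) * card {\<tau> \<in> Tc i A A. \<tau> w = z} = full_support_card i"
proof -
  let ?N = "\<lambda>z. {\<tau> \<in> Tc i A A. \<tau> w = z}"
  have fT: "finite (Tc i A A)" using assms(1) finite_Tc by auto
  have eq: "card (?N z') = card (?N z)" if z': "z' \<in> A - {w}" for z'
  proof -
    let ?t = "transpose z z'"
    have conj: "?t \<circ> \<tau> \<circ> ?t \<in> Tc i A A" if "\<tau> \<in> Tc i A A" for \<tau>
    proof -
      have "?t ` A = A" using assms(5) z' by (auto simp: transpose_image_eq)
      then show ?thesis using conj_Tc[of ?t i A A] that by auto
    qed
    have "bij_betw (\<lambda>\<tau>. ?t \<circ> \<tau> \<circ> ?t) (?N z') (?N z)"
    proof (rule bij_betw_byWitness[of _ "\<lambda>\<tau>. ?t \<circ> \<tau> \<circ> ?t"])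
      show "(\<lambda>\<tau>. ?t \<circ> \<tau> \<circ> ?t) ` ?N z' \<subseteq> ?N z" "(\<lambda>\<tau>. ?t \<circ> \<tau> \<circ> ?t) ` ?N z \<subseteq> ?N z'"
        using conj assms(6) z' by auto
    qed (auto simp: fun_eq_iff)
    then show ?thesis by (rule bij_betw_same_card)
  qed
  have "Tc i A A = (\<Union>z'\<in>A - {w}. ?N z')"
  proof (intro equalityI subsetI)
    fix \<tau> assume \<tau>: "\<tau> \<in> Tc i A A"
    then have "\<tau> w \<noteq> w" using assms(4) by (auto simp: Tc_def supp_def)
    moreover have "\<tau> w \<in> A" using Tc_permutes[OF \<tau>] assms(4) by (simp add: permutes_in_image)
    ultimately show "\<tau> \<in> (\<Union>z'\<in>A - {w}. ?N z')" using \<tau> by auto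
  qed auto
  then have "card (Tc i A A) = card (\<Union>z'\<in>A - {w}. ?N z')" by simp
  also have "\<dots> = (\<Sum>z'\<in>A - {w}. card (?N z'))"
    by (rule card_UN_disjoint) (use assms(1) fT in auto)
  also have "\<dots> = (\<Sum>z'\<in>A - {w}. card (?N z))" using eq by (intro sum.cong) auto
  also have "\<dots> = (msz i - 1) * card (?N z)" using assms by simp
  finally show ?thesis using card_Tc_full[OF assms(1-3)] by simp
qed

text \<open>The condition \<open>\<tau> w = z\<close> with \<open>w \<noteq> z\<close> forces both
  points into the support, so they can be added to \<open>K\<close>; then the recursion of
  \<open>card_Tc\<close> applies. The factor on the left avoids a division.\<close>

lemma card_move:
  assumes "finite A" "K \<subseteq> A" "i \<in> {1..6}" "w \<in> A" "z \<in> A" "w \<noteq> z"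
  shows "(msz i - 1) * card {\<tau> \<in> Tc i A K. \<tau> w = z} =
     full_support_card i * subset_card (msz i) (card A) (card (insert w (insert z K)))"
proof -
  have *: "(msz i - 1) * card {\<tau> \<in> Tc i A K. \<tau> w = z} = full_support_card i * subset_card (msz i) (card A) (card K)"
    if "finite A" "K \<subseteq> A" "w \<in> K" "z \<in> K" for A K
    using that
  proof (induction "card (A - K)" arbitrary: A K rule: less_induct)
    case less
    show ?case
    proof (cases "A = K")
      case True
      then show ?thesis using card_move_full[of A i w z] Tc_AA_empty[of A i] less.prems assms(3,6)
        by (cases "card A = msz i") (simp_all add: subset_card_diag)
    next
      case False
      then obtain x where x: "x \<in> A" "x \<notin> K" using less.prems by auto
      have s1: "card (A - {x} - K) < card (A - K)" "card (A - insert x K) < card (A - K)"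
        using x less.prems by (auto intro!: psubset_card_mono simp del: card_Diff_insert)
      have fK: "finite K" using less.prems finite_subset by auto
      have kA: "card K < card A" using less.prems False by (simp add: psubset_card_mono psubsetI)
      have "{\<tau> \<in> Tc i A K. \<tau> w = z} = {\<tau> \<in> Tc i (A - {x}) K. \<tau> w = z} \<union> {\<tau> \<in> Tc i A (insert x K). \<tau> w = z}"
        using Tc_split[of i A K x] by auto
      moreover have "{\<tau> \<in> Tc i (A - {x}) K. \<tau> w = z} \<inter> {\<tau> \<in> Tc i A (insert x K). \<tau> w = z} = {}"
        using Tc_split_disjoint[of i A x K] by auto
      ultimately have "card {\<tau> \<in> Tc i A K. \<tau> w = z} =
          card {\<tau> \<in> Tc i (A - {x}) K. \<tau> w = z} + card {\<tau> \<in> Tc i A (insert x K). \<tau> w = z}"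
        using less.prems(1) by (simp add: card_Un_disjoint finite_Tc)
      moreover have "(msz i - 1) * card {\<tau> \<in> Tc i (A - {x}) K. \<tau> w = z} =
          full_support_card i * subset_card (msz i) (card A - 1) (card K)"
        using x less.prems by (subst less.hyps[OF s1(1)]) auto
      moreover have "(msz i - 1) * card {\<tau> \<in> Tc i A (insert x K). \<tau> w = z} =
          full_support_card i * subset_card (msz i) (card A) (Suc (card K))"
        using x less.prems fK by (subst less.hyps[OF s1(2)]) auto
      ultimately show ?thesis using subset_card_Suc[OF kA, of "msz i"]
        by (simp add: algebra_simps)
    qed
  qed
  have "{\<tau> \<in> Tc i A K. \<tau> w = z} = {\<tau> \<in> Tc i A (insert w (insert z K)). \<tau> w = z}"
  proof -
    have "w \<in> supp \<tau> \<and> z \<in> supp \<tau>" if "\<tau> \<in> cls i" "\<tau> w = z" for \<tau>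
    proof -
      have "inj \<tau>" using bij_cls[OF that(1)] by (rule bij_is_inj)
      then have "\<tau> z \<noteq> z" using that(2) assms(6) by (metis injD)
      then show ?thesis using that(2) assms(6) by (simp add: supp_def)
    qed
    then show ?thesis by (auto simp: Tc_def)
  qed
  then show ?thesis using *[of A "insert w (insert z K)"] assms by simp
qed

section \<open>Class sums acting on functions on the symmetric group\<close>

text \<open>Since \<open>\<tau> \<odot> \<sigma> = \<sigma> \<circ> \<tau>\<close>, translation from
  the right under \<open>\<circ>\<close> is the one that belongs to the Cayley graph: if
  \<open>S\<close> is closed under inverses, \<open>sm S\<close> is the adjacency operator.\<close>

definition sm :: "(nat \<Rightarrow> nat) set \<Rightarrow> ((nat \<Rightarrow> nat) \<Rightarrow> real) \<Rightarrow> (nat \<Rightarrow> nat) \<Rightarrow> real" where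
  "sm S f = (\<lambda>\<sigma>. \<Sum>\<tau>\<in>S. f (\<sigma> \<circ> \<tau>))"

definition act :: "(nat \<Rightarrow> nat) \<Rightarrow> ((nat \<Rightarrow> nat) \<Rightarrow> real) \<Rightarrow> (nat \<Rightarrow> nat) \<Rightarrow> real" where
  "act \<tau> f = (\<lambda>\<sigma>. f (\<sigma> \<circ> \<tau>))"

lemma act_apply: "act \<tau> f \<sigma> = f (\<sigma> \<circ> \<tau>)"
  by (simp add: act_def)

lemma sm_apply: "sm S f \<sigma> = (\<Sum>\<tau>\<in>S. f (\<sigma> \<circ> \<tau>))"
  by (simp add: sm_def)

lemma sm_singleton: "sm {\<tau>} f = act \<tau> f"
  by (simp add: sm_def act_def)

lemma act_act: "act \<tau> (act \<rho> f) = act (\<tau> \<circ> \<rho>) f"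
  by (simp add: act_def comp_assoc)

lemma act_id: "act id f = f"
  by (simp add: act_def)

lemma act_transpose_invol: "act (transpose p q) (act (transpose p q) f) = f"
  by (simp add: act_act act_id)

lemma sm_comb: "sm S (\<lambda>x. a * f x + b * g x) = (\<lambda>x. a * sm S f x + b * sm S g x)"
  by (simp add: sm_def sum.distrib sum_distrib_left)

lemma sm_scale: "sm S (\<lambda>x. a * f x) = (\<lambda>x. a * sm S f x)"
  by (simp add: sm_def sum_distrib_left)

lemma sm_sm: "sm S (sm S' f) \<sigma> = (\<Sum>s\<in>S. \<Sum>t\<in>S'. f (\<sigma> \<circ> s \<circ> t))"
  by (simp add: sm_def)

text \<open>Each \<open>t\<close> in \<open>S'\<close> preserves \<open>S\<close> under conjugation,
  so moving \<open>t\<close> past an element of \<open>S\<close> only permutes the summands.\<close>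

lemma sm_comm:
  assumes "\<And>t. t \<in> S' \<Longrightarrow> bij t \<and> (\<lambda>s. t \<circ> s \<circ> pinv t) ` S = S"
  shows "sm S (sm S' f) = sm S' (sm S f)"
proof
  fix \<sigma>
  have "(\<Sum>s\<in>S. f (\<sigma> \<circ> s \<circ> t)) = (\<Sum>s\<in>S. f (\<sigma> \<circ> t \<circ> s))" if "t \<in> S'" for t
  proof -
    have t: "bij t" and im: "(\<lambda>s. t \<circ> s \<circ> pinv t) ` S = S" using assms[OF that] by auto
    have e: "t \<circ> s \<circ> pinv t \<circ> t = t \<circ> s" for s
      using t by (simp add: comp_assoc bij_is_inj)
    have "inj_on (\<lambda>s. t \<circ> s \<circ> pinv t) S"
    proof (rule inj_onI)
      fix s s' assume "t \<circ> s \<circ> pinv t = t \<circ> s' \<circ> pinv t"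
      then have "t \<circ> s = t \<circ> s'" using e by metis
      then show "s = s'" using t by (metis bij_is_inj comp_assoc id_comp inv_o_cancel)
    qed
    then have "(\<Sum>s\<in>(\<lambda>s. t \<circ> s \<circ> pinv t) ` S. f (\<sigma> \<circ> s \<circ> t)) =
        (\<Sum>s\<in>S. f (\<sigma> \<circ> (t \<circ> s \<circ> pinv t) \<circ> t))"
      by (simp add: sum.reindex)
    then show ?thesis unfolding im by (simp add: comp_assoc) (metis e comp_assoc)
  qed
  then have "sm S' (sm S f) \<sigma> = (\<Sum>t\<in>S'. \<Sum>s\<in>S. f (\<sigma> \<circ> s \<circ> t))"
    by (simp add: sm_sm)
  also have "\<dots> = sm S (sm S' f) \<sigma>" unfolding sm_sm by (rule sum.swap)
  finally show "sm S (sm S' f) \<sigma> = sm S' (sm S f) \<sigma>" by simp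
qed

lemma sm_Tc_comm:
  assumes "\<And>t. t \<in> S' \<Longrightarrow> bij t \<and> t ` A = A \<and> t ` K = K"
  shows "sm (Tc i A K) (sm S' f) = sm S' (sm (Tc i A K) f)"
  by (rule sm_comm) (use assms conj_Tc[of _ i A K] in auto)

lemma act_Tc_comm:
  assumes "bij t" "t ` A = A" "t ` K = K"
  shows "sm (Tc i A K) (act t f) = act t (sm (Tc i A K) f)"
  unfolding sm_singleton[symmetric] by (rule sm_Tc_comm) (use assms in auto)

text \<open>One character with a switch between trivial and sign, so that the same proofs treat both
  extreme representations.\<close>

definition chr :: "bool \<Rightarrow> (nat \<Rightarrow> nat) \<Rightarrow> real" where
  "chr e \<tau> = (if e then of_int (sign \<tau>) else 1)"

lemma chr_comp: "permutation p \<Longrightarrow> permutation q \<Longrightarrow> chr e (p \<circ> q) = chr e p * chr e q"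
  by (simp add: chr_def sign_compose)

lemma chr_sq: "chr e p * chr e p = 1"
  by (simp add: chr_def sign_def)

lemma chr_inv: "permutation p \<Longrightarrow> chr e (pinv p) = chr e p"
  by (simp add: chr_def sign_inverse)

locale sym_group =
  fixes N :: "nat set"
  assumes finN: "finite N"
begin

sublocale fin_index "{p. p permutes N}"
  by standard (rule finite_permutations[OF finN])

abbreviation "G \<equiv> {p. p permutes N}"

lemma comp_in_G:
  assumes t: "\<tau> permutes N"
  shows "\<sigma> \<circ> \<tau> permutes N \<longleftrightarrow> \<sigma> permutes N"
proof
  assume "\<sigma> \<circ> \<tau> permutes N"
  then have "(\<sigma> \<circ> \<tau>) \<circ> pinv \<tau> permutes N"
    by (rule permutes_compose[OF permutes_inv[OF t]])
  moreover have "(\<sigma> \<circ> \<tau>) \<circ> pinv \<tau> = \<sigma>" using permutes_inv_o(1)[OF t] by (simp add: comp_assoc)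
  ultimately show "\<sigma> permutes N" by simp
next
  assume "\<sigma> permutes N"
  then show "\<sigma> \<circ> \<tau> permutes N" by (rule permutes_compose[OF t])
qed

lemma act_V: "\<tau> permutes N \<Longrightarrow> f \<in> V \<Longrightarrow> act \<tau> f \<in> V"
  by (simp add: V_def act_def comp_in_G)

lemma sm_V:
  assumes "S \<subseteq> G" "f \<in> V"
  shows "sm S f \<in> V"
proof -
  have "f (\<sigma> \<circ> \<tau>) = 0" if "\<tau> \<in> S" "\<not> \<sigma> permutes N" for \<sigma> \<tau>
    using that assms comp_in_G[of \<tau> \<sigma>] by (auto simp: V_def)
  then show ?thesis by (simp add: V_def sm_def)
qed

lemma sum_G_shift:
  assumes "\<tau> permutes N"
  shows "(\<Sum>\<sigma>\<in>G. h (\<sigma> \<circ> \<tau>)) = (\<Sum>\<sigma>\<in>G. h \<sigma>)"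
  by (rule sum.reindex_bij_witness[of _ "\<lambda>\<sigma>. \<sigma> \<circ> pinv \<tau>" "\<lambda>\<sigma>. \<sigma> \<circ> \<tau>"])
    (use assms permutes_inv_o[OF assms] in \<open>auto simp: comp_assoc permutes_compose permutes_inv\<close>)

lemma ip_act: "\<tau> permutes N \<Longrightarrow> ip (act \<tau> f) (act \<tau> g) = ip f g"
  unfolding ip_def act_def using sum_G_shift[of \<tau> "\<lambda>\<sigma>. f \<sigma> * g \<sigma>"] by simp

lemma ip_act_left:
  assumes "\<tau> permutes N"
  shows "ip (act \<tau> f) g = ip f (act (pinv \<tau>) g)"
proof -
  have "act \<tau> (act (pinv \<tau>) g) = g" using permutes_inv_o[OF assms] by (simp add: act_act act_id)
  then show ?thesis using ip_act[OF assms, of f "act (pinv \<tau>) g"] by simp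
qed

lemma ip_sum_left: "ip (\<lambda>x. \<Sum>s\<in>S. h s x) g = (\<Sum>s\<in>S. ip (h s) g)"
  unfolding ip_def sum_distrib_right by (rule sum.swap)

lemma ip_sm_left: "ip (sm S f) g = (\<Sum>s\<in>S. ip (act s f) g)"
  unfolding sm_def act_def by (rule ip_sum_left)

lemma selfadj_sm:
  assumes "S \<subseteq> G" "\<And>\<tau>. \<tau> \<in> S \<Longrightarrow> pinv \<tau> \<in> S"
  shows "selfadj (sm S)"
proof -
  have "ip (sm S f) g = ip f (sm S g)" for f g
  proof -
    have "ip (sm S f) g = (\<Sum>s\<in>S. ip f (act (pinv s) g))"
      unfolding ip_sm_left using assms(1) by (intro sum.cong) (auto simp: ip_act_left)
    also have "\<dots> = (\<Sum>s\<in>S. ip f (act s g))"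
      by (rule sum.reindex_bij_witness[of _ pinv pinv])
        (use assms in \<open>auto simp: permutes_inv_inv\<close>)
    also have "\<dots> = ip f (sm S g)" using ip_sm_left[of S g f] by (simp add: ip_commute)
    finally show ?thesis .
  qed
  then show ?thesis using sm_V[OF assms(1)] by (auto simp: selfadj_def sm_comb)
qed

lemma Tc_G: "A \<subseteq> N \<Longrightarrow> Tc i A K \<subseteq> G"
  using Tc_permutes permutes_subset by blast

lemma selfadj_Tc: "A \<subseteq> N \<Longrightarrow> selfadj (sm (Tc i A K))"
  by (intro selfadj_sm Tc_G inv_Tc)

lemma selfadj_act_transpose:
  assumes "p \<in> N" "q \<in> N"
  shows "selfadj (act (transpose p q))"
proof -
  have "selfadj (sm {transpose p q})"
    by (rule selfadj_sm) (use assms in \<open>auto intro: permutes_swap_id\<close>)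
  moreover have "sm {transpose p q} = act (transpose p q)" by (simp add: fun_eq_iff sm_singleton)
  ultimately show ?thesis by simp
qed

text \<open>Translations are isometries, so the squared norm of \<open>act s f - f\<close> being
  nonnegative bounds each summand.\<close>

lemma quadratic_trivial_bound:
  assumes "S \<subseteq> G" "f \<in> V"
  shows "ip (sm S f) f \<le> real (card S) * ip f f"
proof -
  have "ip (act s f) f \<le> ip f f" if "s \<in> S" for s
  proof -
    have s: "s permutes N" using that assms(1) by auto
    have "0 \<le> ip (\<lambda>x. 1 * act s f x + (- 1) * f x) (\<lambda>x. 1 * act s f x + (- 1) * f x)" by (rule ip_nonneg)
    then show ?thesis unfolding ip_left ip_right
      using ip_act[OF s, of f f] by (simp add: ip_commute)
  qed
  then have "ip (sm S f) f \<le> (\<Sum>s\<in>S. ip f f)" unfolding ip_sm_left by (intro sum_mono)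
  then show ?thesis by simp
qed

text \<open>
  \<open>Gen A\<close> consists of the functions without trivial or sign constituent under the symmetric group on
  \<open>A\<close>, and \<open>W A\<close> of those that in addition have no constituent induced from the trivial or sign
  character of a point stabiliser in it.
\<close>

definition gen1 :: "bool \<Rightarrow> nat set \<Rightarrow> ((nat \<Rightarrow> nat) \<Rightarrow> real) set" where
  "gen1 e A = {f \<in> V. \<forall>\<sigma>\<in>UNIV. (\<Sum>\<tau>\<in>{\<tau>. \<tau> permutes A}. chr e \<tau> * f (\<sigma> \<circ> \<tau>)) = 0}"

definition Gen :: "nat set \<Rightarrow> ((nat \<Rightarrow> nat) \<Rightarrow> real) set" where
  "Gen A = gen1 False A \<inter> gen1 True A"

definition W :: "nat set \<Rightarrow> ((nat \<Rightarrow> nat) \<Rightarrow> real) set" where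
  "W A = Gen A \<inter> (\<Inter>x\<in>A. Gen (A - {x}))"

lemma subsp_gen1: "finite A \<Longrightarrow> subsp (gen1 e A)"
  unfolding gen1_def by (rule subsp_linear_condition) (rule finite_permutations)

lemma subsp_Gen: "finite A \<Longrightarrow> subsp (Gen A)"
  unfolding Gen_def by (intro subsp_Int subsp_gen1)

lemma subsp_W: "finite A \<Longrightarrow> subsp (W A)"
proof -
  assume f: "finite A"
  have "W A = \<Inter> (insert (Gen A) ((\<lambda>x. Gen (A - {x})) ` A))" by (auto simp: W_def)
  moreover have "subsp (\<Inter> (insert (Gen A) ((\<lambda>x. Gen (A - {x})) ` A)))"
    by (rule subsp_Inter) (use f subsp_Gen in auto)
  ultimately show ?thesis by simp
qed

definition invU :: "((nat \<Rightarrow> nat) \<Rightarrow> real) set \<Rightarrow> nat set \<Rightarrow> bool" where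
  "invU U A \<longleftrightarrow> subsp U \<and> (\<forall>s. s permutes A \<longrightarrow> (\<forall>f\<in>U. act s f \<in> U))"

lemma sm_in_U:
  assumes U: "invU U A" and S: "finite S" "\<And>s. s \<in> S \<Longrightarrow> s permutes A" and f: "f \<in> U"
  shows "sm S f \<in> U"
  using S
proof (induction S)
  case empty
  then show ?case using U by (auto simp: sm_def invU_def subsp_def)
next
  case (insert s S)
  have "sm (insert s S) f = (\<lambda>x. 1 * act s f x + 1 * sm S f x)"
    using insert by (simp add: sm_def act_def)
  moreover have "act s f \<in> U" "sm S f \<in> U" using U f insert by (auto simp: invU_def)
  ultimately show ?case using U subsp_comb[of U "act s f" "sm S f" 1 1] by (simp add: invU_def)
qed

lemma Tc_in_U: "invU U A \<Longrightarrow> finite A \<Longrightarrow> B \<subseteq> A \<Longrightarrow> f \<in> U \<Longrightarrow> sm (Tc i B K) f \<in> U"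
  by (rule sm_in_U[of U A]) (auto intro: finite_Tc finite_subset dest: Tc_permutes permutes_subset)

lemma conj_permutes:
  fixes p s :: "nat \<Rightarrow> nat"
  assumes "p permutes A" "bij s"
  shows "s \<circ> p \<circ> pinv s permutes s ` A"
proof -
  have "bij p" using assms(1) permutes_bij by blast
  then have "bij (s \<circ> p \<circ> pinv s)" using assms(2) by (intro bij_comp bij_imp_bij_inv)
  moreover have "supp (s \<circ> p \<circ> pinv s) \<subseteq> s ` A"
    unfolding supp_conj[OF assms(2)] using supp_permutes[OF assms(1)] by auto
  ultimately show ?thesis by (rule permutes_supp)
qed

text \<open>Conjugation by \<open>s\<close> maps the permutations of the preimage of
  \<open>A\<close> under \<open>s\<close> onto those of \<open>A\<close>, and \<open>chr\<close> is
  constant on conjugates.\<close>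

lemma act_gen1:
  assumes A: "A \<subseteq> N" and s: "s permutes N" and f: "f \<in> gen1 e (pinv s ` A)"
  shows "act s f \<in> gen1 e A"
proof -
  have bs: "bij s" "permutation s" using s finN permutes_bij permutes_imp_permutation by blast+
  have bi: "bij (pinv s)" using bs(1) by (rule bij_imp_bij_inv)
  have perm: "permutation p" if "p permutes A" for p
    using that A finN finite_subset permutes_imp_permutation by blast
  have eq: "s \<circ> (pinv s \<circ> \<tau> \<circ> s) = \<tau> \<circ> s" for \<tau>
    using bs(1) by (simp add: fun_eq_iff bij_is_surj surj_f_inv_f)
  have "(\<Sum>\<tau>\<in>{\<tau>. \<tau> permutes A}. chr e \<tau> * f (\<sigma> \<circ> \<tau> \<circ> s)) = 0" for \<sigma>
  proof -
    have "(\<Sum>\<tau>\<in>{\<tau>. \<tau> permutes A}. chr e \<tau> * f (\<sigma> \<circ> \<tau> \<circ> s)) =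
       (\<Sum>\<tau>\<in>{\<tau>. \<tau> permutes (pinv s ` A)}. chr e \<tau> * f ((\<sigma> \<circ> s) \<circ> \<tau>))"
    proof (rule sum.reindex_bij_witness[of _ "\<lambda>\<tau>. s \<circ> \<tau> \<circ> pinv s" "\<lambda>\<tau>. pinv s \<circ> \<tau> \<circ> s"])
      fix \<tau> assume "\<tau> \<in> {\<tau>. \<tau> permutes A}"
      then have \<tau>: "\<tau> permutes A" by simp
      show "s \<circ> (pinv s \<circ> \<tau> \<circ> s) \<circ> pinv s = \<tau>"
        unfolding eq using bs(1) by (simp add: fun_eq_iff bij_is_surj surj_f_inv_f)
      show "pinv s \<circ> \<tau> \<circ> s \<in> {\<tau>. \<tau> permutes (pinv s ` A)}"
        using conj_permutes[OF \<tau> bi] bs(1) by (simp add: inv_inv_eq)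
      have "chr e (pinv s \<circ> \<tau> \<circ> s) = chr e (pinv s) * chr e \<tau> * chr e s"
        using bs perm[OF \<tau>] by (simp add: chr_comp permutation_compose permutation_inverse)
      also have "\<dots> = chr e \<tau>" using chr_inv[OF bs(2), of e] chr_sq[of e s] by simp
      finally show "chr e (pinv s \<circ> \<tau> \<circ> s) * f (\<sigma> \<circ> s \<circ> (pinv s \<circ> \<tau> \<circ> s)) = chr e \<tau> * f (\<sigma> \<circ> \<tau> \<circ> s)"
        using eq[of \<tau>] by (simp add: comp_assoc)
    next
      fix \<tau> assume "\<tau> \<in> {\<tau>. \<tau> permutes (pinv s ` A)}"
      then have \<tau>: "\<tau> permutes (pinv s ` A)" by simp
      show "pinv s \<circ> (s \<circ> \<tau> \<circ> pinv s) \<circ> s = \<tau>"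
        using bs(1) by (simp add: fun_eq_iff bij_is_inj)
      show "s \<circ> \<tau> \<circ> pinv s \<in> {\<tau>. \<tau> permutes A}"
        using conj_permutes[OF \<tau> bs(1)] bs(1) by (simp add: bij_is_surj image_f_inv_f)
    qed
    also have "\<dots> = 0" using f by (simp add: gen1_def)
    finally show ?thesis .
  qed
  moreover have "act s f \<in> V" using f s by (auto simp: gen1_def intro: act_V)
  ultimately show ?thesis by (simp add: gen1_def act_def)
qed

lemma act_Gen: "A \<subseteq> N \<Longrightarrow> s permutes N \<Longrightarrow> f \<in> Gen (pinv s ` A) \<Longrightarrow> act s f \<in> Gen A"
  by (auto simp: Gen_def act_gen1)

lemma invU_Gen:
  assumes "A \<subseteq> N"
  shows "invU (Gen A) A"
proof -
  have "act s f \<in> Gen A" if s: "s permutes A" and f: "f \<in> Gen A" for s f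
  proof (rule act_Gen[OF assms])
    show "s permutes N" using s assms by (rule permutes_subset)
    show "f \<in> Gen (pinv s ` A)" using permutes_image[OF permutes_inv[OF s]] f by simp
  qed
  then show ?thesis using subsp_Gen finite_subset[OF assms finN] by (auto simp: invU_def)
qed

lemma invU_W:
  assumes "A \<subseteq> N"
  shows "invU (W A) A"
proof -
  have "act s f \<in> W A" if s: "s permutes A" and f: "f \<in> W A" for s f
  proof -
    have sN: "s permutes N" using s assms by (rule permutes_subset)
    have "act s f \<in> Gen A" using invU_Gen[OF assms] s f by (auto simp: invU_def W_def)
    moreover have "act s f \<in> Gen (A - {x})" if x: "x \<in> A" for x
    proof (rule act_Gen[OF _ sN])
      have b: "bij (pinv s)" using permutes_bij[OF s] by (rule bij_imp_bij_inv)
      have "pinv s ` (A - {x}) = A - {pinv s x}"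
        using permutes_image[OF permutes_inv[OF s]] b by (simp add: image_set_diff bij_is_inj)
      moreover have "pinv s x \<in> A" using permutes_in_image[OF permutes_inv[OF s]] x by simp
      ultimately show "f \<in> Gen (pinv s ` (A - {x}))" using f by (auto simp: W_def)
    qed (use assms in auto)
    ultimately show ?thesis by (auto simp: W_def)
  qed
  then show ?thesis using subsp_W finite_subset[OF assms finN] by (auto simp: invU_def)
qed

end

section \<open>Joint eigenvalues of Jucys--Murphy elements\<close>

text \<open>The enumeration \<open>x\<close> determines a chain of subsets and thereby the
  Jucys--Murphy elements. It is a parameter because the points of \<open>K\<close> have to stand at
  the end of the chain in some estimates and at its beginning in others.\<close>

locale jm = sym_group +
  fixes U :: "((nat \<Rightarrow> nat) \<Rightarrow> real) set" and x :: "nat \<Rightarrow> nat" and a :: nat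
  assumes inj: "inj_on x {..<a}" and xN: "x ` {..<a} \<subseteq> N" and U: "invU U (x ` {..<a})"
begin

definition J :: "nat \<Rightarrow> ((nat \<Rightarrow> nat) \<Rightarrow> real) \<Rightarrow> (nat \<Rightarrow> nat) \<Rightarrow> real" where
  "J j = sm (Tc 1 (x ` {..j}) {x j})"

definition eigs :: "((nat \<Rightarrow> nat) \<Rightarrow> real) \<Rightarrow> (nat \<Rightarrow> real) \<Rightarrow> nat \<Rightarrow> bool" where
  "eigs v \<alpha> b \<longleftrightarrow> (\<forall>j<b. J j v = (\<lambda>\<sigma>. \<alpha> j * v \<sigma>))"

text \<open>The joint spectrum of the Jucys--Murphy elements on \<open>U\<close>; entries from index
  \<open>a\<close> on are arbitrary. It is constrained below by the exchange arguments of Okounkov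
  and Vershik, without a decomposition of \<open>U\<close> into irreducible constituents.\<close>

definition Spec :: "(nat \<Rightarrow> real) \<Rightarrow> bool" where
  "Spec \<alpha> \<longleftrightarrow> (\<exists>v\<in>U. v \<noteq> (\<lambda>\<sigma>. 0) \<and> eigs v \<alpha> a)"

lemma U_V: "f \<in> U \<Longrightarrow> f \<in> V"
  using U by (auto simp: invU_def subsp_def)

lemma subU: "subsp U"
  using U by (simp add: invU_def)

lemma x_eq: "i < a \<Longrightarrow> j < a \<Longrightarrow> x i = x j \<longleftrightarrow> i = j"
  using inj by (auto simp: inj_on_def)

lemma J_apply:
  assumes "j < a"
  shows "J j v \<sigma> = (\<Sum>i<j. v (\<sigma> \<circ> transpose (x i) (x j)))"
proof -
  have nin: "x j \<notin> x ` {..<j}" using assms x_eq by auto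
  have "x ` {..j} = insert (x j) (x ` {..<j})" by (auto simp: less_le)
  then have "J j v \<sigma> = (\<Sum>b\<in>x ` {..<j}. v (\<sigma> \<circ> transpose (x j) b))"
    unfolding J_def sm_def using sum_root_1[OF nin, of "\<lambda>\<tau>. v (\<sigma> \<circ> \<tau>)"] by simp
  also have "\<dots> = (\<Sum>i<j. v (\<sigma> \<circ> transpose (x j) (x i)))"
    using inj assms by (subst sum.reindex) (auto intro: inj_on_subset)
  finally show ?thesis by (simp add: transpose_commute)
qed

lemma J_selfadj: "j < a \<Longrightarrow> selfadj (J j)"
  unfolding J_def using xN by (intro selfadj_Tc) auto

lemma transpose_permutes: "i < a \<Longrightarrow> j < a \<Longrightarrow> transpose (x i) (x j) permutes x ` {..<a}"
  by (intro permutes_swap_id) auto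

lemma act_U: "i < a \<Longrightarrow> j < a \<Longrightarrow> f \<in> U \<Longrightarrow> act (transpose (x i) (x j)) f \<in> U"
  using U transpose_permutes by (auto simp: invU_def)

lemma transpose_N: "i < a \<Longrightarrow> j < a \<Longrightarrow> transpose (x i) (x j) permutes N"
  using transpose_permutes xN permutes_subset by blast

abbreviation "sw j \<equiv> act (transpose (x j) (x (Suc j)))"

lemma J_Suc:
  assumes "Suc j < a"
  shows "J (Suc j) v \<sigma> = sw j (J j (sw j v)) \<sigma> + sw j v \<sigma>"
proof -
  have eq: "transpose (x j) (x (Suc j)) \<circ> transpose (x i) (x j) \<circ> transpose (x j) (x (Suc j)) =
     transpose (x i) (x (Suc j))" if "i < j" for i
    using that assms x_eq[of i j] x_eq[of i "Suc j"] x_eq[of j "Suc j"]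
    by (auto simp: fun_eq_iff transpose_def)
  have "sw j (J j (sw j v)) \<sigma> = (\<Sum>i<j. v (\<sigma> \<circ> (transpose (x j) (x (Suc j)) \<circ> transpose (x i) (x j)
      \<circ> transpose (x j) (x (Suc j)))))"
    using assms by (simp add: act_apply J_apply comp_assoc)
  also have "\<dots> = (\<Sum>i<j. v (\<sigma> \<circ> transpose (x i) (x (Suc j))))"
    using eq by (intro sum.cong) auto
  finally show ?thesis using assms by (simp add: J_apply act_apply)
qed

lemma J_sw_comm:
  assumes "i < a" "Suc j < a" "i \<noteq> j" "i \<noteq> Suc j"
  shows "J i (sw j v) = sw j (J i v)"
  unfolding J_def
proof (rule act_Tc_comm)
  have "transpose (x j) (x (Suc j)) ` (x ` {..i}) = x ` {..i}"
  proof (cases "i < j")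
    case True
    have "x j \<notin> x ` {..i}" "x (Suc j) \<notin> x ` {..i}"
      using True assms x_eq by auto
    then show ?thesis by (simp add: transpose_image_eq)
  next
    case False
    then have "x j \<in> x ` {..i}" "x (Suc j) \<in> x ` {..i}" using assms by auto
    then show ?thesis by (simp add: transpose_image_eq)
  qed
  then show "transpose (x j) (x (Suc j)) ` x ` {..i} = x ` {..i}" .
  have "x i \<noteq> x j" "x i \<noteq> x (Suc j)" using assms x_eq by auto
  then show "transpose (x j) (x (Suc j)) ` {x i} = {x i}" by simp
qed simp

text \<open>
  With \<open>s = sw j\<close>, \<open>X = J j\<close>, \<open>Y = J (Suc j)\<close> one has \<open>s X s + s = Y\<close>. Hence \<open>v\<close> and \<open>s v\<close> span an
  invariant space, on which \<open>s\<close> is determined by the eigenvalues \<open>p\<close> and \<open>q\<close>.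
\<close>

lemma sw_core:
  assumes j: "Suc j < a" and v: "v \<in> U" "v \<noteq> (\<lambda>\<sigma>. 0)"
    and e: "J j v = (\<lambda>\<sigma>. p * v \<sigma>)" "J (Suc j) v = (\<lambda>\<sigma>. q * v \<sigma>)"
  shows "p \<noteq> q" "\<bar>q - p\<bar> = 1 \<Longrightarrow> sw j v = (\<lambda>\<sigma>. (q - p) * v \<sigma>)"
    "\<bar>q - p\<bar> \<noteq> 1 \<Longrightarrow> \<exists>v'\<in>U. v' \<noteq> (\<lambda>\<sigma>. 0) \<and> J j v' = (\<lambda>\<sigma>. q * v' \<sigma>) \<and> J (Suc j) v' = (\<lambda>\<sigma>. p * v' \<sigma>) \<and>
        (\<forall>i<a. i \<noteq> j \<longrightarrow> i \<noteq> Suc j \<longrightarrow> (\<forall>c. J i v = (\<lambda>\<sigma>. c * v \<sigma>) \<longrightarrow> J i v' = (\<lambda>\<sigma>. c * v' \<sigma>)))"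
proof -
  define w where "w = sw j v"
  have wU: "w \<in> U" unfolding w_def using act_U j v by auto
  have vV: "v \<in> V" and wV: "w \<in> V" using v wU U_V by auto
  have sww: "sw j w = v" unfolding w_def by (rule act_transpose_invol)
  have Jw: "J j w \<sigma> = q * w \<sigma> - v \<sigma>" for \<sigma>
  proof -
    let ?s = "transpose (x j) (x (Suc j))"
    have "J (Suc j) v (\<sigma> \<circ> ?s) = sw j (J j w) (\<sigma> \<circ> ?s) + w (\<sigma> \<circ> ?s)"
      unfolding w_def by (rule J_Suc[OF j])
    moreover have "sw j (J j w) (\<sigma> \<circ> ?s) = J j w \<sigma>" by (simp add: act_apply comp_assoc)
    moreover have "w (\<sigma> \<circ> ?s) = v \<sigma>" using sww by (metis act_apply)
    moreover have "v (\<sigma> \<circ> ?s) = w \<sigma>" by (simp add: w_def act_apply)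
    ultimately show ?thesis unfolding e(2) by simp
  qed
  have J1w: "J (Suc j) w \<sigma> = p * w \<sigma> + v \<sigma>" for \<sigma>
    using J_Suc[OF j, of w \<sigma>] unfolding sww e(1) by (simp add: w_def act_apply)
  have vv: "ip v v > 0" using ip_pos vV v(2) by auto
  have jj: "j < a" using j by simp
  have "ip (J j w) v = ip w (J j v)" using selfadj_ip[OF J_selfadj[OF jj] wV vV] .
  moreover have "ip (J j w) v = q * ip w v - ip v v"
  proof -
    have "J j w = (\<lambda>\<sigma>. q * w \<sigma> + (- 1) * v \<sigma>)" using Jw by (simp add: fun_eq_iff)
    then show ?thesis by (simp only: ip_left)
  qed
  ultimately have key: "(q - p) * ip w v = ip v v"
    unfolding e(1) by (simp add: ip_scale algebra_simps)
  show pq: "p \<noteq> q" using key vv by auto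
  have ww: "ip w w = ip v v" unfolding w_def using ip_act[OF transpose_N[OF jj j]] by auto
  \<comment> \<open>\<open>u\<close> is \<open>sw j v\<close> minus its orthogonal projection to
    \<open>v\<close>. Its norm shows that it vanishes exactly if
    \<open>\<bar>q - p\<bar> = 1\<close>; otherwise it is the eigenvector with exchanged
    eigenvalues.\<close>
  define u where "u = (\<lambda>\<sigma>. 1 * w \<sigma> + (- 1 / (q - p)) * v \<sigma>)"
  have uU: "u \<in> U" unfolding u_def using subsp_comb[OF subU wU v(1)] .
  have d: "q - p \<noteq> 0" using pq by simp
  have ipwv: "ip w v = ip v v / (q - p)" using key d by (simp add: field_simps)
  have uu: "ip u u = ip v v * (1 - 1 / (q - p)\<^sup>2)"
    unfolding u_def ip_left ip_right
    by (simp add: ww ip_commute[of v w] ipwv algebra_simps power2_eq_square divide_simps d)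
  show "sw j v = (\<lambda>\<sigma>. (q - p) * v \<sigma>)" if "\<bar>q - p\<bar> = 1"
  proof -
    have sq: "(q - p)\<^sup>2 = 1" using that by (simp add: abs_square_eq_1)
    then have "u = (\<lambda>\<sigma>. 0)" using uu ip_eq_0_iff[OF U_V[OF uU]] by simp
    then have "w \<sigma> = 1 / (q - p) * v \<sigma>" for \<sigma> unfolding u_def by (auto simp: fun_eq_iff)
    moreover have "1 / (q - p) = q - p" using sq d by (simp add: field_simps power2_eq_square)
    ultimately have "w \<sigma> = (q - p) * v \<sigma>" for \<sigma> by metis
    then show ?thesis unfolding w_def by (intro ext)
  qed
  show "\<exists>v'\<in>U. v' \<noteq> (\<lambda>\<sigma>. 0) \<and> J j v' = (\<lambda>\<sigma>. q * v' \<sigma>) \<and> J (Suc j) v' = (\<lambda>\<sigma>. p * v' \<sigma>) \<and>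
        (\<forall>i<a. i \<noteq> j \<longrightarrow> i \<noteq> Suc j \<longrightarrow> (\<forall>c. J i v = (\<lambda>\<sigma>. c * v \<sigma>) \<longrightarrow> J i v' = (\<lambda>\<sigma>. c * v' \<sigma>)))"
    if n1: "\<bar>q - p\<bar> \<noteq> 1"
  proof (intro bexI[of _ u] conjI uU allI impI)
    show "u \<noteq> (\<lambda>\<sigma>. 0)"
    proof
      assume "u = (\<lambda>\<sigma>. 0)"
      then have "ip u u = 0" by (simp add: ip_def)
      then have "(q - p)\<^sup>2 = 1" using uu vv d by (auto simp: divide_simps split: if_splits)
      then show False using n1 by (simp add: abs_square_eq_1)
    qed
    have lin: "J i u = (\<lambda>\<sigma>. 1 * J i w \<sigma> + (- 1 / (q - p)) * J i v \<sigma>)" for i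
      unfolding u_def J_def by (rule sm_comb)
    have us: "u \<sigma> = w \<sigma> + (- 1 / (q - p)) * v \<sigma>" for \<sigma> by (simp add: u_def)
    show "J j u = (\<lambda>\<sigma>. q * u \<sigma>)"
    proof
      fix \<sigma>
      have "J j u \<sigma> = q * w \<sigma> - v \<sigma> + (- 1 / (q - p)) * (p * v \<sigma>)"
        using fun_cong[OF lin[of j], of \<sigma>] unfolding e(1) Jw by simp
      then show "J j u \<sigma> = q * u \<sigma>" unfolding us using d by (simp add: divide_simps algebra_simps)
    qed
    show "J (Suc j) u = (\<lambda>\<sigma>. p * u \<sigma>)"
    proof
      fix \<sigma>
      have "J (Suc j) u \<sigma> = p * w \<sigma> + v \<sigma> + (- 1 / (q - p)) * (q * v \<sigma>)"
        using fun_cong[OF lin[of "Suc j"], of \<sigma>] unfolding e(2) J1w by simp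
      then show "J (Suc j) u \<sigma> = p * u \<sigma>" unfolding us using d by (simp add: divide_simps algebra_simps)
    qed
    fix i c assume i: "i < a" "i \<noteq> j" "i \<noteq> Suc j" and c: "J i v = (\<lambda>\<sigma>. c * v \<sigma>)"
    have "J i w = sw j (J i v)" unfolding w_def by (rule J_sw_comm[OF i(1) j i(2,3)])
    then have "J i w = (\<lambda>\<sigma>. c * w \<sigma>)" unfolding c by (simp add: w_def act_def)
    then show "J i u = (\<lambda>\<sigma>. c * u \<sigma>)"
      unfolding lin[of i] c by (simp add: us fun_eq_iff algebra_simps)
  qed
qed

lemma Spec_adjacent:
  assumes "Spec \<alpha>" "Suc j < a"
  shows "\<alpha> j \<noteq> \<alpha> (Suc j)"
    and "\<bar>\<alpha> (Suc j) - \<alpha> j\<bar> \<noteq> 1 \<Longrightarrow> Spec (\<alpha> \<circ> transpose j (Suc j))"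
proof -
  obtain v where v: "v \<in> U" "v \<noteq> (\<lambda>\<sigma>. 0)" "eigs v \<alpha> a" using assms(1) by (auto simp: Spec_def)
  have e: "J j v = (\<lambda>\<sigma>. \<alpha> j * v \<sigma>)" "J (Suc j) v = (\<lambda>\<sigma>. \<alpha> (Suc j) * v \<sigma>)"
    using v(3) assms(2) by (auto simp: eigs_def)
  note core = sw_core[OF assms(2) v(1,2) e]
  show "\<alpha> j \<noteq> \<alpha> (Suc j)" by (rule core(1))
  assume "\<bar>\<alpha> (Suc j) - \<alpha> j\<bar> \<noteq> 1"
  from core(3)[OF this] obtain v' where v': "v' \<in> U" "v' \<noteq> (\<lambda>\<sigma>. 0)"
    "J j v' = (\<lambda>\<sigma>. \<alpha> (Suc j) * v' \<sigma>)" "J (Suc j) v' = (\<lambda>\<sigma>. \<alpha> j * v' \<sigma>)"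
    and oth: "\<And>i c. i < a \<Longrightarrow> i \<noteq> j \<Longrightarrow> i \<noteq> Suc j \<Longrightarrow> J i v = (\<lambda>\<sigma>. c * v \<sigma>) \<Longrightarrow> J i v' = (\<lambda>\<sigma>. c * v' \<sigma>)"
    by blast
  have "J i v' = (\<lambda>\<sigma>. (\<alpha> \<circ> transpose j (Suc j)) i * v' \<sigma>)" if "i < a" for i
  proof -
    consider "i = j" | "i = Suc j" | "i \<noteq> j" "i \<noteq> Suc j" by blast
    then show ?thesis
    proof cases
      case 3
      then show ?thesis using oth[OF that 3, of "\<alpha> i"] v(3) that by (simp add: eigs_def)
    qed (use v' in auto)
  qed
  then show "Spec (\<alpha> \<circ> transpose j (Suc j))" using v' by (auto simp: Spec_def eigs_def)
qed

text \<open>Both adjacent transpositions act on \<open>v\<close> by scalars, \<open>e\<close> and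
  \<open>- e\<close>. The two sides of the braid relation then act by \<open>- e\<close> and by
  \<open>e\<close>, which is impossible on a nonzero vector.\<close>

lemma Spec_braid:
  assumes S: "Spec \<alpha>" and j: "Suc (Suc j) < a" and e: "e = 1 \<or> e = - 1"
    and al: "\<alpha> (Suc j) = \<alpha> j + e" "\<alpha> (Suc (Suc j)) = \<alpha> j"
  shows False
proof -
  obtain v where v: "v \<in> U" "v \<noteq> (\<lambda>\<sigma>. 0)" "eigs v \<alpha> a" using S by (auto simp: Spec_def)
  have s1: "sw j v = (\<lambda>\<sigma>. e * v \<sigma>)"
  proof -
    have "sw j v = (\<lambda>\<sigma>. (\<alpha> (Suc j) - \<alpha> j) * v \<sigma>)"
      by (rule sw_core(2)[of j v]) (use v j al e in \<open>auto simp: eigs_def\<close>)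
    then show ?thesis using al by simp
  qed
  have s2: "sw (Suc j) v = (\<lambda>\<sigma>. (- e) * v \<sigma>)"
  proof -
    have "sw (Suc j) v = (\<lambda>\<sigma>. (\<alpha> (Suc (Suc j)) - \<alpha> (Suc j)) * v \<sigma>)"
      by (rule sw_core(2)[of "Suc j" v]) (use v j al e in \<open>auto simp: eigs_def\<close>)
    then show ?thesis using al by simp
  qed
  have h1: "v (\<sigma> \<circ> transpose (x j) (x (Suc j))) = e * v \<sigma>" for \<sigma>
    using fun_cong[OF s1] by (simp add: act_apply)
  have h2: "v (\<sigma> \<circ> transpose (x (Suc j)) (x (Suc (Suc j)))) = - e * v \<sigma>" for \<sigma>
    using fun_cong[OF s2] by (simp add: act_apply)
  have br: "transpose (x j) (x (Suc j)) \<circ> transpose (x (Suc j)) (x (Suc (Suc j))) \<circ> transpose (x j) (x (Suc j))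
     = transpose (x (Suc j)) (x (Suc (Suc j))) \<circ> transpose (x j) (x (Suc j)) \<circ> transpose (x (Suc j)) (x (Suc (Suc j)))"
    using j x_eq[of j "Suc j"] x_eq[of j "Suc (Suc j)"] x_eq[of "Suc j" "Suc (Suc j)"]
    by (auto simp: fun_eq_iff transpose_def)
  have "v \<sigma> = 0" for \<sigma>
  proof -
    have "v (\<sigma> \<circ> (transpose (x j) (x (Suc j)) \<circ> transpose (x (Suc j)) (x (Suc (Suc j))) \<circ> transpose (x j) (x (Suc j))))
        = - e * v \<sigma>"
      using e by (auto simp: h1 h2 comp_assoc[symmetric])
    moreover have "v (\<sigma> \<circ> (transpose (x (Suc j)) (x (Suc (Suc j))) \<circ> transpose (x j) (x (Suc j)) \<circ> transpose (x (Suc j)) (x (Suc (Suc j)))))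
        = e * v \<sigma>"
      using e by (auto simp: h1 h2 comp_assoc[symmetric])
    ultimately show ?thesis unfolding br using e by auto
  qed
  then show False using v(2) by auto
qed

lemma Spec_zero: "Spec \<alpha> \<Longrightarrow> 0 < a \<Longrightarrow> \<alpha> 0 = 0"
proof -
  assume "Spec \<alpha>" "0 < a"
  then obtain v where v: "v \<noteq> (\<lambda>\<sigma>. 0)" "J 0 v = (\<lambda>\<sigma>. \<alpha> 0 * v \<sigma>)" by (auto simp: Spec_def eigs_def)
  have "J 0 v \<sigma> = 0" for \<sigma> using J_apply[OF \<open>0 < a\<close>] by simp
  then show "\<alpha> 0 = 0" using v by (auto simp: fun_eq_iff)
qed

text \<open>Without an earlier neighbour the entry can be exchanged step by step to the front. The
  sequences before and after the last exchange both begin with 0, so two adjacent entries were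
  equal, contrary to \<open>Spec_adjacent\<close>.\<close>

lemma Spec_prev_aux:
  assumes "Spec \<alpha>" "q < a" "\<And>p. p < q \<Longrightarrow> \<bar>\<alpha> p - \<alpha> q\<bar> \<noteq> 1"
  shows "q = 0"
  using assms
proof (induction q arbitrary: \<alpha>)
  case (Suc q)
  have ne: "\<alpha> q \<noteq> \<alpha> (Suc q)" using Spec_adjacent(1)[OF Suc.prems(1,2)] .
  have "\<bar>\<alpha> (Suc q) - \<alpha> q\<bar> \<noteq> 1" using Suc.prems(3)[of q] by (simp add: abs_minus_commute)
  then have S: "Spec (\<alpha> \<circ> transpose q (Suc q))" using Spec_adjacent(2)[OF Suc.prems(1,2)] by simp
  have "q = 0"
  proof (rule Suc.IH[OF S])
    show "q < a" using Suc.prems by simp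
    fix p assume "p < q"
    then show "\<bar>(\<alpha> \<circ> transpose q (Suc q)) p - (\<alpha> \<circ> transpose q (Suc q)) q\<bar> \<noteq> 1"
      using Suc.prems(3)[of p] by simp
  qed
  moreover have "(\<alpha> \<circ> transpose q (Suc q)) 0 = 0" by (rule Spec_zero[OF S]) (use Suc.prems in simp)
  moreover have "\<alpha> 0 = 0" by (rule Spec_zero[OF Suc.prems(1)]) (use Suc.prems in simp)
  ultimately show ?case using ne by simp
qed simp

lemma Spec_prev:
  assumes "Spec \<alpha>" "q < a" "0 < q"
  shows "\<exists>p<q. \<bar>\<alpha> p - \<alpha> q\<bar> = 1"
  using Spec_prev_aux[OF assms(1,2)] assms(3) by auto

text \<open>Suppose that \<open>\<alpha> q + e\<close> is missing between consecutive occurrences of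
  \<open>\<alpha> q\<close>. An inner end different from \<open>\<alpha> q - e\<close> can be
  exchanged outward, which shortens the interval; so both inner ends are
  \<open>\<alpha> q - e\<close>. If they are the same entry, \<open>Spec_braid\<close> applies. If
  not, induction on a gap between two such entries yields another occurrence of
  \<open>\<alpha> q\<close>.\<close>

lemma Spec_between:
  assumes "Spec \<alpha>" "p < q" "q < a" "\<alpha> p = \<alpha> q" "\<And>r. p < r \<Longrightarrow> r < q \<Longrightarrow> \<alpha> r \<noteq> \<alpha> q"
    "e = 1 \<or> e = - 1"
  shows "\<exists>r. p < r \<and> r < q \<and> \<alpha> r = \<alpha> q + e"
  using assms
proof (induction "q - p" arbitrary: \<alpha> p q e rule: less_induct)
  case less
  note S = less.prems(1)
  show ?case
  proof (rule ccontr)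
    assume no: "\<nexists>r. p < r \<and> r < q \<and> \<alpha> r = \<alpha> q + e"
    have pq1: "Suc p < q"
      using Spec_adjacent(1)[OF S, of p] less.prems by (cases "Suc p = q") auto
    define q' where "q' = q - 1"
    have q': "q = Suc q'" "p < q'" using pq1 by (auto simp: q'_def)
    have "\<alpha> q' = \<alpha> q - e"
    proof (rule ccontr)
      assume ne: "\<alpha> q' \<noteq> \<alpha> q - e"
      have "\<alpha> q' \<noteq> \<alpha> q + e" using no q' by auto
      then have "\<bar>\<alpha> (Suc q') - \<alpha> q'\<bar> \<noteq> 1" using ne less.prems(6) q' by auto
      then have S': "Spec (\<alpha> \<circ> transpose q' (Suc q'))" using Spec_adjacent(2)[OF S] less.prems q' by auto
      have "\<exists>r. p < r \<and> r < q' \<and> (\<alpha> \<circ> transpose q' (Suc q')) r = (\<alpha> \<circ> transpose q' (Suc q')) q' + e"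
      proof (rule less.hyps[OF _ S'])
        show "q' - p < q - p" "p < q'" "q' < a" using q' less.prems by auto
        show "(\<alpha> \<circ> transpose q' (Suc q')) p = (\<alpha> \<circ> transpose q' (Suc q')) q'" using q' less.prems by auto
        show "e = 1 \<or> e = - 1" by (rule less.prems(6))
        fix r assume "p < r" "r < q'"
        then show "(\<alpha> \<circ> transpose q' (Suc q')) r \<noteq> (\<alpha> \<circ> transpose q' (Suc q')) q'"
          using less.prems(5)[of r] q' by auto
      qed
      then obtain r where "p < r" "r < q'" "\<alpha> r = \<alpha> q + e" using q' by auto
      then show False using no q' by auto
    qed
    moreover have "\<alpha> (Suc p) = \<alpha> q - e"
    proof (rule ccontr)
      assume ne: "\<alpha> (Suc p) \<noteq> \<alpha> q - e"
      have "\<alpha> (Suc p) \<noteq> \<alpha> q + e" using no pq1 by auto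
      then have "\<bar>\<alpha> (Suc p) - \<alpha> p\<bar> \<noteq> 1" using ne less.prems(4,6) by auto
      then have S': "Spec (\<alpha> \<circ> transpose p (Suc p))" using Spec_adjacent(2)[OF S] less.prems by auto
      have "\<exists>r. Suc p < r \<and> r < q \<and> (\<alpha> \<circ> transpose p (Suc p)) r = (\<alpha> \<circ> transpose p (Suc p)) q + e"
      proof (rule less.hyps[OF _ S'])
        show "q - Suc p < q - p" "Suc p < q" "q < a" using pq1 less.prems by auto
        show "(\<alpha> \<circ> transpose p (Suc p)) (Suc p) = (\<alpha> \<circ> transpose p (Suc p)) q" using pq1 less.prems by auto
        show "e = 1 \<or> e = - 1" by (rule less.prems(6))
        fix r assume "Suc p < r" "r < q"
        then show "(\<alpha> \<circ> transpose p (Suc p)) r \<noteq> (\<alpha> \<circ> transpose p (Suc p)) q"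
          using less.prems(5)[of r] pq1 by auto
      qed
      then obtain r where "Suc p < r" "r < q" "\<alpha> r = \<alpha> q + e" using pq1 by auto
      then show False using no by (meson Suc_lessD)
    qed
    ultimately have ends: "\<alpha> q' = \<alpha> q - e" "\<alpha> (Suc p) = \<alpha> q - e" by auto
    show False
    proof (cases "Suc p = q'")
      case True
      then show False
        using Spec_braid[OF S, of p "- e"] less.prems q' ends by auto
    next
      case False
      then have lt: "Suc p < q'" using q' by simp
      \<comment> \<open>The next occurrence of \<open>\<alpha> q - e\<close> is taken so that
        \<open>Suc p\<close> and \<open>r\<close> are consecutive, as the induction hypothesis
        requires.\<close>
      define r where "r = (LEAST r. Suc p < r \<and> \<alpha> r = \<alpha> q - e)"
      have r: "Suc p < r" "\<alpha> r = \<alpha> q - e" "r \<le> q'"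
        using LeastI[of "\<lambda>r. Suc p < r \<and> \<alpha> r = \<alpha> q - e" q'] lt ends
          Least_le[of "\<lambda>r. Suc p < r \<and> \<alpha> r = \<alpha> q - e" q'] by (auto simp: r_def)
      have btw: "\<alpha> t \<noteq> \<alpha> q - e" if "Suc p < t" "t < r" for t
        using not_less_Least[of t "\<lambda>r. Suc p < r \<and> \<alpha> r = \<alpha> q - e"] that by (auto simp: r_def)
      have "\<exists>t. Suc p < t \<and> t < r \<and> \<alpha> t = \<alpha> r + e"
        by (rule less.hyps[OF _ S]) (use r q' less.prems ends btw in auto)
      then obtain t where "Suc p < t" "t < r" "\<alpha> t = \<alpha> r + e" by blast
      then have "p < t" "t < q" "\<alpha> t = \<alpha> q" using r q' by auto
      then show False using less.prems(5) by auto
    qed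
  qed
qed

lemma fixes_imp_invariant:
  assumes b: "b \<le> a" and h: "\<And>i j \<sigma>. i < b \<Longrightarrow> j < b \<Longrightarrow> i \<noteq> j \<Longrightarrow> v (\<sigma> \<circ> transpose (x i) (x j)) = chr e (transpose (x i) (x j)) * v \<sigma>"
    and \<tau>: "\<tau> permutes x ` {..<b}"
  shows "v (\<sigma> \<circ> \<tau>) = chr e \<tau> * v \<sigma>"
proof -
  have fin: "finite (x ` {..<b})" by simp
  show ?thesis
    using fin \<tau>
proof (induction \<tau> arbitrary: \<sigma> rule: permutes_rev_induct)
  case id
  then show ?case by (simp add: chr_def)
next
  case (swap c d p)
  obtain i j where ij: "i < b" "j < b" "c = x i" "d = x j" "i \<noteq> j" using swap by auto
  have "permutation p" using swap permutes_imp_permutation by blast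
  then have "chr e (p \<circ> transpose c d) = chr e p * chr e (transpose c d)"
    by (rule chr_comp) (rule permutation_swap_id)
  moreover have "v (\<sigma> \<circ> (p \<circ> transpose c d)) = chr e (transpose c d) * (chr e p * v \<sigma>)"
    using h[OF ij(1,2,5), of "\<sigma> \<circ> p"] swap.IH[of \<sigma>] unfolding ij(3,4) by (simp only: comp_assoc)
  ultimately show ?case by (simp only: mult_ac)
qed
qed

text \<open>The equality case of the trivial estimate: \<open>J j\<close> is a sum of
  \<open>j\<close> isometric involutions, so an eigenvalue of absolute value \<open>j\<close> forces
  each of them to act by the same sign. The squared norms of the differences \<open>u i\<close> add
  up to zero.\<close>

lemma extreme_eigs:
  assumes v: "v \<in> U" and b: "b \<le> a" and e: "eigs v (\<lambda>j. (if e then - 1 else 1) * real j) b"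
    and \<tau>: "\<tau> permutes x ` {..<b}"
  shows "v (\<sigma> \<circ> \<tau>) = chr e \<tau> * v \<sigma>"
proof -
  define c :: real where "c = (if e then - 1 else 1)"
  have vV: "v \<in> V" using v U_V by auto
  have sq: "c * c = 1" by (simp add: c_def)
  have tr: "act (transpose (x i) (x j)) v = (\<lambda>\<sigma>. c * v \<sigma>)" if ij: "i < j" "j < b" for i j
  proof -
    have jN: "transpose (x i) (x j) permutes N" if "i < j" for i
      using that ij b by (intro transpose_N) auto
    define u where "u i = (\<lambda>\<sigma>. 1 * act (transpose (x i) (x j)) v \<sigma> + (- c) * v \<sigma>)" for i
    have uu: "ip (u i) (u i) = 2 * (ip v v - c * ip (act (transpose (x i) (x j)) v) v)" if "i < j" for i
    proof -
      let ?p = "ip (act (transpose (x i) (x j)) v) v"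
      have "ip (u i) (u i) = ip v v + (- c) * ?p + (- c) * (?p + (- c) * ip v v)"
        unfolding u_def ip_left ip_right
        by (simp add: ip_act[OF jN[OF that]] ip_commute[of v "act (transpose (x i) (x j)) v"])
      also have "\<dots> = ip v v - 2 * (c * ?p) + (c * c) * ip v v" by (simp only: algebra_simps)
      finally show ?thesis unfolding sq by (simp add: algebra_simps)
    qed
    have "ip (J j v) v = (\<Sum>i<j. ip (act (transpose (x i) (x j)) v) v)"
    proof -
      have "J j v = (\<lambda>\<sigma>. \<Sum>i<j. act (transpose (x i) (x j)) v \<sigma>)"
        using J_apply[of j] ij b by (auto simp: fun_eq_iff act_apply)
      then show ?thesis by (simp only: ip_sum_left)
    qed
    moreover have "ip (J j v) v = c * real j * ip v v"
      using e ij by (simp add: eigs_def ip_scale c_def)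
    ultimately have "(\<Sum>i<j. ip (act (transpose (x i) (x j)) v) v) = c * real j * ip v v" by simp
    then have "c * (\<Sum>i<j. ip (act (transpose (x i) (x j)) v) v) = real j * ip v v"
      using sq by (metis mult.assoc mult_1)
    moreover have "(\<Sum>i<j. ip (u i) (u i)) =
        2 * (real j * ip v v - c * (\<Sum>i<j. ip (act (transpose (x i) (x j)) v) v))"
      by (simp add: uu sum_subtractf sum_distrib_left right_diff_distrib)
    ultimately have "(\<Sum>i<j. ip (u i) (u i)) = 0" by simp
    then have "ip (u i) (u i) = 0" using ij(1) ip_nonneg
      by (subst (asm) sum_nonneg_eq_0_iff) auto
    moreover have "u i \<in> V" unfolding u_def by (intro comb_V act_V jN ij(1) vV)
    ultimately have "u i = (\<lambda>\<sigma>. 0)" using ip_eq_0_iff by blast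
    then show ?thesis by (auto simp: u_def fun_eq_iff)
  qed
  show ?thesis
  proof (rule fixes_imp_invariant[OF b _ \<tau>])
    fix i j \<sigma> assume ij: "i < b" "j < b" "i \<noteq> j"
    have "x i \<noteq> x j" using ij b x_eq by auto
    then have c: "chr e (transpose (x i) (x j)) = c" by (simp add: chr_def sign_swap_id c_def)
    show "v (\<sigma> \<circ> transpose (x i) (x j)) = chr e (transpose (x i) (x j)) * v \<sigma>"
    proof (cases "i < j")
      case True
      then show ?thesis using fun_cong[OF tr[OF True ij(2)], of \<sigma>] unfolding c by (simp add: act_apply)
    next
      case False
      then have "j < i" using ij by simp
      then show ?thesis using fun_cong[OF tr[OF _ ij(1)], of j \<sigma>] unfolding c
        by (simp add: act_apply transpose_commute)
    qed
  qed
qed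

text \<open>By \<open>extreme_eigs\<close> such a vector transforms by \<open>chr e\<close>, so
  summing it against this character multiplies it by the order of the group instead of annihilating
  it.\<close>

lemma extreme_not_Gen:
  assumes v: "v \<in> U" "v \<noteq> (\<lambda>\<sigma>. 0)" and b: "b \<le> a" and e: "eigs v (\<lambda>j. (if e then - 1 else 1) * real j) b"
  shows "v \<notin> Gen (x ` {..<b})"
proof
  assume g: "v \<in> Gen (x ` {..<b})"
  have fin: "finite {\<tau>. \<tau> permutes x ` {..<b}}" by (rule finite_permutations) simp
  have "v \<sigma> = 0" for \<sigma>
  proof -
    have "(\<Sum>\<tau>\<in>{\<tau>. \<tau> permutes x ` {..<b}}. chr e \<tau> * v (\<sigma> \<circ> \<tau>)) = 0"
      using g by (cases e) (auto simp: Gen_def gen1_def)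
    moreover have "(\<Sum>\<tau>\<in>{\<tau>. \<tau> permutes x ` {..<b}}. chr e \<tau> * v (\<sigma> \<circ> \<tau>)) =
        (\<Sum>\<tau>\<in>{\<tau>. \<tau> permutes x ` {..<b}}. v \<sigma>)"
    proof (rule sum.cong)
      fix \<tau> assume "\<tau> \<in> {\<tau>. \<tau> permutes x ` {..<b}}"
      then have "v (\<sigma> \<circ> \<tau>) = chr e \<tau> * v \<sigma>" using extreme_eigs[OF v(1) b e] by auto
      then show "chr e \<tau> * v (\<sigma> \<circ> \<tau>) = v \<sigma>" using chr_sq[of e \<tau>] by (simp add: mult.assoc[symmetric])
    qed simp
    moreover have "card {\<tau>. \<tau> permutes x ` {..<b}} > 0"
      using fin by (auto simp: card_gt_0_iff intro!: exI[of _ id] permutes_id)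
    ultimately show ?thesis by simp
  qed
  then show False using v(2) by auto
qed

end

section \<open>Content sequences\<close>

text \<open>
  Content sequences are stored with the latest entry first. The condition says that \<open>c\<close> is next to an
  earlier entry, and that both neighbours of \<open>c\<close> occur after the previous occurrence of \<open>c\<close>.
\<close>

definition content_ok :: "int \<Rightarrow> int list \<Rightarrow> bool" where
  "content_ok c l \<longleftrightarrow> (if l = [] then c = 0
     else (c - 1 \<in> set l \<or> c + 1 \<in> set l) \<and>
       (c \<in> set l \<longrightarrow> c - 1 \<in> set (takeWhile (\<lambda>y. y \<noteq> c) l) \<and> c + 1 \<in> set (takeWhile (\<lambda>y. y \<noteq> c) l)))"

definition content_candidates :: "int list \<Rightarrow> int list" where
  "content_candidates l = (if l = [] then [0] else remdups (map (\<lambda>y. y + 1) l @ map (\<lambda>y. y - 1) l))"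

fun content_seqs :: "nat \<Rightarrow> int list list" where
  "content_seqs 0 = [[]]"
| "content_seqs (Suc n) = concat (map (\<lambda>l. map (\<lambda>c. c # l) (filter (\<lambda>c. content_ok c l) (content_candidates l))) (content_seqs n))"

text \<open>
  The eigenvalues of the six class sums on \<open>b + 1\<close> points, computed from those on \<open>b\<close> points and the
  eigenvalue \<open>X\<close> of the new Jucys--Murphy element. The increments \<open>z3\<close>, \<open>d\<close>, \<open>z4\<close>, \<open>e\<close>, \<open>z5\<close> belong to
  the elements of the classes that move the new point.
\<close>

fun class_vals_step :: "int \<Rightarrow> int \<Rightarrow> int \<times> int \<times> int \<times> int \<times> int \<times> int \<Rightarrow> int \<times> int \<times> int \<times> int \<times> int \<times> int" where
  "class_vals_step b X (c1, c2, c3, c4, c5, c6) =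
    (let z3 = X * X - b; d = X * c1 - z3; z4 = X * z3 - 2 * c1 - (b - 1) * X;
         e = X * c2 + c1 * z3 - 3 * z4 - (b - 1) * X; z5 = X * z4 - 3 * c2 - 2 * d - (b - 2) * z3
     in (c1 + X, c2 + z3, c3 + d, c4 + z4, c5 + e, c6 + z5))"

fun class_vals :: "int list \<Rightarrow> int \<times> int \<times> int \<times> int \<times> int \<times> int" where
  "class_vals [] = (0, 0, 0, 0, 0, 0)"
| "class_vals (X # l) = class_vals_step (int (length l)) X (class_vals l)"

fun class_val :: "nat \<Rightarrow> int \<times> int \<times> int \<times> int \<times> int \<times> int \<Rightarrow> int" where
  "class_val i (c1, c2, c3, c4, c5, c6) =
     (if i = 1 then c1 else if i = 2 then c2 else if i = 3 then c3 else if i = 4 then c4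
      else if i = 5 then c5 else c6)"

text \<open>
  The content sequences of the partitions \<open>(n - 1, 1)\<close> (for \<open>e = 1\<close>, the second row being filled by
  entry \<open>p < n\<close>) and \<open>(n)\<close> (for \<open>p = n\<close>), and of their transposes (for \<open>e = - 1\<close>).
\<close>

definition hook_contents :: "int \<Rightarrow> nat \<Rightarrow> nat \<Rightarrow> int list" where
  "hook_contents e p n = rev (map (\<lambda>j. e * (if j < p then int j else if j = p then - 1 else int j - 1)) [0..<n])"

definition is_excluded :: "nat \<Rightarrow> int list \<Rightarrow> bool" where
  "is_excluded p l \<longleftrightarrow> (let n = length l in list_ex (\<lambda>q. l = hook_contents 1 q n \<or> l = hook_contents (- 1) q n) [p..<Suc n])"

text \<open>
  The bounds \<open>b0\<close>, \<open>b1\<close>, \<open>b2\<close> are those for 0, 1 and 2 prescribed moved points; the inequality for two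
  points is multiplied by the difference of the last two contents, which is nonzero.
\<close>

definition check_7 :: "int list \<Rightarrow> bool" where
  "check_7 l = (is_excluded 7 l \<or> (let z = hd l; y = hd (tl l); c0 = class_vals (tl (tl l)); cy = class_vals_step 5 y c0;
     cz = class_vals_step 5 z c0; ca = class_vals_step 6 z cy
     in list_all (\<lambda>(i, b0, b1, b2). class_val i ca \<le> b0 \<and> class_val i ca - class_val i cy \<le> b1 \<and>
         list_all (\<lambda>e. y - z = e \<or> e * sgn (y - z) * (class_val i cy - class_val i cz)
             \<le> (b2 - class_val i ca - class_val i c0 + class_val i cy + class_val i cz) * \<bar>y - z\<bar>) [1, - 1])
       [(1, 14, 5, 1), (2, 35, 19, 8), (3, 35, 26, 17), (4, 70, 52, 34), (5, 70, 70, 65), (6, 84, 84, 78)]))"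

definition check_two_points :: "nat \<Rightarrow> nat \<Rightarrow> (nat \<times> int) list \<Rightarrow> int list \<Rightarrow> bool" where
  "check_two_points p a bs l = (is_excluded p l \<or> (let z = hd l; y = hd (tl l); c0 = class_vals (tl (tl l)); cy = class_vals_step (int a - 2) y c0;
     cz = class_vals_step (int a - 2) z c0
     in list_all (\<lambda>(i, b). list_all (\<lambda>e. y - z = e \<or> - e * sgn (y - z) * (class_val i cy - class_val i cz)
             \<le> (b - class_val i cy - class_val i cz) * \<bar>y - z\<bar>) [1, - 1]) bs))"

text \<open>The constants here and in the check for six points are limited by an averaging on six
  points with three prescribed ones, which multiplies them by 3/2. The values 4, 6, 10, 8 for the
  classes 3 to 6 become 6, 9, 15, 12, and \<open>mu i 6 3\<close> is 6, 12, 15, 18.\<close>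

lemma check_two_points_5: "list_all (check_two_points 5 5 [(3, 4), (4, 6)]) (content_seqs 5)"
  by code_simp

lemma check_two_points_6: "list_all (check_two_points 1 6 [(5, 10), (6, 8)]) (content_seqs 6)"
  by code_simp

lemma check_7_7: "list_all check_7 (content_seqs 7)"
  by code_simp

section \<open>Class sums on joint eigenvectors\<close>

lemma takeWhile_rev_upt:
  assumes "p < q" "f p = c" "\<And>r. p < r \<Longrightarrow> r < q \<Longrightarrow> f r \<noteq> c"
  shows "takeWhile (\<lambda>y. y \<noteq> c) (map f (rev [0..<q])) = map f (rev [Suc p..<q])"
proof -
  have "[0..<q] = [0..<p] @ [p..<q]"
    using assms(1) by (metis le0 less_imp_le_nat upt_add_eq_append le_add_diff_inverse)
  also have "[p..<q] = p # [Suc p..<q]" using assms(1) by (rule upt_conv_Cons)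
  finally have "map f (rev [0..<q]) = map f (rev [Suc p..<q]) @ f p # map f (rev [0..<p])" by simp
  moreover have "\<forall>y\<in>set (map f (rev [Suc p..<q])). y \<noteq> c" using assms(3) by auto
  ultimately show ?thesis using assms(2) by (simp add: takeWhile_append)
qed

lemma sm_Tc_insert:
  assumes "finite B" "x \<notin> B"
  shows "sm (Tc i (insert x B) {}) f \<sigma> = sm (Tc i B {}) f \<sigma> + sm (Tc i (insert x B) {x}) f \<sigma>"
proof -
  have "finite (insert x B)" using assms by simp
  from sum_Tc_split[OF this, of "\<lambda>\<tau>. f (\<sigma> \<circ> \<tau>)" i "{}" x] show ?thesis
    using assms by (simp add: sm_def insert_Diff_if)
qed

text \<open>The class identities are applied to the function
  \<open>\<tau> \<mapsto> v (\<sigma> \<circ> \<tau>)\<close>. All factors on their left act on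
  \<open>v\<close> by scalars, and solving for the one new class sum gives the formulas of
  \<open>class_vals_step\<close>.\<close>

lemma rooted_eigenvalues:
  fixes v :: "(nat \<Rightarrow> nat) \<Rightarrow> real"
  assumes fin: "finite B" and x: "x \<notin> B"
    and E: "\<And>\<sigma>. sm (Tc 1 (insert x B) {x}) v \<sigma> = X * v \<sigma>"
    and C1: "\<And>\<sigma>. sm (Tc 1 B {}) v \<sigma> = c1 * v \<sigma>"
    and C2: "\<And>\<sigma>. sm (Tc 2 B {}) v \<sigma> = c2 * v \<sigma>"
    and b: "b = real (card B)" and z3: "z3 = X * X - b" and z4: "z4 = X * z3 - 2 * c1 - (b - 1) * X"
  shows "sm (Tc 2 (insert x B) {x}) v \<sigma> = z3 * v \<sigma>"
    "sm (Tc 3 (insert x B) {x}) v \<sigma> = (X * c1 - z3) * v \<sigma>"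
    "sm (Tc 4 (insert x B) {x}) v \<sigma> = z4 * v \<sigma>"
    "sm (Tc 5 (insert x B) {x}) v \<sigma> = (X * c2 + c1 * z3 - 3 * z4 - (b - 1) * X) * v \<sigma>"
    "sm (Tc 6 (insert x B) {x}) v \<sigma> = (X * z4 - 3 * c2 - 2 * (X * c1 - z3) - (b - 2) * z3) * v \<sigma>"
proof -
  let ?g = "\<lambda>\<sigma> \<tau>. v (\<sigma> \<circ> \<tau>)"
  have X: "(\<Sum>b\<in>B. v (\<rho> \<circ> transpose x b)) = X * v \<rho>" for \<rho>
    using E[of \<rho>] sum_root_1[OF x, of "\<lambda>\<tau>. v (\<rho> \<circ> \<tau>)"] by (simp add: sm_def)
  have c1: "(\<Sum>\<tau>\<in>Tc 1 B {}. v (\<rho> \<circ> \<tau>)) = c1 * v \<rho>" for \<rho> using C1[of \<rho>] by (simp add: sm_def)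
  have c2: "(\<Sum>\<tau>\<in>Tc 2 B {}. v (\<rho> \<circ> \<tau>)) = c2 * v \<rho>" for \<rho> using C2[of \<rho>] by (simp add: sm_def)
  have s2: "sm (Tc 2 (insert x B) {x}) v \<sigma> = z3 * v \<sigma>" for \<sigma>
    using class_id_2[OF fin x, of "?g \<sigma>"] X
    by (simp add: sm_def comp_assoc[symmetric] z3 b algebra_simps flip: sum_distrib_left)
  have z2: "(\<Sum>\<tau>\<in>Tc 2 (insert x B) {x}. v (\<rho> \<circ> \<tau>)) = z3 * v \<rho>" for \<rho>
    using s2[of \<rho>] by (simp add: sm_def)
  have s4: "sm (Tc 4 (insert x B) {x}) v \<sigma> = z4 * v \<sigma>" for \<sigma>
    using class_id_4[OF fin x, of "?g \<sigma>"] X c1 z2 E[of \<sigma>]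
    by (simp add: sm_def comp_assoc[symmetric] z4 b algebra_simps flip: sum_distrib_left)
  have z4': "(\<Sum>\<tau>\<in>Tc 4 (insert x B) {x}. v (\<rho> \<circ> \<tau>)) = z4 * v \<rho>" for \<rho>
    using s4[of \<rho>] by (simp add: sm_def)
  have s3: "sm (Tc 3 (insert x B) {x}) v \<sigma> = (X * c1 - z3) * v \<sigma>" for \<sigma>
    using class_id_3[OF fin x, of "?g \<sigma>"] X c1 z2
    by (simp add: sm_def comp_assoc[symmetric] algebra_simps flip: sum_distrib_left)
  have s5: "sm (Tc 5 (insert x B) {x}) v \<sigma> = (X * c2 + c1 * z3 - 3 * z4 - (b - 1) * X) * v \<sigma>" for \<sigma>
    using class_id_5[OF fin x, of "?g \<sigma>"] X c1 c2 z2 z4' E[of \<sigma>]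
    by (simp add: sm_def comp_assoc[symmetric] b algebra_simps flip: sum_distrib_left)
  have s6: "sm (Tc 6 (insert x B) {x}) v \<sigma> = (X * z4 - 3 * c2 - 2 * (X * c1 - z3) - (b - 2) * z3) * v \<sigma>" for \<sigma>
    using class_id_6[OF fin x, of "?g \<sigma>"] X c2 z2 z4' s3[of \<sigma>]
    by (simp add: sm_def comp_assoc[symmetric] b algebra_simps flip: sum_distrib_left)
  show "sm (Tc 2 (insert x B) {x}) v \<sigma> = z3 * v \<sigma>"
    "sm (Tc 3 (insert x B) {x}) v \<sigma> = (X * c1 - z3) * v \<sigma>"
    "sm (Tc 4 (insert x B) {x}) v \<sigma> = z4 * v \<sigma>"
    "sm (Tc 5 (insert x B) {x}) v \<sigma> = (X * c2 + c1 * z3 - 3 * z4 - (b - 1) * X) * v \<sigma>"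
    "sm (Tc 6 (insert x B) {x}) v \<sigma> = (X * z4 - 3 * c2 - 2 * (X * c1 - z3) - (b - 2) * z3) * v \<sigma>"
    by (rule s2 s3 s4 s5 s6)+
qed

lemma class_vals_step_eigenvalues:
  fixes v :: "(nat \<Rightarrow> nat) \<Rightarrow> real"
  assumes fin: "finite B" and x: "x \<notin> B"
    and E: "\<And>\<sigma>. sm (Tc 1 (insert x B) {x}) v \<sigma> = of_int X * v \<sigma>"
    and C: "\<And>i \<sigma>. i \<in> {1..6} \<Longrightarrow> sm (Tc i B {}) v \<sigma> = of_int (class_val i t) * v \<sigma>"
    and i: "i \<in> {1..6}"
  shows "sm (Tc i (insert x B) {}) v \<sigma> = of_int (class_val i (class_vals_step (int (card B)) X t)) * v \<sigma>"
proof -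
  obtain c1 c2 c3 c4 c5 c6 where t: "t = (c1, c2, c3, c4, c5, c6)" by (metis surj_pair)
  have C1: "sm (Tc 1 B {}) v \<sigma> = of_int c1 * v \<sigma>" for \<sigma> using C[of 1 \<sigma>] by (simp add: t)
  have C2: "sm (Tc 2 B {}) v \<sigma> = of_int c2 * v \<sigma>" for \<sigma> using C[of 2 \<sigma>] by (simp add: t)
  note re = rooted_eigenvalues[OF fin x E C1 C2 refl refl refl, of \<sigma>]
  note ins = sm_Tc_insert[OF fin x, of _ v \<sigma>]
  from i have "i = 1 \<or> i = 2 \<or> i = 3 \<or> i = 4 \<or> i = 5 \<or> i = 6" unfolding in_1_6 .
  then show ?thesis
    by (elim disjE) (simp_all add: ins re E C t Let_def algebra_simps)
qed

context jm
begin

definition contents :: "(nat \<Rightarrow> real) \<Rightarrow> nat \<Rightarrow> int list" where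
  "contents \<alpha> j = map (\<lambda>i. \<lfloor>\<alpha> i\<rfloor>) (rev [0..<j])"

lemma contents_0: "contents \<alpha> 0 = []"
  by (simp add: contents_def)

lemma contents_Suc: "contents \<alpha> (Suc j) = \<lfloor>\<alpha> j\<rfloor> # contents \<alpha> j"
  by (simp add: contents_def)

lemma length_contents: "length (contents \<alpha> j) = j"
  by (simp add: contents_def)

lemma set_contents: "set (contents \<alpha> j) = (\<lambda>i. \<lfloor>\<alpha> i\<rfloor>) ` {..<j}"
  by (auto simp: contents_def)

lemma Spec_int:
  assumes "Spec \<alpha>" "j < a"
  shows "\<alpha> j = of_int \<lfloor>\<alpha> j\<rfloor>"
proof -
  have "\<exists>z::int. \<alpha> j = of_int z"
    using assms(2)
  proof (induction j rule: less_induct)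
    case (less j)
    show ?case
    proof (cases "j = 0")
      case True
      then show ?thesis using Spec_zero[OF assms(1)] less.prems by (intro exI[of _ 0]) auto
    next
      case False
      then obtain p where p: "p < j" "\<bar>\<alpha> p - \<alpha> j\<bar> = 1" using Spec_prev[OF assms(1) less.prems] by auto
      then obtain z :: int where "\<alpha> p = of_int z" using less.IH[of p] less.prems by auto
      then have "\<alpha> j = of_int (z + 1) \<or> \<alpha> j = of_int (z - 1)" using p(2) by auto
      then show ?thesis by blast
    qed
  qed
  then show ?thesis by auto
qed

text \<open>The two conditions of \<open>content_ok\<close> are \<open>Spec_prev\<close> and, for
  the latest earlier occurrence of an entry, \<open>Spec_between\<close>. For upper bounds an
  inclusion of the spectrum in the list is enough.\<close>

lemma Spec_content_seqs:
  assumes S: "Spec \<alpha>"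
  shows "j \<le> a \<Longrightarrow> contents \<alpha> j \<in> set (content_seqs j)"
proof (induction j)
  case 0
  then show ?case by (simp add: contents_0)
next
  case (Suc j)
  have j: "j < a" using Suc.prems by simp
  have int: "\<alpha> i = of_int \<lfloor>\<alpha> i\<rfloor>" if "i \<le> j" for i using Spec_int[OF S, of i] that j by simp
  let ?c = "\<lfloor>\<alpha> j\<rfloor>" and ?l = "contents \<alpha> j"
  have "content_ok ?c ?l \<and> ?c \<in> set (content_candidates ?l)"
  proof (cases "j = 0")
    case True
    then show ?thesis using Spec_zero[OF S] j by (simp add: content_ok_def content_candidates_def contents_0)
  next
    case False
    then have ne: "?l \<noteq> []" using length_contents[of \<alpha> j] by auto
    obtain p where p: "p < j" "\<bar>\<alpha> p - \<alpha> j\<bar> = 1" using Spec_prev[OF S j] False by auto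
    have "\<alpha> p = \<alpha> j + 1 \<or> \<alpha> p = \<alpha> j - 1" using p(2) by auto
    then have "\<lfloor>\<alpha> p\<rfloor> = ?c + 1 \<or> \<lfloor>\<alpha> p\<rfloor> = ?c - 1" using int[of j] by auto
    moreover have pl: "\<lfloor>\<alpha> p\<rfloor> \<in> set ?l" using p(1) by (auto simp: set_contents)
    ultimately have "?c - 1 \<in> set ?l \<or> ?c + 1 \<in> set ?l" by metis
    moreover from this have "?c \<in> set (content_candidates ?l)"
      using ne by (force simp: content_candidates_def image_iff)
    moreover have "?c - 1 \<in> set (takeWhile (\<lambda>y. y \<noteq> ?c) ?l) \<and> ?c + 1 \<in> set (takeWhile (\<lambda>y. y \<noteq> ?c) ?l)"
      if "?c \<in> set ?l"
    proof -
      \<comment> \<open>\<open>takeWhile\<close> stops at the latest earlier occurrence of the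
        entry; this is also the one that \<open>Spec_between\<close> can use, hence the
        maximum.\<close>
      define Q where "Q = {p. p < j \<and> \<lfloor>\<alpha> p\<rfloor> = ?c}"
      have Q: "finite Q" "Q \<noteq> {}" using that by (auto simp: Q_def set_contents)
      define r where "r = Max Q"
      have r: "r < j" "\<lfloor>\<alpha> r\<rfloor> = ?c" using Max_in[OF Q] by (auto simp: r_def Q_def)
      have btw: "\<lfloor>\<alpha> t\<rfloor> \<noteq> ?c" if "r < t" "t < j" for t
      proof
        assume "\<lfloor>\<alpha> t\<rfloor> = ?c"
        then have "t \<in> Q" using that by (simp add: Q_def)
        then have "t \<le> r" unfolding r_def by (rule Max_ge[OF Q(1)])
        then show False using that by simp
      qed
      have tw: "takeWhile (\<lambda>y. y \<noteq> ?c) ?l = map (\<lambda>i. \<lfloor>\<alpha> i\<rfloor>) (rev [Suc r..<j])"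
        unfolding contents_def by (rule takeWhile_rev_upt) (use r btw in auto)
      have ar: "\<alpha> r = \<alpha> j" using int[of r] int[of j] r by simp
      have al: "\<alpha> t \<noteq> \<alpha> j" if "r < t" "t < j" for t using btw[OF that] by auto
      have mem: "?c + e \<in> set (takeWhile (\<lambda>y. y \<noteq> ?c) ?l)" if e: "e = 1 \<or> e = - 1" for e :: int
      proof -
        have "\<exists>t. r < t \<and> t < j \<and> \<alpha> t = \<alpha> j + of_int e"
          by (rule Spec_between[OF S r(1) j ar al]) (use e in auto)
        then obtain t where t: "r < t" "t < j" "\<alpha> t = \<alpha> j + of_int e" by blast
        then have "\<lfloor>\<alpha> t\<rfloor> = ?c + e" by simp
        then show ?thesis unfolding tw using t(1,2) by (auto intro!: image_eqI[of _ _ t])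
      qed
      show ?thesis using mem[of 1] mem[of "- 1"] by simp
    qed
    ultimately show ?thesis using ne by (simp add: content_ok_def)
  qed
  then show ?case using Suc.IH j by (auto simp: contents_Suc)
qed

definition C :: "nat \<Rightarrow> nat \<Rightarrow> ((nat \<Rightarrow> nat) \<Rightarrow> real) \<Rightarrow> (nat \<Rightarrow> nat) \<Rightarrow> real" where
  "C i j = sm (Tc i (x ` {..<j}) {})"

lemma x_Suc: "j < a \<Longrightarrow> x ` {..<Suc j} = insert (x j) (x ` {..<j}) \<and> x j \<notin> x ` {..<j} \<and>
    x ` {..j} = insert (x j) (x ` {..<j})"
proof -
  assume "j < a"
  then have "x j \<notin> x ` {..<j}" using x_eq by auto
  moreover have "{..<Suc j} = insert j {..<j}" "{..j} = insert j {..<j}" by auto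
  ultimately show ?thesis by simp
qed

lemma card_x: "j \<le> a \<Longrightarrow> card (x ` {..<j}) = j"
  using inj by (subst card_image) (auto intro: inj_on_subset)

lemma C_Suc: "j < a \<Longrightarrow> C i (Suc j) f \<sigma> = C i j f \<sigma> + sm (Tc i (x ` {..<Suc j}) {x j}) f \<sigma>"
  unfolding C_def using x_Suc[of j] sm_Tc_insert[of "x ` {..<j}" "x j" i f \<sigma>] by auto

lemma C1_Suc: "j < a \<Longrightarrow> C 1 (Suc j) f \<sigma> = C 1 j f \<sigma> + J j f \<sigma>"
  using C_Suc[where i = 1] x_Suc[of j] by (simp add: J_def)

text \<open>Up to additive constants the sum of 3-cycles is therefore the second power sum of the
  Jucys--Murphy elements. Through \<open>C2_Suc\<close> this supplies the quadratic relation for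
  \<open>J n\<close> in the case of two distinguished points.\<close>

lemma J_J:
  assumes "j < a"
  shows "J j (J j f) \<sigma> = sm (Tc 2 (x ` {..<Suc j}) {x j}) f \<sigma> + real j * f \<sigma>"
proof -
  have nin: "x j \<notin> x ` {..<j}" and eq: "x ` {..j} = insert (x j) (x ` {..<j})"
    "x ` {..<Suc j} = insert (x j) (x ` {..<j})" using x_Suc[OF assms] by auto
  have Jf: "J j h \<rho> = (\<Sum>b\<in>x ` {..<j}. h (\<rho> \<circ> transpose (x j) b))" for h \<rho>
    unfolding J_def eq sm_def by (rule sum_root_1[OF nin])
  show ?thesis
    using class_id_2[OF _ nin, where g = "\<lambda>\<tau>. f (\<sigma> \<circ> \<tau>)"] card_x[of j] assms
    unfolding Jf eq by (simp add: sm_def comp_assoc[symmetric])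
qed

lemma C2_Suc: "j < a \<Longrightarrow> C 2 (Suc j) f \<sigma> = C 2 j f \<sigma> + J j (J j f) \<sigma> - real j * f \<sigma>"
  using C_Suc[of j 2 f \<sigma>] J_J[of j f \<sigma>] by simp

lemma class_values:
  assumes "eigs v \<alpha> b" "b \<le> a" "\<And>j. j < b \<Longrightarrow> \<alpha> j = of_int \<lfloor>\<alpha> j\<rfloor>" "i \<in> {1..6}"
  shows "C i b v \<sigma> = of_int (class_val i (class_vals (contents \<alpha> b))) * v \<sigma>"
  using assms
proof (induction b arbitrary: i \<sigma>)
  case 0
  have "Tc i {} {} = {}"
    using card_supp_cls[of _ i] by (force simp: Tc_def msz_def split: if_splits)
  then show ?case by (simp add: C_def sm_def contents_0)
next
  case (Suc b)
  have b: "b < a" using Suc.prems by simp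
  have "eigs v \<alpha> b" using Suc.prems(1) by (simp add: eigs_def)
  then have IH: "sm (Tc i (x ` {..<b}) {}) v \<sigma> = of_int (class_val i (class_vals (contents \<alpha> b))) * v \<sigma>"
    if "i \<in> {1..6}" for i \<sigma> using Suc.IH that Suc.prems(2,3) by (simp add: C_def)
  have E: "sm (Tc 1 (insert (x b) (x ` {..<b})) {x b}) v \<sigma> = of_int \<lfloor>\<alpha> b\<rfloor> * v \<sigma>" for \<sigma>
  proof -
    have "J b v \<sigma> = \<alpha> b * v \<sigma>" using Suc.prems(1) by (simp add: eigs_def)
    also have "\<alpha> b = of_int \<lfloor>\<alpha> b\<rfloor>" by (rule Suc.prems(3)) simp
    finally show ?thesis using x_Suc[OF b] by (simp add: J_def)
  qed
  have fin: "finite (x ` {..<b})" and nin: "x b \<notin> x ` {..<b}" using x_Suc[OF b] by auto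
  have "sm (Tc i (insert (x b) (x ` {..<b})) {}) v \<sigma> =
      of_int (class_val i (class_vals_step (int (card (x ` {..<b}))) \<lfloor>\<alpha> b\<rfloor> (class_vals (contents \<alpha> b)))) * v \<sigma>"
    by (rule class_vals_step_eigenvalues[OF fin nin E IH Suc.prems(4)])
  then show ?case using x_Suc[OF b] card_x[of b] b by (simp add: C_def contents_Suc length_contents)
qed

section \<open>From joint eigenvectors to operator bounds\<close>

lemma C_selfadj: "j \<le> a \<Longrightarrow> selfadj (C i j)"
  unfolding C_def using xN by (intro selfadj_Tc) auto

lemma C_U: "j \<le> a \<Longrightarrow> f \<in> U \<Longrightarrow> C i j f \<in> U"
  unfolding C_def by (rule Tc_in_U[OF U]) auto

lemma Tc_image: "t \<in> Tc i B K \<Longrightarrow> B \<subseteq> A \<Longrightarrow> bij t \<and> t ` A = A"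
  using Tc_permutes[of t i B K] permutes_subset[of t B A] permutes_image permutes_bij by blast

lemma C_comm: "C i j (C i' j' f) = C i' j' (C i j f)"
proof -
  have *: "C i j (C i' j' f) = C i' j' (C i j f)" if "j' \<le> j" for i j i' j'
  proof -
    have "x ` {..<j'} \<subseteq> x ` {..<j}" using that by auto
    then show ?thesis unfolding C_def by (intro sm_Tc_comm) (use Tc_image in auto)
  qed
  then show ?thesis by (metis nat_le_linear)
qed

lemma Tc_C_comm:
  assumes "j \<le> a" "\<And>t. t permutes x ` {..<j} \<Longrightarrow> t ` K = K"
  shows "sm (Tc i' (x ` {..<a}) K) (C i j f) = C i j (sm (Tc i' (x ` {..<a}) K) f)"
proof -
  have "x ` {..<j} \<subseteq> x ` {..<a}" using assms(1) by auto
  then show ?thesis unfolding C_def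
  proof (intro sm_Tc_comm)
    fix t assume sub: "x ` {..<j} \<subseteq> x ` {..<a}" and t: "t \<in> Tc i (x ` {..<j}) {}"
    show "bij t \<and> t ` x ` {..<a} = x ` {..<a} \<and> t ` K = K"
      using Tc_image[OF t sub] assms(2)[OF Tc_permutes[OF t]] by simp
  qed
qed

lemma Tc_Ca_comm: "sm (Tc i' (x ` {..<a}) K) (C i a f) = C i a (sm (Tc i' (x ` {..<a}) K) f)"
  unfolding C_def by (intro sm_Tc_comm[symmetric]) (use Tc_image[OF _ subset_refl] in auto)

lemma Tca_selfadj: "selfadj (sm (Tc i (x ` {..<a}) K))"
  by (rule selfadj_Tc[OF xN])

lemma Tca_U: "f \<in> U \<Longrightarrow> sm (Tc i (x ` {..<a}) K) f \<in> U"
  by (rule Tc_in_U[OF U]) auto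

lemma eigs_of_C1:
  assumes "\<And>j. j \<le> b \<Longrightarrow> C 1 j v = (\<lambda>\<sigma>. c j * v \<sigma>)" "b \<le> a"
  shows "eigs v (\<lambda>j. c (Suc j) - c j) b"
proof -
  have "J j v \<sigma> = (c (Suc j) - c j) * v \<sigma>" if "j < b" for j \<sigma>
    using C1_Suc[of j v \<sigma>] assms(1)[of j] assms(1)[of "Suc j"] that assms(2) by (simp add: algebra_simps)
  then show ?thesis by (auto simp: eigs_def)
qed

text \<open>The condition on \<open>K\<close> makes the operator commute with the transposition sums
  of the chain. Their differences are the Jucys--Murphy elements, so \<open>quadratic_bound\<close>
  leaves only eigenvectors that have a content sequence.\<close>

lemma bound_via_contents:
  assumes K: "\<And>j t. j < a \<Longrightarrow> t permutes x ` {..<j} \<Longrightarrow> t ` K = K"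
    and bd: "\<And>\<alpha> v l. Spec \<alpha> \<Longrightarrow> v \<in> U \<Longrightarrow> v \<noteq> (\<lambda>\<sigma>. 0) \<Longrightarrow> eigs v \<alpha> a \<Longrightarrow>
       sm (Tc i (x ` {..<a}) K) v = (\<lambda>\<sigma>. l * v \<sigma>) \<Longrightarrow> l \<le> b"
    and f: "f \<in> U"
  shows "ip (sm (Tc i (x ` {..<a}) K) f) f \<le> b * ip f f"
proof (rule quadratic_bound[OF subU Tca_selfadj Tca_U, where As = "map (C 1) [0..<Suc a]"])
  let ?T = "sm (Tc i (x ` {..<a}) K)"
  show "selfadj B" if "B \<in> set (map (C 1) [0..<Suc a])" for B using that C_selfadj by auto
  show "B f \<in> U" if "B \<in> set (map (C 1) [0..<Suc a])" "f \<in> U" for B f using that C_U by auto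
  have TC: "?T (C 1 j f) = C 1 j (?T f)" if "j \<le> a" for j f
  proof (cases "j = a")
    case True
    then show ?thesis using Tc_Ca_comm by simp
  next
    case False
    then have "j < a" using that by simp
    then show ?thesis by (intro Tc_C_comm K) auto
  qed
  show "B (D f) = D (B f)" if "B \<in> set (?T # map (C 1) [0..<Suc a])" "D \<in> set (?T # map (C 1) [0..<Suc a])"
    for B D f using that TC C_comm by (auto simp: less_Suc_eq_le)
  show "l \<le> b" if v: "v \<in> U" "v \<noteq> (\<lambda>x. 0)" "?T v = (\<lambda>x. l * v x)"
    "\<forall>B\<in>set (map (C 1) [0..<Suc a]). \<exists>c. B v = (\<lambda>x. c * v x)" for v l
  proof -
    have "C 1 j \<in> set (map (C 1) [0..<Suc a])" if "j \<le> a" for j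
      unfolding set_map by (rule imageI) (use that in auto)
    then have "\<forall>j. \<exists>c. j \<le> a \<longrightarrow> C 1 j v = (\<lambda>x. c * v x)" using v(4) by blast
    then obtain c where c: "\<And>j. j \<le> a \<Longrightarrow> C 1 j v = (\<lambda>x. c j * v x)" by metis
    have e: "eigs v (\<lambda>j. c (Suc j) - c j) a" by (rule eigs_of_C1[OF c]) auto
    then have "Spec (\<lambda>j. c (Suc j) - c j)" using v by (auto simp: Spec_def)
    then show "l \<le> b" using bd e v by blast
  qed
qed (use f in auto)

lemma bound_0:
  assumes i: "i \<in> {1..6}" and h: "\<And>\<alpha>. Spec \<alpha> \<Longrightarrow> of_int (class_val i (class_vals (contents \<alpha> a))) \<le> b" and f: "f \<in> U"
  shows "ip (sm (Tc i (x ` {..<a}) {}) f) f \<le> b * ip f f"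
proof (rule bound_via_contents[OF _ _ f])
  fix \<alpha> v l assume S: "Spec \<alpha>" and v: "v \<in> U" "v \<noteq> (\<lambda>\<sigma>. 0)" "eigs v \<alpha> a"
    and l: "sm (Tc i (x ` {..<a}) {}) v = (\<lambda>\<sigma>. l * v \<sigma>)"
  obtain \<sigma> where "v \<sigma> \<noteq> 0" using v(2) by auto
  moreover have "C i a v \<sigma> = of_int (class_val i (class_vals (contents \<alpha> a))) * v \<sigma>"
    by (rule class_values[OF v(3)]) (use Spec_int[OF S] i in auto)
  ultimately have "l = of_int (class_val i (class_vals (contents \<alpha> a)))" using l by (simp add: C_def)
  then show "l \<le> b" using h[OF S] by simp
qed simp

text \<open>Moving the last point of the chain is complementary to fixing it, so the operator is a
  difference of two class sums of the chain.\<close>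

lemma bound_1:
  assumes i: "i \<in> {1..6}" and n: "a = Suc n"
    and h: "\<And>\<alpha>. Spec \<alpha> \<Longrightarrow> of_int (class_val i (class_vals (contents \<alpha> a))) - of_int (class_val i (class_vals (contents \<alpha> n))) \<le> b"
    and f: "f \<in> U"
  shows "ip (sm (Tc i (x ` {..<a}) {x n}) f) f \<le> b * ip f f"
proof (rule bound_via_contents[OF _ _ f])
  fix j t assume "j < a" and t: "t permutes x ` {..<j}"
  then have "x n \<notin> x ` {..<j}" using n x_eq by auto
  then show "t ` {x n} = {x n}" using t by (simp add: permutes_def)
next
  fix \<alpha> v l assume S: "Spec \<alpha>" and v: "v \<in> U" "v \<noteq> (\<lambda>\<sigma>. 0)" "eigs v \<alpha> a"
    and l: "sm (Tc i (x ` {..<a}) {x n}) v = (\<lambda>\<sigma>. l * v \<sigma>)"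
  obtain \<sigma> where s: "v \<sigma> \<noteq> 0" using v(2) by auto
  have "C i a v \<sigma> = of_int (class_val i (class_vals (contents \<alpha> a))) * v \<sigma>"
    by (rule class_values[OF v(3)]) (use Spec_int[OF S] i in auto)
  moreover have "C i n v \<sigma> = of_int (class_val i (class_vals (contents \<alpha> n))) * v \<sigma>"
    by (rule class_values) (use Spec_int[OF S] i v(3) n in \<open>auto simp: eigs_def\<close>)
  ultimately have "(l - (of_int (class_val i (class_vals (contents \<alpha> a))) - of_int (class_val i (class_vals (contents \<alpha> n))))) * v \<sigma> = 0"
    using fun_cong[OF l, of \<sigma>] C_Suc[of n i v \<sigma>] n by (simp add: algebra_simps)
  then have "l = of_int (class_val i (class_vals (contents \<alpha> a))) - of_int (class_val i (class_vals (contents \<alpha> n)))" using s by simp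
  then show "l \<le> b" using h[OF S] by simp
qed

end

context jm
begin

text \<open>
  Inside the joint eigenspace \<open>H\<close> the operator \<open>J n\<close> satisfies a quadratic equation with roots \<open>p\<close> and
  \<open>q\<close>. Writing \<open>v\<close> as a combination of its eigenvectors \<open>g1\<close> and \<open>g2\<close> gives the quadratic form of
  \<open>C i (Suc n)\<close> at \<open>v\<close>. Only one of the two orders of \<open>p\<close> and \<open>q\<close> need belong to the spectrum.
\<close>

lemma H2_eigenvector:
  assumes a: "a = Suc (Suc n)" and i: "i \<in> {1..6}" and v: "v \<in> U" "v \<noteq> (\<lambda>\<sigma>. 0)"
    and cv: "\<And>j. j \<le> n \<Longrightarrow> C 1 j v = (\<lambda>\<sigma>. c j * v \<sigma>)"
    and Av: "C 1 a v = (\<lambda>\<sigma>. cA * v \<sigma>)" and Bv: "C 2 a v = (\<lambda>\<sigma>. cB * v \<sigma>)"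
    and Iv: "C i a v = (\<lambda>\<sigma>. cI * v \<sigma>)"
    and sv: "sw n v = (\<lambda>\<sigma>. e * v \<sigma>)" and e: "e = 1 \<or> e = - 1"
  shows "\<exists>\<alpha>. Spec \<alpha> \<and> \<alpha> n - \<alpha> (Suc n) \<noteq> e \<and> cI = of_int (class_val i (class_vals (contents \<alpha> a))) \<and>
     C i n v = (\<lambda>\<sigma>. of_int (class_val i (class_vals (contents \<alpha> n))) * v \<sigma>) \<and>
     2 * ip (C i (Suc n) v) v * (\<alpha> n - \<alpha> (Suc n)) =
       (of_int (class_val i (class_vals (\<lfloor>\<alpha> n\<rfloor> # contents \<alpha> n))) * (\<alpha> n - \<alpha> (Suc n) - e) +
        of_int (class_val i (class_vals (\<lfloor>\<alpha> (Suc n)\<rfloor> # contents \<alpha> n))) * (\<alpha> n - \<alpha> (Suc n) + e)) * ip v v"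
proof -
  have na: "n < a" "Suc n < a" "n \<le> a" "Suc n \<le> a" "a \<le> a" using a by auto
  \<comment> \<open>Besides the chain up to \<open>n\<close>, the sums of transpositions and of
    3-cycles on all points are fixed. They determine the sum and the sum of squares of
    \<open>J n\<close> and \<open>J (Suc n)\<close>, hence a quadratic equation for
    \<open>J n\<close> on \<open>H\<close>, although \<open>v\<close> need not be an eigenvector of
    \<open>J n\<close>.\<close>
  define H where "H = (\<Inter>j\<in>{..n}. {f \<in> U. C 1 j f = (\<lambda>\<sigma>. c j * f \<sigma>)}) \<inter> {f \<in> U. C 1 a f = (\<lambda>\<sigma>. cA * f \<sigma>)}
     \<inter> {f \<in> U. C 2 a f = (\<lambda>\<sigma>. cB * f \<sigma>)} \<inter> {f \<in> U. C i a f = (\<lambda>\<sigma>. cI * f \<sigma>)}"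
  have H: "f \<in> H \<longleftrightarrow> f \<in> U \<and> (\<forall>j\<le>n. C 1 j f = (\<lambda>\<sigma>. c j * f \<sigma>)) \<and> C 1 a f = (\<lambda>\<sigma>. cA * f \<sigma>) \<and>
     C 2 a f = (\<lambda>\<sigma>. cB * f \<sigma>) \<and> C i a f = (\<lambda>\<sigma>. cI * f \<sigma>)" for f
    by (auto simp: H_def)
  have subH: "subsp H"
    unfolding H_def
    by (intro subsp_Int subsp_Inter subsp_eigenspace subU C_selfadj; auto intro!: subsp_eigenspace subU C_selfadj simp: a)
  have vH: "v \<in> H" using H v cv Av Bv Iv by auto
  have vV: "v \<in> V" using v U_V by auto
  have EH: "C 1 (Suc n) f \<in> H" if f: "f \<in> H" for f
  proof -
    have sc: "C i' j (C 1 (Suc n) f) = (\<lambda>\<sigma>. k * C 1 (Suc n) f \<sigma>)" if "C i' j f = (\<lambda>\<sigma>. k * f \<sigma>)" for i' j k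
    proof -
      have "C i' j (C 1 (Suc n) f) = C 1 (Suc n) (C i' j f)" by (rule C_comm)
      also have "\<dots> = (\<lambda>\<sigma>. k * C 1 (Suc n) f \<sigma>)" unfolding that unfolding C_def by (rule sm_scale)
      finally show ?thesis .
    qed
    show ?thesis unfolding H
      using f[unfolded H] C_U[OF na(4), of f 1] by (auto intro!: sc)
  qed
  \<comment> \<open>One eigenvector of \<open>J n\<close> in \<open>H\<close> provides the root
    \<open>p\<close>; the other root is what remains of the fixed sum.\<close>
  obtain g l where g: "g \<in> H" "g \<noteq> (\<lambda>\<sigma>. 0)" "C 1 (Suc n) g = (\<lambda>\<sigma>. l * g \<sigma>)"
    by (rule max_eigenvector[OF subH C_selfadj[OF na(4)] EH vH v(2)])
  define p where "p = l - c n"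
  define q where "q = cA - c n - p"
  have Xf: "J n f = (\<lambda>\<sigma>. 1 * C 1 (Suc n) f \<sigma> + (- c n) * f \<sigma>)" if "f \<in> H" for f
    using C1_Suc[OF na(1), of f] that[unfolded H] by (auto simp: fun_eq_iff)
  have XH: "J n f \<in> H" if "f \<in> H" for f
    unfolding Xf[OF that] by (rule subsp_comb[OF subH EH[OF that] that])
  have X'f: "J (Suc n) f \<sigma> = (p + q) * f \<sigma> - J n f \<sigma>" if "f \<in> H" for f \<sigma>
    using C1_Suc[OF na(2), of f \<sigma>] fun_cong[OF Xf[OF that], of \<sigma>] that[unfolded H] a
    by (simp add: q_def algebra_simps)
  have Xg: "J n g = (\<lambda>\<sigma>. p * g \<sigma>)" using Xf[OF g(1)] g(3) by (simp add: p_def algebra_simps)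
  define al where "al = (\<lambda>p q j. if j < n then c (Suc j) - c j else if j = n then p else q)"
  have eigH: "eigs f (al p' q') n" if "f \<in> H" for f p' q'
  proof -
    have "eigs f (\<lambda>j. c (Suc j) - c j) n" by (rule eigs_of_C1) (use that[unfolded H] na in auto)
    then show ?thesis by (simp add: eigs_def al_def)
  qed
  have eigHa: "eigs f (al p' q') a" if f: "f \<in> H" and Xp: "J n f = (\<lambda>\<sigma>. p' * f \<sigma>)" and s: "p' + q' = p + q" for f p' q'
  proof -
    have "J (Suc n) f = (\<lambda>\<sigma>. q' * f \<sigma>)"
    proof
      fix \<sigma>
      have "J (Suc n) f \<sigma> = (p' + q') * f \<sigma> - p' * f \<sigma>" using X'f[OF f, of \<sigma>] Xp s by simp
      then show "J (Suc n) f \<sigma> = q' * f \<sigma>" by (simp add: algebra_simps)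
    qed
    then have "J j f = (\<lambda>\<sigma>. al p' q' j * f \<sigma>)" if "j < a" for j
      using that eigH[OF f, of p' q'] Xp a by (auto simp: eigs_def al_def less_Suc_eq)
    then show ?thesis by (simp add: eigs_def)
  qed
  have S0: "Spec (al p q)" using eigHa[OF g(1) Xg refl] g H by (auto simp: Spec_def)
  have intp: "p = of_int \<lfloor>p\<rfloor>" using Spec_int[OF S0 na(1)] by (simp add: al_def)
  have intq: "q = of_int \<lfloor>q\<rfloor>" using Spec_int[OF S0 na(2)] by (simp add: al_def)
  have pq: "p \<noteq> q" using Spec_adjacent(1)[OF S0 na(2)] by (simp add: al_def)
  have intal: "al p' q' j = of_int \<lfloor>al p' q' j\<rfloor>" if "j < n" for p' q' j
    using Spec_int[OF S0, of j] that na by (simp add: al_def)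
  have clal: "contents (al p' q') n = contents (al p q) n" for p' q'
    by (auto simp: contents_def al_def)
  define F where "F = (\<lambda>t::real. real_of_int (class_val i (class_vals (\<lfloor>t\<rfloor> # contents (al p q) n))))"
  have Cn: "C i' n f \<sigma> = of_int (class_val i' (class_vals (contents (al p q) n))) * f \<sigma>" if "f \<in> H" "i' \<in> {1..6}" for f i' \<sigma>
    by (rule class_values[OF eigH[OF that(1)] na(3) intal that(2)])
  have CF: "C i (Suc n) f \<sigma> = F p' * f \<sigma>"
    if f: "f \<in> H" and Xp: "J n f = (\<lambda>\<sigma>. p' * f \<sigma>)" and ip: "p' = of_int \<lfloor>p'\<rfloor>" for f p' \<sigma>
  proof -
    have eg: "eigs f (al p' q) (Suc n)" using eigH[OF f, of p' q] Xp by (auto simp: eigs_def less_Suc_eq al_def)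
    have "al p' q j = of_int \<lfloor>al p' q j\<rfloor>" if "j < Suc n" for j
      using intal[of j p' q] ip that by (cases "j = n") (auto simp: al_def)
    then have "C i (Suc n) f \<sigma> = of_int (class_val i (class_vals (contents (al p' q) (Suc n)))) * f \<sigma>"
      by (rule class_values[OF eg na(4) _ i])
    moreover have "al p' q n = p'" by (simp add: al_def)
    ultimately show ?thesis unfolding F_def contents_Suc clal[of p' q] by simp
  qed
  obtain k where XX: "\<And>f \<sigma>. f \<in> H \<Longrightarrow> 2 * J n (J n f) \<sigma> = k * f \<sigma> + 2 * (p + q) * J n f \<sigma>"
  proof -
    have "2 * J n (J n f) \<sigma> = (cB - of_int (class_val 2 (class_vals (contents (al p q) n))) + real n + real (Suc n) - (p + q)\<^sup>2) * f \<sigma>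
        + 2 * (p + q) * J n f \<sigma>" if f: "f \<in> H" for f \<sigma>
    proof -
      have X2: "J (Suc n) (J (Suc n) f) \<sigma> = (p + q) * ((p + q) * f \<sigma> - J n f \<sigma>) - ((p + q) * J n f \<sigma> - J n (J n f) \<sigma>)"
      proof -
        have eq: "J (Suc n) f = (\<lambda>\<sigma>. (p + q) * f \<sigma> + (- 1) * J n f \<sigma>)" using X'f[OF f] by auto
        have "J (Suc n) (\<lambda>\<sigma>. (p + q) * f \<sigma> + (- 1) * J n f \<sigma>) \<sigma> =
            (p + q) * J (Suc n) f \<sigma> + (- 1) * J (Suc n) (J n f) \<sigma>"
          unfolding J_def by (simp only: sm_comb)
        then have "J (Suc n) (J (Suc n) f) \<sigma> = (p + q) * J (Suc n) f \<sigma> + (- 1) * J (Suc n) (J n f) \<sigma>"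
          using fun_cong[OF arg_cong[OF eq, of "J (Suc n)"], of \<sigma>] by simp
        then show ?thesis using X'f[OF f, of \<sigma>] X'f[OF XH[OF f], of \<sigma>] by simp
      qed
      have "cB * f \<sigma> = C 2 (Suc n) f \<sigma> + J (Suc n) (J (Suc n) f) \<sigma> - real (Suc n) * f \<sigma>"
        using C2_Suc[OF na(2), of f \<sigma>] f[unfolded H] a by simp
      also have "C 2 (Suc n) f \<sigma> = C 2 n f \<sigma> + J n (J n f) \<sigma> - real n * f \<sigma>"
        by (rule C2_Suc[OF na(1)])
      also have "C 2 n f \<sigma> = of_int (class_val 2 (class_vals (contents (al p q) n))) * f \<sigma>" by (rule Cn[OF f]) simp
      finally show ?thesis unfolding X2 by (simp add: algebra_simps power2_eq_square)
    qed
    then show thesis using that by blast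
  qed
  \<comment> \<open>Evaluation at \<open>g\<close> identifies the constant term of the quadratic
    relation.\<close>
  have "k = - 2 * p * q"
  proof -
    obtain \<sigma> where s: "g \<sigma> \<noteq> 0" using g(2) by auto
    have "J n (J n g) \<sigma> = p * (p * g \<sigma>)" unfolding Xg J_def using Xg by (simp add: sm_scale J_def)
    then have "2 * (p * (p * g \<sigma>)) = k * g \<sigma> + 2 * (p + q) * (p * g \<sigma>)" using XX[OF g(1), of \<sigma>] Xg by simp
    then have "(k + 2 * p * q) * g \<sigma> = 0" by (simp add: algebra_simps)
    then show ?thesis using s by simp
  qed
  then have "2 * J n (J n f) \<sigma> = 2 * ((p + q) * J n f \<sigma> - p * q * f \<sigma>)" if "f \<in> H" for f \<sigma>
    using XX[OF that, of \<sigma>] by (simp add: algebra_simps)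
  then have XX: "J n (J n f) \<sigma> = (p + q) * J n f \<sigma> - p * q * f \<sigma>" if "f \<in> H" for f \<sigma>
    using that by (metis mult_left_cancel zero_neq_numeral)
  define g1 where "g1 = (\<lambda>\<sigma>. 1 * J n v \<sigma> + (- q) * v \<sigma>)"
  define g2 where "g2 = (\<lambda>\<sigma>. 1 * J n v \<sigma> + (- p) * v \<sigma>)"
  have gH: "g1 \<in> H" "g2 \<in> H" unfolding g1_def g2_def by (intro subsp_comb[OF subH] XH vH)+
  have Xg1: "J n g1 = (\<lambda>\<sigma>. p * g1 \<sigma>)"
  proof
    fix \<sigma>
    have "J n g1 \<sigma> = 1 * J n (J n v) \<sigma> + (- q) * J n v \<sigma>" unfolding g1_def J_def by (simp only: sm_comb)
    then show "J n g1 \<sigma> = p * g1 \<sigma>" using XX[OF vH, of \<sigma>] by (simp add: g1_def algebra_simps)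
  qed
  have Xg2: "J n g2 = (\<lambda>\<sigma>. q * g2 \<sigma>)"
  proof
    fix \<sigma>
    have "J n g2 \<sigma> = 1 * J n (J n v) \<sigma> + (- p) * J n v \<sigma>" unfolding g2_def J_def by (simp only: sm_comb)
    then show "J n g2 \<sigma> = q * g2 \<sigma>" using XX[OF vH, of \<sigma>] by (simp add: g2_def algebra_simps)
  qed
  have XV: "J n v \<in> V" using XH[OF vH] U_V H by auto
  \<comment> \<open>The relation \<open>J (Suc n) = s (J n) s + s\<close> is paired with
    \<open>v\<close>, on which \<open>s\<close> is the scalar \<open>e\<close>. Together with the
    fixed sum of the two operators it determines \<open>ip (J n v) v\<close>.\<close>
  have Xv: "2 * ip (J n v) v = (p + q - e) * ip v v"
  proof -
    have sa: "selfadj (sw n)" by (rule selfadj_act_transpose) (use xN a in auto)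
    have lin: "sw n (\<lambda>\<sigma>. e * h \<sigma>) = (\<lambda>\<sigma>. e * sw n h \<sigma>)" for h by (simp add: act_def)
    have "J (Suc n) v = (\<lambda>\<sigma>. e * sw n (J n v) \<sigma> + e * v \<sigma>)"
    proof
      fix \<sigma>
      have "J n (sw n v) = (\<lambda>\<sigma>. e * J n v \<sigma>)" unfolding sv J_def by (rule sm_scale)
      then show "J (Suc n) v \<sigma> = e * sw n (J n v) \<sigma> + e * v \<sigma>"
        using J_Suc[OF na(2), of v \<sigma>] fun_cong[OF sv, of \<sigma>] by (simp add: lin)
    qed
    then have "ip (J (Suc n) v) v = e * ip (sw n (J n v)) v + e * ip v v" by (simp only: ip_left)
    also have "ip (sw n (J n v)) v = ip (J n v) (sw n v)" by (rule selfadj_ip[OF sa XV vV])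
    also have "\<dots> = e * ip (J n v) v" unfolding sv by (rule ip_scale)
    also have "e * (e * ip (J n v) v) = ip (J n v) v" using e by auto
    finally have "ip (J (Suc n) v) v = ip (J n v) v + e * ip v v" .
    moreover have "ip (J (Suc n) v) v = (p + q) * ip v v + (- 1) * ip (J n v) v"
    proof -
      have "J (Suc n) v = (\<lambda>\<sigma>. (p + q) * v \<sigma> + (- 1) * J n v \<sigma>)" using X'f[OF vH] by auto
      then show ?thesis by (simp only: ip_left)
    qed
    ultimately show ?thesis by (simp add: algebra_simps)
  qed
  have ip1: "2 * ip g1 v = (p - q - e) * ip v v"
    unfolding g1_def ip_left using Xv by (simp add: algebra_simps)
  have ip2: "2 * ip g2 v = (q - p - e) * ip v v"
    unfolding g2_def ip_left using Xv by (simp add: algebra_simps)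
  have main: "2 * ip (C i (Suc n) v) v * (p - q) = (F p * (p - q - e) + F q * (p - q + e)) * ip v v"
  proof -
    have Cg1: "C i (Suc n) g1 = (\<lambda>\<sigma>. F p * g1 \<sigma>)" using CF[OF gH(1) Xg1 intp] by auto
    have Cg2: "C i (Suc n) g2 = (\<lambda>\<sigma>. F q * g2 \<sigma>)" using CF[OF gH(2) Xg2 intq] by auto
    have "(\<lambda>\<sigma>. (p - q) * v \<sigma>) = (\<lambda>\<sigma>. 1 * g1 \<sigma> + (- 1) * g2 \<sigma>)"
      by (simp add: g1_def g2_def algebra_simps)
    then have "C i (Suc n) (\<lambda>\<sigma>. (p - q) * v \<sigma>) = (\<lambda>\<sigma>. 1 * C i (Suc n) g1 \<sigma> + (- 1) * C i (Suc n) g2 \<sigma>)"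
      unfolding C_def by (simp only: sm_comb)
    then have "(\<lambda>\<sigma>. (p - q) * C i (Suc n) v \<sigma>) = (\<lambda>\<sigma>. F p * g1 \<sigma> + (- F q) * g2 \<sigma>)"
      unfolding Cg1 Cg2 unfolding C_def sm_scale by simp
    then have "(p - q) * ip (C i (Suc n) v) v = F p * ip g1 v + (- F q) * ip g2 v"
      by (metis ip_left ip_scale(1))
    then have "2 * ip (C i (Suc n) v) v * (p - q) = F p * (2 * ip g1 v) - F q * (2 * ip g2 v)"
      by (simp add: algebra_simps)
    then show ?thesis unfolding ip1 ip2 by (simp add: algebra_simps)
  qed
  have vv: "ip v v > 0" using ip_pos[OF vV v(2)] .
  have Ca: "cI = of_int (class_val i (class_vals (contents (al p' q') a)))"
    if h: "h \<in> H" "h \<noteq> (\<lambda>\<sigma>. 0)" "eigs h (al p' q') a" "Spec (al p' q')" for h p' q'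
  proof -
    obtain \<sigma> where s: "h \<sigma> \<noteq> 0" using h(2) by auto
    have "C i a h \<sigma> = of_int (class_val i (class_vals (contents (al p' q') a))) * h \<sigma>"
      by (rule class_values[OF h(3) na(5) _ i]) (rule Spec_int[OF h(4)])
    then show ?thesis using h(1)[unfolded H] s by simp
  qed
  have Cnv: "C i n v = (\<lambda>\<sigma>. of_int (class_val i (class_vals (contents (al p' q') n))) * v \<sigma>)" for p' q'
    unfolding clal[of p' q'] using Cn[OF vH i] by auto
  show ?thesis
  proof (cases "p - q = e")
    case False
    have "Spec (al p q) \<and> al p q n = p \<and> al p q (Suc n) = q" using S0 by (simp add: al_def)
    moreover have "cI = of_int (class_val i (class_vals (contents (al p q) a)))"
      by (rule Ca[OF g(1,2) eigHa[OF g(1) Xg refl] S0])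
    ultimately show ?thesis using False Cnv[of p q] main unfolding F_def
      by (intro exI[of _ "al p q"]) simp
  next
    case True
    \<comment> \<open>For \<open>p - q = e\<close> the inner product of \<open>g2\<close> with
      \<open>v\<close> is \<open>- e\<close> times \<open>ip v v\<close>. Hence the exchanged order
      of the roots is realised by an eigenvector.\<close>
    have "g2 \<noteq> (\<lambda>\<sigma>. 0)"
    proof
      assume "g2 = (\<lambda>\<sigma>. 0)"
      then have "ip g2 v = 0" by (simp add: ip_def)
      then show False using ip2 True vv e by auto
    qed
    moreover have eg: "eigs g2 (al q p) a" by (rule eigHa[OF gH(2) Xg2]) simp
    ultimately have S1: "Spec (al q p)" using gH H by (auto simp: Spec_def)
    have cI: "cI = of_int (class_val i (class_vals (contents (al q p) a)))"
      by (rule Ca[OF gH(2) \<open>g2 \<noteq> (\<lambda>\<sigma>. 0)\<close> eg S1])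
    have "2 * ip (C i (Suc n) v) v * (q - p) = (F q * (q - p - e) + F p * (q - p + e)) * ip v v"
      using main by (simp add: algebra_simps)
    moreover have "al q p n = q \<and> al q p (Suc n) = p" by (simp add: al_def)
    moreover have "q - p \<noteq> e" using True e by auto
    ultimately show ?thesis using S1 cI Cnv[of q p] unfolding F_def clal[of q p, symmetric]
      by (intro exI[of _ "al q p"]) simp
  qed
qed

text \<open>At a joint eigenvector with \<open>sw n v = e v\<close> the operator
  \<open>C i (Suc n)\<close> and its conjugate have the same quadratic form, which
  \<open>H2_eigenvector\<close> evaluates. Pairing with \<open>v\<close> suffices, since
  \<open>v\<close> is an eigenvector of the whole combination.\<close>

lemma bound_H2:
  assumes a: "a = Suc (Suc n)" and i: "i \<in> {1..6}"
    and K: "K \<subseteq> x ` {..<a}" "\<And>j t. j \<le> n \<Longrightarrow> t permutes x ` {..<j} \<Longrightarrow> t ` K = K"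
      "transpose (x n) (x (Suc n)) ` K = K"
    and T: "\<And>f \<sigma>. sm (Tc i (x ` {..<a}) K) f \<sigma> = k1 * C i a f \<sigma> + k2 * C i n f \<sigma> +
        k3 * (C i (Suc n) f \<sigma> + sw n (C i (Suc n) (sw n f)) \<sigma>)"
    and h: "\<And>\<alpha> e. Spec \<alpha> \<Longrightarrow> e = 1 \<or> e = - 1 \<Longrightarrow> \<alpha> n - \<alpha> (Suc n) \<noteq> e \<Longrightarrow>
        k1 * of_int (class_val i (class_vals (contents \<alpha> a))) + k2 * of_int (class_val i (class_vals (contents \<alpha> n))) +
        k3 * ((of_int (class_val i (class_vals (\<lfloor>\<alpha> n\<rfloor> # contents \<alpha> n))) * (\<alpha> n - \<alpha> (Suc n) - e) +
        of_int (class_val i (class_vals (\<lfloor>\<alpha> (Suc n)\<rfloor> # contents \<alpha> n))) * (\<alpha> n - \<alpha> (Suc n) + e)) / (\<alpha> n - \<alpha> (Suc n))) \<le> b"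
    and f: "f \<in> U"
  shows "ip (sm (Tc i (x ` {..<a}) K) f) f \<le> b * ip f f"
proof (rule quadratic_bound[OF subU Tca_selfadj Tca_U, where As = "map (C 1) [0..<Suc n] @ [C 1 a, C 2 a, C i a, sw n]"])
  let ?T = "sm (Tc i (x ` {..<a}) K)" and ?As = "map (C 1) [0..<Suc n] @ [C 1 a, C 2 a, C i a, sw n]"
  have na: "n < a" "Suc n < a" using a by auto
  have sasw: "selfadj (sw n)" by (rule selfadj_act_transpose) (use xN a in auto)
  have inAs: "B \<in> set ?As \<longleftrightarrow> (\<exists>j\<le>n. B = C 1 j) \<or> B = C 1 a \<or> B = C 2 a \<or> B = C i a \<or> B = sw n" for B
  proof -
    have "set (map (C 1) [0..<Suc n]) = C 1 ` {..n}"
      by (simp only: set_map set_upt atLeast0LessThan lessThan_Suc_atMost)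
    then show ?thesis unfolding set_append by auto
  qed
  show "selfadj B" if "B \<in> set ?As" for B using that sasw a unfolding inAs by (auto intro!: C_selfadj)
  show "B f \<in> U" if "B \<in> set ?As" "f \<in> U" for B f using that a unfolding inAs
    by (auto intro!: C_U act_U)
  have TC: "?T (C 1 j f) = C 1 j (?T f)" if "j \<le> n" for j f
    by (rule Tc_C_comm) (use that a K(2) in auto)
  have swj: "C 1 j (sw n f) = sw n (C 1 j f)" if "j \<le> n" for j f
    unfolding C_def
  proof (rule act_Tc_comm)
    have "x n \<notin> x ` {..<j}" "x (Suc n) \<notin> x ` {..<j}" using that a x_eq by auto
    then show "transpose (x n) (x (Suc n)) ` x ` {..<j} = x ` {..<j}" by (simp add: transpose_image_eq)
  qed auto
  have swa: "C i' a (sw n f) = sw n (C i' a f)" for i' f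
    unfolding C_def by (rule act_Tc_comm) (use a in \<open>auto simp: transpose_image_eq\<close>)
  have Tsw: "?T (sw n f) = sw n (?T f)" for f
    by (rule act_Tc_comm) (use a K(3) in \<open>auto simp: transpose_image_eq\<close>)
  have Ta: "?T (C i' a f) = C i' a (?T f)" for i' f by (rule Tc_Ca_comm)
  have cs: "P B" if "B \<in> set ?As" "\<And>j. j \<le> n \<Longrightarrow> P (C 1 j)" "\<And>i'. P (C i' a)" "P (sw n)" for P B
    using that(1) unfolding inAs
  proof (elim disjE exE conjE)
    show "P B" if "j \<le> n" "B = C 1 j" for j unfolding that(2) by (rule \<open>\<And>j. j \<le> n \<Longrightarrow> P (C 1 j)\<close>[OF that(1)])
  qed (simp_all only: that(3,4))
  have TA: "?T (D f) = D (?T f)" if "D \<in> set ?As" for D f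
    by (rule cs[OF that]; rule TC Ta Tsw)
  have CA: "C i' j (D f) = D (C i' j f)" if "D \<in> set ?As" "\<And>f. C i' j (sw n f) = sw n (C i' j f)" for D f i' j
    by (rule cs[OF that(1)]; rule C_comm that(2))
  have SA: "sw n (D f) = D (sw n f)" if "D \<in> set ?As" for D f
    by (rule cs[OF that]; rule swj[symmetric] swa[symmetric] refl)
  have AA: "B (D f) = D (B f)" if B: "B \<in> set ?As" and D: "D \<in> set ?As" for B D f
    by (rule cs[OF B]; rule CA[OF D] SA[OF D]; rule swj swa)
  show "B (D f) = D (B f)" if B: "B \<in> set (?T # ?As)" and D: "D \<in> set (?T # ?As)" for B D f
  proof -
    have "B = ?T \<or> B \<in> set ?As" "D = ?T \<or> D \<in> set ?As" using B D unfolding list.set(2) insert_iff by this+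
    then show ?thesis
    proof (elim disjE)
      assume "B = ?T" "D = ?T" then show ?thesis by (simp only:)
    next
      assume "B = ?T" "D \<in> set ?As" then show ?thesis using TA[of D f] by (simp only:)
    next
      assume "B \<in> set ?As" "D = ?T" then show ?thesis using TA[of B f] by (simp only:)
    next
      assume "B \<in> set ?As" "D \<in> set ?As" then show ?thesis by (rule AA)
    qed
  qed
  show "l \<le> b" if v: "v \<in> U" "v \<noteq> (\<lambda>x. 0)" "?T v = (\<lambda>x. l * v x)"
    "\<forall>B\<in>set ?As. \<exists>c. B v = (\<lambda>x. c * v x)" for v l
  proof -
    have vV: "v \<in> V" using v U_V by auto
    have vv: "ip v v > 0" using ip_pos[OF vV v(2)] .
    have ex: "\<exists>c. B v = (\<lambda>x. c * v x)" if "B \<in> set ?As" for B using bspec[OF v(4) that] .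
    have "C 1 j \<in> set ?As" if "j \<le> n" for j using that unfolding inAs by blast
    then have "\<forall>j. \<exists>c. j \<le> n \<longrightarrow> C 1 j v = (\<lambda>x. c * v x)" using ex by blast
    from choice[OF this] obtain c where c: "\<And>j. j \<le> n \<Longrightarrow> C 1 j v = (\<lambda>x. c j * v x)" by blast
    have "C 1 a \<in> set ?As" "C 2 a \<in> set ?As" "C i a \<in> set ?As" "sw n \<in> set ?As" by simp_all
    from this[THEN ex] obtain cA cB cI e where ev: "C 1 a v = (\<lambda>x. cA * v x)" "C 2 a v = (\<lambda>x. cB * v x)"
      "C i a v = (\<lambda>x. cI * v x)" "sw n v = (\<lambda>x. e * v x)" by (elim exE)
    have "v \<sigma> = e * (e * v \<sigma>)" for \<sigma>
    proof -
      have "sw n (sw n v) = (\<lambda>x. e * (e * v x))" unfolding ev(4) using ev(4) by (simp add: act_def fun_eq_iff)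
      then have "sw n (sw n v) \<sigma> = e * (e * v \<sigma>)" by (rule fun_cong)
      then show ?thesis unfolding act_transpose_invol .
    qed
    moreover obtain \<sigma> where "v \<sigma> \<noteq> 0" using v(2) by auto
    ultimately have "v \<sigma> * 1 = v \<sigma> * (e * e)" by (simp only: mult.commute mult.left_commute mult_1)
    then have "e * e = 1" using \<open>v \<sigma> \<noteq> 0\<close> by auto
    then have e: "e = 1 \<or> e = - 1" by (simp add: square_eq_1_iff)
    obtain \<alpha> where al: "Spec \<alpha>" "\<alpha> n - \<alpha> (Suc n) \<noteq> e" "cI = of_int (class_val i (class_vals (contents \<alpha> a)))"
      "C i n v = (\<lambda>\<sigma>. of_int (class_val i (class_vals (contents \<alpha> n))) * v \<sigma>)"
      and q: "2 * ip (C i (Suc n) v) v * (\<alpha> n - \<alpha> (Suc n)) =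
       (of_int (class_val i (class_vals (\<lfloor>\<alpha> n\<rfloor> # contents \<alpha> n))) * (\<alpha> n - \<alpha> (Suc n) - e) +
        of_int (class_val i (class_vals (\<lfloor>\<alpha> (Suc n)\<rfloor> # contents \<alpha> n))) * (\<alpha> n - \<alpha> (Suc n) + e)) * ip v v"
      using H2_eigenvector[OF a i v(1,2) c ev(1-4) e] by blast
    have d: "\<alpha> n - \<alpha> (Suc n) \<noteq> 0" using Spec_adjacent(1)[OF al(1) na(2)] by simp
    let ?Y = "C i (Suc n)"
    have YV: "?Y v \<in> V" using C_U[of "Suc n" v i] U_V v a by auto
    have Ysw: "?Y (sw n v) = (\<lambda>\<sigma>. e * ?Y v \<sigma>)" unfolding ev(4) C_def by (rule sm_scale)
    have "sw n (?Y (sw n v)) = (\<lambda>\<sigma>. e * sw n (?Y v) \<sigma>)" unfolding Ysw by (simp add: act_def)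
    then have "ip (sw n (?Y (sw n v))) v = e * ip (sw n (?Y v)) v" by (simp only: ip_scale)
    also have "ip (sw n (?Y v)) v = ip (?Y v) (sw n v)" by (rule selfadj_ip[OF sasw YV vV])
    also have "\<dots> = e * ip (?Y v) v" unfolding ev(4) by (rule ip_scale)
    finally have sYs: "ip (sw n (?Y (sw n v))) v = ip (?Y v) v" using e by auto
    have "l * ip v v = ip (?T v) v" unfolding v(3) by (simp add: ip_scale)
    also have "?T v = (\<lambda>\<sigma>. 1 * (k1 * C i a v \<sigma> + k2 * C i n v \<sigma>) + k3 * (1 * ?Y v \<sigma> + 1 * sw n (?Y (sw n v)) \<sigma>))"
      using T[of v] by auto
    also have "ip \<dots> v = k1 * (cI * ip v v) + k2 * (of_int (class_val i (class_vals (contents \<alpha> n))) * ip v v) + k3 * (2 * ip (?Y v) v)"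
      unfolding ip_left ev(3) al(4) ip_scale sYs by simp
    also have "2 * ip (?Y v) v = ((of_int (class_val i (class_vals (\<lfloor>\<alpha> n\<rfloor> # contents \<alpha> n))) * (\<alpha> n - \<alpha> (Suc n) - e) +
        of_int (class_val i (class_vals (\<lfloor>\<alpha> (Suc n)\<rfloor> # contents \<alpha> n))) * (\<alpha> n - \<alpha> (Suc n) + e)) / (\<alpha> n - \<alpha> (Suc n))) * ip v v"
      using q d by (simp add: nonzero_eq_divide_eq)
    finally have "l * ip v v = (k1 * of_int (class_val i (class_vals (contents \<alpha> a))) + k2 * of_int (class_val i (class_vals (contents \<alpha> n))) +
        k3 * ((of_int (class_val i (class_vals (\<lfloor>\<alpha> n\<rfloor> # contents \<alpha> n))) * (\<alpha> n - \<alpha> (Suc n) - e) +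
        of_int (class_val i (class_vals (\<lfloor>\<alpha> (Suc n)\<rfloor> # contents \<alpha> n))) * (\<alpha> n - \<alpha> (Suc n) + e)) / (\<alpha> n - \<alpha> (Suc n)))) * ip v v"
      unfolding al(3) by (simp only: distrib_right mult.assoc)
    then have "l = k1 * of_int (class_val i (class_vals (contents \<alpha> a))) + k2 * of_int (class_val i (class_vals (contents \<alpha> n))) +
        k3 * ((of_int (class_val i (class_vals (\<lfloor>\<alpha> n\<rfloor> # contents \<alpha> n))) * (\<alpha> n - \<alpha> (Suc n) - e) +
        of_int (class_val i (class_vals (\<lfloor>\<alpha> (Suc n)\<rfloor> # contents \<alpha> n))) * (\<alpha> n - \<alpha> (Suc n) + e)) / (\<alpha> n - \<alpha> (Suc n)))"
      using vv by simp
    then show "l \<le> b" using h[OF al(1) e al(2)] by simp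
  qed
qed (use f in auto)

text \<open>The entry at \<open>p\<close> differs from its successor by \<open>p + 1 >= 2\<close>,
  so it can be exchanged to later positions. Once it is last, or absent, the entries before it are
  0, 1, 2, ... up to a common sign, and \<open>extreme_not_Gen\<close> contradicts the assumption on
  \<open>U\<close>.\<close>

lemma pattern_excluded:
  assumes "1 \<le> p" "p \<le> a" "p = a \<Longrightarrow> U \<subseteq> Gen (x ` {..<a})" "p < a \<Longrightarrow> U \<subseteq> Gen (x ` {..<a - 1})"
    and "Spec \<alpha>"
    and "\<And>j. j < a \<Longrightarrow> \<alpha> j = (if e then - 1 else 1) * (if j < p then real j else if j = p then - 1 else real j - 1)"
  shows False
  using assms
proof (induction "a - p" arbitrary: p \<alpha> rule: less_induct)
  case less
  let ?e = "if e then - 1 else (1::real)"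
  have *: False if b: "b \<le> p" "U \<subseteq> Gen (x ` {..<b})" for b
  proof -
    obtain v where v: "v \<in> U" "v \<noteq> (\<lambda>\<sigma>. 0)" "eigs v \<alpha> a" using less.prems(5) by (auto simp: Spec_def)
    have "eigs v (\<lambda>j. ?e * real j) b"
      using v(3) less.prems(2,6) b(1) by (auto simp: eigs_def)
    then have "v \<notin> Gen (x ` {..<b})" using b(1) less.prems(2) by (intro extreme_not_Gen[OF v(1,2)]) auto
    then show False using v(1) b(2) by auto
  qed
  consider "p = a" | "p < a" "p = a - 1" | "Suc p < a" using less.prems by linarith
  then show False
  proof cases
    case 1
    then show ?thesis using *[of a] less.prems(3) by simp
  next
    case 2
    then show ?thesis using *[of "a - 1"] less.prems(4) by simp
  next
    case 3
    have "\<alpha> p = - ?e" "\<alpha> (Suc p) = ?e * real p" using less.prems(6)[of p] less.prems(6)[of "Suc p"] 3 by auto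
    then have "\<bar>\<alpha> (Suc p) - \<alpha> p\<bar> = real p + 1" by auto
    then have "\<bar>\<alpha> (Suc p) - \<alpha> p\<bar> \<noteq> 1" using less.prems(1) by simp
    then have S: "Spec (\<alpha> \<circ> transpose p (Suc p))" using Spec_adjacent(2)[OF less.prems(5) 3] by simp
    show False
    proof (rule less.hyps[OF _ _ _ _ _ S])
      fix j assume j: "j < a"
      consider "j = p" | "j = Suc p" | "j \<noteq> p" "j \<noteq> Suc p" by blast
      then show "(\<alpha> \<circ> transpose p (Suc p)) j =
          ?e * (if j < Suc p then real j else if j = Suc p then - 1 else real j - 1)"
      proof cases
        case 1
        then show ?thesis using less.prems(6)[of "Suc p"] 3 by simp
      next
        case 2
        then show ?thesis using less.prems(6)[of p] 3 by simp
      next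
        case 3
        then show ?thesis using less.prems(6)[OF j] by auto
      qed
    qed (use 3 less.prems in auto)
  qed
qed

lemma not_is_excluded:
  assumes S: "Spec \<alpha>" and p: "1 \<le> p" and UG: "U \<subseteq> Gen (x ` {..<a})"
    and UW: "p < a \<Longrightarrow> U \<subseteq> Gen (x ` {..<a - 1})"
  shows "\<not> is_excluded p (contents \<alpha> a)"
proof
  assume "is_excluded p (contents \<alpha> a)"
  then obtain q where q0: "q \<in> set [p..<Suc a]" "contents \<alpha> a = hook_contents 1 q a \<or> contents \<alpha> a = hook_contents (- 1) q a"
    unfolding is_excluded_def Let_def list_ex_iff length_contents by blast
  then obtain E :: int where E: "E = 1 \<or> E = - 1" "contents \<alpha> a = hook_contents E q a" by blast
  have q: "p \<le> q" "q \<le> a" "E = 1 \<or> E = - 1" "contents \<alpha> a = hook_contents E q a"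
    using q0(1) E by (simp_all only: set_upt atLeastLessThan_iff less_Suc_eq_le)
  have "map (\<lambda>i. \<lfloor>\<alpha> i\<rfloor>) [0..<a] = map (\<lambda>j. E * (if j < q then int j else if j = q then - 1 else int j - 1)) [0..<a]"
    using q(4) unfolding contents_def hook_contents_def rev_map[symmetric] by (simp only: rev_is_rev_conv)
  then have fl: "\<lfloor>\<alpha> j\<rfloor> = E * (if j < q then int j else if j = q then - 1 else int j - 1)" if "j < a" for j
    using that by (auto simp: map_eq_conv)
  show False
  proof (rule pattern_excluded[of q \<alpha> "E = - 1"])
    fix j assume j: "j < a"
    have "\<alpha> j = of_int \<lfloor>\<alpha> j\<rfloor>" by (rule Spec_int[OF S j])
    also have "\<dots> = (if E = - 1 then - 1 else 1) * (if j < q then real j else if j = q then - 1 else real j - 1)"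
      unfolding fl[OF j] using q(3) by auto
    finally show "\<alpha> j = (if E = - 1 then - 1 else 1) * (if j < q then real j else if j = q then - 1 else real j - 1)" .
  qed (use q p S UG UW in auto)
qed

end

section \<open>Transfer of the finite checks to operators on 5, 6 and 7 points\<close>

lemma div_bound_int:
  fixes D e G M :: int
  assumes "D \<noteq> 0" "e * sgn D * G \<le> M * \<bar>D\<bar>"
  shows "real_of_int (e * G) / real_of_int D \<le> real_of_int M"
proof (cases "D > 0")
  case True
  then have "e * G \<le> M * D" using assms(2) by simp
  then have "real_of_int (e * G) \<le> real_of_int (M * D)" by (simp only: of_int_le_iff)
  then show ?thesis using True by (simp add: divide_le_eq)
next
  case False
  then have D: "D < 0" using assms(1) by simp
  then have "M * D \<le> e * G" using assms(2) by simp
  then have "real_of_int (M * D) \<le> real_of_int (e * G)" by (simp only: of_int_le_iff)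
  then show ?thesis using D by (simp add: divide_le_eq)
qed

lemma act_conj_Tc:
  assumes "p \<noteq> q"
  shows "act (transpose p q) (sm (Tc i B K) (act (transpose p q) f)) =
    sm (Tc i (transpose p q ` B) (transpose p q ` K)) f"
proof
  fix \<sigma>
  let ?t = "transpose p q"
  have t: "pinv ?t = ?t" by simp
  have inj: "inj_on (\<lambda>\<tau>. ?t \<circ> \<tau> \<circ> ?t) (Tc i B K)"
    by (rule inj_on_inverseI[of _ "\<lambda>\<tau>. ?t \<circ> \<tau> \<circ> ?t"]) (simp add: fun_eq_iff)
  have "sm (Tc i (?t ` B) (?t ` K)) f \<sigma> = (\<Sum>\<tau>\<in>(\<lambda>\<tau>. ?t \<circ> \<tau> \<circ> ?t) ` Tc i B K. f (\<sigma> \<circ> \<tau>))"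
    using conj_Tc[of ?t i B K] by (simp add: sm_def)
  also have "\<dots> = (\<Sum>\<tau>\<in>Tc i B K. f (\<sigma> \<circ> (?t \<circ> \<tau> \<circ> ?t)))"
    by (subst sum.reindex[OF inj]) simp
  finally show "act ?t (sm (Tc i B K) (act ?t f)) \<sigma> = sm (Tc i (?t ` B) (?t ` K)) f \<sigma>"
    by (simp add: act_apply sm_apply comp_assoc)
qed

lemma transpose_image_Diff:
  assumes "p \<in> A" "q \<in> A"
  shows "transpose p q ` (A - {q}) = A - {p}"
proof -
  have "inj (transpose p q)" by (rule inj_on_inverseI[of _ "transpose p q"]) simp
  then show ?thesis using assms by (subst image_set_diff) (auto simp: transpose_image_eq)
qed

lemma sm_Tc_split:
  assumes "finite A"
  shows "sm (Tc i A K) f \<sigma> = sm (Tc i (A - {y}) K) f \<sigma> + sm (Tc i A (insert y K)) f \<sigma>"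
  unfolding sm_def by (rule sum_Tc_split[OF assms])

text \<open>Applied to \<open>K\<close> when few points are prescribed and to \<open>A - K\<close>
  when all but two are, so that the distinguished points always come last in the chain.\<close>

lemma enumeration_with_tail:
  fixes A K :: "nat set"
  assumes "finite A" "K \<subseteq> A"
  shows "\<exists>x. inj_on x {..<card A} \<and> x ` {..<card A} = A \<and> x ` {card A - card K..<card A} = K \<and>
     x ` {..<card A - card K} = A - K"
proof -
  define m where "m = card A - card K"
  have fK: "finite K" using assms finite_subset by auto
  have cA: "card (A - K) = m" "card A = m + card K"
    using assms fK card_mono[OF assms] by (auto simp: m_def card_Diff_subset)
  obtain h where h: "bij_betw h {0..<m} (A - K)"
    using ex_bij_betw_nat_finite[of "A - K"] assms cA by auto
  obtain h' where h': "bij_betw h' {0..<card K} K" using ex_bij_betw_nat_finite[OF fK] by auto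
  define x where "x = (\<lambda>j. if j < m then h j else h' (j - m))"
  have b1: "bij_betw x {..<m} (A - K)"
    using h by (subst bij_betw_cong[where g = h]) (auto simp: x_def atLeast0LessThan)
  have b2: "bij_betw x {m..<m + card K} K"
  proof -
    have "bij_betw (\<lambda>j. j - m) {m..<m + card K} {0..<card K}"
      by (rule bij_betw_byWitness[of _ "\<lambda>j. j + m"]) auto
    then have "bij_betw (h' \<circ> (\<lambda>j. j - m)) {m..<m + card K} K" using h' by (rule bij_betw_trans)
    then show ?thesis by (subst bij_betw_cong[where g = "h' \<circ> (\<lambda>j. j - m)"]) (auto simp: x_def)
  qed
  have "bij_betw x ({..<m} \<union> {m..<m + card K}) ((A - K) \<union> K)"
    by (rule bij_betw_combine[OF b1 b2]) auto
  moreover have "{..<m} \<union> {m..<m + card K} = {..<card A}" "(A - K) \<union> K = A"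
    using assms(2) cA(2) by auto
  ultimately have b: "bij_betw x {..<card A} A" by simp
  have m: "card A - card K = m" by (simp add: m_def)
  have "x ` {m..<card A} = K" using bij_betw_imp_surj_on[OF b2] by (simp only: cA(2))
  then show ?thesis
    using bij_betw_imp_inj_on[OF b] bij_betw_imp_surj_on[OF b] bij_betw_imp_surj_on[OF b1]
    unfolding m by blast
qed

context sym_group
begin

lemma jm_Gen:
  assumes "A \<subseteq> N" "inj_on x {..<card A}" "x ` {..<card A} = A"
  shows "jm N (Gen A) x (card A)"
  using assms invU_Gen[OF assms(1)] by unfold_locales auto

lemma jm_W:
  assumes "A \<subseteq> N" "inj_on x {..<card A}" "x ` {..<card A} = A"
  shows "jm N (W A) x (card A)"
  using assms invU_W[OF assms(1)] by unfold_locales auto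

text \<open>These are the numbers \<open>mu i 7 k\<close> for \<open>k = 0, 1, 2\<close> as
  integers, because the finite check computes with integers; \<open>bound_7_value_mu\<close>
  confirms the agreement.\<close>

definition bound_7_value :: "nat \<Rightarrow> nat \<Rightarrow> int" where
  "bound_7_value i k = (if k = 0 then [14, 35, 35, 70, 70, 84] else if k = 1 then [5, 19, 26, 52, 70, 84]
     else [1, 8, 17, 34, 65, 78]) ! (i - 1)"

lemma bound_7:
  assumes A: "A \<subseteq> N" "card A = 7" and K: "K \<subseteq> A" "card K \<le> 2" and i: "i \<in> {1..6}" and f: "f \<in> Gen A"
  shows "ip (sm (Tc i A K) f) f \<le> of_int (bound_7_value i (card K)) * ip f f"
proof -
  have fA: "finite A" using A finN finite_subset by blast
  obtain x where x: "inj_on x {..<card A}" "x ` {..<card A} = A"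
    and xK: "x ` {card A - card K..<card A} = K" "x ` {..<card A - card K} = A - K"
    using enumeration_with_tail[OF fA K(1)] by blast
  interpret jm N "Gen A" x "card A" by (rule jm_Gen[OF A(1) x])
  have chk: "check_7 (contents \<alpha> 7) \<and> \<not> is_excluded 7 (contents \<alpha> 7)" if "Spec \<alpha>" for \<alpha>
  proof -
    have "contents \<alpha> 7 \<in> set (content_seqs 7)" by (rule Spec_content_seqs[OF that]) (simp add: A(2))
    moreover have "\<not> is_excluded 7 (contents \<alpha> (card A))" by (rule not_is_excluded[OF that]) (simp_all add: x(2), simp add: A(2))
    ultimately show ?thesis using bspec[OF check_7_7[unfolded list_all_iff]] unfolding A(2) by blast
  qed
  have facts: "class_val i (class_vals (contents \<alpha> 7)) \<le> bound_7_value i 0 \<and> class_val i (class_vals (contents \<alpha> 7)) - class_val i (class_vals (contents \<alpha> 6)) \<le> bound_7_value i 1 \<and>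
     (\<forall>e\<in>{1, - 1}. \<lfloor>\<alpha> 5\<rfloor> - \<lfloor>\<alpha> 6\<rfloor> = e \<or> e * sgn (\<lfloor>\<alpha> 5\<rfloor> - \<lfloor>\<alpha> 6\<rfloor>) *
        (class_val i (class_vals (\<lfloor>\<alpha> 5\<rfloor> # contents \<alpha> 5)) - class_val i (class_vals (\<lfloor>\<alpha> 6\<rfloor> # contents \<alpha> 5))) \<le>
        (bound_7_value i 2 - class_val i (class_vals (contents \<alpha> 7)) - class_val i (class_vals (contents \<alpha> 5)) + class_val i (class_vals (\<lfloor>\<alpha> 5\<rfloor> # contents \<alpha> 5)) +
         class_val i (class_vals (\<lfloor>\<alpha> 6\<rfloor> # contents \<alpha> 5))) * \<bar>\<lfloor>\<alpha> 5\<rfloor> - \<lfloor>\<alpha> 6\<rfloor>\<bar>)" if S: "Spec \<alpha>" for \<alpha>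
  proof -
    define y z where "y = \<lfloor>\<alpha> 5\<rfloor>" and "z = \<lfloor>\<alpha> 6\<rfloor>"
    have c7: "contents \<alpha> 7 = z # y # contents \<alpha> 5" "contents \<alpha> 6 = y # contents \<alpha> 5"
      using contents_Suc[of \<alpha> 6] contents_Suc[of \<alpha> 5] by (simp_all add: y_def z_def)
    have cs: "class_vals_step 5 y (class_vals (contents \<alpha> 5)) = class_vals (y # contents \<alpha> 5)" "class_vals_step 5 z (class_vals (contents \<alpha> 5)) = class_vals (z # contents \<alpha> 5)"
      "class_vals_step 6 z (class_vals (y # contents \<alpha> 5)) = class_vals (z # y # contents \<alpha> 5)"
      by (simp_all add: length_contents del: class_vals_step.simps)
    have L: "list_all (\<lambda>(i, b0, b1, b2). class_val i (class_vals (contents \<alpha> 7)) \<le> b0 \<and> class_val i (class_vals (contents \<alpha> 7)) - class_val i (class_vals (contents \<alpha> 6)) \<le> b1 \<and>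
         list_all (\<lambda>e. y - z = e \<or> e * sgn (y - z) * (class_val i (class_vals (y # contents \<alpha> 5)) - class_val i (class_vals (z # contents \<alpha> 5)))
             \<le> (b2 - class_val i (class_vals (contents \<alpha> 7)) - class_val i (class_vals (contents \<alpha> 5)) + class_val i (class_vals (y # contents \<alpha> 5)) + class_val i (class_vals (z # contents \<alpha> 5)))
               * \<bar>y - z\<bar>) [1, - 1])
       [(1, 14, 5, 1), (2, 35, 19, 8), (3, 35, 26, 17), (4, 70, 52, 34), (5, 70, 70, 65), (6, 84, 84, 78)]"
      using chk[OF S] unfolding c7 check_7_def Let_def list.sel cs by (elim conjE disjE) (erule (1) notE, assumption)
    have mem: "(i, bound_7_value i 0, bound_7_value i 1, bound_7_value i 2) \<in>
        set [(1, 14, 5, 1), (2, 35, 19, 8), (3, 35, 26, 17), (4, 70, 52, 34), (5, 70, 70, 65), (6, 84, 84, 78)]"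
      using i unfolding in_1_6 by (elim disjE) (simp_all add: bound_7_value_def)
    show ?thesis
      using bspec[OF L[unfolded list_all_iff] mem] unfolding y_def z_def by (simp del: class_vals.simps class_val.simps)
  qed
  have ints: "\<alpha> 5 = of_int \<lfloor>\<alpha> 5\<rfloor>" "\<alpha> 6 = of_int \<lfloor>\<alpha> 6\<rfloor>" if "Spec \<alpha>" for \<alpha>
    using Spec_int[OF that, of 5] Spec_int[OF that, of 6] A(2) by auto
  consider "card K = 0" | "card K = 1" | "card K = 2" using K(2) by linarith
  then show ?thesis
  proof cases
    case 1
    then have "K = {}" using finite_subset[OF K(1) fA] by simp
    then show ?thesis
      using bound_0[OF i _ f, of "of_int (bound_7_value i 0)"] facts x(2) A(2) by simp
  next
    case 2
    have "{card A - card K..<card A} = {6}" using 2 A(2) by auto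
    then have "K = {x 6}" using xK(1) by auto
    then have "ip (sm (Tc i A K) f) f \<le> of_int (bound_7_value i 1) * ip f f"
      using bound_1[OF i _ _ f, of 6 "of_int (bound_7_value i 1)"] facts x(2) A(2) 2 by (simp flip: of_int_diff)
    then show ?thesis by (simp only: 2)
  next
    case 3
    have "{card A - card K..<card A} = {5, 6}" using 3 A(2) by auto
    then have Kx: "K = {x 5, x 6}" using xK(1) by auto
    have x56: "x 5 \<noteq> x 6" using x_eq[of 5 6] A(2) by simp
    have A'': "x ` {..<5} = A - {x 6} - {x 5}" using xK(2) 3 A(2) Kx by auto
    have A': "x ` {..<6} = A - {x 6}"
    proof -
      have "{..<6::nat} = insert 5 {..<5}" by auto
      then show ?thesis using A'' x56 x(2) A(2) by auto
    qed
    have xA: "x 5 \<in> A" "x 6 \<in> A" using Kx K(1) by auto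
    have "ip (sm (Tc i (x ` {..<card A}) K) f) f \<le> of_int (bound_7_value i 2) * ip f f"
    \<comment> \<open>The coefficients come from inclusion-exclusion over the two prescribed points:
      all points, plus the set without both, minus the two sets without one of them.\<close>
    proof (rule bound_H2[of 5 i K 1 1 "- 1"])
      show "card A = Suc (Suc 5)" using A(2) by simp
      show "K \<subseteq> x ` {..<card A}" using K(1) x(2) by simp
      show "t ` K = K" if "j \<le> 5" "t permutes x ` {..<j}" for j t
      proof -
        have "x 5 \<notin> x ` {..<j}" "x 6 \<notin> x ` {..<j}" using that(1) x_eq A(2) by auto
        then show ?thesis using that(2) by (simp add: Kx permutes_def)
      qed
      show "transpose (x 5) (x (Suc 5)) ` K = K" by (simp add: Kx insert_commute)
      fix h \<sigma>
      have tA: "transpose (x 5) (x 6) ` (A - {x 6}) = A - {x 5}"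
        by (rule transpose_image_Diff[OF xA])
      have "sw 5 (C i (Suc 5) (sw 5 h)) = sm (Tc i (A - {x 5}) {}) h"
        unfolding C_def using act_conj_Tc[OF x56, of i "A - {x 6}" "{}" h] A' tA by simp
      moreover have "sm (Tc i A {}) h \<sigma> = sm (Tc i (A - {x 6}) {}) h \<sigma> + sm (Tc i A {x 6}) h \<sigma>"
        by (rule sm_Tc_split[OF fA])
      moreover have "sm (Tc i A {x 6}) h \<sigma> = sm (Tc i (A - {x 5}) {x 6}) h \<sigma> + sm (Tc i A {x 5, x 6}) h \<sigma>"
        by (rule sm_Tc_split[OF fA])
      moreover have "sm (Tc i (A - {x 5}) {}) h \<sigma> = sm (Tc i (A - {x 5} - {x 6}) {}) h \<sigma> + sm (Tc i (A - {x 5}) {x 6}) h \<sigma>"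
        by (rule sm_Tc_split) (use fA in simp)
      moreover have "A - {x 5} - {x 6} = x ` {..<5}" using A'' by auto
      ultimately show "sm (Tc i (x ` {..<card A}) K) h \<sigma> = 1 * C i (card A) h \<sigma> + 1 * C i 5 h \<sigma> +
        - 1 * (C i (Suc 5) h \<sigma> + sw 5 (C i (Suc 5) (sw 5 h)) \<sigma>)"
        unfolding Kx using A' by (simp add: C_def x(2))
    next
      fix \<alpha> and e :: real assume S: "Spec \<alpha>" and e: "e = 1 \<or> e = - 1" and ne: "\<alpha> 5 - \<alpha> (Suc 5) \<noteq> e"
      define y z where "y = \<lfloor>\<alpha> 5\<rfloor>" and "z = \<lfloor>\<alpha> 6\<rfloor>"
      have yz: "\<alpha> 5 = of_int y" "\<alpha> 6 = of_int z" using ints[OF S] by (auto simp: y_def z_def)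
      obtain E :: int where E: "e = of_int E" "E \<in> {1, - 1}" using e by (metis insertCI of_int_1 of_int_minus)
      have D: "y - z \<noteq> 0" using Spec_adjacent(1)[OF S, of 5] A(2) yz by auto
      have D': "real_of_int y - real_of_int z \<noteq> 0" using D by simp
      have nE: "y - z \<noteq> E" using ne yz E(1) by (auto simp flip: of_int_diff)
      define c7 c5 fy fz where "c7 = class_val i (class_vals (contents \<alpha> 7))" and "c5 = class_val i (class_vals (contents \<alpha> 5))"
        and "fy = class_val i (class_vals (y # contents \<alpha> 5))" and "fz = class_val i (class_vals (z # contents \<alpha> 5))"
      have "E * sgn (y - z) * (fy - fz) \<le> (bound_7_value i 2 - c7 - c5 + fy + fz) * \<bar>y - z\<bar>"
        using facts[OF S] E(2) nE unfolding y_def z_def c7_def c5_def fy_def fz_def by blast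
      from div_bound_int[OF D this]
      have "e * (of_int fy - of_int fz) / (of_int y - of_int z) \<le> of_int (bound_7_value i 2) - of_int c7 - of_int c5 + of_int fy + of_int fz"
        by (simp add: E(1))
      moreover have s6: "Suc 5 = (6::nat)" by simp
      moreover have "(of_int fy * (of_int y - of_int z - e) + of_int fz * (of_int y - of_int z + e)) / (of_int y - of_int z) =
         of_int fy + of_int fz - e * (of_int fy - of_int fz) / (of_int y - of_int z :: real)"
        using D' by (simp add: field_simps)
      ultimately show "1 * of_int (class_val i (class_vals (contents \<alpha> (card A)))) + 1 * of_int (class_val i (class_vals (contents \<alpha> 5))) +
        - 1 * ((of_int (class_val i (class_vals (\<lfloor>\<alpha> 5\<rfloor> # contents \<alpha> 5))) * (\<alpha> 5 - \<alpha> (Suc 5) - e) +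
        of_int (class_val i (class_vals (\<lfloor>\<alpha> (Suc 5)\<rfloor> # contents \<alpha> 5))) * (\<alpha> 5 - \<alpha> (Suc 5) + e)) / (\<alpha> 5 - \<alpha> (Suc 5))) \<le> of_int (bound_7_value i 2)"
        unfolding s6 A(2) unfolding y_def[symmetric] z_def[symmetric]
        unfolding c7_def[symmetric] c5_def[symmetric] fy_def[symmetric] fz_def[symmetric] yz by linarith
    qed (use i f in auto)
    then show ?thesis using 3 x(2) by simp
  qed
qed

end

context jm
begin

text \<open>Here \<open>msz i\<close> is one less than the number of points and \<open>K\<close>
  omits two of them. Every element thus fixes exactly one of the last two points, and the operator
  is \<open>C i (Suc n)\<close> plus its conjugate under their transposition.\<close>

lemma bound_two_points:
  assumes a: "a = Suc (Suc n)" and i: "i \<in> {1..6}" and m: "msz i = Suc n"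
    and h: "\<And>\<alpha> E. Spec \<alpha> \<Longrightarrow> E \<in> {1, - 1} \<Longrightarrow> \<lfloor>\<alpha> n\<rfloor> - \<lfloor>\<alpha> (Suc n)\<rfloor> \<noteq> E \<Longrightarrow>
        - E * sgn (\<lfloor>\<alpha> n\<rfloor> - \<lfloor>\<alpha> (Suc n)\<rfloor>) *
        (class_val i (class_vals (\<lfloor>\<alpha> n\<rfloor> # contents \<alpha> n)) - class_val i (class_vals (\<lfloor>\<alpha> (Suc n)\<rfloor> # contents \<alpha> n))) \<le>
        (b - class_val i (class_vals (\<lfloor>\<alpha> n\<rfloor> # contents \<alpha> n)) - class_val i (class_vals (\<lfloor>\<alpha> (Suc n)\<rfloor> # contents \<alpha> n))) *
          \<bar>\<lfloor>\<alpha> n\<rfloor> - \<lfloor>\<alpha> (Suc n)\<rfloor>\<bar>"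
    and f: "f \<in> U"
  shows "ip (sm (Tc i (x ` {..<a}) (x ` {..<n})) f) f \<le> of_int b * ip f f"
proof (rule bound_H2[of n i _ 0 0 1])
  let ?A = "x ` {..<a}" and ?K = "x ` {..<n}"
  have fA: "finite ?A" by simp
  have na: "n < a" "Suc n < a" using a by auto
  have nin: "x n \<notin> ?K" "x (Suc n) \<notin> ?K" "x n \<noteq> x (Suc n)" using a x_eq by auto
  have sets: "{..<a} = insert (Suc n) (insert n {..<n})" "{..<Suc n} = insert n {..<n}" using a by auto
  have Az: "?A - {x (Suc n)} = x ` {..<Suc n}" 
    unfolding sets image_insert insert_Diff_if using nin by (simp only: Diff_insert_absorb insert_iff empty_iff) simp
  have Ay: "?A - {x n} = insert (x (Suc n)) ?K"
    unfolding sets image_insert insert_Diff_if using nin by (simp only: Diff_insert_absorb insert_iff empty_iff) simp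
  have cAz: "card (?A - {x (Suc n)}) = msz i" unfolding Az m using card_x[of "Suc n"] na by simp
  have cA: "card ?A = a" using card_x[of a] by simp
  have cAy: "card (?A - {x n}) = msz i" using cA na m a by (subst card_Diff_singleton) auto
  show "?K \<subseteq> ?A" using a by auto
  show "t ` ?K = ?K" if "j \<le> n" "t permutes x ` {..<j}" for j t
  proof -
    have "x ` {..<j} \<subseteq> ?K" using that(1) by auto
    from permutes_subset[OF that(2) this] show ?thesis by (rule permutes_image)
  qed
  show "transpose (x n) (x (Suc n)) ` ?K = ?K" using nin by (simp add: transpose_image_eq)
  fix h \<sigma>
  have tA: "transpose (x n) (x (Suc n)) ` (?A - {x (Suc n)}) = ?A - {x n}"
    by (rule transpose_image_Diff) (use a in auto)
  have sw: "sw n (C i (Suc n) (sw n h)) = sm (Tc i (?A - {x n}) {}) h"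
    unfolding C_def using act_conj_Tc[OF nin(3), of i "?A - {x (Suc n)}" "{}" h] tA Az by simp
  have "sm (Tc i ?A ?K) h \<sigma> = sm (Tc i (?A - {x (Suc n)}) ?K) h \<sigma> + sm (Tc i ?A (insert (x (Suc n)) ?K)) h \<sigma>"
    by (rule sm_Tc_split[OF fA])
  also have "Tc i (?A - {x (Suc n)}) ?K = Tc i (?A - {x (Suc n)}) {}"
  proof -
    have s: "?K \<subseteq> ?A - {x (Suc n)}" unfolding Az by (rule image_mono) auto
    have f: "finite (?A - {x (Suc n)})" by simp
    show ?thesis by (rule trans[OF Tc_full[OF f cAz s] Tc_full[OF f cAz empty_subsetI, symmetric]])
  qed
  also have "sm (Tc i ?A (insert (x (Suc n)) ?K)) h \<sigma> =
      sm (Tc i (?A - {x n}) (insert (x (Suc n)) ?K)) h \<sigma> + sm (Tc i ?A (insert (x n) (insert (x (Suc n)) ?K))) h \<sigma>"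
    by (rule sm_Tc_split[OF fA])
  also have "Tc i (?A - {x n}) (insert (x (Suc n)) ?K) = Tc i (?A - {x n}) {}"
  proof -
    have s: "insert (x (Suc n)) ?K \<subseteq> ?A - {x n}" unfolding Ay by (rule subset_refl)
    have f: "finite (?A - {x n})" by simp
    show ?thesis by (rule trans[OF Tc_full[OF f cAy s] Tc_full[OF f cAy empty_subsetI, symmetric]])
  qed
  also have "insert (x n) (insert (x (Suc n)) ?K) = ?A" unfolding sets by auto
  also have "Tc i ?A ?A = {}" by (rule Tc_AA_empty) (use cA a m in simp)
  finally show "sm (Tc i ?A ?K) h \<sigma> = 0 * C i a h \<sigma> + 0 * C i n h \<sigma> + 1 * (C i (Suc n) h \<sigma> + sw n (C i (Suc n) (sw n h)) \<sigma>)"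
    unfolding sw by (simp add: C_def Az sm_def)
next
  fix \<alpha> and e :: real assume S: "Spec \<alpha>" and e: "e = 1 \<or> e = - 1" and ne: "\<alpha> n - \<alpha> (Suc n) \<noteq> e"
  define y z where "y = \<lfloor>\<alpha> n\<rfloor>" and "z = \<lfloor>\<alpha> (Suc n)\<rfloor>"
  have yz: "\<alpha> n = of_int y" "\<alpha> (Suc n) = of_int z"
    unfolding y_def z_def by (rule Spec_int[OF S], use a in simp)+
  obtain E :: int where E: "e = of_int E" "E \<in> {1, - 1}" using e by (metis insertCI of_int_1 of_int_minus)
  have D: "y - z \<noteq> 0" using Spec_adjacent(1)[OF S, of n] a yz by auto
  have D': "real_of_int y - real_of_int z \<noteq> 0" using D by simp
  have nE: "y - z \<noteq> E" using ne yz E(1) by (auto simp flip: of_int_diff)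
  define fy fz where "fy = class_val i (class_vals (y # contents \<alpha> n))" and "fz = class_val i (class_vals (z # contents \<alpha> n))"
  have "- E * sgn (y - z) * (fy - fz) \<le> (b - fy - fz) * \<bar>y - z\<bar>"
    using h[OF S E(2)] nE unfolding y_def z_def fy_def fz_def by blast
  from div_bound_int[OF D this]
  have "- e * (of_int fy - of_int fz) / (of_int y - of_int z) \<le> of_int b - of_int fy - of_int fz"
    by (simp add: E(1))
  moreover have "(of_int fy * (of_int y - of_int z - e) + of_int fz * (of_int y - of_int z + e)) / (of_int y - of_int z) =
     of_int fy + of_int fz + (- e * (of_int fy - of_int fz) / (of_int y - of_int z :: real))"
    using D' by (simp add: field_simps)
  ultimately show "0 * of_int (class_val i (class_vals (contents \<alpha> a))) + 0 * of_int (class_val i (class_vals (contents \<alpha> n))) +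
    1 * ((of_int (class_val i (class_vals (\<lfloor>\<alpha> n\<rfloor> # contents \<alpha> n))) * (\<alpha> n - \<alpha> (Suc n) - e) +
    of_int (class_val i (class_vals (\<lfloor>\<alpha> (Suc n)\<rfloor> # contents \<alpha> n))) * (\<alpha> n - \<alpha> (Suc n) + e)) / (\<alpha> n - \<alpha> (Suc n))) \<le> of_int b"
    unfolding y_def[symmetric] z_def[symmetric] unfolding fy_def[symmetric] fz_def[symmetric] yz by linarith
qed (use a i f in auto)

end

context sym_group
begin

lemma bound_5:
  assumes A: "A \<subseteq> N" "card A = 5" and K: "K \<subseteq> A" "card K = 3" and i: "i \<in> {3, 4}" and f: "f \<in> Gen A"
  shows "ip (sm (Tc i A K) f) f \<le> of_int (if i = 3 then 4 else 6) * ip f f"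
proof -
  have fA: "finite A" using A finN finite_subset by blast
  have fK: "finite K" using fA K finite_subset by blast
  have cAK: "card (A - K) = 2" using A K fK by (simp add: card_Diff_subset)
  obtain x where x: "inj_on x {..<card A}" "x ` {..<card A} = A"
    and xK: "x ` {..<card A - card (A - K)} = A - (A - K)"
    using enumeration_with_tail[OF fA Diff_subset[of A K]] by blast
  have Kx: "x ` {..<3} = K" using xK cAK A K by (simp add: double_diff)
  interpret jm N "Gen A" x "card A" by (rule jm_Gen[OF A(1) x])
  let ?b = "if i = 3 then 4 else 6 :: int"
  have "ip (sm (Tc i (x ` {..<card A}) (x ` {..<3})) f) f \<le> of_int ?b * ip f f"
  proof (rule bound_two_points)
    show "card A = Suc (Suc 3)" "i \<in> {1..6}" "msz i = Suc 3" using A i by (auto simp: msz_def)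
    fix \<alpha> and E :: int assume S: "Spec \<alpha>" and E: "E \<in> {1, - 1}" and ne: "\<lfloor>\<alpha> 3\<rfloor> - \<lfloor>\<alpha> (Suc 3)\<rfloor> \<noteq> E"
    have ch: "check_two_points 5 5 [(3, 4), (4, 6)] (contents \<alpha> 5)" "\<not> is_excluded 5 (contents \<alpha> 5)"
    proof -
      have "contents \<alpha> 5 \<in> set (content_seqs 5)" by (rule Spec_content_seqs[OF S]) (simp add: A(2))
      then show "check_two_points 5 5 [(3, 4), (4, 6)] (contents \<alpha> 5)" by (rule bspec[OF check_two_points_5[unfolded list_all_iff]])
      have "\<not> is_excluded 5 (contents \<alpha> (card A))" by (rule not_is_excluded[OF S]) (simp_all add: x(2), simp add: A(2))
      then show "\<not> is_excluded 5 (contents \<alpha> 5)" unfolding A(2) .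
    qed
    define y z where "y = \<lfloor>\<alpha> 3\<rfloor>" and "z = \<lfloor>\<alpha> 4\<rfloor>"
    have c: "contents \<alpha> 5 = z # y # contents \<alpha> 3"
      using contents_Suc[of \<alpha> 4] contents_Suc[of \<alpha> 3] by (simp add: y_def z_def)
    have cs: "class_vals_step (int 5 - 2) y (class_vals (contents \<alpha> 3)) = class_vals (y # contents \<alpha> 3)"
      "class_vals_step (int 5 - 2) z (class_vals (contents \<alpha> 3)) = class_vals (z # contents \<alpha> 3)"
      by (simp_all add: length_contents del: class_vals_step.simps)
    have L: "list_all (\<lambda>(i, b). list_all (\<lambda>e. y - z = e \<or> - e * sgn (y - z) *
          (class_val i (class_vals (y # contents \<alpha> 3)) - class_val i (class_vals (z # contents \<alpha> 3)))
             \<le> (b - class_val i (class_vals (y # contents \<alpha> 3)) - class_val i (class_vals (z # contents \<alpha> 3))) * \<bar>y - z\<bar>) [1, - 1]) [(3, 4), (4, 6)]"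
      using ch unfolding c check_two_points_def Let_def list.sel cs by (elim conjE disjE) (erule (1) notE, assumption)
    have mem: "(i, ?b) \<in> set [(3, 4), (4, 6)]" using i by auto
    have "Suc 3 = 4" by simp
    then show "- E * sgn (\<lfloor>\<alpha> 3\<rfloor> - \<lfloor>\<alpha> (Suc 3)\<rfloor>) *
        (class_val i (class_vals (\<lfloor>\<alpha> 3\<rfloor> # contents \<alpha> 3)) - class_val i (class_vals (\<lfloor>\<alpha> (Suc 3)\<rfloor> # contents \<alpha> 3))) \<le>
        (?b - class_val i (class_vals (\<lfloor>\<alpha> 3\<rfloor> # contents \<alpha> 3)) - class_val i (class_vals (\<lfloor>\<alpha> (Suc 3)\<rfloor> # contents \<alpha> 3))) *
          \<bar>\<lfloor>\<alpha> 3\<rfloor> - \<lfloor>\<alpha> (Suc 3)\<rfloor>\<bar>"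
      using bspec[OF L[unfolded list_all_iff] mem] E ne
      by (simp only: y_def[symmetric] z_def[symmetric] prod.case list_all_iff) auto
  qed (use f in auto)
  then show ?thesis by (simp add: x(2) Kx)
qed

text \<open>Membership in \<open>Gen A\<close> would not suffice: on functions induced from a point
  stabiliser, the difference of the two points outside \<open>K\<close> has the eigenvalue
  \<open>mu i 6 4\<close>, which is 20 or 24 and exceeds the constants 10 and 8.\<close>

lemma bound_6:
  assumes A: "A \<subseteq> N" "card A = 6" and K: "K \<subseteq> A" "card K = 4" and i: "i \<in> {5, 6}" and f: "f \<in> W A"
  shows "ip (sm (Tc i A K) f) f \<le> of_int (if i = 5 then 10 else 8) * ip f f"
proof -
  have fA: "finite A" using A finN finite_subset by blast
  have fK: "finite K" using fA K finite_subset by blast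
  have cAK: "card (A - K) = 2" using A K fK by (simp add: card_Diff_subset)
  obtain x where x: "inj_on x {..<card A}" "x ` {..<card A} = A"
    and xK: "x ` {..<card A - card (A - K)} = A - (A - K)"
    using enumeration_with_tail[OF fA Diff_subset[of A K]] by blast
  have Kx: "x ` {..<4} = K" using xK cAK A K by (simp add: double_diff)
  interpret jm N "W A" x "card A" by (rule jm_W[OF A(1) x])
  have x5: "x ` {..<5} = A - {x 5}"
  proof -
    have "{..<6::nat} = insert 5 {..<5}" by auto
    then have "A = insert (x 5) (x ` {..<5})" using x(2) unfolding A(2) by (simp only: image_insert)
    moreover have "x 5 \<notin> x ` {..<5}" using x_eq A(2) by auto
    ultimately show ?thesis by blast
  qed
  have "x 5 \<in> A" using x(2) A(2) by auto
  then have WG: "W A \<subseteq> Gen (x ` {..<5})" "W A \<subseteq> Gen A" unfolding x5 by (auto simp: W_def)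
  let ?b = "if i = 5 then 10 else 8 :: int"
  have "ip (sm (Tc i (x ` {..<card A}) (x ` {..<4})) f) f \<le> of_int ?b * ip f f"
  proof (rule bound_two_points)
    show "card A = Suc (Suc 4)" "i \<in> {1..6}" "msz i = Suc 4" using A i by (auto simp: msz_def)
    fix \<alpha> and E :: int assume S: "Spec \<alpha>" and E: "E \<in> {1, - 1}" and ne: "\<lfloor>\<alpha> 4\<rfloor> - \<lfloor>\<alpha> (Suc 4)\<rfloor> \<noteq> E"
    have ch: "check_two_points 1 6 [(5, 10), (6, 8)] (contents \<alpha> 6)" "\<not> is_excluded 1 (contents \<alpha> 6)"
    proof -
      have "contents \<alpha> 6 \<in> set (content_seqs 6)" by (rule Spec_content_seqs[OF S]) (simp add: A(2))
      then show "check_two_points 1 6 [(5, 10), (6, 8)] (contents \<alpha> 6)" by (rule bspec[OF check_two_points_6[unfolded list_all_iff]])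
      have "\<not> is_excluded 1 (contents \<alpha> (card A))"
        by (rule not_is_excluded[OF S]) (use WG in \<open>simp_all add: x(2), simp_all add: A(2)\<close>)
      then show "\<not> is_excluded 1 (contents \<alpha> 6)" unfolding A(2) .
    qed
    define y z where "y = \<lfloor>\<alpha> 4\<rfloor>" and "z = \<lfloor>\<alpha> 5\<rfloor>"
    have c: "contents \<alpha> 6 = z # y # contents \<alpha> 4"
      using contents_Suc[of \<alpha> 5] contents_Suc[of \<alpha> 4] by (simp add: y_def z_def)
    have cs: "class_vals_step (int 6 - 2) y (class_vals (contents \<alpha> 4)) = class_vals (y # contents \<alpha> 4)"
      "class_vals_step (int 6 - 2) z (class_vals (contents \<alpha> 4)) = class_vals (z # contents \<alpha> 4)"
      by (simp_all add: length_contents del: class_vals_step.simps)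
    have L: "list_all (\<lambda>(i, b). list_all (\<lambda>e. y - z = e \<or> - e * sgn (y - z) *
          (class_val i (class_vals (y # contents \<alpha> 4)) - class_val i (class_vals (z # contents \<alpha> 4)))
             \<le> (b - class_val i (class_vals (y # contents \<alpha> 4)) - class_val i (class_vals (z # contents \<alpha> 4))) * \<bar>y - z\<bar>) [1, - 1]) [(5, 10), (6, 8)]"
      using ch unfolding c check_two_points_def Let_def list.sel cs by (elim conjE disjE) (erule (1) notE, assumption)
    have mem: "(i, ?b) \<in> set [(5, 10), (6, 8)]" using i by auto
    have "Suc 4 = 5" by simp
    then show "- E * sgn (\<lfloor>\<alpha> 4\<rfloor> - \<lfloor>\<alpha> (Suc 4)\<rfloor>) *
        (class_val i (class_vals (\<lfloor>\<alpha> 4\<rfloor> # contents \<alpha> 4)) - class_val i (class_vals (\<lfloor>\<alpha> (Suc 4)\<rfloor> # contents \<alpha> 4))) \<le>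
        (?b - class_val i (class_vals (\<lfloor>\<alpha> 4\<rfloor> # contents \<alpha> 4)) - class_val i (class_vals (\<lfloor>\<alpha> (Suc 4)\<rfloor> # contents \<alpha> 4))) *
          \<bar>\<lfloor>\<alpha> 4\<rfloor> - \<lfloor>\<alpha> (Suc 4)\<rfloor>\<bar>"
      using bspec[OF L[unfolded list_all_iff] mem] E ne
      by (simp only: y_def[symmetric] z_def[symmetric] prod.case list_all_iff) auto
  qed (use f in auto)
  then show ?thesis by (simp add: x(2) Kx)
qed

end

section \<open>Eigenvectors induced from point stabilisers\<close>

text \<open>
  \<open>move_count i a j\<close> is the number of elements of \<open>Tc i A K\<close> that take \<open>w\<close> to \<open>z \<noteq> w\<close> if
  \<open>j = card (insert w (insert z K))\<close>. On vectors with entries summing to 0, the matrix of these numbers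
  has the eigenvalue \<open>mu i a k\<close> on differences of points outside \<open>K\<close>, one eigenvalue on differences of
  points of \<open>K\<close> and one on the vector that is constant on \<open>K\<close> and on its complement; \<open>quotient_bounded\<close>
  bounds them together with their twists by the sign.
\<close>

definition move_count :: "nat \<Rightarrow> nat \<Rightarrow> nat \<Rightarrow> real" where
  "move_count i a j = real (full_support_card i) * real (subset_card (msz i) a j) / (real (msz i) - 1)"

definition mu :: "nat \<Rightarrow> nat \<Rightarrow> nat \<Rightarrow> real" where
  "mu i a k = real (full_support_card i) * real (subset_card (msz i) (a - 1) k) - move_count i a (k + 2)"

definition quotient_bounded :: "nat \<Rightarrow> nat \<Rightarrow> nat \<Rightarrow> real \<Rightarrow> bool" where
  "quotient_bounded i a k b \<longleftrightarrow> (\<forall>s\<in>{1, real_of_int (eps i)}. s * mu i a k \<le> b \<and> (k \<ge> 2 \<longrightarrow> - s * move_count i a k \<le> b) \<and>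
     (k \<ge> 1 \<longrightarrow> s * (mu i a k + (real a - real k) * (move_count i a (k + 2) - move_count i a (k + 1))) \<le> b))"

lemma card_move_real:
  assumes "finite A" "K \<subseteq> A" "i \<in> {1..6}" "w \<in> A" "z \<in> A" "w \<noteq> z"
  shows "real (card {\<tau> \<in> Tc i A K. \<tau> w = z}) = move_count i (card A) (card (insert w (insert z K)))"
proof -
  have m: "msz i \<ge> 2" by (simp add: msz_def)
  have "(real (msz i) - 1) * real (card {\<tau> \<in> Tc i A K. \<tau> w = z}) =
      real (full_support_card i) * real (subset_card (msz i) (card A) (card (insert w (insert z K))))"
    using arg_cong[OF card_move[OF assms], of real] m by (simp add: of_nat_diff One_nat_def)
  then show ?thesis using m by (simp add: move_count_def field_simps)
qed

lemma card_fix_real: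
  assumes "finite A" "K \<subseteq> A" "i \<in> {1..6}" "z \<in> A" "z \<notin> K"
  shows "real (card {\<tau> \<in> Tc i A K. \<tau> z = z}) = real (full_support_card i) * real (subset_card (msz i) (card A - 1) (card K))"
proof -
  have "{\<tau> \<in> Tc i A K. \<tau> z = z} = Tc i (A - {z}) K"
    by (auto simp: Tc_def supp_def)
  moreover have "K \<subseteq> A - {z}" using assms by auto
  ultimately show ?thesis using card_Tc[of "A - {z}" K i] assms by simp
qed

text \<open>Off the diagonal, the entry for \<open>z\<close> and \<open>w\<close> depends only on
  how many of the two points lie in \<open>K\<close>. If the partial sum over \<open>K\<close>
  vanishes, the vector is scaled on \<open>K\<close> and on \<open>A - K\<close> separately;
  otherwise summing the equations over \<open>A - K\<close> isolates the remaining
  eigenvalue.\<close>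

lemma quotient_eigenvalue:
  fixes v :: "nat \<Rightarrow> real"
  assumes A: "finite A" "K \<subseteq> A" "i \<in> {1..6}" and l: "\<And>z. z \<in> A \<Longrightarrow>
      l * v z = s * (\<Sum>w\<in>A. real (card {\<tau> \<in> Tc i A K. \<tau> z = w}) * v w)"
    and sum0: "sum v A = 0" and nz: "z0 \<in> A" "v z0 \<noteq> 0"
    and s: "s \<in> {1, real_of_int (eps i)}" and pb: "quotient_bounded i (card A) (card K) b"
  shows "l \<le> b"
proof -
  let ?a = "card A" and ?k = "card K"
  define p q r D where "p = move_count i ?a ?k" and "q = move_count i ?a (?k + 1)" and "r = move_count i ?a (?k + 2)"
    and "D = real (full_support_card i) * real (subset_card (msz i) (?a - 1) ?k)"
  have mu: "mu i ?a ?k = D - r" by (simp add: mu_def r_def D_def)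
  have fK: "finite K" using A finite_subset by auto
  define Vi Vo where "Vi = sum v K" and "Vo = sum v (A - K)"
  have V: "Vi + Vo = 0" unfolding Vi_def Vo_def
    using sum.subset_diff[OF A(2,1), of v] sum0 by simp
  have N: "real (card {\<tau> \<in> Tc i A K. \<tau> z = w}) = move_count i ?a (card (insert z (insert w K)))"
    if "z \<in> A" "w \<in> A" "z \<noteq> w" for z w using card_move_real[OF A that] .
  have split: "(\<Sum>w\<in>A. real (card {\<tau> \<in> Tc i A K. \<tau> z = w}) * v w) =
     (\<Sum>w\<in>K. real (card {\<tau> \<in> Tc i A K. \<tau> z = w}) * v w) + (\<Sum>w\<in>A - K. real (card {\<tau> \<in> Tc i A K. \<tau> z = w}) * v w)" for z
    using sum.subset_diff[OF A(2,1)] by (simp add: add.commute)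
  have out: "l * v z = s * ((D - r) * v z + (r - q) * Vo)" if z: "z \<in> A - K" for z
  proof -
    have "(\<Sum>w\<in>K. real (card {\<tau> \<in> Tc i A K. \<tau> z = w}) * v w) = (\<Sum>w\<in>K. q * v w)"
    proof (rule sum.cong)
      fix w assume w: "w \<in> K"
      have "card (insert z (insert w K)) = ?k + 1" using z w fK by (simp add: insert_absorb)
      then show "real (card {\<tau> \<in> Tc i A K. \<tau> z = w}) * v w = q * v w"
        using N[of z w] z w A(2) unfolding q_def by auto
    qed simp
    moreover have "(\<Sum>w\<in>A - K. real (card {\<tau> \<in> Tc i A K. \<tau> z = w}) * v w) = D * v z + (\<Sum>w\<in>A - K - {z}. r * v w)"
    proof -
      have "(\<Sum>w\<in>A - K. real (card {\<tau> \<in> Tc i A K. \<tau> z = w}) * v w) =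
        real (card {\<tau> \<in> Tc i A K. \<tau> z = z}) * v z + (\<Sum>w\<in>A - K - {z}. real (card {\<tau> \<in> Tc i A K. \<tau> z = w}) * v w)"
        by (rule sum.remove) (use z A in auto)
      moreover have "real (card {\<tau> \<in> Tc i A K. \<tau> z = z}) = D"
        unfolding D_def by (rule card_fix_real[OF A]) (use z in auto)
      moreover have "(\<Sum>w\<in>A - K - {z}. real (card {\<tau> \<in> Tc i A K. \<tau> z = w}) * v w) = (\<Sum>w\<in>A - K - {z}. r * v w)"
      proof (rule sum.cong)
        fix w assume w: "w \<in> A - K - {z}"
        have "card (insert z (insert w K)) = ?k + 2" using z w fK by simp
        then show "real (card {\<tau> \<in> Tc i A K. \<tau> z = w}) * v w = r * v w"
          using N[of z w] z w unfolding r_def by auto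
      qed simp
      ultimately show ?thesis by simp
    qed
    moreover have "(\<Sum>w\<in>A - K - {z}. r * v w) = r * (Vo - v z)"
      using sum.remove[of "A - K" z v] z A by (simp add: Vo_def flip: sum_distrib_left)
    ultimately have "l * v z = s * (q * Vi + (D * v z + r * (Vo - v z)))"
      using l[of z] z split[of z] by (simp add: Vi_def flip: sum_distrib_left)
    also have "Vi = - Vo" using V by simp
    finally show ?thesis by (simp add: algebra_simps)
  qed
  have inn: "l * v z = s * (- p * v z + (p - q) * Vi)" if z: "z \<in> K" for z
  proof -
    have "(\<Sum>w\<in>A - K. real (card {\<tau> \<in> Tc i A K. \<tau> z = w}) * v w) = (\<Sum>w\<in>A - K. q * v w)"
    proof (rule sum.cong)
      fix w assume w: "w \<in> A - K"
      have "card (insert z (insert w K)) = ?k + 1" using z w fK by (simp add: insert_absorb insert_commute)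
      then show "real (card {\<tau> \<in> Tc i A K. \<tau> z = w}) * v w = q * v w"
        using N[of z w] z w A(2) unfolding q_def by auto
    qed simp
    moreover have "(\<Sum>w\<in>K. real (card {\<tau> \<in> Tc i A K. \<tau> z = w}) * v w) = (\<Sum>w\<in>K - {z}. p * v w)"
    proof -
      have "{\<tau> \<in> Tc i A K. \<tau> z = z} = {}" using z by (auto simp: Tc_def supp_def)
      then have "card {\<tau> \<in> Tc i A K. \<tau> z = z} = 0" by (simp only: card.empty)
      then have "(\<Sum>w\<in>K. real (card {\<tau> \<in> Tc i A K. \<tau> z = w}) * v w) =
        (\<Sum>w\<in>K - {z}. real (card {\<tau> \<in> Tc i A K. \<tau> z = w}) * v w)"
        using sum.remove[of K z "\<lambda>w. real (card {\<tau> \<in> Tc i A K. \<tau> z = w}) * v w"] z fK by simp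
      also have "\<dots> = (\<Sum>w\<in>K - {z}. p * v w)"
      proof (rule sum.cong)
        fix w assume w: "w \<in> K - {z}"
        have "card (insert z (insert w K)) = ?k" using z w by (simp add: insert_absorb)
        then show "real (card {\<tau> \<in> Tc i A K. \<tau> z = w}) * v w = p * v w"
          using N[of z w] z w A(2) unfolding p_def by auto
      qed simp
      finally show ?thesis .
    qed
    moreover have "(\<Sum>w\<in>K - {z}. p * v w) = p * (Vi - v z)"
      using sum.remove[of K z v] z fK by (simp add: Vi_def flip: sum_distrib_left)
    ultimately have "l * v z = s * (p * (Vi - v z) + q * Vo)"
      using l[of z] z A(2) split[of z] by (auto simp: Vo_def simp flip: sum_distrib_left)
    also have "Vo = - Vi" using V by simp
    finally show ?thesis by (simp add: algebra_simps)
  qed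
  have pb': "s * (D - r) \<le> b" "?k \<ge> 2 \<Longrightarrow> - s * p \<le> b"
    "?k \<ge> 1 \<Longrightarrow> s * ((D - r) + (real ?a - real ?k) * (r - q)) \<le> b"
    using pb s unfolding quotient_bounded_def mu p_def q_def r_def by blast+
  show ?thesis
  proof (cases "Vo = 0")
    case True
    then have Vi0: "Vi = 0" using V by simp
    show ?thesis
    proof (cases "z0 \<in> K")
      case True
      \<comment> \<open>A nonzero entry in \<open>K\<close> with vanishing sum over \<open>K\<close>
        needs a second point there; this is the origin of the condition \<open>k >= 2\<close> in
        \<open>quotient_bounded\<close>.\<close>
      have "?k \<ge> 2"
      proof (rule ccontr)
        assume "\<not> 2 \<le> ?k"
        moreover have "?k > 0" using True fK by (auto simp: card_gt_0_iff)
        ultimately have "?k = 1" by linarith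
        then have "K = {z0}" using True by (metis One_nat_def card_1_singletonE singletonD)
        then show False using Vi0 nz by (simp add: Vi_def)
      qed
      moreover have "l * v z0 = (- s * p) * v z0" using inn[OF True] Vi0 by simp
      then have "l = - s * p" using nz(2) by (simp only: mult_cancel_right) simp
      ultimately show ?thesis using pb'(2) by simp
    next
      case False
      then have "l * v z0 = (s * (D - r)) * v z0" using out[of z0] nz(1) True by simp
      then have "l = s * (D - r)" using nz(2) by (simp only: mult_cancel_right) simp
      then show ?thesis using pb'(1) by simp
    qed
  next
    case False
    have "?k \<ge> 1"
    proof (rule ccontr)
      assume "\<not> 1 \<le> ?k"
      then have "card K = 0" by linarith
      then have "K = {}" using fK by simp
      then show False using False V by (simp add: Vi_def)
    qed
    have cAK: "real (card (A - K)) = real ?a - real ?k"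
      using A fK card_mono[OF A(1,2)] by (simp add: card_Diff_subset of_nat_diff)
    have "l * Vo = (\<Sum>z\<in>A - K. l * v z)" by (simp add: Vo_def sum_distrib_left)
    also have "\<dots> = (\<Sum>z\<in>A - K. s * ((D - r) * v z + (r - q) * Vo))"
      by (rule sum.cong) (simp_all add: out)
    also have "\<dots> = s * ((D - r) * Vo + (real ?a - real ?k) * ((r - q) * Vo))"
      by (simp add: sum.distrib cAK Vo_def flip: sum_distrib_left)
    finally have "l * Vo = (s * ((D - r) + (real ?a - real ?k) * (r - q))) * Vo" by (simp add: algebra_simps)
    then have "l = s * ((D - r) + (real ?a - real ?k) * (r - q))" using False by (simp only: mult_cancel_right) simp
    then show ?thesis using pb'(3) \<open>?k \<ge> 1\<close> by simp
  qed
qed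

context sym_group
begin

text \<open>A form of Frobenius reciprocity. Failure of genericity on some \<open>A - {x}\<close>
  means that a twisted average of \<open>f\<close> over a point stabiliser is nonzero. The averages
  over its cosets form a vector on \<open>A\<close>, which is an eigenvector of the matrix of
  transition counts, with the sign of the class as a factor if \<open>e\<close> holds. Genericity on
  \<open>A\<close> makes its sum zero.\<close>

lemma induced_eigenvalue:
  assumes A: "A \<subseteq> N" "K \<subseteq> A" "i \<in> {1..6}" and f: "f \<in> Gen A" "f \<notin> W A"
    and ev: "sm (Tc i A K) f = (\<lambda>\<sigma>. l * f \<sigma>)" and pb: "quotient_bounded i (card A) (card K) b"
  shows "l \<le> b"
proof -
  have fA: "finite A" using A(1) finN finite_subset by blast
  have fV: "f \<in> V" using f(1) by (auto simp: Gen_def gen1_def)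
  let ?P = "{\<pi>. \<pi> permutes A}"
  have fP: "finite ?P" by (rule finite_permutations[OF fA])
  obtain x where x: "x \<in> A" "f \<notin> Gen (A - {x})" using f by (auto simp: W_def)
  obtain e where "f \<notin> gen1 e (A - {x})" using x(2) unfolding Gen_def by blast
  then obtain \<sigma> where sg: "(\<Sum>\<tau>\<in>{\<tau>. \<tau> permutes A - {x}}. chr e \<tau> * f (\<sigma> \<circ> \<tau>)) \<noteq> 0"
    using fV by (auto simp: gen1_def)
  \<comment> \<open>The permutations with \<open>\<pi> z = x\<close> form one coset of the
    stabiliser of \<open>x\<close>; for \<open>z = x\<close> the sum is the nonvanishing
    average.\<close>
  define v where "v z = (\<Sum>\<pi>\<in>{\<pi> \<in> ?P. \<pi> z = x}. chr e \<pi> * f (\<sigma> \<circ> \<pi>))" for z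
  have vx: "v x \<noteq> 0"
  proof -
    have "{\<pi> \<in> ?P. \<pi> x = x} = {\<tau>. \<tau> permutes A - {x}}"
      using x(1) by (auto simp: permutes_def)
    then show ?thesis using sg by (simp add: v_def)
  qed
  have sum0: "sum v A = 0"
  proof -
    have "sum v A = (\<Sum>z\<in>A. \<Sum>\<pi>\<in>?P. if \<pi> z = x then chr e \<pi> * f (\<sigma> \<circ> \<pi>) else 0)"
      unfolding v_def by (intro sum.cong refl sum.inter_filter fP)
    also have "\<dots> = (\<Sum>\<pi>\<in>?P. \<Sum>z\<in>A. if \<pi> z = x then chr e \<pi> * f (\<sigma> \<circ> \<pi>) else 0)" by (rule sum.swap)
    also have "\<dots> = (\<Sum>\<pi>\<in>?P. chr e \<pi> * f (\<sigma> \<circ> \<pi>))"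
    proof (rule sum.cong)
      fix \<pi> assume "\<pi> \<in> ?P"
      then have p: "\<pi> permutes A" by simp
      have "\<pi> z = x \<longleftrightarrow> z = pinv \<pi> x" for z using permutes_inverses[OF p] by metis
      moreover have "pinv \<pi> x \<in> A" using permutes_in_image[OF permutes_inv[OF p]] x(1) by simp
      ultimately show "(\<Sum>z\<in>A. if \<pi> z = x then chr e \<pi> * f (\<sigma> \<circ> \<pi>) else 0) = chr e \<pi> * f (\<sigma> \<circ> \<pi>)"
        using fA by (simp add: sum.delta)
    qed simp
    also have "\<dots> = 0" using f(1) by (cases e) (auto simp: Gen_def gen1_def)
    finally show ?thesis .
  qed
  define s where "s = (if e then real_of_int (eps i) else 1)"
  have chs: "chr e \<tau> = s" if "\<tau> \<in> Tc i A K" for \<tau>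
    using that sign_cls[of \<tau> i] by (simp add: chr_def s_def Tc_def)
  have ss: "s * s = 1" by (simp add: s_def eps_def)
  have main: "l * v z = s * (\<Sum>w\<in>A. real (card {\<tau> \<in> Tc i A K. \<tau> z = w}) * v w)" if z: "z \<in> A" for z
  proof -
    have "l * v z = (\<Sum>\<pi>\<in>{\<pi> \<in> ?P. \<pi> z = x}. chr e \<pi> * (\<Sum>\<tau>\<in>Tc i A K. f (\<sigma> \<circ> \<pi> \<circ> \<tau>)))"
    proof -
      have "l * f \<rho> = (\<Sum>\<tau>\<in>Tc i A K. f (\<rho> \<circ> \<tau>))" for \<rho> using fun_cong[OF ev, of \<rho>] by (simp add: sm_def)
      then show ?thesis unfolding v_def sum_distrib_left by (intro sum.cong) (simp_all add: mult.left_commute[of l] sum_distrib_left)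
    qed
    also have "\<dots> = (\<Sum>\<tau>\<in>Tc i A K. \<Sum>\<pi>\<in>{\<pi> \<in> ?P. \<pi> z = x}. chr e \<pi> * f (\<sigma> \<circ> \<pi> \<circ> \<tau>))"
      unfolding sum_distrib_left by (rule sum.swap)
    also have "\<dots> = (\<Sum>\<tau>\<in>Tc i A K. s * v (pinv \<tau> z))"
    proof (rule sum.cong)
      fix \<tau> assume \<tau>: "\<tau> \<in> Tc i A K"
      have t: "\<tau> permutes A" by (rule Tc_permutes[OF \<tau>])
      have inv: "\<tau> \<circ> pinv \<tau> = id" "pinv \<tau> \<circ> \<tau> = id" using permutes_inv_o[OF t] by auto
      show "(\<Sum>\<pi>\<in>{\<pi> \<in> ?P. \<pi> z = x}. chr e \<pi> * f (\<sigma> \<circ> \<pi> \<circ> \<tau>)) = s * v (pinv \<tau> z)"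
        unfolding v_def sum_distrib_left
      proof (rule sum.reindex_bij_witness[of _ "\<lambda>\<pi>. \<pi> \<circ> pinv \<tau>" "\<lambda>\<pi>. \<pi> \<circ> \<tau>"])
        fix \<pi> assume "\<pi> \<in> {\<pi> \<in> ?P. \<pi> z = x}"
        then have p: "\<pi> permutes A" "\<pi> z = x" by auto
        show "\<pi> \<circ> \<tau> \<circ> pinv \<tau> = \<pi>" by (simp add: comp_assoc inv)
        show "\<pi> \<circ> \<tau> \<in> {\<pi> \<in> ?P. \<pi> (pinv \<tau> z) = x}"
          using p permutes_compose[OF t p(1)] permutes_inverses(1)[OF t] by simp
        have "permutation \<pi>" "permutation \<tau>" using p t fA permutes_imp_permutation by blast+
        then have "chr e (\<pi> \<circ> \<tau>) = chr e \<pi> * s" using chs[OF \<tau>] by (simp add: chr_comp)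
        then have "s * (chr e (\<pi> \<circ> \<tau>) * f (\<sigma> \<circ> (\<pi> \<circ> \<tau>))) = s * s * (chr e \<pi> * f (\<sigma> \<circ> \<pi> \<circ> \<tau>))"
          by (simp only: comp_assoc mult_ac)
        then show "s * (chr e (\<pi> \<circ> \<tau>) * f (\<sigma> \<circ> (\<pi> \<circ> \<tau>))) = chr e \<pi> * f (\<sigma> \<circ> \<pi> \<circ> \<tau>)"
          unfolding ss by (simp only: mult_1)
      next
        fix \<pi> assume "\<pi> \<in> {\<pi> \<in> ?P. \<pi> (pinv \<tau> z) = x}"
        then have p: "\<pi> permutes A" "\<pi> (pinv \<tau> z) = x" by auto
        show "\<pi> \<circ> pinv \<tau> \<circ> \<tau> = \<pi>" by (simp add: comp_assoc inv)
        show "\<pi> \<circ> pinv \<tau> \<in> {\<pi> \<in> ?P. \<pi> z = x}"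
          using p permutes_compose[OF permutes_inv[OF t] p(1)] by simp
      qed
    qed simp
    also have "\<dots> = s * (\<Sum>\<tau>\<in>Tc i A K. v (\<tau> z))"
      unfolding sum_distrib_left
      by (rule sum.reindex_bij_witness[of _ pinv pinv])
        (auto intro: inv_Tc dest: Tc_permutes simp: permutes_inv_inv)
    also have "(\<Sum>\<tau>\<in>Tc i A K. v (\<tau> z)) = (\<Sum>w\<in>A. real (card {\<tau> \<in> Tc i A K. \<tau> z = w}) * v w)"
    proof -
      have "(\<Sum>\<tau>\<in>Tc i A K. v (\<tau> z)) = (\<Sum>w\<in>A. \<Sum>\<tau>\<in>{\<tau> \<in> Tc i A K. \<tau> z = w}. v (\<tau> z))"
        using fA by (intro sum.group[symmetric] finite_Tc)
          (auto dest: Tc_permutes simp: permutes_in_image z)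
      then show ?thesis by simp
    qed
    finally show ?thesis .
  qed
  show ?thesis
    by (rule quotient_eigenvalue[OF fA A(2,3) main sum0 x(1) vx _ pb]) (auto simp: s_def)
qed

text \<open>An eigenfunction in \<open>Gen A\<close> either lies in \<open>W A\<close>, where the
  bound is assumed, or has an induced constituent, and then its eigenvalue is one of the quotient
  matrix or its twist.\<close>

lemma bound_from_W:
  assumes A: "A \<subseteq> N" "K \<subseteq> A" "i \<in> {1..6}" and pb: "quotient_bounded i (card A) (card K) b"
    and w: "\<And>f. f \<in> W A \<Longrightarrow> ip (sm (Tc i A K) f) f \<le> b * ip f f" and f: "f \<in> Gen A"
  shows "ip (sm (Tc i A K) f) f \<le> b * ip f f"
proof (rule quadratic_bound[of "Gen A" _ "[]"])
  have fA: "finite A" using A(1) finN finite_subset by blast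
  show "subsp (Gen A)" by (rule subsp_Gen[OF fA])
  show "selfadj (sm (Tc i A K))" by (rule selfadj_Tc[OF A(1)])
  show "sm (Tc i A K) f \<in> Gen A" if "f \<in> Gen A" for f
    by (rule Tc_in_U[OF invU_Gen[OF A(1)] fA subset_refl that])
  show "l \<le> b" if v: "v \<in> Gen A" "v \<noteq> (\<lambda>x. 0)" "sm (Tc i A K) v = (\<lambda>x. l * v x)" for v l
  proof (cases "v \<in> W A")
    case True
    have "v \<in> V" using v(1) by (auto simp: Gen_def gen1_def)
    then have "ip v v > 0" using ip_pos v(2) by blast
    moreover have "l * ip v v \<le> b * ip v v" using w[OF True] unfolding v(3) by (simp add: ip_scale)
    ultimately show ?thesis by simp
  next
    case False
    then show ?thesis using induced_eigenvalue[OF A v(1) _ v(3) pb] by simp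
  qed
qed (use f in auto)

end

section \<open>The numerical inequalities\<close>

text \<open>
  For \<open>a = t + 7\<close> all quantities are polynomials in \<open>t\<close>, and the inequalities hold coefficientwise.
\<close>

lemma choose_poly:
  "real (n choose 0) = 1"
  "real (n choose 1) = real n"
  "real (n choose Suc 0) = real n"
  "real (n choose 2) = real n * (real n - 1) / 2"
  "real (n choose 3) = real n * (real n - 1) * (real n - 2) / 6"
  "real (n choose 4) = real n * (real n - 1) * (real n - 2) * (real n - 3) / 24"
  "real (n choose 5) = real n * (real n - 1) * (real n - 2) * (real n - 3) * (real n - 4) / 120"
proof -
  have e: "2 = Suc (Suc 0)" by simp
  have b: "(Suc n choose 3) = (n choose 2) + (n choose 3)" "(Suc n choose 4) = (n choose 3) + (n choose 4)"
    "(Suc n choose 5) = (n choose 4) + (n choose 5)" for n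
    using binomial_Suc_Suc[of n 2] binomial_Suc_Suc[of n 3] binomial_Suc_Suc[of n 4] by simp_all
  show c0: "real (n choose 0) = 1" by simp
  show c1: "real (n choose Suc 0) = real n" for n by simp
  then show "real (n choose 1) = real n" by (simp add: One_nat_def)
  show c2: "real (n choose 2) = real n * (real n - 1) / 2" for n
    unfolding e by (induction n) (simp_all add: field_simps)
  show c3: "real (n choose 3) = real n * (real n - 1) * (real n - 2) / 6" for n
    by (induction n) (simp_all add: b field_simps c2)
  show c4: "real (n choose 4) = real n * (real n - 1) * (real n - 2) * (real n - 3) / 24" for n
    by (induction n) (simp_all add: b field_simps c3)
  show "real (n choose 5) = real n * (real n - 1) * (real n - 2) * (real n - 3) * (real n - 4) / 120"
    by (induction n) (simp_all add: b field_simps c4)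
qed

lemma mu_poly:
  fixes t :: nat
  defines "x \<equiv> real t"
  shows
    "mu 1 (t + 7) 0 = 14 + 11 / 2 * x + 1 / 2 * (x * x)"
    "mu 1 (t + 7) 1 = 5 + 1 * x"
    "mu 1 (t + 7) 2 = 1"
    "mu 2 (t + 7) 0 = 35 + 71 / 3 * x + 5 * (x * x) + 1 / 3 * (x * (x * x))"
    "mu 2 (t + 7) 1 = 19 + 9 * x + 1 * (x * x)"
    "mu 2 (t + 7) 2 = 8 + 2 * x"
    "mu 2 (t + 7) 3 = 2"
    "mu 3 (t + 7) 0 = 35 + 153 / 4 * x + 115 / 8 * (x * x) + 9 / 4 * (x * (x * x)) + 1 / 8 * (x * (x * (x * x)))"
    "mu 3 (t + 7) 1 = 26 + 45 / 2 * x + 6 * (x * x) + 1 / 2 * (x * (x * x))"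
    "mu 3 (t + 7) 2 = 17 + 21 / 2 * x + 3 / 2 * (x * x)"
    "mu 3 (t + 7) 3 = 9 + 3 * x"
    "mu 3 (t + 7) 4 = 3"
    "mu 4 (t + 7) 0 = 70 + 153 / 2 * x + 115 / 4 * (x * x) + 9 / 2 * (x * (x * x)) + 1 / 4 * (x * (x * (x * x)))"
    "mu 4 (t + 7) 1 = 52 + 45 * x + 12 * (x * x) + 1 * (x * (x * x))"
    "mu 4 (t + 7) 2 = 34 + 21 * x + 3 * (x * x)"
    "mu 4 (t + 7) 3 = 18 + 6 * x"
    "mu 4 (t + 7) 4 = 6"
    "mu 5 (t + 7) 0 = 70 + 809 / 6 * x + 260 / 3 * (x * x) + 25 * (x * (x * x)) + 10 / 3 * (x * (x * (x * x))) + 1 / 6 * (x * (x * (x * (x * x))))"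
    "mu 5 (t + 7) 1 = 70 + 665 / 6 * x + 170 / 3 * (x * x) + 35 / 3 * (x * (x * x)) + 5 / 6 * (x * (x * (x * x)))"
    "mu 5 (t + 7) 2 = 65 + 245 / 3 * x + 30 * (x * x) + 10 / 3 * (x * (x * x))"
    "mu 5 (t + 7) 3 = 55 + 50 * x + 10 * (x * x)"
    "mu 5 (t + 7) 4 = 40 + 20 * x"
    "mu 5 (t + 7) 5 = 20"
    "mu 6 (t + 7) 0 = 84 + 809 / 5 * x + 104 * (x * x) + 30 * (x * (x * x)) + 4 * (x * (x * (x * x))) + 1 / 5 * (x * (x * (x * (x * x))))"
    "mu 6 (t + 7) 1 = 84 + 133 * x + 68 * (x * x) + 14 * (x * (x * x)) + 1 * (x * (x * (x * x)))"
    "mu 6 (t + 7) 2 = 78 + 98 * x + 36 * (x * x) + 4 * (x * (x * x))"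
    "mu 6 (t + 7) 3 = 66 + 60 * x + 12 * (x * x)"
    "mu 6 (t + 7) 4 = 48 + 24 * x"
    "mu 6 (t + 7) 5 = 24"
  unfolding x_def by (simp_all add: mu_def move_count_def subset_card_def full_support_card_def msz_def choose_poly field_simps)

lemma N_poly:
  fixes t :: nat
  defines "x \<equiv> real t"
  shows
    "real (full_support_card 1) * real (subset_card (msz 1) (t + 7) 0) = 21 + 13 / 2 * x + 1 / 2 * (x * x)"
    "real (full_support_card 1) * real (subset_card (msz 1) (t + 7) 1) = 6 + 1 * x"
    "real (full_support_card 1) * real (subset_card (msz 1) (t + 7) 2) = 1"
    "real (full_support_card 2) * real (subset_card (msz 2) (t + 7) 0) = 70 + 107 / 3 * x + 6 * (x * x) + 1 / 3 * (x * (x * x))"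
    "real (full_support_card 2) * real (subset_card (msz 2) (t + 7) 1) = 30 + 11 * x + 1 * (x * x)"
    "real (full_support_card 2) * real (subset_card (msz 2) (t + 7) 2) = 10 + 2 * x"
    "real (full_support_card 2) * real (subset_card (msz 2) (t + 7) 3) = 2"
    "real (full_support_card 3) * real (subset_card (msz 3) (t + 7) 0) = 105 + 319 / 4 * x + 179 / 8 * (x * x) + 11 / 4 * (x * (x * x)) + 1 / 8 * (x * (x * (x * x)))"
    "real (full_support_card 3) * real (subset_card (msz 3) (t + 7) 1) = 60 + 37 * x + 15 / 2 * (x * x) + 1 / 2 * (x * (x * x))"
    "real (full_support_card 3) * real (subset_card (msz 3) (t + 7) 2) = 30 + 27 / 2 * x + 3 / 2 * (x * x)"
    "real (full_support_card 3) * real (subset_card (msz 3) (t + 7) 3) = 12 + 3 * x"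
    "real (full_support_card 3) * real (subset_card (msz 3) (t + 7) 4) = 3"
    "real (full_support_card 4) * real (subset_card (msz 4) (t + 7) 0) = 210 + 319 / 2 * x + 179 / 4 * (x * x) + 11 / 2 * (x * (x * x)) + 1 / 4 * (x * (x * (x * x)))"
    "real (full_support_card 4) * real (subset_card (msz 4) (t + 7) 1) = 120 + 74 * x + 15 * (x * x) + 1 * (x * (x * x))"
    "real (full_support_card 4) * real (subset_card (msz 4) (t + 7) 2) = 60 + 27 * x + 3 * (x * x)"
    "real (full_support_card 4) * real (subset_card (msz 4) (t + 7) 3) = 24 + 6 * x"
    "real (full_support_card 4) * real (subset_card (msz 4) (t + 7) 4) = 6"
    "real (full_support_card 5) * real (subset_card (msz 5) (t + 7) 0) = 420 + 459 * x + 1175 / 6 * (x * x) + 245 / 6 * (x * (x * x)) + 25 / 6 * (x * (x * (x * x))) + 1 / 6 * (x * (x * (x * (x * x))))"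
    "real (full_support_card 5) * real (subset_card (msz 5) (t + 7) 1) = 300 + 285 * x + 595 / 6 * (x * x) + 15 * (x * (x * x)) + 5 / 6 * (x * (x * (x * x)))"
    "real (full_support_card 5) * real (subset_card (msz 5) (t + 7) 2) = 200 + 470 / 3 * x + 40 * (x * x) + 10 / 3 * (x * (x * x))"
    "real (full_support_card 5) * real (subset_card (msz 5) (t + 7) 3) = 120 + 70 * x + 10 * (x * x)"
    "real (full_support_card 5) * real (subset_card (msz 5) (t + 7) 4) = 60 + 20 * x"
    "real (full_support_card 5) * real (subset_card (msz 5) (t + 7) 5) = 20"
    "real (full_support_card 6) * real (subset_card (msz 6) (t + 7) 0) = 504 + 2754 / 5 * x + 235 * (x * x) + 49 * (x * (x * x)) + 5 * (x * (x * (x * x))) + 1 / 5 * (x * (x * (x * (x * x))))"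
    "real (full_support_card 6) * real (subset_card (msz 6) (t + 7) 1) = 360 + 342 * x + 119 * (x * x) + 18 * (x * (x * x)) + 1 * (x * (x * (x * x)))"
    "real (full_support_card 6) * real (subset_card (msz 6) (t + 7) 2) = 240 + 188 * x + 48 * (x * x) + 4 * (x * (x * x))"
    "real (full_support_card 6) * real (subset_card (msz 6) (t + 7) 3) = 144 + 84 * x + 12 * (x * x)"
    "real (full_support_card 6) * real (subset_card (msz 6) (t + 7) 4) = 72 + 24 * x"
    "real (full_support_card 6) * real (subset_card (msz 6) (t + 7) 5) = 24"
  unfolding x_def by (simp_all add: subset_card_def full_support_card_def msz_def choose_poly field_simps)

lemma move_count_poly:
  fixes t :: nat
  defines "x \<equiv> real t"
  shows
    "move_count 1 (t + 7) 1 = 6 + 1 * x"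
    "move_count 1 (t + 7) 2 = 1"
    "move_count 1 (t + 7) 3 = 0"
    "move_count 4 (t + 7) 1 = 40 + 74 / 3 * x + 5 * (x * x) + 1 / 3 * (x * (x * x))"
    "move_count 4 (t + 7) 2 = 20 + 9 * x + 1 * (x * x)"
    "move_count 4 (t + 7) 3 = 8 + 2 * x"
    "move_count 4 (t + 7) 4 = 2"
    "move_count 4 (t + 7) 5 = 0"
    "move_count 5 (t + 7) 1 = 75 + 285 / 4 * x + 595 / 24 * (x * x) + 15 / 4 * (x * (x * x)) + 5 / 24 * (x * (x * (x * x)))"
    "move_count 5 (t + 7) 2 = 50 + 235 / 6 * x + 10 * (x * x) + 5 / 6 * (x * (x * x))"
    "move_count 5 (t + 7) 3 = 30 + 35 / 2 * x + 5 / 2 * (x * x)"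
    "move_count 5 (t + 7) 4 = 15 + 5 * x"
    "move_count 5 (t + 7) 5 = 5"
    "move_count 5 (t + 7) 6 = 0"
  unfolding x_def by (simp_all add: move_count_def subset_card_def full_support_card_def msz_def choose_poly field_simps)

lemma mu_large: "k > msz i \<Longrightarrow> mu i a k = 0"
  by (simp add: mu_def move_count_def subset_card_def)

lemma monomials_nonneg:
  fixes t :: nat
  shows "0 \<le> real t" "0 \<le> real t * real t" "0 \<le> real t * (real t * real t)"
    "0 \<le> real t * (real t * (real t * real t))" "0 \<le> real t * (real t * (real t * (real t * real t)))"
  by simp_all

lemma mu_poly_nonneg:
  fixes t :: nat
  shows "0 \<le> mu 1 (t + 7) 0"
    "0 \<le> mu 1 (t + 7) 1"
    "0 \<le> mu 1 (t + 7) 2"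
    "0 \<le> mu 2 (t + 7) 0"
    "0 \<le> mu 2 (t + 7) 1"
    "0 \<le> mu 2 (t + 7) 2"
    "0 \<le> mu 2 (t + 7) 3"
    "0 \<le> mu 3 (t + 7) 0"
    "0 \<le> mu 3 (t + 7) 1"
    "0 \<le> mu 3 (t + 7) 2"
    "0 \<le> mu 3 (t + 7) 3"
    "0 \<le> mu 3 (t + 7) 4"
    "0 \<le> mu 4 (t + 7) 0"
    "0 \<le> mu 4 (t + 7) 1"
    "0 \<le> mu 4 (t + 7) 2"
    "0 \<le> mu 4 (t + 7) 3"
    "0 \<le> mu 4 (t + 7) 4"
    "0 \<le> mu 5 (t + 7) 0"
    "0 \<le> mu 5 (t + 7) 1"
    "0 \<le> mu 5 (t + 7) 2"
    "0 \<le> mu 5 (t + 7) 3"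
    "0 \<le> mu 5 (t + 7) 4"
    "0 \<le> mu 5 (t + 7) 5"
    "0 \<le> mu 6 (t + 7) 0"
    "0 \<le> mu 6 (t + 7) 1"
    "0 \<le> mu 6 (t + 7) 2"
    "0 \<le> mu 6 (t + 7) 3"
    "0 \<le> mu 6 (t + 7) 4"
    "0 \<le> mu 6 (t + 7) 5"
  by (simp only: mu_poly, ((intro add_nonneg_nonneg mult_nonneg_nonneg)?, simp_all)?)+

lemma move_count_le_mu:
  fixes t :: nat
  shows "move_count 4 (t + 7) 2 \<le> mu 4 (t + 7) 2"
    "move_count 4 (t + 7) 3 \<le> mu 4 (t + 7) 3"
    "move_count 5 (t + 7) 2 \<le> mu 5 (t + 7) 2"
    "move_count 5 (t + 7) 3 \<le> mu 5 (t + 7) 3"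
    "move_count 5 (t + 7) 4 \<le> mu 5 (t + 7) 4"
  by (simp_all add: mu_poly move_count_poly) (use monomials_nonneg[of t] in linarith)+

lemma move_count_diff_le_mu:
  fixes t :: nat
  shows "(real (t + 7) - real 1) * (move_count 1 (t + 7) 2 - move_count 1 (t + 7) 3) \<le> 2 * mu 1 (t + 7) 1"
    "(real (t + 7) - real 1) * (move_count 4 (t + 7) 2 - move_count 4 (t + 7) 3) \<le> 2 * mu 4 (t + 7) 1"
    "(real (t + 7) - real 2) * (move_count 4 (t + 7) 3 - move_count 4 (t + 7) 4) \<le> 2 * mu 4 (t + 7) 2"
    "(real (t + 7) - real 3) * (move_count 4 (t + 7) 4 - move_count 4 (t + 7) 5) \<le> 2 * mu 4 (t + 7) 3"
    "(real (t + 7) - real 1) * (move_count 5 (t + 7) 2 - move_count 5 (t + 7) 3) \<le> 2 * mu 5 (t + 7) 1"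
    "(real (t + 7) - real 2) * (move_count 5 (t + 7) 3 - move_count 5 (t + 7) 4) \<le> 2 * mu 5 (t + 7) 2"
    "(real (t + 7) - real 3) * (move_count 5 (t + 7) 4 - move_count 5 (t + 7) 5) \<le> 2 * mu 5 (t + 7) 3"
    "(real (t + 7) - real 4) * (move_count 5 (t + 7) 5 - move_count 5 (t + 7) 6) \<le> 2 * mu 5 (t + 7) 4"
  by (simp_all add: mu_poly move_count_poly algebra_simps add_divide_distrib) (use monomials_nonneg[of t] in linarith)+

lemma less_cases:
  "k < (2::nat) \<longleftrightarrow> k = 0 \<or> k = 1"
  "k < (3::nat) \<longleftrightarrow> k = 0 \<or> k = 1 \<or> k = 2"
  "k < (4::nat) \<longleftrightarrow> k = 0 \<or> k = 1 \<or> k = 2 \<or> k = 3"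
  "k < (5::nat) \<longleftrightarrow> k = 0 \<or> k = 1 \<or> k = 2 \<or> k = 3 \<or> k = 4"
  by auto

lemma mu_nonneg:
  assumes "i \<in> {1..6}" "k \<le> msz i" "a \<ge> 7"
  shows "0 \<le> mu i a k"
proof -
  obtain t where a: "a = t + 7" using assms(3) by (metis le_iff_add add.commute)
  have k: "k < msz i \<or> k = msz i" using assms(2) by auto
  from assms(1) consider "i = 1" | "i = 2" | "i = 3" | "i = 4" | "i = 5" | "i = 6" unfolding in_1_6 by blast
  then show ?thesis
    by cases (use k in \<open>simp only: a msz_simps less_cases, elim disjE, simp_all only: mu_poly_nonneg\<close>)+
qed

lemma move_count_antimono: "Suc k < a \<Longrightarrow> move_count i a (k + 2) \<le> move_count i a (k + 1)"
proof -
  assume "Suc k < a"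
  then have "subset_card (msz i) a (k + 2) \<le> subset_card (msz i) a (k + 1)"
    using subset_card_Suc[of "k + 1" a "msz i"] by (simp add: One_nat_def)
  then have "real (subset_card (msz i) a (k + 2)) \<le> real (subset_card (msz i) a (k + 1))" by (simp only: of_nat_le_iff)
  moreover have "real (msz i) - 1 > 0" by (simp add: msz_def)
  ultimately show ?thesis unfolding move_count_def
    by (intro divide_right_mono mult_left_mono) (assumption, simp_all)
qed

lemma move_count_nonneg: "0 \<le> move_count i a k"
  by (simp add: move_count_def msz_def)

text \<open>For \<open>s = 1\<close> the other two eigenvalues are at most \<open>mu i a k\<close>,
  because transition counts are nonnegative and decrease when more points are prescribed. The two
  extra inequalities serve \<open>s = - 1\<close>, which occurs for odd classes only.\<close>

lemma quotient_bounded_I: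
  assumes "Suc k < a" "0 \<le> mu i a k"
    and "eps i = - 1 \<Longrightarrow> k \<ge> 2 \<Longrightarrow> move_count i a k \<le> mu i a k"
    and "eps i = - 1 \<Longrightarrow> k \<ge> 1 \<Longrightarrow> (real a - real k) * (move_count i a (k + 1) - move_count i a (k + 2)) \<le> 2 * mu i a k"
  shows "quotient_bounded i a k (mu i a k)"
proof -
  have le: "(real a - real k) * (move_count i a (k + 2) - move_count i a (k + 1)) \<le> 0"
    using move_count_antimono[OF assms(1)] assms(1) by (intro mult_nonneg_nonpos) auto
  have eq: "(real a - real k) * (move_count i a (k + 2) - move_count i a (k + 1)) =
      - ((real a - real k) * (move_count i a (k + 1) - move_count i a (k + 2)))" by (simp add: algebra_simps)
  have "eps i = 1 \<or> eps i = - 1" by (simp add: eps_def)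
  then show ?thesis
    using assms(2-4) le move_count_nonneg[of i a k] unfolding quotient_bounded_def eq by auto
qed

lemma quotient_bounded_mu:
  assumes i: "i \<in> {1..6}" and k: "k < msz i" and a: "a \<ge> 7"
  shows "quotient_bounded i a k (mu i a k)"
proof (rule quotient_bounded_I)
  obtain t where t: "a = t + 7" using a by (metis le_iff_add add.commute)
  show "Suc k < a" using k a by (auto simp: msz_def split: if_splits)
  show "0 \<le> mu i a k" using mu_nonneg[OF i _ a] k by simp
  have odd: "i = 1 \<or> i = 4 \<or> i = 5" if "eps i = - 1" using that i by (auto simp: eps_def split: if_splits)
  show "move_count i a k \<le> mu i a k" if e: "eps i = - 1" "k \<ge> 2"
  proof -
    have "k = 2 \<or> k = 3 \<or> k = 4" using e(2) k by (auto simp: msz_def split: if_splits)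
    then show ?thesis using odd[OF e(1)] k
      by ((elim disjE; simp only: t move_count_le_mu msz_simps); simp)
  qed
  show "(real a - real k) * (move_count i a (k + 1) - move_count i a (k + 2)) \<le> 2 * mu i a k" if e: "eps i = - 1" "k \<ge> 1"
  proof -
    have "k = 1 \<or> k = 2 \<or> k = 3 \<or> k = 4" using e(2) k by (auto simp: msz_def split: if_splits)
    moreover have "1 + 1 = (2::nat)" "1 + 2 = (3::nat)" "2 + 1 = (3::nat)" "2 + 2 = (4::nat)" "3 + 1 = (4::nat)"
      "3 + 2 = (5::nat)" "4 + 1 = (5::nat)" "4 + 2 = (6::nat)" by simp_all
    ultimately show ?thesis using odd[OF e(1)] k
      by ((elim disjE; simp only: t move_count_diff_le_mu msz_simps); simp)
  qed
qed

text \<open>The general inequality starts at seven points; these are the cases on six points that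
  feed the base of the induction.\<close>

lemma quotient_bounded_mu_6:
  "i \<in> {3, 4, 5, 6} \<Longrightarrow> quotient_bounded i 6 3 (mu i 6 3)" "i \<in> {5, 6} \<Longrightarrow> quotient_bounded i 6 4 (mu i 6 4)"
  "mu 3 6 3 = 6" "mu 4 6 3 = 12" "mu 5 6 3 = 15" "mu 6 6 3 = 18" "mu 5 6 4 = 20" "mu 6 6 4 = 24"
  by (auto simp: quotient_bounded_def mu_def move_count_def subset_card_def full_support_card_def msz_def choose_poly eps_def)

section \<open>The sign eigenvalue compared with the bounds\<close>

definition class_card :: "nat \<Rightarrow> nat \<Rightarrow> nat \<Rightarrow> real" where
  "class_card i a k = real (full_support_card i) * real (subset_card (msz i) a k)"

lemma class_card_large: "k > msz i \<Longrightarrow> class_card i a k = 0"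
  by (simp add: class_card_def subset_card_def)

text \<open>Each odd class on the right compensates the even classes on the left. Beyond the stated
  ranges of \<open>k\<close> the left sides vanish, since \<open>mu i a k\<close> equals
  \<open>class_card i a k\<close> as soon as \<open>k >= msz i\<close> for an even class.\<close>

lemma sign_count:
  assumes "a \<ge> 7"
  shows "k < 3 \<Longrightarrow> class_card 2 a k - mu 2 a k \<le> class_card 1 a k + mu 1 a k"
    "k < 4 \<Longrightarrow> class_card 2 a k - mu 2 a k + (class_card 3 a k - mu 3 a k) \<le> class_card 4 a k + mu 4 a k"
    "k < 5 \<Longrightarrow> class_card 2 a k - mu 2 a k + (class_card 3 a k - mu 3 a k) \<le> class_card 5 a k + mu 5 a k"
    "k < 5 \<Longrightarrow> class_card 2 a k - mu 2 a k + (class_card 6 a k - mu 6 a k) \<le> class_card 5 a k + mu 5 a k"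
    "k < 5 \<Longrightarrow> class_card 3 a k - mu 3 a k + (class_card 6 a k - mu 6 a k) \<le> class_card 5 a k + mu 5 a k"
proof -
  obtain t where a: "a = t + 7" using assms by (metis le_iff_add add.commute)
  note mono = monomials_nonneg[of t]
  note P = class_card_def N_poly mu_poly
  show "class_card 2 a k - mu 2 a k \<le> class_card 1 a k + mu 1 a k" if "k < 3"
    using that unfolding less_cases a
    by (elim disjE; simp only: P; use mono in linarith)
  show "class_card 2 a k - mu 2 a k + (class_card 3 a k - mu 3 a k) \<le> class_card 4 a k + mu 4 a k" if "k < 4"
    using that unfolding less_cases a
    by (elim disjE; simp only: P; use mono in linarith)
  have large: "class_card 2 (t + 7) 4 = 0" "mu 2 (t + 7) 4 = 0"
    using mu_large[of 2 4 "t + 7"] class_card_large[of 2 4 "t + 7"] by (simp_all add: msz_simps)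
  show "class_card 2 a k - mu 2 a k + (class_card 3 a k - mu 3 a k) \<le> class_card 5 a k + mu 5 a k"
      "class_card 2 a k - mu 2 a k + (class_card 6 a k - mu 6 a k) \<le> class_card 5 a k + mu 5 a k"
      "class_card 3 a k - mu 3 a k + (class_card 6 a k - mu 6 a k) \<le> class_card 5 a k + mu 5 a k" if "k < 5"
    using that unfolding less_cases a
    by (elim disjE; simp only: large; (simp only: P)?; use mono in linarith)+
qed

lemma sign_count_nonneg:
  assumes "i \<in> {1..6}" "a \<ge> 7"
  shows "0 \<le> class_card i a k + mu i a k" "0 \<le> class_card i a k - mu i a k"
proof -
  have n: "0 \<le> class_card i a k" by (simp add: class_card_def)
  have m: "0 \<le> mu i a k" using mu_nonneg[OF assms(1) _ assms(2), of k] mu_large[of i k a] by (cases "k \<le> msz i") auto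
  show "0 \<le> class_card i a k + mu i a k" using n m by simp
  show "0 \<le> class_card i a k - mu i a k"
  proof (cases "k < a")
    case True
    have "real (subset_card (msz i) (a - 1) k) \<le> real (subset_card (msz i) a k)" using subset_card_Suc[OF True, of "msz i"] by simp
    then have "real (full_support_card i) * real (subset_card (msz i) (a - 1) k) \<le> class_card i a k"
      unfolding class_card_def by (rule mult_left_mono) simp
    then show ?thesis using move_count_nonneg[of i a "k + 2"] by (simp add: mu_def)
  next
    case False
    then have "k > msz i" using assms(2) by (auto simp: msz_def split: if_splits)
    then show ?thesis by (simp add: mu_large class_card_large)
  qed
qed

section \<open>Symmetric matrices with constant row sums\<close>

lemma mult_mat_entry:
  fixes X Y :: "real mat"
  assumes "X \<in> carrier_mat (Suc n) (Suc n)" "Y \<in> carrier_mat (Suc n) (Suc n)" "i < Suc n" "j < Suc n"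
  shows "(X * Y) $$ (i, j) = X $$ (i, 0) * Y $$ (0, j) + (\<Sum>l<n. X $$ (i, Suc l) * Y $$ (Suc l, j))"
proof -
  have "(X * Y) $$ (i, j) = (\<Sum>l\<in>{0..<Suc n}. X $$ (i, l) * Y $$ (l, j))"
    using assms by (auto simp: scalar_prod_def)
  then show ?thesis by (simp only: atLeast0LessThan sum.lessThan_Suc_shift)
qed

text \<open>
  Conjugation by the unipotent matrix whose first column is constant 1.
\<close>

lemma char_poly_const_row_sum:
  fixes A :: "real mat"
  assumes A: "A \<in> carrier_mat (Suc n) (Suc n)"
    and row: "\<And>i. i < Suc n \<Longrightarrow> (\<Sum>j<Suc n. A $$ (i, j)) = d"
  shows "char_poly A = [:- d, 1:] * char_poly (mat n n (\<lambda>(i, j). A $$ (Suc i, Suc j) - A $$ (0, Suc j)))"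
proof -
  let ?N = "Suc n" and ?B1 = "mat 1 1 (\<lambda>_. d)" and ?B2 = "mat 1 n (\<lambda>(i, j). A $$ (0, Suc j))"
  let ?B4 = "mat n n (\<lambda>(i, j). A $$ (Suc i, Suc j) - A $$ (0, Suc j))"
  define P :: "real mat" where "P = mat ?N ?N (\<lambda>(i, j). if i = j \<or> j = 0 then 1 else 0)"
  define Q :: "real mat" where "Q = mat ?N ?N (\<lambda>(i, j). if i = j then 1 else if j = 0 then - 1 else 0)"
  define B where "B = four_block_mat ?B1 ?B2 (0\<^sub>m n 1) ?B4"
  have c: "P \<in> carrier_mat ?N ?N" "Q \<in> carrier_mat ?N ?N" "B \<in> carrier_mat ?N ?N"
    by (simp_all add: P_def Q_def B_def carrier_matI)
  have P: "P $$ (0, 0) = 1" "i < n \<Longrightarrow> P $$ (Suc i, 0) = 1" "i < n \<Longrightarrow> P $$ (0, Suc i) = 0"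
    "i < n \<Longrightarrow> j < n \<Longrightarrow> P $$ (Suc i, Suc j) = (if i = j then 1 else 0)" for i j
    by (simp_all add: P_def)
  have Q: "Q $$ (0, 0) = 1" "i < n \<Longrightarrow> Q $$ (Suc i, 0) = - 1" "i < n \<Longrightarrow> Q $$ (0, Suc i) = 0"
    "i < n \<Longrightarrow> j < n \<Longrightarrow> Q $$ (Suc i, Suc j) = (if i = j then 1 else 0)" for i j
    by (simp_all add: Q_def)
  have B: "B $$ (0, 0) = d" "i < n \<Longrightarrow> B $$ (Suc i, 0) = 0" "i < n \<Longrightarrow> B $$ (0, Suc i) = A $$ (0, Suc i)"
    "i < n \<Longrightarrow> j < n \<Longrightarrow> B $$ (Suc i, Suc j) = A $$ (Suc i, Suc j) - A $$ (0, Suc j)" for i j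
    by (simp_all add: B_def)
  have entries: "X = Y" if "X \<in> carrier_mat ?N ?N" "Y \<in> carrier_mat ?N ?N" "X $$ (0, 0) = Y $$ (0, 0)"
    "\<And>i. i < n \<Longrightarrow> X $$ (Suc i, 0) = Y $$ (Suc i, 0)" "\<And>i. i < n \<Longrightarrow> X $$ (0, Suc i) = Y $$ (0, Suc i)"
    "\<And>i j. i < n \<Longrightarrow> j < n \<Longrightarrow> X $$ (Suc i, Suc j) = Y $$ (Suc i, Suc j)" for X Y :: "real mat"
  proof (rule eq_matI)
    fix i j assume "i < dim_row Y" "j < dim_col Y"
    then show "X $$ (i, j) = Y $$ (i, j)" using that by (cases i; cases j) auto
  qed (use that in auto)
  have delta: "(\<Sum>l<n. h l * (if l = j then 1 else 0)) = h j" "(\<Sum>l<n. (if j = l then 1 else 0) * h l) = h j"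
    if "j < n" for j and h :: "nat \<Rightarrow> real"
    using that by (simp_all add: if_distrib[of "\<lambda>x. _ * x"] if_distrib[of "\<lambda>x. x * _"] cong: if_cong)
  note m = mult_mat_entry[OF c(1,2)] mult_mat_entry[OF c(2,1)] mult_mat_entry[OF A c(1)] mult_mat_entry[OF c(1,3)]
  have one: "1\<^sub>m ?N $$ (i, j) = (if i = j then 1 else (0::real))" if "i < ?N" "j < ?N" for i j using that by simp
  have PQ: "P * Q = 1\<^sub>m ?N"
    by (rule entries) (use c in \<open>simp_all add: m P Q one delta sum_negf del: index_one_mat index_mult_mat\<close>)
  have QP: "Q * P = 1\<^sub>m ?N"
    by (rule entries) (use c in \<open>simp_all add: m P Q one delta sum_negf del: index_one_mat index_mult_mat\<close>)
  have row': "A $$ (i, 0) + (\<Sum>j<n. A $$ (i, Suc j)) = d" if "i < Suc n" for i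
    using row[OF that] by (simp add: sum.lessThan_Suc_shift del: sum.lessThan_Suc)
  have AP: "A * P = P * B"
    by (rule entries) (use c A row' in \<open>simp_all add: m P B delta del: index_mult_mat\<close>)
  have "A = A * (P * Q)" using A PQ by simp
  also have "\<dots> = A * P * Q" using A c by (simp add: assoc_mult_mat[of _ ?N ?N _ ?N _ ?N])
  finally have "A = P * B * Q" unfolding AP .
  then have "similar_mat A B" using A c PQ QP by (intro similar_matI[of _ _ P Q ?N]) auto
  then have "char_poly A = char_poly B" by (rule char_poly_similar)
  also have "\<dots> = char_poly ?B1 * char_poly ?B4"
    unfolding B_def by (rule char_poly_four_block_zeros_col) auto
  also have "char_poly ?B1 = [:- d, 1:]"
    by (subst char_poly_upper_triangular[of _ 1]) (auto simp: diag_mat_def One_nat_def)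
  finally show ?thesis .
qed

text \<open>The all-ones vector accounts for one root \<open>d\<close>, and the other factor of the
  characteristic polynomial belongs to the action on vectors of sum zero. By \<open>bound\<close>
  and the vector \<open>w\<close> its largest root is \<open>L\<close>, so \<open>L\<close> comes
  next in the descending list; because of multiplicities this includes the case
  \<open>L = d\<close>.\<close>

lemma second_eigenvalue_index:
  fixes A :: "real mat"
  assumes A: "A \<in> carrier_mat N N" and sym: "\<And>i j. i < N \<Longrightarrow> j < N \<Longrightarrow> A $$ (i, j) = A $$ (j, i)"
    and row: "\<And>i. i < N \<Longrightarrow> (\<Sum>j<N. A $$ (i, j)) = d"
    and bound: "\<And>g l i. i < N \<Longrightarrow> g i \<noteq> 0 \<Longrightarrow> (\<Sum>i<N. g i) = 0 \<Longrightarrow>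
        (\<And>i. i < N \<Longrightarrow> (\<Sum>j<N. A $$ (i, j) * g j) = l * g i) \<Longrightarrow> l \<le> L"
    and att: "i0 < N" "w i0 \<noteq> 0" "(\<Sum>i<N. w i) = 0" "\<And>i. i < N \<Longrightarrow> (\<Sum>j<N. A $$ (i, j) * w j) = L * w i"
    and d: "L \<le> d"
  shows "second_eigenvalue A = L"
proof -
  obtain n where N: "N = Suc n" using att(1) by (cases N) auto
  \<comment> \<open>\<open>B\<close> is the action on vectors of sum zero in the coordinates other
    than 0; the entry at 0 is minus the sum of these.\<close>
  define B where "B = mat n n (\<lambda>(i, j). A $$ (Suc i, Suc j) - A $$ (Suc i, 0))"
  have Bc: "B \<in> carrier_mat n n" by (simp add: B_def)
  have shift: "(\<Sum>j<N. h j) = h 0 + (\<Sum>j<n. h (Suc j))" for h :: "nat \<Rightarrow> real"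
    unfolding N by (rule sum.lessThan_Suc_shift)
  \<comment> \<open>By symmetry of \<open>A\<close> the factor found by conjugation is the transpose
    of \<open>B\<close>, which has the same characteristic polynomial.\<close>
  have "mat n n (\<lambda>(i, j). A $$ (Suc i, Suc j) - A $$ (0, Suc j)) = transpose_mat B"
    by (rule eq_matI) (use sym in \<open>auto simp: B_def N\<close>)
  then have cp: "char_poly A = [:- d, 1:] * char_poly B"
    using char_poly_const_row_sum[OF A[unfolded N], of d] row Bc by (simp add: N)
  have eqv: "(B *\<^sub>v u) $ i = (\<Sum>j<N. A $$ (Suc i, j) * g j)"
    if "u \<in> carrier_vec n" "i < n" "\<And>j. j < n \<Longrightarrow> g (Suc j) = u $ j" "(\<Sum>j<N. g j) = 0" for u g i
  proof -
    have "g 0 = - (\<Sum>j<n. g (Suc j))" using that(4) unfolding shift by simp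
    moreover have "(B *\<^sub>v u) $ i = (\<Sum>j<n. (A $$ (Suc i, Suc j) - A $$ (Suc i, 0)) * g (Suc j))"
      using that(1-3) by (simp add: B_def scalar_prod_def atLeast0LessThan)
    ultimately show ?thesis unfolding shift
      by (simp add: left_diff_distrib sum_subtractf sum_distrib_left)
  qed
  have total: "(\<Sum>i<N. \<Sum>j<N. A $$ (i, j) * g j) = d * (\<Sum>j<N. g j)" for g
  proof -
    have "(\<Sum>i<N. \<Sum>j<N. A $$ (i, j) * g j) = (\<Sum>j<N. (\<Sum>i<N. A $$ (j, i)) * g j)"
      unfolding sum_distrib_right by (subst sum.swap) (intro sum.cong; simp add: sym)
    then show ?thesis by (simp add: row sum_distrib_left)
  qed
  have roots: "x \<le> L" if "poly (char_poly B) x = 0" for x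
  proof -
    have "eigenvalue B x" using that eigenvalue_root_char_poly[OF Bc] by simp
    then obtain u where u: "u \<in> carrier_vec n" "u \<noteq> 0\<^sub>v n" "B *\<^sub>v u = x \<cdot>\<^sub>v u"
      using Bc by (auto simp: eigenvalue_def eigenvector_def)
    define g where "g j = (case j of 0 \<Rightarrow> - (\<Sum>l<n. u $ l) | Suc l \<Rightarrow> u $ l)" for j
    have g: "g 0 = - (\<Sum>l<n. u $ l)" "g (Suc j) = u $ j" for j by (simp_all add: g_def)
    have g0: "(\<Sum>j<N. g j) = 0" unfolding shift by (simp add: g)
    obtain j where "j < n" "u $ j \<noteq> 0" using u(1,2) by (metis eq_vecI carrier_vecD index_zero_vec)
    show "x \<le> L"
    proof (rule bound[of "Suc j" g])
      have S: "(\<Sum>j<N. A $$ (Suc i, j) * g j) = x * g (Suc i)" if "i < n" for i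
        using eqv[OF u(1) that _ g0] u(1,3) that by (simp add: g)
      \<comment> \<open>\<open>B\<close> gives the eigenvalue equation in all rows except row 0. The
        missing equation follows because the entries of \<open>A g\<close> add up to
        \<open>d\<close> times the sum of \<open>g\<close>, which is zero.\<close>
      have "(\<Sum>j<N. A $$ (0, j) * g j) + (\<Sum>i<n. x * g (Suc i)) = 0"
        using total[of g] g0 S unfolding shift[of "\<lambda>i. \<Sum>j<N. A $$ (i, j) * g j"] by simp
      then have "(\<Sum>j<N. A $$ (0, j) * g j) = x * g 0"
        by (simp add: g sum_distrib_left)
      then show "(\<Sum>j<N. A $$ (i, j) * g j) = x * g i" if "i < N" for i
        using S that by (cases i) (auto simp: N)
    qed (use \<open>j < n\<close> \<open>u $ j \<noteq> 0\<close> g0 in \<open>auto simp: N g\<close>)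
  qed
  have rootL: "poly (char_poly B) L = 0"
  proof -
    define u where "u = vec n (\<lambda>j. w (Suc j))"
    have u: "u \<in> carrier_vec n" "j < n \<Longrightarrow> u $ j = w (Suc j)" for j by (simp_all add: u_def)
    have "B *\<^sub>v u = L \<cdot>\<^sub>v u"
    proof (rule eq_vecI)
      show "(B *\<^sub>v u) $ i = (L \<cdot>\<^sub>v u) $ i" if "i < dim_vec (L \<cdot>\<^sub>v u)" for i
        using that u eqv[OF u(1), of i w] att(3,4) by (simp add: N)
    qed (use u Bc in auto)
    moreover have "u \<noteq> 0\<^sub>v n"
    proof
      assume "u = 0\<^sub>v n"
      then have z: "w (Suc j) = 0" if "j < n" for j using u(2)[OF that] that by simp
      then have "w 0 = 0" using att(3) unfolding shift by simp
      then show False using att(1,2) z by (cases i0) (auto simp: N)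
    qed
    ultimately have "eigenvalue B L" using u(1) Bc by (auto simp: eigenvalue_def eigenvector_def)
    then show ?thesis using eigenvalue_root_char_poly[OF Bc] by simp
  qed
  have nz: "char_poly B \<noteq> 0" using degree_monic_char_poly[OF Bc] by auto
  define M where "M = proots (char_poly B)"
  have M: "set_mset M = {x. poly (char_poly B) x = 0}" unfolding M_def by (rule set_count_proots[OF nz])
  have class_val: "proots (char_poly A) = add_mset d M"
    unfolding cp M_def using nz by (subst proots_mult) auto
  obtain M' where M': "M = add_mset L M'" using M rootL by (metis mem_Collect_eq multi_member_split)
  have le: "x \<le> L" if "x \<in># M" for x using that M roots by auto
  have "sorted_list_of_multiset M = sorted_list_of_multiset M' @ [L]"
    unfolding M' sorted_list_of_multiset_insert
    by (rule sorted_insort_is_snoc) (use le M' in auto)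
  moreover have "sorted_list_of_multiset (add_mset d M) = sorted_list_of_multiset M @ [d]"
    unfolding sorted_list_of_multiset_insert
    by (rule sorted_insort_is_snoc) (use le d in force)+
  ultimately show ?thesis
    by (simp add: second_eigenvalue_def eigenvalues_desc_def class_val One_nat_def)
qed

lemma second_eigenvalue_list:
  fixes a :: "'v \<Rightarrow> 'v \<Rightarrow> real"
  assumes vs: "distinct vs" "set vs = X"
    and A: "A = mat (length vs) (length vs) (\<lambda>(i, j). a (vs ! i) (vs ! j))"
    and sym: "\<And>x y. x \<in> X \<Longrightarrow> y \<in> X \<Longrightarrow> a x y = a y x" and row: "\<And>x. x \<in> X \<Longrightarrow> (\<Sum>y\<in>X. a x y) = d"
    and bound: "\<And>f l x. x \<in> X \<Longrightarrow> f x \<noteq> 0 \<Longrightarrow> (\<Sum>x\<in>X. f x) = 0 \<Longrightarrow>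
        (\<And>x. x \<in> X \<Longrightarrow> (\<Sum>y\<in>X. a x y * f y) = l * f x) \<Longrightarrow> l \<le> L"
    and att: "x0 \<in> X" "f0 x0 \<noteq> 0" "(\<Sum>x\<in>X. f0 x) = 0" "\<And>x. x \<in> X \<Longrightarrow> (\<Sum>y\<in>X. a x y * f0 y) = L * f0 x"
    and d: "L \<le> d"
  shows "second_eigenvalue A = L"
proof -
  let ?N = "length vs"
  have bij: "bij_betw (nth vs) {..<?N} X" using bij_betw_nth[OF vs(1) refl vs(2)[symmetric]] .
  have S: "(\<Sum>i<?N. h (vs ! i)) = (\<Sum>x\<in>X. h x)" for h :: "'v \<Rightarrow> real"
    by (rule sum.reindex_bij_betw[OF bij])
  have ix: "vs ! i \<in> X" if "i < ?N" for i using that vs(2) by auto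
  have ent: "A $$ (i, j) = a (vs ! i) (vs ! j)" if "i < ?N" "j < ?N" for i j using that by (simp add: A)
  obtain i0 where i0: "i0 < ?N" "vs ! i0 = x0" using att(1) vs(2) by (auto simp: in_set_conv_nth)
  show ?thesis
  proof (rule second_eigenvalue_index[where N = ?N and w = "\<lambda>i. f0 (vs ! i)" and d = d])
    show "A \<in> carrier_mat ?N ?N" by (simp add: A)
    show "A $$ (i, j) = A $$ (j, i)" if "i < ?N" "j < ?N" for i j using that sym ix by (simp add: ent)
    show "(\<Sum>j<?N. A $$ (i, j)) = d" if "i < ?N" for i
      using that row[OF ix[OF that]] S[of "a (vs ! i)"] by (simp add: ent)
    show "i0 < ?N" "f0 (vs ! i0) \<noteq> 0" "(\<Sum>i<?N. f0 (vs ! i)) = 0"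
      using i0 att S[of f0] by auto
    show "(\<Sum>j<?N. A $$ (i, j) * f0 (vs ! j)) = L * f0 (vs ! i)" if "i < ?N" for i
      using that att(4)[OF ix[OF that]] S[of "\<lambda>y. a (vs ! i) y * f0 y"] by (simp add: ent)
    show "L \<le> d" by (rule d)
    fix g :: "nat \<Rightarrow> real" and l i
    assume g: "i < ?N" "g i \<noteq> 0" "(\<Sum>i<?N. g i) = 0" "\<And>i. i < ?N \<Longrightarrow> (\<Sum>j<?N. A $$ (i, j) * g j) = l * g i"
    define f where "f x = g (inv_into {..<?N} (nth vs) x)" for x
    have f: "f (vs ! j) = g j" if "j < ?N" for j
      unfolding f_def using bij that by (simp add: bij_betw_inv_into_left)
    show "l \<le> L"
    proof (rule bound[of "vs ! i" f])
      show "(\<Sum>x\<in>X. f x) = 0" using S[of f] g(3) by (simp add: f)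
      show "(\<Sum>y\<in>X. a x y * f y) = l * f x" if "x \<in> X" for x
      proof -
        obtain k where k: "k < ?N" "x = vs ! k" using \<open>x \<in> X\<close> vs(2) by (auto simp: in_set_conv_nth)
        then show ?thesis using S[of "\<lambda>y. a x y * f y"] g(4)[of k] by (simp add: f ent)
      qed
    qed (use g f ix in auto)
  qed
qed

section \<open>Induction on the number of points\<close>

lemma Tc_remove: "Tc i (A - {z}) K = {\<tau> \<in> Tc i A K. z \<notin> supp \<tau>}"
  and Tc_insert: "Tc i A (insert z K) = {\<tau> \<in> Tc i A K. z \<in> supp \<tau>}"
  by (auto simp: Tc_def)

text \<open>Double counting: an element is counted once for each point of \<open>A\<close> that it
  fixes, and these points all lie outside \<open>K\<close>.\<close>

lemma sum_Tc_remove: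
  fixes g :: "(nat \<Rightarrow> nat) \<Rightarrow> real"
  assumes "finite A" "K \<subseteq> A" "msz i \<le> card A"
  shows "(\<Sum>z\<in>A - K. sum g (Tc i (A - {z}) K)) = real (card A - msz i) * sum g (Tc i A K)"
proof -
  have "(\<Sum>z\<in>A - K. sum g (Tc i (A - {z}) K)) = (\<Sum>\<tau>\<in>Tc i A K. \<Sum>z\<in>{z \<in> A - K. z \<notin> supp \<tau>}. g \<tau>)"
    unfolding Tc_remove by (rule sum.swap_restrict) (use assms finite_Tc in auto)
  also have "\<dots> = (\<Sum>\<tau>\<in>Tc i A K. real (card A - msz i) * g \<tau>)"
  proof (rule sum.cong)
    fix \<tau> assume "\<tau> \<in> Tc i A K"
    then have t: "\<tau> \<in> cls i" "K \<subseteq> supp \<tau>" "supp \<tau> \<subseteq> A" by (auto simp: Tc_def)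
    then have "{z \<in> A - K. z \<notin> supp \<tau>} = A - supp \<tau>" by auto
    then have "card {z \<in> A - K. z \<notin> supp \<tau>} = card A - msz i"
      using t assms finite_supp_cls[OF t(1)] by (simp add: card_Diff_subset card_supp_cls)
    then show "(\<Sum>z\<in>{z \<in> A - K. z \<notin> supp \<tau>}. g \<tau>) = real (card A - msz i) * g \<tau>" by simp
  qed simp
  finally show ?thesis by (simp add: sum_distrib_left)
qed

lemma sum_Tc_insert:
  fixes g :: "(nat \<Rightarrow> nat) \<Rightarrow> real"
  assumes "finite A" "K \<subseteq> A"
  shows "(\<Sum>z\<in>A - K. sum g (Tc i A (insert z K))) = real (msz i - card K) * sum g (Tc i A K)"
proof -
  have fK: "finite K" using assms finite_subset by auto
  have "(\<Sum>z\<in>A - K. sum g (Tc i A (insert z K))) = (\<Sum>\<tau>\<in>Tc i A K. \<Sum>z\<in>{z \<in> A - K. z \<in> supp \<tau>}. g \<tau>)"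
    unfolding Tc_insert by (rule sum.swap_restrict) (use assms finite_Tc in auto)
  also have "\<dots> = (\<Sum>\<tau>\<in>Tc i A K. real (msz i - card K) * g \<tau>)"
  proof (rule sum.cong)
    fix \<tau> assume "\<tau> \<in> Tc i A K"
    then have t: "\<tau> \<in> cls i" "K \<subseteq> supp \<tau>" "supp \<tau> \<subseteq> A" by (auto simp: Tc_def)
    then have "{z \<in> A - K. z \<in> supp \<tau>} = supp \<tau> - K" by auto
    then have "card {z \<in> A - K. z \<in> supp \<tau>} = msz i - card K"
      using t fK by (simp add: card_Diff_subset card_supp_cls)
    then show "(\<Sum>z\<in>{z \<in> A - K. z \<in> supp \<tau>}. g \<tau>) = real (msz i - card K) * g \<tau>" by simp
  qed simp
  finally show ?thesis by (simp add: sum_distrib_left)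
qed

text \<open>Both terms of \<open>mu\<close> satisfy Pascal's rule, so the bound is additive along
  the splitting of a class at a point outside \<open>K\<close>.\<close>

lemma mu_Suc:
  assumes "k + 3 \<le> Suc a"
  shows "mu i (Suc a) k = mu i a k + mu i (Suc a) (k + 1)"
proof -
  have 1: "subset_card (msz i) a k = subset_card (msz i) (a - 1) k + subset_card (msz i) a (Suc k)"
    by (rule subset_card_Suc) (use assms in linarith)
  have 2: "subset_card (msz i) (Suc a) (k + 2) = subset_card (msz i) (Suc a - 1) (k + 2) + subset_card (msz i) (Suc a) (Suc (k + 2))"
    by (rule subset_card_Suc) (use assms in linarith)
  have "move_count i (Suc a) (k + 2) = move_count i a (k + 2) + move_count i (Suc a) (k + 1 + 2)"
    using 2 by (simp add: move_count_def distrib_left add_divide_distrib One_nat_def)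
  then show ?thesis using 1 by (simp add: mu_def distrib_left One_nat_def)
qed

context sym_group
begin

lemma bound_7_value_mu: "i \<in> {1..6} \<Longrightarrow> k \<le> 2 \<Longrightarrow> real_of_int (bound_7_value i k) = mu i 7 k"
proof -
  assume i: "i \<in> {1..6}" and "k \<le> 2"
  then have "k = 0 \<or> k = 1 \<or> k = 2" by auto
  then show ?thesis using i unfolding in_1_6
    by (elim disjE; simp only:; simp add: bound_7_value_def mu_poly[of 0, simplified, unfolded One_nat_def] One_nat_def)
qed

definition bounded :: "nat \<Rightarrow> nat \<Rightarrow> nat \<Rightarrow> bool" where
  "bounded i a k \<longleftrightarrow> (\<forall>A K f. A \<subseteq> N \<longrightarrow> K \<subseteq> A \<longrightarrow> card A = a \<longrightarrow> card K = k \<longrightarrow> f \<in> Gen A \<longrightarrow>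
     ip (sm (Tc i A K) f) f \<le> mu i a k * ip f f)"

lemma boundedD: "bounded i (card A) (card K) \<Longrightarrow> A \<subseteq> N \<Longrightarrow> K \<subseteq> A \<Longrightarrow> f \<in> Gen A \<Longrightarrow>
    ip (sm (Tc i A K) f) f \<le> mu i (card A) (card K) * ip f f"
  by (auto simp: bounded_def)

lemma Gen_V: "f \<in> Gen A \<Longrightarrow> f \<in> V"
  by (auto simp: Gen_def gen1_def)

lemma W_Gen: "f \<in> W A \<Longrightarrow> f \<in> Gen A" "f \<in> W A \<Longrightarrow> x \<in> A \<Longrightarrow> f \<in> Gen (A - {x})"
  by (auto simp: W_def)

lemma bounded_from_W:
  assumes "i \<in> {1..6}" "quotient_bounded i a k (mu i a k)"
    and "\<And>A K f. A \<subseteq> N \<Longrightarrow> K \<subseteq> A \<Longrightarrow> card A = a \<Longrightarrow> card K = k \<Longrightarrow> f \<in> W A \<Longrightarrow>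
        ip (sm (Tc i A K) f) f \<le> mu i a k * ip f f"
  shows "bounded i a k"
  unfolding bounded_def
proof (intro allI impI)
  fix A K f
  assume A: "A \<subseteq> N" "K \<subseteq> A" "card A = a" "card K = k" and f: "f \<in> Gen A"
  show "ip (sm (Tc i A K) f) f \<le> mu i a k * ip f f"
    by (rule bound_from_W[OF A(1,2) assms(1) _ _ f]) (use A assms in auto)
qed

text \<open>From \<open>msz i\<close> prescribed points on, \<open>mu i a k\<close> is the number of
  elements of the class part, so the trivial bound is enough.\<close>

lemma bounded_trivial:
  assumes i: "i \<in> {1..6}" and k: "msz i \<le> k"
  shows "bounded i a k"
  unfolding bounded_def
proof (intro allI impI)
  fix A K f
  assume A: "A \<subseteq> N" "K \<subseteq> A" "card A = a" "card K = k" and f: "f \<in> Gen A"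
  have "finite A" using A(1) finN finite_subset by blast
  then have "real (card (Tc i A K)) = mu i a k"
    using card_Tc[OF _ A(2) i] A(3,4) k by (simp add: mu_def move_count_def subset_card_def)
  then show "ip (sm (Tc i A K) f) f \<le> mu i a k * ip f f"
    using quadratic_trivial_bound[OF Tc_G[OF A(1), of i K] Gen_V[OF f]] by simp
qed

text \<open>By \<open>bounded_from_W\<close> only functions in \<open>W A\<close> remain. They are
  generic on \<open>A\<close> and on \<open>A - {z}\<close>, so both parts of the splitting at
  \<open>z\<close> fall under the assumptions.\<close>

lemma bounded_step:
  assumes i: "i \<in> {1..6}" and b: "bounded i a k" "bounded i (Suc a) (k + 1)" and k: "k < msz i" and a: "7 \<le> Suc a"
  shows "bounded i (Suc a) k"
proof (rule bounded_from_W[OF i quotient_bounded_mu[OF i k a]])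
  fix A K f
  assume A: "A \<subseteq> N" "K \<subseteq> A" "card A = Suc a" "card K = k" and f: "f \<in> W A"
  have fA: "finite A" using A(1) finN finite_subset by blast
  have ka: "k + 3 \<le> Suc a" using k a by (auto simp: msz_def split: if_splits)
  then have "K \<noteq> A" using A by auto
  then obtain z where z: "z \<in> A" "z \<notin> K" using A(2) by blast
  have fK: "finite K" using fA A(2) finite_subset by blast
  have "sm (Tc i A K) f = (\<lambda>\<sigma>. sm (Tc i (A - {z}) K) f \<sigma> + sm (Tc i A (insert z K)) f \<sigma>)"
    using sm_Tc_split[OF fA] by (intro ext)
  then have "ip (sm (Tc i A K) f) f = ip (sm (Tc i (A - {z}) K) f) f + ip (sm (Tc i A (insert z K)) f) f"
    by (simp only: ip_add)
  also have "ip (sm (Tc i (A - {z}) K) f) f \<le> mu i a k * ip f f"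
  proof -
    have c: "card (A - {z}) = a" using z A(3) by simp
    show ?thesis using boundedD[of i "A - {z}" K f] b(1) A W_Gen(2)[OF f z(1)] z c by auto
  qed
  also have "ip (sm (Tc i A (insert z K)) f) f \<le> mu i (Suc a) (k + 1) * ip f f"
  proof -
    have c: "card (insert z K) = k + 1" using z fK A(4) by simp
    show ?thesis using boundedD[of i A "insert z K" f] b(2) A W_Gen(1)[OF f] z c by auto
  qed
  finally show "ip (sm (Tc i A K) f) f \<le> mu i (Suc a) k * ip f f"
    unfolding mu_Suc[OF ka] by (simp add: distrib_right)
qed

lemma ip_average:
  assumes "\<And>\<sigma>. (\<Sum>z\<in>Z. sm (S z) f \<sigma>) = c * sm T f \<sigma>" and "\<And>z. z \<in> Z \<Longrightarrow> ip (sm (S z) f) f \<le> b * ip f f"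
  shows "c * ip (sm T f) f \<le> real (card Z) * b * ip f f"
proof -
  have "c * ip (sm T f) f = (\<Sum>z\<in>Z. ip (sm (S z) f) f)"
    unfolding ip_scale(1)[symmetric] ip_sum_left[symmetric] assms(1) ..
  also have "\<dots> \<le> (\<Sum>z\<in>Z. b * ip f f)" by (rule sum_mono) (rule assms(2))
  finally show ?thesis by simp
qed

text \<open>An element that moves four of six points, including \<open>K\<close>, fixes two of the
  three points outside \<open>K\<close>. Averaging over the removed point leads to five points with
  exactly two outside \<open>K\<close>, at the cost of a factor 3/2.\<close>

lemma bounded_6_3_34:
  assumes i: "i \<in> {3, 4}"
  shows "bounded i 6 3"
proof (rule bounded_from_W)
  show "quotient_bounded i 6 3 (mu i 6 3)" using quotient_bounded_mu_6(1)[of i] i by auto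
  fix A K f
  assume A: "A \<subseteq> N" "K \<subseteq> A" "card A = 6" "card K = 3" and f: "f \<in> W A"
  have fA: "finite A" using A(1) finN finite_subset by blast
  have fK: "finite K" using fA A(2) finite_subset by blast
  let ?b = "of_int (if i = 3 then 4 else 6) :: real"
  have m: "card A - msz i = 2" "msz i \<le> card A" using i A(3) by (auto simp: msz_def)
  have "real 2 * ip (sm (Tc i A K) f) f \<le> real (card (A - K)) * ?b * ip f f"
  proof (rule ip_average)
    show "(\<Sum>z\<in>A - K. sm (Tc i (A - {z}) K) f \<sigma>) = real 2 * sm (Tc i A K) f \<sigma>" for \<sigma>
      using sum_Tc_remove[OF fA A(2) m(2), of "\<lambda>\<tau>. f (\<sigma> \<circ> \<tau>)"] m(1) by (simp add: sm_def)
    show "ip (sm (Tc i (A - {z}) K) f) f \<le> ?b * ip f f" if "z \<in> A - K" for z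
      by (rule bound_5) (use that A i W_Gen(2)[OF f] in auto)
  qed
  moreover have "card (A - K) = 3" using A fK by (simp add: card_Diff_subset)
  ultimately have "ip (sm (Tc i A K) f) f \<le> (3 / 2 * ?b) * ip f f" by simp
  also have "\<dots> \<le> mu i 6 3 * ip f f"
    by (rule mult_right_mono) (use i ip_nonneg in \<open>auto simp: quotient_bounded_mu_6(3,4)\<close>)
  finally show "ip (sm (Tc i A K) f) f \<le> mu i 6 3 * ip f f" .
qed (use i in auto)

lemma bounded_6_4_56:
  assumes i: "i \<in> {5, 6}"
  shows "bounded i 6 4"
proof (rule bounded_from_W)
  show "quotient_bounded i 6 4 (mu i 6 4)" using quotient_bounded_mu_6(2)[OF i] .
  fix A K f
  assume A: "A \<subseteq> N" "K \<subseteq> A" "card A = 6" "card K = 4" and f: "f \<in> W A"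
  have "ip (sm (Tc i A K) f) f \<le> of_int (if i = 5 then 10 else 8) * ip f f"
    by (rule bound_6[OF A(1,3,2,4) i f])
  also have "\<dots> \<le> mu i 6 4 * ip f f"
    by (rule mult_right_mono) (use i ip_nonneg in \<open>auto simp: quotient_bounded_mu_6(7,8)\<close>)
  finally show "ip (sm (Tc i A K) f) f \<le> mu i 6 4 * ip f f" .
qed (use i in auto)

text \<open>Here every element moves two of the three points outside \<open>K\<close>, so the
  average prescribes one more point instead of removing one; the factor is again 3/2.\<close>

lemma bounded_6_3_56:
  assumes i: "i \<in> {5, 6}"
  shows "bounded i 6 3"
proof (rule bounded_from_W)
  show "quotient_bounded i 6 3 (mu i 6 3)" using quotient_bounded_mu_6(1)[of i] i by auto
  fix A K f
  assume A: "A \<subseteq> N" "K \<subseteq> A" "card A = 6" "card K = 3" and f: "f \<in> W A"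
  have fA: "finite A" using A(1) finN finite_subset by blast
  have fK: "finite K" using fA A(2) finite_subset by blast
  let ?b = "of_int (if i = 5 then 10 else 8) :: real"
  have m: "msz i - card K = 2" using i A(4) by (auto simp: msz_def)
  have "real 2 * ip (sm (Tc i A K) f) f \<le> real (card (A - K)) * ?b * ip f f"
  proof (rule ip_average)
    show "(\<Sum>z\<in>A - K. sm (Tc i A (insert z K)) f \<sigma>) = real 2 * sm (Tc i A K) f \<sigma>" for \<sigma>
      using sum_Tc_insert[OF fA A(2), of "\<lambda>\<tau>. f (\<sigma> \<circ> \<tau>)" i] m by (simp add: sm_def)
    show "ip (sm (Tc i A (insert z K)) f) f \<le> ?b * ip f f" if "z \<in> A - K" for z
      by (rule bound_6[OF A(1,3) _ _ i f]) (use that A fK in auto)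
  qed
  moreover have "card (A - K) = 3" using A fK by (simp add: card_Diff_subset)
  ultimately have "ip (sm (Tc i A K) f) f \<le> (3 / 2 * ?b) * ip f f" by simp
  also have "\<dots> \<le> mu i 6 3 * ip f f"
    by (rule mult_right_mono) (use i ip_nonneg in \<open>auto simp: quotient_bounded_mu_6(5,6)\<close>)
  finally show "ip (sm (Tc i A K) f) f \<le> mu i 6 3 * ip f f" .
qed (use i in auto)

lemma bounded_6:
  assumes i: "i \<in> {1..6}" and k: "3 \<le> k"
  shows "bounded i 6 k"
proof (cases "msz i \<le> k")
  case False
  then have "i \<in> {3, 4} \<and> k = 3 \<or> i \<in> {5, 6} \<and> k = 3 \<or> i \<in> {5, 6} \<and> k = 4"
    using k i unfolding in_1_6 by (auto simp: msz_def split: if_splits)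
  then show ?thesis using bounded_6_3_34 bounded_6_3_56 bounded_6_4_56 by blast
qed (rule bounded_trivial[OF i])

text \<open>The finite check covers at most two prescribed points. For more, \<open>k\<close>
  descends from the range where the bound is trivial, and each step refers only to six points with
  \<open>k >= 3\<close>.\<close>

lemma bounded_7:
  assumes i: "i \<in> {1..6}"
  shows "bounded i 7 k"
proof (cases "k \<le> 2")
  case True
  then show ?thesis
    unfolding bounded_def using bound_7[OF _ _ _ _ i] bound_7_value_mu[OF i] by auto
next
  case False
  then have "3 \<le> k" by simp
  then show ?thesis
  proof (induction "5 - k" arbitrary: k rule: less_induct)
    case less
    show ?case
    proof (cases "msz i \<le> k")
      case False
      then have "k < 5" by (auto simp: msz_def split: if_splits)
      then have "bounded i 7 (k + 1)" using less by simp
      moreover have "bounded i 6 k" by (rule bounded_6[OF i less.prems])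
      ultimately show ?thesis using bounded_step[OF i, of 6 k] False by simp
    qed (rule bounded_trivial[OF i])
  qed
qed

lemma bounded_all:
  assumes i: "i \<in> {1..6}" and a: "7 \<le> a"
  shows "bounded i a k"
  using a
proof (induction a arbitrary: k rule: dec_induct)
  case base
  show ?case by (rule bounded_7[OF i])
next
  case (step a)
  show ?case
  proof (induction "5 - k" arbitrary: k rule: less_induct)
    case less
    show ?case
    proof (cases "msz i \<le> k")
      case False
      then have "k < 5" by (auto simp: msz_def split: if_splits)
      then have "bounded i (Suc a) (k + 1)" using less by simp
      then show ?thesis using bounded_step[OF i step.IH, of k] False step.hyps by simp
    qed (rule bounded_trivial[OF i])
  qed
qed

end

text \<open>
  Let \<open>q i = class_card i - mu i\<close> for classes of sign 1 and \<open>p i = class_card i + mu i\<close> for sign -1.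
  The condition is what makes the sum of the \<open>q i\<close> at most that of the \<open>p i\<close>.
\<close>

definition admissible :: "nat set \<Rightarrow> bool" where
  "admissible I \<longleftrightarrow> I \<subseteq> {1..6} \<and>
     (if 5 \<in> I then 1 \<in> I \<or> 4 \<in> I \<or> \<not> {2, 3, 6} \<subseteq> I
      else 6 \<notin> I \<and> (4 \<in> I \<or> 1 \<in> I \<and> 3 \<notin> I))"

lemma admissibleI:
  assumes "I \<noteq> {}" and sub: "I \<subseteq> {1, 2, 3, 4, 5, 6}"
    and n1: "I \<notin> {{2}, {3}, {6}, {2, 3}, {2, 6}, {3, 6}, {2, 3, 6}}" (is "I \<notin> ?S1")
    and n2: "I \<notin> {{1, 3}, {1, 6}, {4, 6}, {1, 2, 3}, {1, 2, 6}, {1, 3, 6}, {1, 4, 6},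
               {2, 4, 6}, {3, 4, 6}, {1, 2, 3, 6}, {1, 2, 4, 6}, {1, 3, 4, 6},
               {2, 3, 4, 6}, {2, 3, 5, 6}, {1, 2, 3, 4, 6}}" (is "I \<notin> ?S2")
  shows "admissible I"
proof -
  have eq: "I = J \<longleftrightarrow> (1 \<in> I \<longleftrightarrow> 1 \<in> J) \<and> (2 \<in> I \<longleftrightarrow> 2 \<in> J) \<and> (3 \<in> I \<longleftrightarrow> 3 \<in> J) \<and>
      (4 \<in> I \<longleftrightarrow> 4 \<in> J) \<and> (5 \<in> I \<longleftrightarrow> 5 \<in> J) \<and> (6 \<in> I \<longleftrightarrow> 6 \<in> J)" if "J \<subseteq> {1, 2, 3, 4, 5, 6}" for J
    using sub that by blast
  have "I \<subseteq> {1..6}" using sub by auto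
  moreover have "5 \<in> I \<Longrightarrow> 1 \<in> I \<or> 4 \<in> I \<or> 2 \<notin> I \<or> 3 \<notin> I \<or> 6 \<notin> I"
  proof (rule ccontr)
    assume "5 \<in> I" "\<not> (1 \<in> I \<or> 4 \<in> I \<or> 2 \<notin> I \<or> 3 \<notin> I \<or> 6 \<notin> I)"
    then have "I = {2, 3, 5, 6}" by (simp add: eq)
    then show False using n2 by simp
  qed
  moreover have "5 \<notin> I \<Longrightarrow> 6 \<notin> I \<and> (4 \<in> I \<or> 1 \<in> I \<and> 3 \<notin> I)"
  proof (rule ccontr)
    assume "5 \<notin> I" "\<not> (6 \<notin> I \<and> (4 \<in> I \<or> 1 \<in> I \<and> 3 \<notin> I))"
    then have "I \<in> {{}} \<union> ?S1 \<union> ?S2"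
      by (cases "1 \<in> I"; cases "2 \<in> I"; cases "3 \<in> I"; cases "4 \<in> I"; cases "6 \<in> I"; simp add: eq)
    then show False using assms(1) n1 n2 by blast
  qed
  ultimately show ?thesis by (auto simp: admissible_def)
qed

text \<open>\<open>P i\<close> is the surplus of class \<open>i\<close>, nonnegative for odd and
  nonpositive for even classes. By \<open>q\<close>, class 1 covers 2, class 4 covers 2 and 3, and
  class 5 covers any two of 2, 3, 6. With the help of class 1 or 4 class 5 covers all three, so
  admissibility provides a cover in every case.\<close>

lemma sign_bound:
  assumes I: "admissible I" and a: "a \<ge> 7"
  shows "(\<Sum>i\<in>I. of_int (eps i) * class_card i a k) \<le> (\<Sum>i\<in>I. mu i a k)"
proof -
  define P where "P i = mu i a k - of_int (eps i) * class_card i a k" for i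
  have e: "eps 1 = - 1" "eps 2 = 1" "eps 3 = 1" "eps 4 = - 1" "eps 5 = - 1" "eps 6 = 1"
    by (simp_all add: eps_def)
  have z: "P i = 0" if "i \<in> {2, 3, 6}" "msz i \<le> k" for i
  proof (cases "k = msz i")
    case True
    then show ?thesis using that(1) by (auto simp: P_def e mu_def class_card_def move_count_def subset_card_def)
  next
    case False
    then show ?thesis using that by (simp add: P_def mu_large class_card_large)
  qed
  have p: "0 \<le> P 1" "0 \<le> P 4" "0 \<le> P 5" "P 2 \<le> 0" "P 3 \<le> 0" "P 6 \<le> 0"
    using sign_count_nonneg[OF _ a, of _ k] unfolding P_def e in_1_6 by force+
  note zz = z[of 2, simplified msz_simps] z[of 3, simplified msz_simps] z[of 6, simplified msz_simps]
  have q: "0 \<le> P 1 + P 2" "0 \<le> P 4 + P 2 + P 3" "0 \<le> P 5 + P 2 + P 3" "0 \<le> P 5 + P 2 + P 6" "0 \<le> P 5 + P 3 + P 6"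
  proof -
    show "0 \<le> P 1 + P 2" using sign_count(1)[OF a, of k] p zz unfolding P_def e by (cases "k < 3") auto
    show "0 \<le> P 4 + P 2 + P 3" using sign_count(2)[OF a, of k] p zz unfolding P_def e by (cases "k < 4") auto
    show "0 \<le> P 5 + P 2 + P 3" using sign_count(3)[OF a, of k] p zz unfolding P_def e by (cases "k < 5") auto
    show "0 \<le> P 5 + P 2 + P 6" using sign_count(4)[OF a, of k] p zz unfolding P_def e by (cases "k < 5") auto
    show "0 \<le> P 5 + P 3 + P 6" using sign_count(5)[OF a, of k] p zz unfolding P_def e by (cases "k < 5") auto
  qed
  have I6: "I = {i \<in> {1, 2, 3, 4, 5, 6}. i \<in> I}" using I by (auto simp: admissible_def)
  have "sum P I = (\<Sum>i\<in>{1, 2, 3, 4, 5, 6}. if i \<in> I then P i else 0)"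
    by (subst I6, rule sum.inter_filter) simp
  then have "sum P I = (if 1 \<in> I then P 1 else 0) + (if 2 \<in> I then P 2 else 0) + (if 3 \<in> I then P 3 else 0) +
      (if 4 \<in> I then P 4 else 0) + (if 5 \<in> I then P 5 else 0) + (if 6 \<in> I then P 6 else 0)" by simp
  moreover have "(5 \<in> I \<and> (1 \<in> I \<or> 4 \<in> I \<or> 2 \<notin> I \<or> 3 \<notin> I \<or> 6 \<notin> I)) \<or>
      5 \<notin> I \<and> 6 \<notin> I \<and> (4 \<in> I \<or> 1 \<in> I \<and> 3 \<notin> I)"
    using I by (auto simp: admissible_def split: if_splits)
  ultimately have "0 \<le> sum P I" using p q by (auto split: if_splits)
  then show ?thesis by (simp add: P_def sum_subtractf)
qed

section \<open>Unions of classes and the eigenvalue bound\<close>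

lemma Tc_disjoint:
  assumes "i \<noteq> j" "i \<in> {1..6}" "j \<in> {1..6}"
  shows "Tc i A K \<inter> Tc j B L = {}"
proof -
  have "msz i = msz j \<and> eps i = eps j" if "\<tau> \<in> Tc i A K" "\<tau> \<in> Tc j B L" for \<tau>
    using that card_supp_cls[of \<tau>] sign_cls[of \<tau>] unfolding Tc_def by (metis (mono_tags, lifting) mem_Collect_eq)
  moreover have "\<not> (msz i = msz j \<and> eps i = eps j)"
    using assms unfolding in_1_6 by (elim disjE) (simp_all add: msz_def eps_def)
  ultimately show ?thesis by blast
qed

definition class_union :: "nat set \<Rightarrow> nat set \<Rightarrow> nat set \<Rightarrow> (nat \<Rightarrow> nat) set" where
  "class_union I A K = (\<Union>i\<in>I. Tc i A K)"

lemma sum_class_union: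
  fixes g :: "(nat \<Rightarrow> nat) \<Rightarrow> real"
  assumes "I \<subseteq> {1..6}" "finite A"
  shows "sum g (class_union I A K) = (\<Sum>i\<in>I. sum g (Tc i A K))"
  unfolding class_union_def
proof (rule sum.UNION_disjoint)
  show "\<forall>i\<in>I. \<forall>j\<in>I. i \<noteq> j \<longrightarrow> Tc i A K \<inter> Tc j A K = {}"
    by (intro ballI impI Tc_disjoint) (use assms(1) in blast)+
qed (use assms in \<open>auto intro: finite_Tc finite_subset\<close>)

lemma finite_class_union: "I \<subseteq> {1..6} \<Longrightarrow> finite A \<Longrightarrow> finite (class_union I A K)"
  unfolding class_union_def by (auto intro: finite_Tc finite_subset)

lemma inv_class_union: "\<tau> \<in> class_union I A K \<Longrightarrow> pinv \<tau> \<in> class_union I A K"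
  by (auto simp: class_union_def intro: inv_Tc)

lemma class_union_permutes: "\<tau> \<in> class_union I A K \<Longrightarrow> \<tau> permutes A"
  by (auto simp: class_union_def intro: Tc_permutes)

lemma card_class_union_filter:
  assumes "I \<subseteq> {1..6}" "finite A"
  shows "real (card {\<tau> \<in> class_union I A K. P \<tau>}) = (\<Sum>i\<in>I. real (card {\<tau> \<in> Tc i A K. P \<tau>}))"
proof -
  have c: "real (card {\<tau> \<in> S. P \<tau>}) = (\<Sum>\<tau>\<in>S. if P \<tau> then 1 else 0)" if "finite S" for S
    using that by (simp add: sum.inter_filter[symmetric])
  show ?thesis
    unfolding c[OF finite_class_union[OF assms]] sum_class_union[OF assms] using assms by (intro sum.cong) (auto simp: c finite_Tc)
qed

lemma card_class_union:
  assumes "I \<subseteq> {1..6}" "finite A" "K \<subseteq> A"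
  shows "real (card (class_union I A K)) = (\<Sum>i\<in>I. class_card i (card A) (card K))"
proof -
  have "real (card (class_union I A K)) = (\<Sum>i\<in>I. real (card (Tc i A K)))"
    using card_class_union_filter[OF assms(1,2), of K "\<lambda>_. True"] by simp
  also have "\<dots> = (\<Sum>i\<in>I. class_card i (card A) (card K))"
    by (rule sum.cong) (use assms card_Tc[OF assms(2,3)] in \<open>auto simp: class_card_def\<close>)
  finally show ?thesis .
qed

definition union_move_count :: "nat set \<Rightarrow> nat set \<Rightarrow> nat set \<Rightarrow> nat \<Rightarrow> nat \<Rightarrow> real" where
  "union_move_count I A K w z = real (card {\<tau> \<in> class_union I A K. \<tau> w = z})"

lemma union_move_count_move:
  assumes "I \<subseteq> {1..6}" "finite A" "K \<subseteq> A" "w \<in> A" "z \<in> A" "w \<noteq> z"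
  shows "union_move_count I A K w z = (\<Sum>i\<in>I. move_count i (card A) (card (insert w (insert z K))))"
  unfolding union_move_count_def card_class_union_filter[OF assms(1,2)]
  by (rule sum.cong) (use assms card_move_real in auto)

lemma union_move_count_fix:
  assumes "I \<subseteq> {1..6}" "finite A" "K \<subseteq> A" "z \<in> A" "z \<notin> K"
  shows "union_move_count I A K z z = (\<Sum>i\<in>I. real (full_support_card i) * real (subset_card (msz i) (card A - 1) (card K)))"
  unfolding union_move_count_def card_class_union_filter[OF assms(1,2)]
  by (rule sum.cong) (use assms card_fix_real in auto)

lemma union_move_count_sym:
  assumes "I \<subseteq> {1..6}" "finite A" "K \<subseteq> A" "w \<in> A" "z \<in> A"
  shows "union_move_count I A K w z = union_move_count I A K z w"
proof (cases "w = z")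
  case False
  then show ?thesis using union_move_count_move[OF assms(1-5)] union_move_count_move[OF assms(1-3,5,4)] by (simp add: insert_commute)
qed simp

lemma sum_union_move_count:
  assumes "I \<subseteq> {1..6}" "finite A" "w \<in> A"
  shows "(\<Sum>z\<in>A. union_move_count I A K w z * v z) = (\<Sum>\<tau>\<in>class_union I A K. v (\<tau> w))"
proof -
  have "(\<Sum>\<tau>\<in>class_union I A K. v (\<tau> w)) = (\<Sum>z\<in>A. \<Sum>\<tau>\<in>{\<tau> \<in> class_union I A K. \<tau> w = z}. v (\<tau> w))"
    using assms by (intro sum.group[symmetric] finite_class_union) (auto dest!: class_union_permutes simp: permutes_in_image)
  then show ?thesis by (simp add: union_move_count_def)
qed

context sym_group
begin

text \<open>Pulling back along \<open>\<sigma> \<mapsto> pinv \<sigma> x\<close> intertwines the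
  matrix on points with the operator on the group. Right translation by \<open>\<tau>\<close>
  becomes the action of \<open>pinv \<tau>\<close> on points, and the connection set is closed under
  inverses.\<close>

lemma lift_eigenvector:
  assumes I: "I \<subseteq> {1..6}" and K: "K \<subseteq> N" and x: "x \<in> N"
    and v: "\<And>y. y \<in> N \<Longrightarrow> (\<Sum>z\<in>N. union_move_count I N K y z * v z) = l * v y" "sum v N = 0" "y0 \<in> N" "v y0 \<noteq> 0"
  defines "f \<equiv> \<lambda>\<sigma>. if \<sigma> permutes N then v (pinv \<sigma> x) else 0"
  shows "f \<in> V" "sum f G = 0" "sm (class_union I N K) f = (\<lambda>\<sigma>. l * f \<sigma>)" "\<exists>\<sigma>\<in>G. f \<sigma> \<noteq> 0"
proof -
  show "f \<in> V" by (simp add: V_def f_def)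
  have TG: "\<tau> permutes N" if "\<tau> \<in> class_union I N K" for \<tau> using class_union_permutes[OF that] .
  show "sm (class_union I N K) f = (\<lambda>\<sigma>. l * f \<sigma>)"
  proof
    fix \<sigma>
    show "sm (class_union I N K) f \<sigma> = l * f \<sigma>"
    proof (cases "\<sigma> permutes N")
      case True
      have y: "pinv \<sigma> x \<in> N" using permutes_in_image[OF permutes_inv[OF True]] x by simp
      have "sm (class_union I N K) f \<sigma> = (\<Sum>\<tau>\<in>class_union I N K. v (pinv \<tau> (pinv \<sigma> x)))"
        unfolding sm_def
      proof (rule sum.cong)
        fix \<tau> assume "\<tau> \<in> class_union I N K"
        then have t: "\<tau> permutes N" by (rule TG)
        have "pinv (\<sigma> \<circ> \<tau>) = pinv \<tau> \<circ> pinv \<sigma>"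
          by (rule o_inv_distrib) (use t True permutes_bij in auto)
        then show "f (\<sigma> \<circ> \<tau>) = v (pinv \<tau> (pinv \<sigma> x))"
          using permutes_compose[OF t True] by (simp add: f_def)
      qed simp
      also have "\<dots> = (\<Sum>\<tau>\<in>class_union I N K. v (\<tau> (pinv \<sigma> x)))"
        by (rule sum.reindex_bij_witness[of _ pinv pinv])
          (auto intro: inv_class_union dest: TG simp: permutes_inv_inv)
      also have "\<dots> = l * v (pinv \<sigma> x)" using sum_union_move_count[OF I finN y, of K v] v(1)[OF y] by simp
      finally show ?thesis using True by (simp add: f_def)
    next
      case False
      then have "f (\<sigma> \<circ> \<tau>) = 0" if "\<tau> \<in> class_union I N K" for \<tau>
        using comp_in_G[OF TG[OF that], of \<sigma>] by (simp add: f_def)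
      then show ?thesis using False by (simp add: sm_def f_def)
    qed
  qed
  show "\<exists>\<sigma>\<in>G. f \<sigma> \<noteq> 0"
  proof
    show "transpose x y0 \<in> G" using x v(3) by (simp add: permutes_swap_id)
    then show "f (transpose x y0) \<noteq> 0" using v(4) by (simp add: f_def)
  qed
  show "sum f G = 0"
  proof -
    have 1: "sum f G = (\<Sum>\<sigma>\<in>G. v (\<sigma> x))"
      by (rule sum.reindex_bij_witness[of _ pinv pinv]) (auto simp: f_def permutes_inv_inv permutes_inv)
    have 2: "(\<Sum>\<sigma>\<in>G. v (\<sigma> z)) = (\<Sum>\<sigma>\<in>G. v (\<sigma> x))" if "z \<in> N" for z
      using sum_G_shift[of "transpose x z" "\<lambda>\<sigma>. v (\<sigma> x)"] permutes_swap_id[OF x that] by simp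
    have "(\<Sum>z\<in>N. \<Sum>\<sigma>\<in>G. v (\<sigma> z)) = (\<Sum>\<sigma>\<in>G. \<Sum>z\<in>N. v (\<sigma> z))" by (rule sum.swap)
    also have "\<dots> = (\<Sum>\<sigma>\<in>G. sum v N)"
    proof (rule sum.cong)
      show "(\<Sum>z\<in>N. v (\<sigma> z)) = sum v N" if "\<sigma> \<in> G" for \<sigma>
        using sum.permute[of \<sigma> N v] that by (simp add: comp_def)
    qed simp
    finally have "real (card N) * sum f G = 0" using v(2) by (simp add: 1 2)
    moreover have "card N \<noteq> 0" using x finN by auto
    ultimately show ?thesis by simp
  qed
qed

lemma ip_class_union:
  assumes "I \<subseteq> {1..6}"
  shows "ip (sm (class_union I N K) f) f = (\<Sum>i\<in>I. ip (sm (Tc i N K) f) f)"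
proof -
  have "sm (class_union I N K) f = (\<lambda>\<sigma>. \<Sum>i\<in>I. sm (Tc i N K) f \<sigma>)"
    by (simp add: sm_def fun_eq_iff sum_class_union[OF assms finN])
  then show ?thesis by (simp only: ip_sum_left)
qed

text \<open>Sum zero excludes the trivial constituent. If the sign constituent is absent too, the
  bounds of the classes add up. Otherwise projection to it identifies \<open>l\<close> as the sum of
  the signs over the connection set, which \<open>sign_bound\<close> estimates.\<close>

lemma eigenvalue_bound:
  assumes I: "admissible I" and n: "7 \<le> card N" and K: "K \<subseteq> N"
    and f: "f \<in> V" "\<sigma>0 \<in> G" "f \<sigma>0 \<noteq> 0" "sum f G = 0" and ev: "sm (class_union I N K) f = (\<lambda>\<sigma>. l * f \<sigma>)"
  shows "l \<le> (\<Sum>i\<in>I. mu i (card N) (card K))"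
proof (cases "f \<in> Gen N")
  case True
  have sub: "I \<subseteq> {1..6}" using I by (simp add: admissible_def)
  have "l * ip f f = (\<Sum>i\<in>I. ip (sm (Tc i N K) f) f)"
    using ip_class_union[OF sub, of K f] unfolding ev by (simp add: ip_scale)
  also have "\<dots> \<le> (\<Sum>i\<in>I. mu i (card N) (card K) * ip f f)"
    by (rule sum_mono) (use sub bounded_all[OF _ n] boundedD[OF _ subset_refl K True] in blast)
  finally have "l * ip f f \<le> (\<Sum>i\<in>I. mu i (card N) (card K)) * ip f f" by (simp add: sum_distrib_right)
  moreover have "ip f f > 0" using ip_pos[OF f(1)] f(3) by auto
  ultimately show ?thesis by simp
next
  case False
  have sub: "I \<subseteq> {1..6}" using I by (simp add: admissible_def)
  have "f \<in> gen1 False N"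
  proof -
    have "(\<Sum>\<tau>\<in>G. f (\<sigma> \<circ> \<tau>)) = 0" for \<sigma>
    proof (cases "\<sigma> permutes N")
      case True
      have "(\<Sum>\<tau>\<in>G. f (\<sigma> \<circ> \<tau>)) = sum f G"
        by (rule sum.reindex_bij_witness[of _ "\<lambda>\<tau>. pinv \<sigma> \<circ> \<tau>" "\<lambda>\<tau>. \<sigma> \<circ> \<tau>"])
          (use True permutes_inv_o[OF True] in \<open>auto simp: comp_assoc[symmetric] permutes_compose permutes_inv\<close>)
      then show ?thesis using f(4) by simp
    next
      case False
      then show ?thesis using f(1) comp_in_G by (simp add: V_def)
    qed
    then show ?thesis using f(1) by (simp add: gen1_def chr_def)
  qed
  then have "f \<notin> gen1 True N" using False by (simp add: Gen_def)
  then obtain \<sigma> where s: "(\<Sum>\<tau>\<in>G. chr True \<tau> * f (\<sigma> \<circ> \<tau>)) \<noteq> 0" using f(1) by (auto simp: gen1_def)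
  have perm: "permutation \<tau>" if "\<tau> permutes N" for \<tau> using that finN permutes_imp_permutation by blast
  have shift: "(\<Sum>\<tau>\<in>G. chr True \<tau> * f (\<sigma> \<circ> (\<tau> \<circ> \<rho>))) = chr True \<rho> * (\<Sum>\<tau>\<in>G. chr True \<tau> * f (\<sigma> \<circ> \<tau>))"
    if r: "\<rho> permutes N" for \<rho>
  proof -
    have "(\<Sum>\<tau>\<in>G. chr True \<tau> * f (\<sigma> \<circ> \<tau>)) = (\<Sum>\<tau>\<in>G. chr True (\<tau> \<circ> \<rho>) * f (\<sigma> \<circ> (\<tau> \<circ> \<rho>)))"
      by (rule sum_G_shift[OF r, symmetric])
    also have "\<dots> = (\<Sum>\<tau>\<in>G. chr True \<rho> * (chr True \<tau> * f (\<sigma> \<circ> (\<tau> \<circ> \<rho>))))"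
      by (rule sum.cong) (use perm r in \<open>auto simp: chr_comp mult_ac\<close>)
    finally have "chr True \<rho> * (\<Sum>\<tau>\<in>G. chr True \<tau> * f (\<sigma> \<circ> \<tau>)) =
        (chr True \<rho> * chr True \<rho>) * (\<Sum>\<tau>\<in>G. chr True \<tau> * f (\<sigma> \<circ> (\<tau> \<circ> \<rho>)))"
      by (simp only: sum_distrib_left mult.assoc)
    then show ?thesis by (simp add: chr_sq)
  qed
  have e: "l * f (\<sigma> \<circ> \<tau>) = (\<Sum>\<rho>\<in>class_union I N K. f (\<sigma> \<circ> (\<tau> \<circ> \<rho>)))" for \<tau>
    using fun_cong[OF ev, of "\<sigma> \<circ> \<tau>"] by (simp add: sm_def comp_assoc)
  have "l * (\<Sum>\<tau>\<in>G. chr True \<tau> * f (\<sigma> \<circ> \<tau>)) = (\<Sum>\<tau>\<in>G. chr True \<tau> * (l * f (\<sigma> \<circ> \<tau>)))"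
    unfolding sum_distrib_left by (simp only: mult.left_commute)
  also have "\<dots> = (\<Sum>\<tau>\<in>G. \<Sum>\<rho>\<in>class_union I N K. chr True \<tau> * f (\<sigma> \<circ> (\<tau> \<circ> \<rho>)))"
    unfolding e sum_distrib_left ..
  also have "\<dots> = (\<Sum>\<rho>\<in>class_union I N K. \<Sum>\<tau>\<in>G. chr True \<tau> * f (\<sigma> \<circ> (\<tau> \<circ> \<rho>)))" by (rule sum.swap)
  also have "\<dots> = (\<Sum>\<rho>\<in>class_union I N K. chr True \<rho> * (\<Sum>\<tau>\<in>G. chr True \<tau> * f (\<sigma> \<circ> \<tau>)))"
    by (rule sum.cong) (simp_all add: shift[OF class_union_permutes])
  also have "\<dots> = (\<Sum>\<rho>\<in>class_union I N K. chr True \<rho>) * (\<Sum>\<tau>\<in>G. chr True \<tau> * f (\<sigma> \<circ> \<tau>))"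
    by (rule sum_distrib_right[symmetric])
  finally have "l = (\<Sum>\<rho>\<in>class_union I N K. chr True \<rho>)" by (rule iffD1[OF mult_right_cancel[OF s]])
  also have "\<dots> = (\<Sum>i\<in>I. \<Sum>\<rho>\<in>Tc i N K. chr True \<rho>)" by (rule sum_class_union[OF sub finN])
  also have "\<dots> = (\<Sum>i\<in>I. of_int (eps i) * class_card i (card N) (card K))"
  proof (rule sum.cong)
    fix i assume i: "i \<in> I"
    have "(\<Sum>\<rho>\<in>Tc i N K. chr True \<rho>) = (\<Sum>\<rho>\<in>Tc i N K. of_int (eps i))"
      by (rule sum.cong) (auto simp: chr_def Tc_def sign_cls)
    also have "\<dots> = of_int (eps i) * class_card i (card N) (card K)"
      using card_Tc[OF finN K, of i] i sub by (auto simp: class_card_def)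
    finally show "(\<Sum>\<rho>\<in>Tc i N K. chr True \<rho>) = of_int (eps i) * class_card i (card N) (card K)" .
  qed simp
  finally show ?thesis using sign_bound[OF I n, of "card K"] by simp
qed

text \<open>In a row \<open>y\<close> other than \<open>p\<close> and \<open>q\<close> the entries
  at \<open>p\<close> and \<open>q\<close> agree, since both points lie outside \<open>K\<close>. In
  the rows \<open>p\<close> and \<open>q\<close> the diagonal entry minus the other one is the sum
  of the \<open>mu i\<close>.\<close>

lemma attained:
  assumes I: "I \<subseteq> {1..6}" and K: "K \<subseteq> N" and pq: "p \<in> N - K" "q \<in> N - K" "p \<noteq> q"
    and y: "y \<in> N"
  defines "v \<equiv> \<lambda>z. if z = p then 1 else if z = q then - 1 else (0::real)"
  shows "(\<Sum>z\<in>N. union_move_count I N K y z * v z) = (\<Sum>i\<in>I. mu i (card N) (card K)) * v y"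
proof -
  let ?D = "\<Sum>i\<in>I. real (full_support_card i) * real (subset_card (msz i) (card N - 1) (card K))"
  let ?r = "\<Sum>i\<in>I. move_count i (card N) (card K + 2)"
  have fK: "finite K" using finN K finite_subset by blast
  have D: "union_move_count I N K p p = ?D" "union_move_count I N K q q = ?D" using union_move_count_fix[OF I finN K] pq by auto
  have "card (insert p (insert q K)) = card K + 2" "card (insert q (insert p K)) = card K + 2" using pq fK by auto
  then have r: "union_move_count I N K p q = ?r" "union_move_count I N K q p = ?r" using union_move_count_move[OF I finN K, of p q] union_move_count_move[OF I finN K, of q p] pq by auto
  have mu: "(\<Sum>i\<in>I. mu i (card N) (card K)) = ?D - ?r" by (simp add: mu_def sum_subtractf)
  have "(\<Sum>z\<in>N. union_move_count I N K y z * v z) = (\<Sum>z\<in>N. (if z = p then union_move_count I N K y p else 0) - (if z = q then union_move_count I N K y q else 0))"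
    by (rule sum.cong) (use pq in \<open>auto simp: v_def\<close>)
  also have "\<dots> = union_move_count I N K y p - union_move_count I N K y q" using finN pq by (simp add: sum_subtractf)
  also have "\<dots> = (\<Sum>i\<in>I. mu i (card N) (card K)) * v y"
  proof -
    consider "y = p" | "y = q" | "y \<noteq> p" "y \<noteq> q" by blast
    then show ?thesis
    proof cases
      case 3
      have "card (insert y (insert p K)) = card (insert y (insert q K))"
        using pq fK 3 by (cases "y \<in> K") (auto simp: insert_absorb)
      then have "union_move_count I N K y p = union_move_count I N K y q"
        using union_move_count_move[OF I finN K y, of p] union_move_count_move[OF I finN K y, of q] pq 3 by auto
      then show ?thesis using 3 by (simp add: v_def)
    qed (use pq in \<open>simp_all add: v_def mu D r\<close>)
  qed
  finally show ?thesis .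
qed

text \<open>The first term of \<open>mu\<close> counts the elements that fix a given point outside
  \<open>K\<close>. A class with \<open>k < msz i\<close> also has elements that move this point,
  which gives strictness; the other classes contribute a weak inequality.\<close>

lemma mu_less_card:
  assumes I: "I \<subseteq> {1..6}" and n: "7 \<le> card N" and K: "K \<subseteq> N" and i: "i \<in> I" "card K < msz i"
  shows "(\<Sum>i\<in>I. mu i (card N) (card K)) < real (card (class_union I N K))"
proof -
  have "mu i (card N) (card K) < class_card i (card N) (card K)"
  proof -
    have m: "msz i \<le> 5" by (simp add: msz_def)
    have "0 < subset_card (msz i) (card N) (Suc (card K))"
      using i(2) n m by (auto simp: subset_card_def zero_less_binomial_iff)
    then have "subset_card (msz i) (card N - 1) (card K) < subset_card (msz i) (card N) (card K)"
      using subset_card_Suc[of "card K" "card N" "msz i"] i(2) n m by simp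
    then have "real (subset_card (msz i) (card N - 1) (card K)) < real (subset_card (msz i) (card N) (card K))" by simp
    moreover have "0 < real (full_support_card i)" by (simp add: full_support_card_def)
    ultimately have "real (full_support_card i) * real (subset_card (msz i) (card N - 1) (card K)) < class_card i (card N) (card K)"
      unfolding class_card_def by (rule mult_strict_left_mono)
    then show ?thesis using move_count_nonneg[of i "card N" "card K + 2"] by (simp add: mu_def)
  qed
  moreover have "mu j (card N) (card K) \<le> class_card j (card N) (card K)" if "j \<in> I" for j
    using sign_count_nonneg(2)[OF _ n, of j "card K"] that I by auto
  moreover have "finite I" using I finite_subset by blast
  ultimately show ?thesis
    unfolding card_class_union[OF I finN K] using i(1) by (intro sum_strict_mono_ex1) auto
qed

end

section \<open>The Cayley graph and its quotient matrix\<close>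

lemma parcs_cayley_sym: "(\<sigma>, \<rho>) \<in> parcs (cayley n S) \<longleftrightarrow> (\<rho>, \<sigma>) \<in> parcs (cayley n S)"
  by (auto simp: cayley_def)

text \<open>Arcs occur in both orientations; closure of \<open>S\<close> under inverses turns either
  of them into right composition with an element of \<open>S\<close>.\<close>

lemma parcs_cayley_iff:
  assumes S: "S \<subseteq> sym_perms n" "\<And>\<tau>. \<tau> \<in> S \<Longrightarrow> pinv \<tau> \<in> S" and s: "\<sigma> \<in> sym_perms n"
  shows "(\<sigma>, \<rho>) \<in> parcs (cayley n S) \<longleftrightarrow> \<rho> \<in> (\<lambda>\<tau>. \<sigma> \<circ> \<tau>) ` S"
proof
  assume "(\<sigma>, \<rho>) \<in> parcs (cayley n S)"
  then obtain \<tau> where t: "\<tau> \<in> S" "\<rho> = \<sigma> \<circ> \<tau> \<or> \<sigma> = \<rho> \<circ> \<tau>"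
    by (auto simp: cayley_def perm_mult_def)
  then have p: "\<tau> permutes {1..n}" using S(1) by (auto simp: sym_perms_def)
  show "\<rho> \<in> (\<lambda>\<tau>. \<sigma> \<circ> \<tau>) ` S"
  proof (cases "\<rho> = \<sigma> \<circ> \<tau>")
    case True
    then show ?thesis using t(1) by blast
  next
    case False
    then have "\<sigma> \<circ> pinv \<tau> = \<rho>" using t(2) permutes_inv_o[OF p] by (simp add: comp_assoc)
    then show ?thesis using S(2)[OF t(1)] by blast
  qed
next
  assume "\<rho> \<in> (\<lambda>\<tau>. \<sigma> \<circ> \<tau>) ` S"
  then obtain \<tau> where t: "\<tau> \<in> S" "\<rho> = \<sigma> \<circ> \<tau>" by blast
  have "\<sigma> \<circ> \<tau> permutes {1..n}"
    by (rule permutes_compose) (use t S(1) s in \<open>auto simp: sym_perms_def\<close>)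
  then show "(\<sigma>, \<rho>) \<in> parcs (cayley n S)"
    using t s by (auto simp: cayley_def perm_mult_def sym_perms_def)
qed

lemma adjacency_sum:
  fixes f :: "(nat \<Rightarrow> nat) \<Rightarrow> real"
  assumes S: "S \<subseteq> sym_perms n" "\<And>\<tau>. \<tau> \<in> S \<Longrightarrow> pinv \<tau> \<in> S" and s: "\<sigma> \<in> sym_perms n"
  shows "(\<Sum>\<rho>\<in>sym_perms n. of_bool ((\<sigma>, \<rho>) \<in> parcs (cayley n S)) * f \<rho>) = sm S f \<sigma>"
proof -
  have fin: "finite (sym_perms n)" by (simp add: sym_perms_def finite_permutations)
  have "(\<Sum>\<rho>\<in>sym_perms n. of_bool ((\<sigma>, \<rho>) \<in> parcs (cayley n S)) * f \<rho>) =
      sum f (sym_perms n \<inter> {\<rho>. (\<sigma>, \<rho>) \<in> parcs (cayley n S)})"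
    by (rule sum_of_bool_mult_eq[OF fin])
  also have "sym_perms n \<inter> {\<rho>. (\<sigma>, \<rho>) \<in> parcs (cayley n S)} = {\<rho>. (\<sigma>, \<rho>) \<in> parcs (cayley n S)}"
    by (auto simp: cayley_def)
  also have "\<dots> = (\<lambda>\<tau>. \<sigma> \<circ> \<tau>) ` S" using parcs_cayley_iff[OF S s] by blast
  also have "sum f ((\<lambda>\<tau>. \<sigma> \<circ> \<tau>) ` S) = sm S f \<sigma>"
  proof -
    have p: "\<sigma> permutes {1..n}" using s by (simp add: sym_perms_def)
    have "pinv \<sigma> \<circ> (\<sigma> \<circ> \<tau>) = \<tau>" for \<tau> by (simp add: comp_assoc[symmetric] permutes_inv_o[OF p])
    then have "inj_on (\<lambda>\<tau>. \<sigma> \<circ> \<tau>) S" by (intro inj_on_inverseI[of _ "\<lambda>\<rho>. pinv \<sigma> \<circ> \<rho>"])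
    then show ?thesis by (simp add: sum.reindex sm_def)
  qed
  finally show ?thesis .
qed

locale admissible_cayley =
  fixes n k :: nat and I :: "nat set"
  assumes n: "7 \<le> n" and adm: "admissible I" and k: "\<exists>i\<in>I. k < msz i"
begin

abbreviation "N \<equiv> {1..n}"
abbreviation "K \<equiv> {1..k}"
abbreviation "S \<equiv> class_union I N K"
abbreviation "M \<equiv> union_move_count I N K"
definition "L = (\<Sum>i\<in>I. mu i n k)"

sublocale sym_group N
  by unfold_locales simp

lemma I_sub: "I \<subseteq> {1..6}"
  using adm by (simp add: admissible_def)

lemma k2: "k + 2 \<le> n"
  using k n by (auto simp: msz_def split: if_splits)

lemma K_N: "K \<subseteq> N"
  using k2 by auto

lemma L_less: "L < real (card S)"
  using mu_less_card[OF I_sub _ K_N] k n by (auto simp: L_def)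

lemma S_G: "S \<subseteq> G"
  using class_union_permutes by blast

text \<open>The estimate holds for functions that vanish outside the group, so \<open>f\<close> is
  cut off; on \<open>G\<close> the operator only uses values on \<open>G\<close>.\<close>

lemma bound:
  assumes "\<sigma>0 \<in> G" "f \<sigma>0 \<noteq> 0" "sum f G = 0" and ev: "\<And>\<sigma>. \<sigma> \<in> G \<Longrightarrow> sm S f \<sigma> = l * f \<sigma>"
  shows "l \<le> L"
proof -
  define h where "h = (\<lambda>\<sigma>. if \<sigma> \<in> G then f \<sigma> else 0)"
  have "sm S h \<sigma> = l * h \<sigma>" for \<sigma>
  proof (cases "\<sigma> \<in> G")
    case True
    then have "sm S h \<sigma> = sm S f \<sigma>"
      unfolding sm_def using S_G comp_in_G by (intro sum.cong) (auto simp: h_def)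
    then show ?thesis using True ev by (simp add: h_def)
  next
    case False
    then have "sm S h \<sigma> = 0"
      unfolding sm_def using S_G comp_in_G by (intro sum.neutral) (auto simp: h_def)
    then show ?thesis using False by (simp add: h_def)
  qed
  moreover have "h \<in> V" "h \<sigma>0 \<noteq> 0" "sum h G = 0" using assms by (auto simp: V_def h_def)
  ultimately show ?thesis
    using eigenvalue_bound[OF adm _ K_N _ assms(1), of h l] n by (auto simp: L_def)
qed

definition w :: "nat \<Rightarrow> real" where
  "w z = (if z = k + 1 then 1 else if z = k + 2 then - 1 else 0)"

lemma pq: "k + 1 \<in> N - K" "k + 2 \<in> N - K" "k + 1 \<noteq> k + 2"
  using k2 by auto

lemma w: "y \<in> N \<Longrightarrow> (\<Sum>z\<in>N. M y z * w z) = L * w y" "sum w N = 0" "w (k + 1) \<noteq> 0"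
proof -
  show "(\<Sum>z\<in>N. M y z * w z) = L * w y" if "y \<in> N"
    using attained[OF I_sub K_N pq that] by (simp add: w_def L_def)
  have "sum w N = (\<Sum>z\<in>N. (if z = k + 1 then 1 else 0) - (if z = k + 2 then 1 else 0))"
    by (rule sum.cong) (auto simp: w_def)
  also have "\<dots> = 0" using pq by (simp add: sum_subtractf)
  finally show "sum w N = 0" .
  show "w (k + 1) \<noteq> 0" by (simp add: w_def)
qed

lemma one_N: "1 \<in> N"
  using n by simp

lemma second_eigenvalue_quotient: "second_eigenvalue (quotient_matrix n S) = L"
proof (rule second_eigenvalue_list[where vs = "[1..<Suc n]" and X = N and a = "\<lambda>s t. M t s" and d = "real (card S)"])
  have "card (S \<inter> transporter n t s) = card {\<tau> \<in> S. \<tau> t = s}" for s t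
  proof -
    have "S \<inter> transporter n t s = {\<tau> \<in> S. \<tau> t = s}"
      using S_G by (auto simp: transporter_def sym_perms_def)
    then show ?thesis by simp
  qed
  then show "quotient_matrix n S = mat (length [1..<Suc n]) (length [1..<Suc n])
      (\<lambda>(i, j). M ([1..<Suc n] ! j) ([1..<Suc n] ! i))"
    by (intro eq_matI) (auto simp: quotient_matrix_def union_move_count_def nth_upt add.commute simp del: upt_Suc)
  have sym: "M s t = M t s" if "s \<in> N" "t \<in> N" for s t
    using union_move_count_sym[OF I_sub finN K_N that] .
  then show "M t s = M s t" if "s \<in> N" "t \<in> N" for s t using that by simp
  \<comment> \<open>Row \<open>s\<close> of the quotient matrix counts the elements that take
    \<open>t\<close> to \<open>s\<close>, so the arguments of \<open>M\<close> appear exchanged; the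
    symmetry of \<open>M\<close> restores the form used for lifting.\<close>
  have flip: "(\<Sum>t\<in>N. M t s * v t) = (\<Sum>t\<in>N. M s t * v t)" if "s \<in> N" for s and v :: "nat \<Rightarrow> real"
    using that by (intro sum.cong) (auto simp: sym)
  show "(\<Sum>t\<in>N. M t s) = real (card S)" if "s \<in> N" for s
    using flip[OF that, of "\<lambda>_. 1"] sum_union_move_count[OF I_sub finN that, of K "\<lambda>_. 1"] by simp
  show "(\<Sum>t\<in>N. M t s * w t) = L * w s" if "s \<in> N" for s
    using flip[OF that] w(1)[OF that] by simp
  show "sum w N = 0" "w (k + 1) \<noteq> 0" "k + 1 \<in> N" using w(2,3) pq by auto
  show "L \<le> real (card S)" using L_less by simp
  fix v :: "nat \<Rightarrow> real" and l y
  assume v: "y \<in> N" "v y \<noteq> 0" "sum v N = 0" "\<And>s. s \<in> N \<Longrightarrow> (\<Sum>t\<in>N. M t s * v t) = l * v s"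
  have "(\<Sum>t\<in>N. M s t * v t) = l * v s" if "s \<in> N" for s
    using v(4)[OF that] flip[OF that, of v] by simp
  from lift_eigenvector[OF I_sub K_N one_N this v(3,1,2)] show "l \<le> L"
    using bound[of _ "\<lambda>\<sigma>. if \<sigma> permutes N then v (pinv \<sigma> 1) else 0" l] by auto
qed auto

lemma S_sym_perms: "S \<subseteq> sym_perms n"
  using S_G by (auto simp: sym_perms_def)

lemma adjacency: "\<sigma> \<in> G \<Longrightarrow> (\<Sum>\<rho>\<in>G. of_bool ((\<sigma>, \<rho>) \<in> parcs (cayley n S)) * f \<rho>) = sm S f \<sigma>"
  using adjacency_sum[OF S_sym_perms inv_class_union, of \<sigma> f] by (simp add: sym_perms_def)

lemma graph_second_eigenvalue_cayley: "graph_second_eigenvalue (cayley n S) = L"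
proof -
  let ?C = "cayley n S" and ?f = "\<lambda>\<sigma>. if \<sigma> permutes N then w (pinv \<sigma> 1) else 0"
  have fin: "finite (pverts ?C)" by (simp add: cayley_def sym_perms_def finite_permutations)
  have "distinct (vertex_enum ?C) \<and> set (vertex_enum ?C) = pverts ?C"
    unfolding vertex_enum_def by (rule someI_ex) (use finite_distinct_list[OF fin] in blast)
  then have vs: "distinct (vertex_enum ?C)" "set (vertex_enum ?C) = G"
    by (auto simp: cayley_def sym_perms_def)
  have kN: "k + 1 \<in> N" using pq by auto
  have lift: "sum ?f G = 0" "sm S ?f = (\<lambda>\<sigma>. L * ?f \<sigma>)" "\<exists>\<sigma>\<in>G. ?f \<sigma> \<noteq> 0"
    by (rule lift_eigenvector[OF I_sub K_N one_N _ w(2) kN w(3)], rule w(1), assumption)+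
  obtain \<sigma>0 where s0: "\<sigma>0 \<in> G" "?f \<sigma>0 \<noteq> 0" using lift(3) by blast
  show ?thesis
    unfolding graph_second_eigenvalue_def
  proof (rule second_eigenvalue_list[OF vs, where a = "\<lambda>\<sigma> \<rho>. of_bool ((\<sigma>, \<rho>) \<in> parcs ?C)" and d = "real (card S)"])
    show "adjacency_matrix ?C = mat (length (vertex_enum ?C)) (length (vertex_enum ?C))
       (\<lambda>(i, j). of_bool ((vertex_enum ?C ! i, vertex_enum ?C ! j) \<in> parcs ?C))"
      by (simp add: adjacency_matrix_def Let_def)
    show "(of_bool ((\<sigma>, \<rho>) \<in> parcs ?C) :: real) = of_bool ((\<rho>, \<sigma>) \<in> parcs ?C)" for \<sigma> \<rho>
      using parcs_cayley_sym[of \<sigma> \<rho> n S] by simp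
    show "(\<Sum>\<rho>\<in>G. of_bool ((\<sigma>, \<rho>) \<in> parcs ?C)) = real (card S)" if "\<sigma> \<in> G" for \<sigma>
      using adjacency[OF that, of "\<lambda>_. 1"] by (simp add: sm_def)
    show "\<sigma>0 \<in> G" "?f \<sigma>0 \<noteq> 0" "sum ?f G = 0" by (fact s0 lift(1))+
    show "(\<Sum>\<rho>\<in>G. of_bool ((\<sigma>, \<rho>) \<in> parcs ?C) * ?f \<rho>) = L * ?f \<sigma>" if "\<sigma> \<in> G" for \<sigma>
      unfolding adjacency[OF that] lift(2) ..
    show "L \<le> real (card S)" using L_less by simp
    show "l \<le> L" if "\<sigma> \<in> G" "f \<sigma> \<noteq> 0" "sum f G = 0"
      "\<And>\<sigma>. \<sigma> \<in> G \<Longrightarrow> (\<Sum>\<rho>\<in>G. of_bool ((\<sigma>, \<rho>) \<in> parcs ?C) * f \<rho>) = l * f \<sigma>" for f l \<sigma>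
      by (rule bound[OF that(1-3)]) (use that(4) adjacency in simp)
  qed
qed

lemma L_eq: "L = real (card (S \<inter> stabilizer n (k + 1))) - real (card (S \<inter> transporter n (k + 2) (k + 1)))"
proof -
  have t: "S \<inter> transporter n x y = {\<tau> \<in> S. \<tau> x = y}" for x y
    using S_sym_perms by (auto simp: transporter_def)
  have "real (card (S \<inter> stabilizer n (k + 1))) = (\<Sum>i\<in>I. real (full_support_card i) * real (subset_card (msz i) (n - 1) k))"
    using union_move_count_fix[OF I_sub finN K_N, of "k + 1"] pq by (simp add: stabilizer_def t union_move_count_def)
  moreover have "real (card (S \<inter> transporter n (k + 2) (k + 1))) = (\<Sum>i\<in>I. move_count i n (k + 2))"
  proof -
    have "card (insert (k + 2) (insert (k + 1) K)) = k + 2" by simp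
    then show ?thesis using union_move_count_move[OF I_sub finN K_N, of "k + 2" "k + 1"] pq by (simp add: t union_move_count_def)
  qed
  ultimately show ?thesis by (simp add: L_def mu_def sum_subtractf)
qed

lemma connected_cayley: "Digraph_Component.connected (with_proj (cayley n S))"
proof -
  let ?C = "cayley n S"
  have pv: "pverts ?C = G" by (simp add: cayley_def sym_perms_def)
  \<comment> \<open>The arc relation is already symmetric, so \<open>mk_symmetric\<close> leaves it
    unchanged and connectedness is plain reachability.\<close>
  have arcs: "parcs (mk_symmetric (with_proj ?C)) = parcs ?C"
    using parcs_cayley_sym[of _ _ n S] by (auto simp: mk_symmetric_def)
  have verts: "pverts (mk_symmetric (with_proj ?C)) = G" by (simp add: mk_symmetric_def pv)
  have reach: "(u, v) \<in> rtrancl_on G (parcs ?C)" if u: "u \<in> G" and v: "v \<in> G" for u v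
  proof (rule ccontr)
    assume nv: "(u, v) \<notin> rtrancl_on G (parcs ?C)"
    define R where "R = {\<sigma>. (u, \<sigma>) \<in> rtrancl_on G (parcs ?C)}"
    \<comment> \<open>\<open>c\<close> is the density of the component \<open>R\<close>; subtracting
      it makes the sum of \<open>f\<close> zero. Since \<open>R\<close> is closed under arcs in both
      directions, the operator multiplies \<open>f\<close> by \<open>card S\<close>.\<close>
    define c where "c = real (card (G \<inter> R)) / real (card G)"
    define f :: "(nat \<Rightarrow> nat) \<Rightarrow> real" where "f \<sigma> = of_bool (\<sigma> \<in> R) - c" for \<sigma>
    have cG: "real (card G) \<noteq> 0" using u finG by auto
    have step: "\<rho> \<in> R" if "\<sigma> \<in> R" "(\<sigma>, \<rho>) \<in> parcs ?C" for \<sigma> \<rho>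
    proof -
      have "\<rho> \<in> G" using that(2) by (simp add: cayley_def sym_perms_def)
      then show ?thesis using that(1) rtrancl_on_into_rtrancl_on[OF _ that(2)] unfolding R_def by blast
    qed
    have R: "\<sigma> \<circ> \<tau> \<in> R \<longleftrightarrow> \<sigma> \<in> R" if "\<sigma> \<in> G" "\<tau> \<in> S" for \<sigma> \<tau>
    proof -
      have "\<sigma> \<in> sym_perms n" using that(1) by (simp add: sym_perms_def)
      from parcs_cayley_iff[OF S_sym_perms inv_class_union this] have "(\<sigma>, \<sigma> \<circ> \<tau>) \<in> parcs ?C" using that(2) by blast
      then show ?thesis using step parcs_cayley_sym by blast
    qed
    have sum0: "sum f G = 0"
    proof -
      have "(\<Sum>\<sigma>\<in>G. of_bool (\<sigma> \<in> R)) = real (card (G \<inter> R))"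
        using sum_of_bool_mult_eq[OF finG, of "\<lambda>\<sigma>. \<sigma> \<in> R" "\<lambda>_. 1 :: real"] by simp
      then have "sum f G = real (card (G \<inter> R)) - real (card G) * c"
        by (simp add: f_def sum_subtractf)
      then show ?thesis using cG by (simp add: c_def)
    qed
    have ev: "sm S f \<sigma> = real (card S) * f \<sigma>" if "\<sigma> \<in> G" for \<sigma>
    proof -
      have "sm S f \<sigma> = (\<Sum>\<tau>\<in>S. f \<sigma>)" unfolding sm_def by (rule sum.cong) (use R[OF that] in \<open>auto simp: f_def\<close>)
      then show ?thesis by simp
    qed
    have "f u \<noteq> f v" using u nv by (simp add: f_def R_def)
    then have "\<exists>\<sigma>\<in>G. f \<sigma> \<noteq> 0" using u v by (metis)
    then have "real (card S) \<le> L" using bound[OF _ _ sum0 ev] by blast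
    then show False using L_less by simp
  qed
  have "G \<noteq> {}" using permutes_id by blast
  then show ?thesis
    unfolding Digraph_Component.connected_def strongly_connected_def reachable_def
    using reach by (simp add: verts arcs pv)
qed

end

theorem theorem4p1:
  fixes n k m :: nat and I :: "nat set" and T :: "(nat \<Rightarrow> nat) set"
  assumes "n \<ge> 7"
    and "I \<noteq> {}" and "I \<subseteq> {1, 2, 3, 4, 5, 6}"
    and "I \<notin> {{2}, {3}, {6}, {2, 3}, {2, 6}, {3, 6}, {2, 3, 6}}"
    and "I \<notin> {{1, 3}, {1, 6}, {4, 6}, {1, 2, 3}, {1, 2, 6}, {1, 3, 6}, {1, 4, 6},
               {2, 4, 6}, {3, 4, 6}, {1, 2, 3, 6}, {1, 2, 4, 6}, {1, 3, 4, 6},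
               {2, 3, 4, 6}, {2, 3, 5, 6}, {1, 2, 3, 4, 6}}"
    and "T = (\<Union>i\<in>I. conj_class n i)"
    and "m = Max ((\<lambda>\<tau>. card (supp \<tau>)) ` T)"
    and "k < m"
  shows "Digraph_Component.connected (with_proj (cayley n (moving_subset T k))) \<and>
    graph_second_eigenvalue (cayley n (moving_subset T k))
      = second_eigenvalue (quotient_matrix n (moving_subset T k)) \<and>
    second_eigenvalue (quotient_matrix n (moving_subset T k))
      = real (card (moving_subset T k \<inter> stabilizer n (k + 1)))
        - real (card (moving_subset T k \<inter> transporter n (k + 2) (k + 1)))"
proof -
  have adm: "admissible I" by (rule admissibleI[OF assms(2-5)])
  then have I: "I \<subseteq> {1..6}" by (simp add: admissible_def)
  have T: "T = class_union I {1..n} {}" by (simp add: assms(6) class_union_def conj_class_eq)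
  have Tk: "moving_subset T k = class_union I {1..n} {1..k}"
    by (auto simp: T moving_subset_def class_union_def Tc_def)
  have fT: "finite T" unfolding T by (rule finite_class_union[OF I]) simp
  \<comment> \<open>Nonemptiness gives \<open>Max\<close> its meaning: \<open>m\<close> is then
    attained and equals \<open>msz i\<close> for some \<open>i\<close> in \<open>I\<close>, so that
    \<open>k < m\<close> yields a class with \<open>k < msz i\<close>.\<close>
  have "T \<noteq> {}"
  proof -
    obtain i where i: "i \<in> I" using assms(2) by auto
    have "0 < subset_card (msz i) n 0" using assms(1) by (auto simp: subset_card_def msz_def zero_less_binomial_iff)
    moreover have "0 < full_support_card i" by (simp add: full_support_card_def)
    moreover have "card (Tc i {1..n} {}) = full_support_card i * subset_card (msz i) n 0"
      using card_Tc[of "{1..n}" "{}" i] i I by auto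
    ultimately have "Tc i {1..n} {} \<noteq> {}" by auto
    then show ?thesis using i by (auto simp: T class_union_def)
  qed
  then have "m \<in> (\<lambda>\<tau>. card (supp \<tau>)) ` T" unfolding assms(7) using fT by (intro Max_in) auto
  then have "\<exists>i\<in>I. m = msz i" by (auto simp: T class_union_def Tc_def card_supp_cls)
  then have "\<exists>i\<in>I. k < msz i" using assms(8) by auto
  then interpret admissible_cayley n k I using assms(1) adm by unfold_locales auto
  show ?thesis
    unfolding Tk using connected_cayley graph_second_eigenvalue_cayley second_eigenvalue_quotient L_eq by simp
qed

end
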